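(* Let $m\ge 1$ and, for each $j=1,\ldots,m$, let $k_j\ge 2$ be an integer and let $(f_{n,j})_{n\ge 1}$ be a sequence of functions in $\ell^2(\mathbb{Z}^{k_j})$ (symmetric, square summable, vanishing on the diagonals) satisfying $$\sup_n \sum_{-\infty<i_1,\ldots,i_{k_j}<\infty} f_{n,j}(i_1,\ldots,i_{k_j})^2<\infty .$$ Let $\Sigma$ be an $m\times m$ symmetric non-negative definite matrix each of whose diagonal entries is positive, such that $$\Sigma(i,j)=\lim_{n\to\infty}\langle f_{n,i},f_{n,j}\rangle\quad\text{for all } i,j=1,\ldots,m .$$ Then the following are equivalent: 1. For every sequence $\mathbf{X}=(X_i)_{i\in\mathbb{Z}}$ of independent random variables satisfying $\mathbb{E}X_i=0$, $\mathbb{E}X_i^2=1$ for all $i$ and $\sup_i\mathbb{E}|X_i|^3<\infty$, one has, as $n\to\infty$, the joint convergence in distribution $$\Big(Q_{k_j}(f_{n,j},\mathbf{X})\Big)_{j=1}^m \xrightarrow{d} N(\mathbf{0},\Sigma).$$ 2. For all $j=1,\ldots,m$ and all $r=1,\ldots,k_j-1$, $$\lim_{n\to\infty}\|f_{n,j}\star_r f_{n,j}\|_{2k_j-2r}=0 .$$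
   Context: For $k\ge 1$, $\ell^2(\mathbb{Z}^k)$ denotes the space of functions $f:\mathbb{Z}^k\to\mathbb{R}$ that are symmetric, square summable, and vanish on the diagonals, i.e. $f(i_1,\ldots,i_k)=0$ whenever $i_p=i_q$ for some $p\neq q$. For a sequence $\mathbf{X}=(X_i)_{i\in\mathbb{Z}}$ of independent random variables with mean $0$ and variance $1$ and $f\in\ell^2(\mathbb{Z}^k)$, $$Q_k(f,\mathbf{X})=\sum_{-\infty<i_1,\ldots,i_k<\infty} f(i_1,\ldots,i_k)X_{i_1}\cdots X_{i_k},$$ where the series converges in $L^2(\mathbb{P})$. For $f_1\in\ell^2(\mathbb{Z}^{k_1})$ and $f_2\in\ell^2(\mathbb{Z}^{k_2})$, $\langle f_1,f_2\rangle:=k!\sum_{-\infty<i_1,\ldots,i_k<\infty}f_1(i_1,\ldots,i_k)f_2(i_1,\ldots,i_k)$ if $k_1=k_2=k$, and $\langle f_1,f_2\rangle:=0$ if $k_1\ne k_2$. Discrete contraction: for $f\in\ell^2(\mathbb{Z}^p)$, $g\in\ell^2(\mathbb{Z}^q)$, $p,q\ge 2$, and $r=0,\ldots,p\wedge q$, $$(f\star_r g)(i_1,\ldots,i_{p+q-2r})=\sum_{j_1,\ldots,j_r=-\infty}^{\infty}f(j_1,\ldots,j_r,i_1,\ldots,i_{p-r})\,g(j_1,\ldots,j_r,i_{p-r+1},\ldots,i_{p+q-2r}),$$ understood as the tensor product if $r=0$. $\|h\|_k=\big(\sum_{\mathbf{i}\in\mathbb{Z}^k}h(\mathbf{i})^2\big)^{1/2}$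 denotes the discrete $L^2$ norm of a function $h$ on $\mathbb{Z}^k$. $N(\mathbf{0},\Sigma)$ is the centered Gaussian law on $\mathbb{R}^m$ with covariance matrix $\Sigma$. *)

theory Defs
  imports "HOL-Probability.Probability"
begin

(* Points of Z^k are integer lists of length k; functions on Z^k are functions on
   integer lists, whose values at lists of any other length are irrelevant. *)
definition index_tuples :: "nat \<Rightarrow> int list set" where
  "index_tuples k = {i. length i = k}"

definition l2_kernels :: "nat \<Rightarrow> (int list \<Rightarrow> real) set" where
  "l2_kernels k = {f.
     (\<forall>i \<in> index_tuples k. \<forall>j. mset j = mset i \<longrightarrow> f j = f i) \<and>
     (\<lambda>i. (f i)\<^sup>2) summable_on index_tuples k \<and>
     (\<forall>i \<in> index_tuples k. (\<exists>p<k. \<exists>q<k. p \<noteq> q \<and> i ! p = i ! q) \<longrightarrow> f i = 0)}"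

definition discrete_norm :: "nat \<Rightarrow> (int list \<Rightarrow> real) \<Rightarrow> real" where
  "discrete_norm k h = sqrt (\<Sum>\<^sub>\<infinity>i \<in> index_tuples k. (h i)\<^sup>2)"

definition kernel_inner ::
    "nat \<Rightarrow> (int list \<Rightarrow> real) \<Rightarrow> nat \<Rightarrow> (int list \<Rightarrow> real) \<Rightarrow> real" where
  "kernel_inner k1 f1 k2 f2 =
     (if k1 = k2 then fact k1 * (\<Sum>\<^sub>\<infinity>i \<in> index_tuples k1. f1 i * f2 i) else 0)"

(* The contraction of f on Z^p and g on Z^q over r variables, evaluated at a
   tuple i of length p + q - 2 r. *)
definition contraction ::
    "nat \<Rightarrow> nat \<Rightarrow> nat \<Rightarrow> (int list \<Rightarrow> real) \<Rightarrow> (int list \<Rightarrow> real) \<Rightarrow> int list \<Rightarrow> real" where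
  "contraction p q r f g i =
     (\<Sum>\<^sub>\<infinity>j \<in> index_tuples r. f (j @ take (p - r) i) * g (j @ drop (p - r) i))"

definition is_homogeneous_sum ::
    "'a measure \<Rightarrow> (int \<Rightarrow> 'a \<Rightarrow> real) \<Rightarrow> nat \<Rightarrow> (int list \<Rightarrow> real) \<Rightarrow> ('a \<Rightarrow> real) \<Rightarrow> bool" where
  "is_homogeneous_sum M X k f Y \<longleftrightarrow>
     Y \<in> borel_measurable M \<and>
     ((\<lambda>F. \<integral>\<^sup>+ \<omega>. ennreal ((Y \<omega> - (\<Sum>i\<in>F. f i * (\<Prod>p<k. X (i ! p) \<omega>)))\<^sup>2) \<partial>M)
        \<longlongrightarrow> 0) (finite_subsets_at_top (index_tuples k))"

(* Q_k(f, X), the sum of the series in L^2; it is determined up to null sets, and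
   the choice picks one of its versions. *)
definition homogeneous_sum ::
    "'a measure \<Rightarrow> (int \<Rightarrow> 'a \<Rightarrow> real) \<Rightarrow> nat \<Rightarrow> (int list \<Rightarrow> real) \<Rightarrow> 'a \<Rightarrow> real" where
  "homogeneous_sum M X k f = (SOME Y. is_homogeneous_sum M X k f Y)"

(* The law of A Z, where Z is a standard Gaussian vector and A is a matrix with
   A A^T = S.  Such an A exists for every symmetric non-negative definite S (which
   may be singular), and the law does not depend on its choice. *)
definition centered_gaussian :: "real^'m^'m \<Rightarrow> (real^'m::finite) measure" where
  "centered_gaussian S =
     distr (\<Pi>\<^sub>M j\<in>UNIV. std_normal_distribution) borel
       (\<lambda>z. (SOME A :: real^'m^'m. A ** transpose A = S) *v (\<chi> j. z j))"

definition converges_in_distribution ::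
    "'a measure \<Rightarrow> (nat \<Rightarrow> 'a \<Rightarrow> 'b::topological_space) \<Rightarrow> 'b measure \<Rightarrow> bool" where
  "converges_in_distribution M Y \<mu> \<longleftrightarrow>
     (\<forall>g::'b \<Rightarrow> real. continuous_on UNIV g \<and> bounded (range g) \<longrightarrow>
        (\<lambda>n. \<integral>y. g y \<partial>distr M borel (Y n)) \<longlonglongrightarrow> (\<integral>y. g y \<partial>\<mu>))"

definition independent_standardized ::
    "'a measure \<Rightarrow> (int \<Rightarrow> 'a \<Rightarrow> real) \<Rightarrow> bool" where
  "independent_standardized M X \<longleftrightarrow>
     prob_space M \<and>
     prob_space.indep_vars M (\<lambda>_. borel) X UNIV \<and>
     (\<forall>i. integrable M (X i) \<and> (\<integral>\<omega>. X i \<omega> \<partial>M) = 0) \<and>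
     (\<forall>i. integrable M (\<lambda>\<omega>. (X i \<omega>)\<^sup>2) \<and> (\<integral>\<omega>. (X i \<omega>)\<^sup>2 \<partial>M) = 1)"

(* Joint asymptotic normality for every admissible sequence X that is defined on a
   probability space with underlying type 'a.  HOL formulas cannot quantify over
   the type 'a, so it is an explicit parameter.  The joint law of any real sequence
   indexed by the integers is realised by the coordinates of "int \<Rightarrow> real", so
   that choice of 'a already covers all sequences. *)
definition universally_asymptotically_normal ::
    "'a itself \<Rightarrow> ('m \<Rightarrow> nat) \<Rightarrow> (nat \<Rightarrow> 'm \<Rightarrow> int list \<Rightarrow> real) \<Rightarrow> real^'m^'m \<Rightarrow> bool" where
  "universally_asymptotically_normal (_ :: 'a itself) k f S \<longleftrightarrow>
     (\<forall>(M :: 'a measure) X.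
        independent_standardized M X \<and>
        (SUP i. \<integral>\<^sup>+ \<omega>. ennreal (\<bar>X i \<omega>\<bar> ^ 3) \<partial>M) < \<infinity> \<longrightarrow>
        converges_in_distribution M
          (\<lambda>n \<omega>. \<chi> j. homogeneous_sum M X (k j) (f n j) \<omega>) (centered_gaussian S))"

end

(* Truncating the kernels to finite cubes turns the homogeneous sums into multilinear polynomials.

   If the contractions vanish, so do all influences, and hence, by the Lindeberg replacement method and
   hypercontractivity, the limit law is the same for every admissible sequence. For random signs it is
   computed with Stein's method: the characteristic function phi of a linear combination with limiting
   variance v satisfies phi'(t) = - v t phi(t) up to an error bounded by contractions and influences.

   Conversely, apply the assumed convergence to independent symmetric variables with values in
   {0, + sqrt kappa, - sqrt kappa} and a large fourth moment kappa. Their polynomials are bounded in L^6,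
   so the fourth moments converge to the Gaussian ones. Bessel's inequality for the square of a
   polynomial P of degree k bounds E P^4 - 3 (E P^2)^2 from below by the sum of the contraction norms:
   the terms in which this can fail are compensated by the components of P^2 along X_i^2 - 1, whose
   coefficients grow with kappa. *)

theory Submission
  imports Defs "HOL-Combinatorics.Multiset_Permutations"
begin

section \<open>Multilinear polynomials in independent variables\<close>

text \<open>Condition 1 speaks of all admissible sequences, so the converse may choose its own law.
  A Gaussian sequence would lead to the fourth moment theorem on Wiener chaos; a law with three
  atoms keeps the argument combinatorial. For such a law the fourth cumulant need not dominate the
  contractions: in the expansion of a contraction norm an index may belong to all four sets
  involved, and such terms are missing from the degree \<open>2k\<close> part of \<open>P^2\<close>.
  For each of the \<open>k + 1\<close> orders they amount to at most \<open>4^k\<close> times the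
  sum of the squared influences, whereas the components along \<open>X_i^2 - 1\<close> gain
  \<open>kappa - 1\<close> times that sum. This fixes \<open>kappa - 1 = (k + 1) 4^k\<close>. In the
  other direction, condition 2 treats each kernel alone, while a linear combination produces mixed
  contractions. Cauchy-Schwarz bounds these by contractions of single kernels of complementary
  order; a factor of order 0 does not vanish, but is always paired with one that does. Cosines with
  an arbitrary phase stand in for characteristic functions, so that all test functions stay
  real.\<close>

definition mlp :: "'i set \<Rightarrow> ('i set \<Rightarrow> real) \<Rightarrow> ('i \<Rightarrow> real) \<Rightarrow> real" where
  "mlp V b x = (\<Sum>A\<in>Pow V. b A * (\<Prod>i\<in>A. x i))"

lemma sum_Pow_insert:
  assumes "finite V" "i \<notin> V"
  shows "(\<Sum>A\<in>Pow (insert i V). g A) = (\<Sum>A\<in>Pow V. g A) + (\<Sum>A\<in>Pow V. g (insert i A))"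
proof -
  have "(\<Sum>A\<in>Pow (insert i V). g A) = (\<Sum>A\<in>Pow V. g A) + (\<Sum>A\<in>insert i ` Pow V. g A)"
    unfolding Pow_insert using assms by (intro sum.union_disjoint) auto
  also have "(\<Sum>A\<in>insert i ` Pow V. g A) = (\<Sum>A\<in>Pow V. g (insert i A))"
    using assms by (subst sum.reindex) (auto simp: inj_on_def o_def)
  finally show ?thesis .
qed

text \<open>A multilinear polynomial is affine in each variable: a part without \<open>x i\<close>
  plus \<open>x i\<close> times its derivative. All moment estimates are inductions over
  \<open>V\<close> along this splitting.\<close>

lemma mlp_insert:
  assumes "finite V" "i \<notin> V"
  shows "mlp (insert i V) b x = mlp V b x + x i * mlp V (\<lambda>A. b (insert i A)) x"
proof -
  have "(\<Prod>l\<in>insert i A. x l) = x i * (\<Prod>l\<in>A. x l)" if "A \<in> Pow V" for A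
    using that assms finite_subset[of A V] by (subst prod.insert) auto
  then show ?thesis
    unfolding mlp_def using assms by (simp add: sum_Pow_insert sum_distrib_left mult_ac)
qed

lemma mlp_remove:
  assumes "finite V" "i \<in> V"
  shows "mlp V b x = mlp (V - {i}) b x + x i * mlp (V - {i}) (\<lambda>A. b (insert i A)) x"
  using mlp_insert[of "V - {i}" i b x] assms by (simp add: insert_absorb)

lemma mlp_cong_vars: "(\<And>i. i \<in> V \<Longrightarrow> x i = y i) \<Longrightarrow> mlp V b x = mlp V b y"
  unfolding mlp_def by (intro sum.cong refl arg_cong2[of _ _ _ _ "(*)"] prod.cong) auto

lemma mlp_sum: "mlp V (\<lambda>A. \<Sum>j\<in>J. t j * a j A) x = (\<Sum>j\<in>J. t j * mlp V (a j) x)"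
  unfolding mlp_def sum_distrib_left sum_distrib_right
  by (subst sum.swap) (simp add: mult_ac)

text \<open>The product of two square-free monomials lives on the symmetric difference, up to
  squares of the common variables, which equal 1 for signs.\<close>

lemma prod_mult_prod_subset:
  assumes "finite A" "finite B"
  shows "(\<Prod>i\<in>A. x i) * (\<Prod>i\<in>B. x i) = (\<Prod>i\<in>(A - B) \<union> (B - A). x i) * (\<Prod>i\<in>A \<inter> B. (x i :: real)\<^sup>2)"
proof -
  have 1: "(\<Prod>i\<in>A. x i) = (\<Prod>i\<in>A - B. x i) * (\<Prod>i\<in>A \<inter> B. x i)"
    using assms by (subst prod.union_disjoint[symmetric]) (auto intro!: prod.cong)
  have 2: "(\<Prod>i\<in>B. x i) = (\<Prod>i\<in>B - A. x i) * (\<Prod>i\<in>A \<inter> B. x i)"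
    using assms by (subst prod.union_disjoint[symmetric]) (auto intro!: prod.cong)
  have 3: "(\<Prod>i\<in>(A - B) \<union> (B - A). x i) = (\<Prod>i\<in>A - B. x i) * (\<Prod>i\<in>B - A. x i)"
    using assms by (intro prod.union_disjoint) auto
  show ?thesis unfolding 1 2 3 power2_eq_square prod.distrib by (simp add: mult_ac)
qed

section \<open>Independent families: separating one variable from all the others\<close>

locale indep_seq = prob_space M for M :: "'a measure" +
  fixes X :: "'i \<Rightarrow> 'a \<Rightarrow> real"
  assumes indep: "indep_vars (\<lambda>_. borel) X UNIV"
begin

lemma X_meas[measurable]: "X i \<in> borel_measurable M"
  using indep unfolding indep_vars_def by auto

text \<open>The \<sigma>-algebra generated by all variables but \<open>X i\<close>. Measurability
  with respect to it expresses that a random variable does not depend on \<open>X i\<close>, and is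
  preserved by all the usual operations.\<close>

definition others :: "'i \<Rightarrow> 'a measure" where
  "others i = vimage_algebra (space M) (\<lambda>\<omega>. restrict (\<lambda>l. X l \<omega>) (- {i})) (PiM (- {i}) (\<lambda>_. borel))"

lemma others_X: "l \<noteq> i \<Longrightarrow> X l \<in> borel_measurable (others i)"
proof -
  assume "l \<noteq> i"
  have 1: "(\<lambda>\<omega>. restrict (\<lambda>l. X l \<omega>) (- {i})) \<in> measurable (others i) (PiM (- {i}) (\<lambda>_. borel))"
    unfolding others_def by (intro measurable_vimage_algebra1) (auto simp: space_PiM)
  have "(\<lambda>x. x l) \<in> measurable (PiM (- {i}) (\<lambda>_. borel)) borel"
    using \<open>l \<noteq> i\<close> by (intro measurable_component_singleton) auto
  from measurable_compose[OF 1 this] show ?thesis using \<open>l \<noteq> i\<close> by simp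
qed

lemma others_mlp: "i \<notin> V \<Longrightarrow> (\<lambda>\<omega>. mlp V b (\<lambda>l. X l \<omega>)) \<in> borel_measurable (others i)"
  unfolding mlp_def
  by (intro borel_measurable_sum borel_measurable_times borel_measurable_const borel_measurable_prod others_X) auto

lemma mlp_meas[measurable]: "(\<lambda>\<omega>. mlp V b (\<lambda>l. X l \<omega>)) \<in> borel_measurable M"
  unfolding mlp_def by measurable

lemma others_meas:
  fixes H :: "'a \<Rightarrow> real"
  assumes "H \<in> borel_measurable (others i)" shows "H \<in> borel_measurable M"
proof -
  have "(\<lambda>\<omega>. restrict (\<lambda>l. X l \<omega>) (- {i})) \<in> measurable M (PiM (- {i}) (\<lambda>_. borel))"
    by measurable
  then have "sets (others i) \<subseteq> sets M"
    unfolding others_def by (auto simp: sets_vimage_algebra intro!: sets.sigma_sets_subset dest: measurable_sets)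
  moreover have "space (others i) = space M" by (simp add: others_def)
  ultimately have "measurable (others i) borel \<subseteq> measurable M (borel::real measure)"
    unfolding measurable_def by auto
  with assms show "H \<in> borel_measurable M" by auto
qed

text \<open>Grouping the family into \<open>{i}\<close> and its complement gives two independent
  restricted maps; \<open>X i\<close> and \<open>H\<close> generate \<sigma>-algebras contained in
  those of the two groups.\<close>

lemma indep_others:
  fixes H :: "'a \<Rightarrow> real"
  assumes H: "H \<in> borel_measurable (others i)"
  shows "indep_var borel (X i) borel H"
proof -
  let ?A = "\<lambda>\<omega>. restrict (\<lambda>i. X i \<omega>) {i}" and ?B = "\<lambda>\<omega>. restrict (\<lambda>i. X i \<omega>) (- {i})"
  have "indep_var (PiM {i} (\<lambda>_. borel)) ?A (PiM (- {i}) (\<lambda>_. borel)) ?B"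
    by (rule indep_var_restrict[OF indep]) auto
  then have ind: "indep_set (sigma_sets (space M) {?A -` A \<inter> space M |A. A \<in> sets (PiM {i} (\<lambda>_. borel))})
       (sigma_sets (space M) {?B -` A \<inter> space M |A. A \<in> sets (PiM (- {i}) (\<lambda>_. borel))})"
    unfolding indep_var_eq by blast
  have 1: "{X i -` A \<inter> space M |A. A \<in> sets borel} \<subseteq> {?A -` A \<inter> space M |A. A \<in> sets (PiM {i} (\<lambda>_. borel))}"
  proof safe
    fix A :: "real set" assume A: "A \<in> sets borel"
    have "(\<lambda>x. x i) -` A \<inter> space (PiM {i} (\<lambda>_. borel)) \<in> sets (PiM {i} (\<lambda>_. borel::real measure))"
      by (rule measurable_sets[OF _ A]) (intro measurable_component_singleton, simp)
    moreover have "X i -` A \<inter> space M = ?A -` ((\<lambda>x. x i) -` A \<inter> space (PiM {i} (\<lambda>_. borel))) \<inter> space M"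
      by (auto simp: space_PiM)
    ultimately show "\<exists>Aa. X i -` A \<inter> space M = ?A -` Aa \<inter> space M \<and> Aa \<in> sets (PiM {i} (\<lambda>_. borel))"
      by blast
  qed
  have 2: "{H -` A \<inter> space M |A. A \<in> sets borel} \<subseteq> sigma_sets (space M) {?B -` A \<inter> space M |A. A \<in> sets (PiM (- {i}) (\<lambda>_. borel))}"
  proof safe
    fix A :: "real set" assume "A \<in> sets borel"
    from measurable_sets[OF H this] show "H -` A \<inter> space M \<in> sigma_sets (space M) {?B -` A \<inter> space M |A. A \<in> sets (PiM (- {i}) (\<lambda>_. borel))}"
      unfolding others_def by (simp add: sets_vimage_algebra)
  qed
  have "indep_set (sigma_sets (space M) {X i -` A \<inter> space M |A. A \<in> sets borel})
     (sigma_sets (space M) {H -` A \<inter> space M |A. A \<in> sets borel})"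
    unfolding indep_set_def
  proof (rule indep_sets_mono_sets[OF ind[unfolded indep_set_def]])
    fix b :: bool
    show "case_bool (sigma_sets (space M) {X i -` A \<inter> space M |A. A \<in> sets borel}) (sigma_sets (space M) {H -` A \<inter> space M |A. A \<in> sets borel}) b
      \<subseteq> case_bool (sigma_sets (space M) {?A -` A \<inter> space M |A. A \<in> sets (PiM {i} (\<lambda>_. borel))})
       (sigma_sets (space M) {?B -` A \<inter> space M |A. A \<in> sets (PiM (- {i}) (\<lambda>_. borel))}) b"
      using sigma_sets_mono''[OF _ 1] 2 sigma_sets_mono[OF 2] sigma_sets_subseteq[OF 1] by (cases b) auto
  qed
  then show ?thesis
    unfolding indep_var_eq using others_meas[OF H] by simp
qed

text \<open>Integrating out one variable. Integrability of the product comes from independence, so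
  no higher moments are spent on it.\<close>

lemma factor:
  fixes g :: "real \<Rightarrow> real"
  assumes H: "H \<in> borel_measurable (others i)" and g: "g \<in> borel_measurable borel"
    and ig: "integrable M (\<lambda>\<omega>. g (X i \<omega>))" and iH: "integrable M H"
  shows "integrable M (\<lambda>\<omega>. g (X i \<omega>) * H \<omega>)"
    and "(\<integral>\<omega>. g (X i \<omega>) * H \<omega> \<partial>M) = (\<integral>\<omega>. g (X i \<omega>) \<partial>M) * (\<integral>\<omega>. H \<omega> \<partial>M)"
proof -
  have "indep_var borel (g \<circ> X i) borel (id \<circ> H)"
    using g by (intro indep_var_compose[OF indep_others[OF H]]) auto
  then have iv: "indep_var borel (\<lambda>\<omega>. g (X i \<omega>)) borel H" by (simp add: comp_def)
  show "integrable M (\<lambda>\<omega>. g (X i \<omega>) * H \<omega>)"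
    using indep_var_integrable[OF iv ig iH] .
  show "(\<integral>\<omega>. g (X i \<omega>) * H \<omega> \<partial>M) = (\<integral>\<omega>. g (X i \<omega>) \<partial>M) * (\<integral>\<omega>. H \<omega> \<partial>M)"
    using indep_var_lebesgue_integral[OF iv ig iH] .
qed

lemma integrable_pow_le:
  fixes Y :: "'a \<Rightarrow> real"
  assumes "integrable M (\<lambda>\<omega>. \<bar>Y \<omega>\<bar> ^ p)" "q \<le> p" "Y \<in> borel_measurable M"
  shows "integrable M (\<lambda>\<omega>. \<bar>Y \<omega>\<bar> ^ q)"
proof (rule Bochner_Integration.integrable_bound)
  show "integrable M (\<lambda>\<omega>. 1 + \<bar>Y \<omega>\<bar> ^ p)" using assms by auto
  show "AE x in M. norm (\<bar>Y x\<bar> ^ q) \<le> norm (1 + \<bar>Y x\<bar> ^ p)"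
  proof (rule AE_I2)
    fix x
    have "\<bar>Y x\<bar> ^ q \<le> 1 + \<bar>Y x\<bar> ^ p"
    proof (cases "\<bar>Y x\<bar> \<le> 1")
      case True then show ?thesis using power_le_one[of "\<bar>Y x\<bar>" q] by (smt (verit) abs_ge_zero zero_le_power)
    next
      case False then show ?thesis using power_increasing[OF assms(2), of "\<bar>Y x\<bar>"] by linarith
    qed
    then show "norm (\<bar>Y x\<bar> ^ q) \<le> norm (1 + \<bar>Y x\<bar> ^ p)" by simp
  qed
qed (use assms in measurable)

lemma abs_add_pow_le: "\<bar>a + b\<bar> ^ p \<le> 2 ^ p * (\<bar>a\<bar> ^ p + \<bar>b :: real\<bar> ^ p)"
proof -
  have "\<bar>a + b\<bar> \<le> 2 * max \<bar>a\<bar> \<bar>b\<bar>" by simp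
  then have "\<bar>a + b\<bar> ^ p \<le> (2 * max \<bar>a\<bar> \<bar>b\<bar>) ^ p" by (intro power_mono) auto
  also have "\<dots> \<le> 2 ^ p * (\<bar>a\<bar> ^ p + \<bar>b\<bar> ^ p)"
    unfolding power_mult_distrib by (intro mult_left_mono) (auto simp: max_def)
  finally show ?thesis .
qed

text \<open>Since \<open>X i\<close> is independent of its derivative, \<open>p\<close>-th moments
  of the variables suffice whatever the degree of the polynomial.\<close>

lemma integrable_mlp_pow:
  assumes ip: "\<And>i. integrable M (\<lambda>\<omega>. \<bar>X i \<omega>\<bar> ^ p)" and "finite V"
  shows "integrable M (\<lambda>\<omega>. \<bar>mlp V b (\<lambda>l. X l \<omega>)\<bar> ^ p)"
  using \<open>finite V\<close>
proof (induction V arbitrary: b rule: finite_induct)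
  case empty
  then show ?case by (simp add: mlp_def)
next
  case (insert i V)
  let ?D = "\<lambda>\<omega>. mlp V (\<lambda>A. b (insert i A)) (\<lambda>l. X l \<omega>)"
  have [measurable]: "?D \<in> borel_measurable (others i)" using insert by (intro others_mlp)
  have 1: "integrable M (\<lambda>\<omega>. \<bar>X i \<omega>\<bar> ^ p * \<bar>?D \<omega>\<bar> ^ p)"
    by (rule factor(1)[of "\<lambda>\<omega>. \<bar>?D \<omega>\<bar> ^ p" i "\<lambda>x. \<bar>x\<bar> ^ p"]) (use insert ip in \<open>measurable\<close>)
  show ?case
  proof (rule Bochner_Integration.integrable_bound)
    show "integrable M (\<lambda>\<omega>. 2 ^ p * (\<bar>mlp V b (\<lambda>l. X l \<omega>)\<bar> ^ p + \<bar>X i \<omega> * ?D \<omega>\<bar> ^ p))"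
      using insert 1 by (auto simp: abs_mult power_mult_distrib)
    show "AE x in M. norm (\<bar>mlp (insert i V) b (\<lambda>l. X l x)\<bar> ^ p)
         \<le> norm (2 ^ p * (\<bar>mlp V b (\<lambda>l. X l x)\<bar> ^ p + \<bar>X i x * ?D x\<bar> ^ p))"
      using insert abs_add_pow_le by (intro AE_I2) (simp add: mlp_insert)
  qed measurable
qed

end

lemma integral_add3:
  fixes f g h :: "'a \<Rightarrow> real"
  assumes "integrable M f" "integrable M g" "integrable M h"
  shows "(\<integral>x. f x + g x + h x \<partial>M) = (\<integral>x. f x \<partial>M) + (\<integral>x. g x \<partial>M) + (\<integral>x. h x \<partial>M)"
  using assms by (simp add: Bochner_Integration.integral_add)

lemma integral_add4:
  fixes f g h k :: "'a \<Rightarrow> real"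
  assumes "integrable M f" "integrable M g" "integrable M h" "integrable M k"
  shows "(\<integral>x. f x + g x + h x + k x \<partial>M) = (\<integral>x. f x \<partial>M) + (\<integral>x. g x \<partial>M) + (\<integral>x. h x \<partial>M) + (\<integral>x. k x \<partial>M)"
  using assms by (simp add: Bochner_Integration.integral_add)

lemma (in prob_space) indep_sets_reindex:
  assumes "indep_sets F UNIV" "inj h"
  shows "indep_sets (\<lambda>i. F (h i)) UNIV"
proof (rule indep_setsI)
  fix i show "F (h i) \<subseteq> events" using assms(1) unfolding indep_sets_def by auto
next
  fix A J assume J: "J \<noteq> {}" "finite J" "\<forall>j\<in>J. A j \<in> F (h j)"
  have "prob (\<Inter>j\<in>h ` J. A (inv h j)) = (\<Prod>j\<in>h ` J. prob (A (inv h j)))"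
    using J assms(2) by (intro indep_setsD[OF assms(1)]) (auto simp: inv_f_f)
  moreover have "(\<Prod>j\<in>h ` J. prob (A (inv h j))) = (\<Prod>j\<in>J. prob (A j))"
    using assms(2) by (subst prod.reindex) (auto simp: inv_f_f inj_on_def)
  ultimately show "prob (\<Inter>j\<in>J. A j) = (\<Prod>j\<in>J. prob (A j))"
    using assms(2) by (simp add: inv_f_f)
qed

lemma (in indep_seq) indep_seq_reindex:
  assumes "inj h"
  shows "indep_seq M (\<lambda>i. X (h i))"
proof
  show "indep_vars (\<lambda>_. borel) (\<lambda>i. X (h i)) UNIV"
    using indep indep_sets_reindex[OF _ assms, of "\<lambda>i. sigma_sets (space M) {X i -` A \<inter> space M |A. A \<in> sets borel}"]
    unfolding indep_vars_def by auto
qed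

text \<open>Weighted AM-GM, from the factorisation of \<open>2 x^3 + y^3 - 3 x^2 y\<close> as
  \<open>(x - y)^2 (2 x + y)\<close>.\<close>

lemma sq_mult_le: "(x::real)\<^sup>2 * y \<le> (2 * x ^ 3 + y ^ 3) / 3" if "x \<ge> 0" "y \<ge> 0"
proof -
  have "0 \<le> (x - y)\<^sup>2 * (2 * x + y)" using that by simp
  then show ?thesis by (simp add: power2_eq_square power3_eq_cube algebra_simps)
qed

text \<open>Hoelder's inequality with exponents 3/2 and 3: normalise \<open>F\<close> by
  \<open>a\<close> and \<open>G\<close> by \<open>n\<close> and integrate \<open>sq_mult_le\<close>.
  Normalising fails when \<open>a\<close> or \<open>n\<close> is 0; then the function is required to
  vanish pointwise, which \<open>mlp_eq_0\<close> provides for polynomials. Applied to absolute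
  values it serves third moments, applied to squares sixth moments.\<close>

lemma (in prob_space) holder_cube:
  fixes F G :: "'a \<Rightarrow> real"
  assumes F: "\<And>\<omega>. F \<omega> \<ge> 0" "integrable M (\<lambda>\<omega>. F \<omega> ^ 3)" "(\<integral>\<omega>. F \<omega> ^ 3 \<partial>M) \<le> a ^ 3" "F \<in> borel_measurable M"
    and G: "\<And>\<omega>. G \<omega> \<ge> 0" "integrable M (\<lambda>\<omega>. G \<omega> ^ 3)" "(\<integral>\<omega>. G \<omega> ^ 3 \<partial>M) \<le> n ^ 3" "G \<in> borel_measurable M"
    and "a \<ge> 0" "n \<ge> 0" and z: "a = 0 \<Longrightarrow> \<forall>\<omega>. F \<omega> = 0" "n = 0 \<Longrightarrow> \<forall>\<omega>. G \<omega> = 0"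
  shows "integrable M (\<lambda>\<omega>. (F \<omega>)\<^sup>2 * G \<omega>)" "(\<integral>\<omega>. (F \<omega>)\<^sup>2 * G \<omega> \<partial>M) \<le> a\<^sup>2 * n"
proof -
  note [measurable] = F(4) G(4)
  have *: "integrable M (\<lambda>\<omega>. (2 * F \<omega> ^ 3 + G \<omega> ^ 3) / 3)" using F G by auto
  show "integrable M (\<lambda>\<omega>. (F \<omega>)\<^sup>2 * G \<omega>)"
  proof (rule Bochner_Integration.integrable_bound[OF *])
    show "AE x in M. norm ((F x)\<^sup>2 * G x) \<le> norm ((2 * F x ^ 3 + G x ^ 3) / 3)"
      using sq_mult_le[of "F _" "G _"] F(1) G(1) by (intro AE_I2) simp
  qed measurable
  show "(\<integral>\<omega>. (F \<omega>)\<^sup>2 * G \<omega> \<partial>M) \<le> a\<^sup>2 * n"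
  proof (cases "a = 0 \<or> n = 0")
    case True
    then show ?thesis using z by (auto simp: zero_le_mult_iff)
  next
    case False
    then have p: "a > 0" "n > 0" using assms by auto
    have "(F \<omega>)\<^sup>2 * G \<omega> \<le> a\<^sup>2 * n * ((2 * (F \<omega> / a) ^ 3 + (G \<omega> / n) ^ 3) / 3)" for \<omega>
    proof -
      have "(F \<omega>)\<^sup>2 * G \<omega> = a\<^sup>2 * n * ((F \<omega> / a)\<^sup>2 * (G \<omega> / n))" using p by (simp add: power_divide)
      also have "\<dots> \<le> a\<^sup>2 * n * ((2 * (F \<omega> / a) ^ 3 + (G \<omega> / n) ^ 3) / 3)"
        using p F(1) G(1) by (intro mult_left_mono sq_mult_le) auto
      finally show ?thesis .
    qed
    then have "(\<integral>\<omega>. (F \<omega>)\<^sup>2 * G \<omega> \<partial>M) \<le> (\<integral>\<omega>. a\<^sup>2 * n * ((2 * (F \<omega> / a) ^ 3 + (G \<omega> / n) ^ 3) / 3) \<partial>M)"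
      using F G \<open>integrable M (\<lambda>\<omega>. (F \<omega>)\<^sup>2 * G \<omega>)\<close> by (intro integral_mono) (auto simp: power_divide)
    also have "\<dots> = a\<^sup>2 * n * ((2 * ((\<integral>\<omega>. F \<omega> ^ 3 \<partial>M) / a ^ 3) + (\<integral>\<omega>. G \<omega> ^ 3 \<partial>M) / n ^ 3) / 3)"
      using F G by (simp add: power_divide)
    also have "\<dots> \<le> a\<^sup>2 * n * ((2 * 1 + 1) / 3)"
      using p F G by (intro mult_left_mono divide_right_mono add_mono) (auto simp: divide_le_eq)
    finally show ?thesis by simp
  qed
qed

lemma abs_mult_le_squares: "\<bar>x * y\<bar> \<le> x\<^sup>2 + (y::real)\<^sup>2"
proof -
  have "2 * \<bar>x\<bar> * \<bar>y\<bar> \<le> \<bar>x\<bar>\<^sup>2 + \<bar>y\<bar>\<^sup>2" by (rule sum_squares_bound)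
  moreover have "0 \<le> \<bar>x\<bar> * \<bar>y\<bar>" by simp
  ultimately show ?thesis unfolding abs_mult power2_abs by linarith
qed

lemma mlp_eq_0:
  assumes "finite V" "(\<Sum>A\<in>Pow V. w A * (b A)\<^sup>2) = 0" "\<And>A. w A > (0::real)"
  shows "mlp V b x = 0"
proof -
  have "\<forall>A\<in>Pow V. w A * (b A)\<^sup>2 = 0"
    using assms(1) assms(3)[THEN less_imp_le] by (intro sum_nonneg_eq_0_iff[THEN iffD1, OF _ _ assms(2)]) auto
  then have "\<forall>A\<in>Pow V. b A = 0" using assms(3) by (metis less_irrefl mult_eq_0_iff power_eq_0_iff)
  then show ?thesis unfolding mlp_def by simp
qed

section \<open>Standardized families: orthonormality of the monomials\<close>

locale std_seq = indep_seq M X for M :: "'a measure" and X :: "'i \<Rightarrow> 'a \<Rightarrow> real" +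
  assumes int1: "integrable M (X i)" and mean0: "(\<integral>\<omega>. X i \<omega> \<partial>M) = 0"
    and int2: "integrable M (\<lambda>\<omega>. (X i \<omega>)\<^sup>2)" and var1: "(\<integral>\<omega>. (X i \<omega>)\<^sup>2 \<partial>M) = 1"
begin

abbreviation "P V b \<omega> \<equiv> mlp V b (\<lambda>l. X l \<omega>)"

lemma factor_X:
  assumes "H \<in> borel_measurable (others i)" "integrable M H"
  shows "integrable M (\<lambda>\<omega>. X i \<omega> * H \<omega>)" "(\<integral>\<omega>. X i \<omega> * H \<omega> \<partial>M) = 0"
  using factor[of H i "\<lambda>x. x", OF assms(1) _ int1 assms(2)] by (simp_all add: mean0)

lemma factor_X2:
  assumes "H \<in> borel_measurable (others i)" "integrable M H"
  shows "integrable M (\<lambda>\<omega>. (X i \<omega>)\<^sup>2 * H \<omega>)" "(\<integral>\<omega>. (X i \<omega>)\<^sup>2 * H \<omega> \<partial>M) = (\<integral>\<omega>. H \<omega> \<partial>M)"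
  using factor[of H i "\<lambda>x. x\<^sup>2", OF assms(1) _ int2 assms(2)] by (simp_all add: var1)

lemma P_sq_int: "finite V \<Longrightarrow> integrable M (\<lambda>\<omega>. (P V b \<omega>)\<^sup>2)"
  using integrable_mlp_pow[of 2 V b] int2 by simp

lemma P_mult_int: "finite V \<Longrightarrow> integrable M (\<lambda>\<omega>. P V b \<omega> * P V c \<omega>)"
proof (rule Bochner_Integration.integrable_bound)
  assume "finite V"
  then show "integrable M (\<lambda>\<omega>. (P V b \<omega>)\<^sup>2 + (P V c \<omega>)\<^sup>2)" by (intro Bochner_Integration.integrable_add P_sq_int)
  show "AE x in M. norm (P V b x * P V c x) \<le> norm ((P V b x)\<^sup>2 + (P V c x)\<^sup>2)"
  proof (rule AE_I2)
    fix x show "norm (P V b x * P V c x) \<le> norm ((P V b x)\<^sup>2 + (P V c x)\<^sup>2)"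
      using abs_mult_le_squares[of "P V b x" "P V c x"] by simp
  qed
qed measurable

lemma P_int: "finite V \<Longrightarrow> integrable M (P V b)"
  using integrable_pow_le[of "P V b" 2 1] P_sq_int[of V b] by (rule_tac integrable_abs_cancel) (auto simp: power2_abs)

text \<open>Monomials are orthonormal. After splitting off \<open>X i\<close> from both factors, the
  cross terms \<open>H\<close> are killed by the mean 0, and the product \<open>K\<close> of the
  derivatives keeps its integral by the variance 1.\<close>

lemma P_mult: "finite V \<Longrightarrow> (\<integral>\<omega>. P V b \<omega> * P V c \<omega> \<partial>M) = (\<Sum>A\<in>Pow V. b A * c A)"
proof (induction V arbitrary: b c rule: finite_induct)
  case empty
  then show ?case by (simp add: mlp_def prob_space)
next
  case (insert i V)
  let ?b = "\<lambda>A. b (insert i A)" and ?c = "\<lambda>A. c (insert i A)"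
  have m[measurable]: "P V d \<in> borel_measurable (others i)" for d using insert by (intro others_mlp)
  define H where "H \<omega> = P V b \<omega> * P V ?c \<omega> + P V ?b \<omega> * P V c \<omega>" for \<omega>
  define K where "K \<omega> = P V ?b \<omega> * P V ?c \<omega>" for \<omega>
  have mH: "H \<in> borel_measurable (others i)" "K \<in> borel_measurable (others i)"
    unfolding H_def K_def by measurable
  have iH: "integrable M H" "integrable M K"
    unfolding H_def K_def by (intro Bochner_Integration.integrable_add P_mult_int insert.hyps)+
  note f1 = factor_X[OF mH(1) iH(1)]
  note f2 = factor_X2[OF mH(2) iH(2)]
  have "P (insert i V) b \<omega> * P (insert i V) c \<omega> = P V b \<omega> * P V c \<omega> + X i \<omega> * H \<omega> + (X i \<omega>)\<^sup>2 * K \<omega>" for \<omega>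
    using insert.hyps by (simp add: mlp_insert H_def K_def power2_eq_square algebra_simps)
  note eq = this
  have "(\<integral>\<omega>. P (insert i V) b \<omega> * P (insert i V) c \<omega> \<partial>M) =
     (\<integral>\<omega>. P V b \<omega> * P V c \<omega> \<partial>M) + (\<integral>\<omega>. X i \<omega> * H \<omega> \<partial>M) + (\<integral>\<omega>. (X i \<omega>)\<^sup>2 * K \<omega> \<partial>M)"
    unfolding eq by (rule integral_add3[OF P_mult_int[OF insert(1)] f1(1) f2(1)])
  also have "\<dots> = (\<Sum>A\<in>Pow V. b A * c A) + (\<Sum>A\<in>Pow V. ?b A * ?c A)"
  proof -
    note f1(2) f2(2)
    moreover have "(\<integral>\<omega>. K \<omega> \<partial>M) = (\<Sum>A\<in>Pow V. ?b A * ?c A)" unfolding K_def by (rule insert.IH)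
    moreover have "(\<integral>\<omega>. P V b \<omega> * P V c \<omega> \<partial>M) = (\<Sum>A\<in>Pow V. b A * c A)" by (rule insert.IH)
    ultimately show ?thesis by linarith
  qed
  also have "\<dots> = (\<Sum>A\<in>Pow (insert i V). b A * c A)"
    using insert.hyps by (subst sum_Pow_insert) auto
  finally show ?case .
qed

lemma P_sq: "finite V \<Longrightarrow> (\<integral>\<omega>. (P V b \<omega>)\<^sup>2 \<partial>M) = (\<Sum>A\<in>Pow V. (b A)\<^sup>2)"
  using P_mult[of V b b] by (simp add: power2_eq_square)

end

section \<open>Third moments and the Lindeberg replacement\<close>

text \<open>A Taylor-type upper bound for the cube of the modulus, arranged by powers of
  \<open>x\<close>: for a standardized variable independent of \<open>u\<close> and \<open>v\<close>
  the linear term integrates to 0 and the quadratic one has weight 1. The case of negative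
  \<open>u\<close> follows by reflection.\<close>

lemma cube_bound:
  "\<bar>u + x * v\<bar> ^ 3 \<le> \<bar>u\<bar> ^ 3 + 3 * (x * (u * \<bar>u\<bar> * v)) + 3 * (x\<^sup>2 * (\<bar>u\<bar> * v\<^sup>2)) + \<bar>x\<bar> ^ 3 * \<bar>v :: real\<bar> ^ 3"
proof -
  have *: "\<bar>u + h\<bar> ^ 3 \<le> u ^ 3 + 3 * u\<^sup>2 * h + 3 * u * h\<^sup>2 + \<bar>h\<bar> ^ 3" if "u \<ge> 0" for u h :: real
  proof (cases "u + h \<ge> 0")
    case True
    then have "\<bar>u + h\<bar> ^ 3 = u ^ 3 + 3 * u\<^sup>2 * h + 3 * u * h\<^sup>2 + h ^ 3"
      by (simp add: power2_eq_square power3_eq_cube algebra_simps)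
    also have "h ^ 3 \<le> \<bar>h\<bar> ^ 3" by (metis abs_ge_self power_abs)
    finally show ?thesis by simp
  next
    case False
    then have h: "h < 0" "\<bar>h\<bar> = - h" using that by auto
    have "\<bar>u + h\<bar> ^ 3 = - (u ^ 3 + 3 * u\<^sup>2 * h + 3 * u * h\<^sup>2 + h ^ 3)"
      using False by (simp add: power2_eq_square power3_eq_cube algebra_simps)
    \<comment> \<open>This is the difference of the two sides once the signs are resolved; the
      quadratic form in \<open>u\<close> and \<open>h\<close> is positive by completing the
      square.\<close>
    moreover have "0 \<le> 2 * u * (u\<^sup>2 + 3 * u * h + 3 * h\<^sup>2)"
    proof (intro mult_nonneg_nonneg)
      have "u\<^sup>2 + 3 * u * h + 3 * h\<^sup>2 = (u + 3/2 * h)\<^sup>2 + 3 / 4 * h\<^sup>2" by (simp add: power2_eq_square algebra_simps)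
      also have "\<dots> \<ge> 0" by simp
      finally show "0 \<le> u\<^sup>2 + 3 * u * h + 3 * h\<^sup>2" .
    qed (use that in auto)
    ultimately show ?thesis using h by (simp add: power2_eq_square power3_eq_cube algebra_simps)
  qed
  show ?thesis
  proof (cases "u \<ge> 0")
    case True
    then show ?thesis using *[of u "x * v"] by (simp add: power_mult_distrib abs_mult power2_eq_square mult_ac)
  next
    case False
    have "\<bar>- u + - (x * v)\<bar> = \<bar>u + x * v\<bar>" by linarith
    with False show ?thesis using *[of "- u" "- (x * v)"]
      by (simp add: power_mult_distrib abs_mult power2_eq_square mult_ac)
  qed
qed

text \<open>The inductive step for third moments: \<open>\<alpha>\<close> and \<open>\<nu>\<close>
  bound the cubic norms of the part without the new variable and of the derivative. After squaring,
  AM-GM removes the odd powers, and the factor \<open>3 \<beta>\<close> is large enough to compare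
  the remaining coefficients one by one.\<close>

lemma third_moment_step:
  fixes \<alpha> \<nu> \<beta> :: real
  assumes "\<alpha> \<ge> 0" "\<nu> \<ge> 0" "\<beta> \<ge> 1"
  shows "\<alpha> ^ 3 + 3 * (\<alpha> * \<nu>\<^sup>2) + \<beta> * \<nu> ^ 3 \<le> sqrt (\<alpha>\<^sup>2 + 3 * \<beta> * \<nu>\<^sup>2) ^ 3"
proof -
  have 1: "2 * (\<alpha> ^ 3 * \<nu> ^ 3) \<le> \<alpha> ^ 4 * \<nu>\<^sup>2 + \<alpha>\<^sup>2 * \<nu> ^ 4"
  proof -
    have "0 \<le> (\<alpha> * \<nu>)\<^sup>2 * (\<alpha> - \<nu>)\<^sup>2" by simp
    also have "\<dots> = \<alpha> ^ 4 * \<nu>\<^sup>2 + \<alpha>\<^sup>2 * \<nu> ^ 4 - 2 * (\<alpha> ^ 3 * \<nu> ^ 3)"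
      by (simp add: power2_eq_square power3_eq_cube power4_eq_xxxx algebra_simps)
    finally show ?thesis by simp
  qed
  have 2: "2 * (\<alpha> * \<nu> ^ 5) \<le> \<alpha>\<^sup>2 * \<nu> ^ 4 + \<nu> ^ 6"
  proof -
    have "0 \<le> (\<nu> ^ 2)\<^sup>2 * (\<alpha> - \<nu>)\<^sup>2" by simp
    also have "\<dots> = \<alpha>\<^sup>2 * \<nu> ^ 4 + \<nu> ^ 6 - 2 * (\<alpha> * \<nu> ^ 5)"
      by (simp add: power2_eq_square eval_nat_numeral algebra_simps)
    finally show ?thesis by simp
  qed
  have b2: "\<beta>\<^sup>2 \<ge> \<beta>" "\<beta> ^ 3 \<ge> \<beta>\<^sup>2" using assms by (auto simp: power2_eq_square power3_eq_cube)
  have "(\<alpha> ^ 3 + 3 * (\<alpha> * \<nu>\<^sup>2) + \<beta> * \<nu> ^ 3)\<^sup>2 =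
      \<alpha> ^ 6 + 6 * (\<alpha> ^ 4 * \<nu>\<^sup>2) + \<beta> * (2 * (\<alpha> ^ 3 * \<nu> ^ 3)) + 9 * (\<alpha>\<^sup>2 * \<nu> ^ 4) + 3 * \<beta> * (2 * (\<alpha> * \<nu> ^ 5)) + \<beta>\<^sup>2 * \<nu> ^ 6"
    by (simp add: eval_nat_numeral algebra_simps)
  also have "\<dots> \<le> \<alpha> ^ 6 + 6 * (\<alpha> ^ 4 * \<nu>\<^sup>2) + \<beta> * (\<alpha> ^ 4 * \<nu>\<^sup>2 + \<alpha>\<^sup>2 * \<nu> ^ 4) + 9 * (\<alpha>\<^sup>2 * \<nu> ^ 4) + 3 * \<beta> * (\<alpha>\<^sup>2 * \<nu> ^ 4 + \<nu> ^ 6) + \<beta>\<^sup>2 * \<nu> ^ 6"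
    using assms by (intro add_mono mult_left_mono 1 2 order_refl) auto
  also have "\<dots> = \<alpha> ^ 6 + (6 + \<beta>) * (\<alpha> ^ 4 * \<nu>\<^sup>2) + (9 + 4 * \<beta>) * (\<alpha>\<^sup>2 * \<nu> ^ 4) + (\<beta>\<^sup>2 + 3 * \<beta>) * \<nu> ^ 6"
    by (simp add: algebra_simps)
  also have "\<dots> \<le> \<alpha> ^ 6 + (9 * \<beta>) * (\<alpha> ^ 4 * \<nu>\<^sup>2) + (27 * \<beta>\<^sup>2) * (\<alpha>\<^sup>2 * \<nu> ^ 4) + (27 * \<beta> ^ 3) * \<nu> ^ 6"
  proof (intro add_mono mult_right_mono order_refl)
    show "9 + 4 * \<beta> \<le> 27 * \<beta>\<^sup>2" "\<beta>\<^sup>2 + 3 * \<beta> \<le> 27 * \<beta> ^ 3" using b2 assms(3) by linarith+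
  qed (use assms in auto)
  also have "\<dots> = (sqrt (\<alpha>\<^sup>2 + 3 * \<beta> * \<nu>\<^sup>2) ^ 3)\<^sup>2"
  proof -
    have sw: "(x ^ 3)\<^sup>2 = (x\<^sup>2) ^ 3" for x :: real by (simp flip: power_mult)
    have "(sqrt (\<alpha>\<^sup>2 + 3 * \<beta> * \<nu>\<^sup>2) ^ 3)\<^sup>2 = (sqrt (\<alpha>\<^sup>2 + 3 * \<beta> * \<nu>\<^sup>2) ^ 2) ^ 3"
      by (rule sw)
    also have "\<dots> = (\<alpha>\<^sup>2 + 3 * \<beta> * \<nu>\<^sup>2) ^ 3" using assms by (subst real_sqrt_pow2) auto
    finally have e: "(sqrt (\<alpha>\<^sup>2 + 3 * \<beta> * \<nu>\<^sup>2) ^ 3)\<^sup>2 = (\<alpha>\<^sup>2 + 3 * \<beta> * \<nu>\<^sup>2) ^ 3" .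
    have cube: "(x + y) ^ 3 = x ^ 3 + 3 * (x\<^sup>2 * y) + 3 * (x * y\<^sup>2) + y ^ 3" for x y :: real
      by (simp add: power2_eq_square power3_eq_cube algebra_simps)
    have pw: "(\<alpha>\<^sup>2) ^ 3 = \<alpha> ^ 6" "(\<alpha>\<^sup>2)\<^sup>2 = \<alpha> ^ 4" "(\<nu>\<^sup>2)\<^sup>2 = \<nu> ^ 4" "(\<nu>\<^sup>2) ^ 3 = \<nu> ^ 6"
      by (simp_all flip: power_mult)
    show ?thesis unfolding e cube power_mult_distrib pw by simp
  qed
  finally show ?thesis using assms by (rule_tac power2_le_imp_le) auto
qed

locale std3_seq = std_seq M X for M :: "'a measure" and X :: "'i \<Rightarrow> 'a \<Rightarrow> real" +
  fixes \<beta> :: real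
  assumes int3: "integrable M (\<lambda>\<omega>. \<bar>X i \<omega>\<bar> ^ 3)" and mom3: "(\<integral>\<omega>. \<bar>X i \<omega>\<bar> ^ 3 \<partial>M) \<le> \<beta>" and beta1: "\<beta> \<ge> 1"
begin

lemma factor_X3:
  assumes "H \<in> borel_measurable (others i)" "integrable M H"
  shows "integrable M (\<lambda>\<omega>. \<bar>X i \<omega>\<bar> ^ 3 * H \<omega>)"
    "(\<integral>\<omega>. \<bar>X i \<omega>\<bar> ^ 3 * H \<omega> \<partial>M) = (\<integral>\<omega>. \<bar>X i \<omega>\<bar> ^ 3 \<partial>M) * (\<integral>\<omega>. H \<omega> \<partial>M)"
  using factor[of H i "\<lambda>x. \<bar>x\<bar> ^ 3", OF assms(1) _ int3 assms(2)] by simp_all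

lemma P_cube_int: "finite V \<Longrightarrow> integrable M (\<lambda>\<omega>. \<bar>P V b \<omega>\<bar> ^ 3)"
  using integrable_mlp_pow int3 .

text \<open>The weights make the estimate stable under adding a variable: the sets containing the
  new index receive one more factor \<open>3 * \<beta>\<close>, as \<open>third_moment_step\<close>
  demands. In the expansion by \<open>cube_bound\<close> the linear term vanishes, Hoelder bounds
  the quadratic one by \<open>\<alpha> \<nu>^2\<close>, and the cubic one factorises by
  independence.\<close>

lemma hypercontractive3_weighted:
  "finite V \<Longrightarrow> (\<integral>\<omega>. \<bar>P V b \<omega>\<bar> ^ 3 \<partial>M) \<le> sqrt (\<Sum>A\<in>Pow V. (3 * \<beta>) ^ card A * (b A)\<^sup>2) ^ 3"
proof (induction V arbitrary: b rule: finite_induct)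
  case empty
  then show ?case by (simp add: mlp_def prob_space)
next
  case (insert i V)
  let ?b = "\<lambda>A. b (insert i A)"
  let ?S = "\<lambda>b. (\<Sum>A\<in>Pow V. (3 * \<beta>) ^ card A * (b A)\<^sup>2)"
  define \<alpha> where "\<alpha> = sqrt (?S b)"
  define \<nu> where "\<nu> = sqrt (?S ?b)"
  have S0: "?S c \<ge> 0" for c using beta1 by (intro sum_nonneg) auto
  have nn: "\<alpha> \<ge> 0" "\<nu> \<ge> 0" "\<alpha>\<^sup>2 = ?S b" "\<nu>\<^sup>2 = ?S ?b" unfolding \<alpha>_def \<nu>_def using S0 by auto
  let ?U = "\<lambda>\<omega>. P V b \<omega>" and ?D = "\<lambda>\<omega>. P V ?b \<omega>"
  have m[measurable]: "P V d \<in> borel_measurable (others i)" for d using insert by (intro others_mlp)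
  have IH: "(\<integral>\<omega>. \<bar>?U \<omega>\<bar> ^ 3 \<partial>M) \<le> \<alpha> ^ 3" "(\<integral>\<omega>. \<bar>?D \<omega>\<bar> ^ 3 \<partial>M) \<le> \<nu> ^ 3"
    unfolding \<alpha>_def \<nu>_def using insert.IH by auto
  have zU: "\<alpha> = 0 \<Longrightarrow> \<forall>\<omega>. \<bar>?U \<omega>\<bar> = 0"
    using mlp_eq_0[OF \<open>finite V\<close>, of "\<lambda>A. (3 * \<beta>) ^ card A" b] beta1 nn by auto
  have zD: "\<nu> = 0 \<Longrightarrow> \<forall>\<omega>. \<bar>?D \<omega>\<bar> = 0"
    using mlp_eq_0[OF \<open>finite V\<close>, of "\<lambda>A. (3 * \<beta>) ^ card A" ?b] beta1 nn by auto
  have am: "(\<lambda>\<omega>. \<bar>P V c \<omega>\<bar>) \<in> borel_measurable M" for c by (intro borel_measurable_abs mlp_meas)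
  note hold1 = holder_cube[where F="\<lambda>\<omega>. \<bar>?D \<omega>\<bar>" and G="\<lambda>\<omega>. \<bar>?U \<omega>\<bar>", OF abs_ge_zero P_cube_int[OF insert(1)] IH(2) am abs_ge_zero P_cube_int[OF insert(1)] IH(1) am nn(2) nn(1) zD zU]
  note hold2 = holder_cube[where F="\<lambda>\<omega>. \<bar>?U \<omega>\<bar>" and G="\<lambda>\<omega>. \<bar>?D \<omega>\<bar>", OF abs_ge_zero P_cube_int[OF insert(1)] IH(1) am abs_ge_zero P_cube_int[OF insert(1)] IH(2) am nn(1) nn(2) zU zD]
  \<comment> \<open>Only integrability is at stake here, since the factor \<open>X i\<close> will
    make the integral of this term vanish.\<close>
  have i1: "integrable M (\<lambda>\<omega>. ?U \<omega> * \<bar>?U \<omega>\<bar> * ?D \<omega>)"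
    by (rule Bochner_Integration.integrable_bound[OF hold2(1)]) (auto simp: abs_mult power2_eq_square)
  have DU: "\<bar>?U \<omega>\<bar> * (?D \<omega>)\<^sup>2 = \<bar>?D \<omega>\<bar>\<^sup>2 * \<bar>?U \<omega>\<bar>" for \<omega> by simp
  have i2: "integrable M (\<lambda>\<omega>. \<bar>?U \<omega>\<bar> * (?D \<omega>)\<^sup>2)" "(\<integral>\<omega>. \<bar>?U \<omega>\<bar> * (?D \<omega>)\<^sup>2 \<partial>M) \<le> \<alpha> * \<nu>\<^sup>2"
    using hold1 unfolding DU by (auto simp only: mult.commute)
  have i3: "integrable M (\<lambda>\<omega>. \<bar>?D \<omega>\<bar> ^ 3)" by (intro P_cube_int insert)
  have mH: "(\<lambda>\<omega>. ?U \<omega> * \<bar>?U \<omega>\<bar> * ?D \<omega>) \<in> borel_measurable (others i)"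
    "(\<lambda>\<omega>. \<bar>?U \<omega>\<bar> * (?D \<omega>)\<^sup>2) \<in> borel_measurable (others i)"
    "(\<lambda>\<omega>. \<bar>?D \<omega>\<bar> ^ 3) \<in> borel_measurable (others i)" by measurable
  note f1 = factor_X[OF mH(1) i1]
  note f2 = factor_X2[OF mH(2) i2(1)]
  note f3 = factor_X3[OF mH(3) i3]
  have g1: "integrable M (\<lambda>\<omega>. 3 * (X i \<omega> * (?U \<omega> * \<bar>?U \<omega>\<bar> * ?D \<omega>)))"
    and g2: "integrable M (\<lambda>\<omega>. 3 * ((X i \<omega>)\<^sup>2 * (\<bar>?U \<omega>\<bar> * (?D \<omega>)\<^sup>2)))"
    and g3: "integrable M (\<lambda>\<omega>. \<bar>X i \<omega>\<bar> ^ 3 * \<bar>?D \<omega>\<bar> ^ 3)"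
    by (rule integrable_mult_right[OF f1(1)] integrable_mult_right[OF f2(1)] f3(1))+
  note g0 = P_cube_int[OF insert(1), of b]
  have "(\<integral>\<omega>. \<bar>P (insert i V) b \<omega>\<bar> ^ 3 \<partial>M) \<le> (\<integral>\<omega>. \<bar>?U \<omega>\<bar> ^ 3 + 3 * (X i \<omega> * (?U \<omega> * \<bar>?U \<omega>\<bar> * ?D \<omega>)) +
      3 * ((X i \<omega>)\<^sup>2 * (\<bar>?U \<omega>\<bar> * (?D \<omega>)\<^sup>2)) + \<bar>X i \<omega>\<bar> ^ 3 * \<bar>?D \<omega>\<bar> ^ 3 \<partial>M)"
  proof (rule integral_mono)
    show "integrable M (\<lambda>\<omega>. \<bar>P (insert i V) b \<omega>\<bar> ^ 3)" by (intro P_cube_int finite.insertI insert)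
    show "integrable M (\<lambda>\<omega>. \<bar>?U \<omega>\<bar> ^ 3 + 3 * (X i \<omega> * (?U \<omega> * \<bar>?U \<omega>\<bar> * ?D \<omega>)) +
      3 * ((X i \<omega>)\<^sup>2 * (\<bar>?U \<omega>\<bar> * (?D \<omega>)\<^sup>2)) + \<bar>X i \<omega>\<bar> ^ 3 * \<bar>?D \<omega>\<bar> ^ 3)"
      by (intro Bochner_Integration.integrable_add g0 g1 g2 g3)
  qed (simp only: mlp_insert[OF insert(1,2)] cube_bound)
  also have "\<dots> = (\<integral>\<omega>. \<bar>?U \<omega>\<bar> ^ 3 \<partial>M) + (\<integral>\<omega>. 3 * (X i \<omega> * (?U \<omega> * \<bar>?U \<omega>\<bar> * ?D \<omega>)) \<partial>M) +
      (\<integral>\<omega>. 3 * ((X i \<omega>)\<^sup>2 * (\<bar>?U \<omega>\<bar> * (?D \<omega>)\<^sup>2)) \<partial>M) + (\<integral>\<omega>. \<bar>X i \<omega>\<bar> ^ 3 * \<bar>?D \<omega>\<bar> ^ 3 \<partial>M)"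
    by (rule integral_add4[OF g0 g1 g2 g3])
  also have "\<dots> = (\<integral>\<omega>. \<bar>?U \<omega>\<bar> ^ 3 \<partial>M) + 3 * (\<integral>\<omega>. \<bar>?U \<omega>\<bar> * (?D \<omega>)\<^sup>2 \<partial>M) + (\<integral>\<omega>. \<bar>X i \<omega>\<bar> ^ 3 \<partial>M) * (\<integral>\<omega>. \<bar>?D \<omega>\<bar> ^ 3 \<partial>M)"
  proof -
    show ?thesis unfolding integral_mult_right_zero f1(2) f2(2) f3(2) by linarith
  qed
  also have "\<dots> \<le> \<alpha> ^ 3 + 3 * (\<alpha> * \<nu>\<^sup>2) + \<beta> * \<nu> ^ 3"
    using IH i2 mom3 beta1 by (intro add_mono mult_mono mult_left_mono) auto
  also have "\<dots> \<le> sqrt (\<alpha>\<^sup>2 + 3 * \<beta> * \<nu>\<^sup>2) ^ 3"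
    using nn beta1 by (intro third_moment_step)
  also have "\<alpha>\<^sup>2 + 3 * \<beta> * \<nu>\<^sup>2 = (\<Sum>A\<in>Pow (insert i V). (3 * \<beta>) ^ card A * (b A)\<^sup>2)"
  proof -
    have "card (insert i A) = Suc (card A)" if "A \<in> Pow V" for A
      using that insert finite_subset[of A V] by (subst card_insert_disjoint) auto
    then show ?thesis unfolding nn(3,4) using insert
      by (simp add: sum_Pow_insert sum_distrib_left mult_ac)
  qed
  finally show ?case .
qed

lemma hypercontractive3:
  assumes "finite V" "\<And>A. A \<subseteq> V \<Longrightarrow> b A \<noteq> 0 \<Longrightarrow> card A \<le> d"
  shows "(\<integral>\<omega>. \<bar>P V b \<omega>\<bar> ^ 3 \<partial>M) \<le> sqrt ((3 * \<beta>) ^ d * (\<Sum>A\<in>Pow V. (b A)\<^sup>2)) ^ 3"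
proof -
  have "(\<Sum>A\<in>Pow V. (3 * \<beta>) ^ card A * (b A)\<^sup>2) \<le> (3 * \<beta>) ^ d * (\<Sum>A\<in>Pow V. (b A)\<^sup>2)"
    unfolding sum_distrib_left
  proof (rule sum_mono)
    fix A assume "A \<in> Pow V"
    then show "(3 * \<beta>) ^ card A * (b A)\<^sup>2 \<le> (3 * \<beta>) ^ d * (b A)\<^sup>2"
    proof (cases "b A = 0")
      case False
      then have "(3 * \<beta>) ^ card A \<le> (3 * \<beta>) ^ d"
        using \<open>A \<in> Pow V\<close> assms(2)[of A] beta1 by (intro power_increasing) auto
      then show ?thesis by (intro mult_right_mono) auto
    qed simp
  qed
  then have "sqrt (\<Sum>A\<in>Pow V. (3 * \<beta>) ^ card A * (b A)\<^sup>2) ^ 3 \<le> sqrt ((3 * \<beta>) ^ d * (\<Sum>A\<in>Pow V. (b A)\<^sup>2)) ^ 3"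
    using beta1 by (intro power_mono real_sqrt_le_mono real_sqrt_ge_zero sum_nonneg) auto
  with hypercontractive3_weighted[OF assms(1), of b] show ?thesis by linarith
qed

end

section \<open>Replacing the variables one at a time\<close>

lemma cos_taylor: "\<bar>cos (u + h) - (cos u - h * sin u - h\<^sup>2 / 2 * cos u)\<bar> \<le> \<bar>h :: real\<bar> ^ 3 / 6"
proof -
  have "(\<Sum>k\<le>2. (\<i> * complex_of_real h) ^ k / fact k) = 1 + \<i> * h - complex_of_real (h\<^sup>2 / 2)"
    by (simp add: eval_nat_numeral field_simps)
  then have 1: "cmod (cis h - (1 + \<i> * h - complex_of_real (h\<^sup>2 / 2))) \<le> \<bar>h\<bar> ^ 3 / 6"
    using iexp_approx1[of h 2] by (simp add: cis_conv_exp eval_nat_numeral)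
  have "cos (u + h) - (cos u - h * sin u - h\<^sup>2 / 2 * cos u) = Re (cis u * (cis h - (1 + \<i> * h - complex_of_real (h\<^sup>2 / 2))))"
    by (simp add: cos_add algebra_simps)
  also have "\<bar>\<dots>\<bar> \<le> cmod (cis u * (cis h - (1 + \<i> * h - complex_of_real (h\<^sup>2 / 2))))"
    by (rule abs_Re_le_cmod)
  also have "\<dots> \<le> \<bar>h\<bar> ^ 3 / 6" using 1 by (simp add: norm_mult)
  finally show ?thesis .
qed

text \<open>Expanding the cosine to second order in \<open>X i\<close> around the polynomial without
  it, the mean and the variance of \<open>X i\<close> are all that enters the approximating
  integral. It is therefore the same for any other standardized variable in place of
  \<open>X i\<close>, and only the cubic remainder sees the law.\<close>

lemma (in std3_seq) lindeberg_step:
  fixes b :: "'i set \<Rightarrow> real"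
  assumes "finite V" "i \<in> V"
  defines "U \<equiv> P (V - {i}) b" and "D \<equiv> P (V - {i}) (\<lambda>A. b (insert i A))"
  shows "\<bar>(\<integral>\<omega>. cos (P V b \<omega> + \<theta>) \<partial>M) - (\<integral>\<omega>. cos (U \<omega> + \<theta>) - (D \<omega>)\<^sup>2 / 2 * cos (U \<omega> + \<theta>) \<partial>M)\<bar>
    \<le> \<beta> / 6 * (\<integral>\<omega>. \<bar>D \<omega>\<bar> ^ 3 \<partial>M)"
proof -
  have m[measurable]: "U \<in> borel_measurable (others i)" "D \<in> borel_measurable (others i)"
    unfolding U_def D_def by (auto intro!: others_mlp)
  have mM[measurable]: "U \<in> borel_measurable M" "D \<in> borel_measurable M"
    unfolding U_def D_def by auto
  have fin: "finite (V - {i})" using assms by auto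
  have iD: "integrable M D" "integrable M (\<lambda>\<omega>. (D \<omega>)\<^sup>2)" "integrable M (\<lambda>\<omega>. \<bar>D \<omega>\<bar> ^ 3)"
    unfolding D_def using P_int[OF fin] P_sq_int[OF fin] P_cube_int[OF fin] by auto
  have b1: "integrable M (\<lambda>\<omega>. D \<omega> * sin (U \<omega> + \<theta>))"
    by (rule Bochner_Integration.integrable_bound[OF iD(1)]) (auto simp: abs_mult intro!: mult_left_le)
  have b2: "integrable M (\<lambda>\<omega>. (D \<omega>)\<^sup>2 / 2 * cos (U \<omega> + \<theta>))"
    by (rule Bochner_Integration.integrable_bound[OF iD(2)]) (auto simp: abs_mult intro!: mult_left_le[THEN order_trans])
  have b0: "integrable M (\<lambda>\<omega>. cos (Y \<omega> + \<theta>))" if "Y \<in> borel_measurable M" for Y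
    using that by (intro integrable_const_bound[where B=1]) auto
  have mH: "(\<lambda>\<omega>. D \<omega> * sin (U \<omega> + \<theta>)) \<in> borel_measurable (others i)"
    "(\<lambda>\<omega>. (D \<omega>)\<^sup>2 / 2 * cos (U \<omega> + \<theta>)) \<in> borel_measurable (others i)"
    "(\<lambda>\<omega>. \<bar>D \<omega>\<bar> ^ 3) \<in> borel_measurable (others i)" by measurable
  note f1 = factor_X[OF mH(1) b1]
  note f2 = factor_X2[OF mH(2) b2]
  note f3 = factor_X3[OF mH(3) iD(3)]
  define R where "R \<omega> = cos (P V b \<omega> + \<theta>) - (cos (U \<omega> + \<theta>) - X i \<omega> * (D \<omega> * sin (U \<omega> + \<theta>)) - (X i \<omega>)\<^sup>2 * ((D \<omega>)\<^sup>2 / 2 * cos (U \<omega> + \<theta>)))" for \<omega>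
  have Rb: "\<bar>R \<omega>\<bar> \<le> \<bar>X i \<omega>\<bar> ^ 3 * \<bar>D \<omega>\<bar> ^ 3 / 6" for \<omega>
  proof -
    have "P V b \<omega> + \<theta> = (U \<omega> + \<theta>) + X i \<omega> * D \<omega>"
      unfolding U_def D_def using mlp_remove[OF assms(1,2)] by simp
    moreover have "\<bar>X i \<omega> * D \<omega>\<bar> ^ 3 / 6 = \<bar>X i \<omega>\<bar> ^ 3 * \<bar>D \<omega>\<bar> ^ 3 / 6"
      by (simp add: abs_mult power_mult_distrib)
    moreover have "(X i \<omega> * D \<omega>)\<^sup>2 / 2 * cos (U \<omega> + \<theta>) = (X i \<omega>)\<^sup>2 * ((D \<omega>)\<^sup>2 / 2 * cos (U \<omega> + \<theta>))"
      by (simp add: power_mult_distrib)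
    ultimately show ?thesis unfolding R_def using cos_taylor[of "U \<omega> + \<theta>" "X i \<omega> * D \<omega>"]
      by (simp only: mult.assoc)
  qed
  have iC: "integrable M (\<lambda>\<omega>. cos (P V b \<omega> + \<theta>))" "integrable M (\<lambda>\<omega>. cos (U \<omega> + \<theta>))"
    by (intro b0 mlp_meas mM)+
  have iR: "integrable M R" unfolding R_def
    by (intro Bochner_Integration.integrable_diff iC f1(1) f2(1))
  have "(\<integral>\<omega>. R \<omega> \<partial>M) = (\<integral>\<omega>. cos (P V b \<omega> + \<theta>) \<partial>M) - ((\<integral>\<omega>. cos (U \<omega> + \<theta>) \<partial>M) - (\<integral>\<omega>. X i \<omega> * (D \<omega> * sin (U \<omega> + \<theta>)) \<partial>M) - (\<integral>\<omega>. (X i \<omega>)\<^sup>2 * ((D \<omega>)\<^sup>2 / 2 * cos (U \<omega> + \<theta>)) \<partial>M))"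
    unfolding R_def
    by (simp only: Bochner_Integration.integral_diff iC f1(1) f2(1) Bochner_Integration.integrable_diff)
  also have "\<dots> = (\<integral>\<omega>. cos (P V b \<omega> + \<theta>) \<partial>M) - (\<integral>\<omega>. cos (U \<omega> + \<theta>) - (D \<omega>)\<^sup>2 / 2 * cos (U \<omega> + \<theta>) \<partial>M)"
    by (simp only: f1(2) f2(2) Bochner_Integration.integral_diff iC b2)
  finally have "\<bar>(\<integral>\<omega>. cos (P V b \<omega> + \<theta>) \<partial>M) - (\<integral>\<omega>. cos (U \<omega> + \<theta>) - (D \<omega>)\<^sup>2 / 2 * cos (U \<omega> + \<theta>) \<partial>M)\<bar> = \<bar>\<integral>\<omega>. R \<omega> \<partial>M\<bar>" by simp
  also have "\<dots> \<le> (\<integral>\<omega>. \<bar>R \<omega>\<bar> \<partial>M)" using integral_abs_bound .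
  also have "\<dots> \<le> (\<integral>\<omega>. \<bar>X i \<omega>\<bar> ^ 3 * \<bar>D \<omega>\<bar> ^ 3 / 6 \<partial>M)"
    by (intro integral_mono integrable_abs iR integrable_divide f3(1) Rb)
  also have "\<dots> = (\<integral>\<omega>. \<bar>X i \<omega>\<bar> ^ 3 \<partial>M) / 6 * (\<integral>\<omega>. \<bar>D \<omega>\<bar> ^ 3 \<partial>M)" unfolding integral_divide_zero f3(2) by simp
  also have "\<dots> \<le> \<beta> / 6 * (\<integral>\<omega>. \<bar>D \<omega>\<bar> ^ 3 \<partial>M)"
    using mom3[of i] by (intro mult_right_mono divide_right_mono) auto
  finally show ?thesis .
qed

text \<open>The influence of \<open>i\<close>: the second moment of the derivative in direction
  \<open>i\<close>, that is, the share of the total sum of squares carried by the sets containing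
  \<open>i\<close>.\<close>

definition infl :: "'i set \<Rightarrow> ('i set \<Rightarrow> real) \<Rightarrow> 'i \<Rightarrow> real" where
  "infl V b i = (\<Sum>A\<in>Pow (V - {i}). (b (insert i A))\<^sup>2)"

lemma infl_nonneg: "infl V b i \<ge> 0" unfolding infl_def by (intro sum_nonneg) auto

lemma (in std3_seq) third_moment_derivative:
  assumes "finite V" "i \<in> V" "\<And>A. A \<subseteq> V \<Longrightarrow> b A \<noteq> 0 \<Longrightarrow> card A \<le> d"
  shows "(\<integral>\<omega>. \<bar>P (V - {i}) (\<lambda>A. b (insert i A)) \<omega>\<bar> ^ 3 \<partial>M) \<le> sqrt ((3 * \<beta>) ^ d * infl V b i) ^ 3"
  unfolding infl_def
proof (rule hypercontractive3)
  fix A assume A: "A \<subseteq> V - {i}" "b (insert i A) \<noteq> 0"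
  then have "card (insert i A) \<le> d" using assms(2) by (intro assms(3)) auto
  then show "card A \<le> d"
    using A finite_subset[of A "V - {i}"] assms(1) by (subst (asm) card_insert_disjoint) auto
qed (use assms in auto)

lemma (in std3_seq) std3_seq_reindex:
  assumes "inj h" shows "std3_seq M (\<lambda>i. X (h i)) \<beta>"
proof -
  interpret Y: indep_seq M "\<lambda>i. X (h i)" by (rule indep_seq_reindex[OF assms])
  show ?thesis by unfold_locales (auto simp: int1 mean0 int2 var1 int3 mom3 beta1)
qed

text \<open>The two families that are compared live on one space, as the two copies of the index set.\<close>

lemma lindeberg:
  fixes Z :: "'i \<times> bool \<Rightarrow> 'a \<Rightarrow> real"
  assumes Z: "std3_seq M Z \<beta>"
    and V: "finite V" "\<And>A. A \<subseteq> V \<Longrightarrow> b A \<noteq> 0 \<Longrightarrow> card A \<le> d"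
  shows "\<bar>(\<integral>\<omega>. cos (mlp V b (\<lambda>i. Z (i, True) \<omega>) + \<theta>) \<partial>M) - (\<integral>\<omega>. cos (mlp V b (\<lambda>i. Z (i, False) \<omega>) + \<theta>) \<partial>M)\<bar>
    \<le> \<beta> / 3 * (\<Sum>i\<in>V. sqrt ((3 * \<beta>) ^ d * infl V b i) ^ 3)"
proof -
  interpret Z: std3_seq M Z \<beta> by fact
  \<comment> \<open>Hybrid families: the \<open>True\<close> copy for indices in \<open>S\<close>,
    the \<open>False\<close> copy elsewhere. Letting \<open>S\<close> grow from the empty set to
    \<open>V\<close> exchanges one variable at a time.\<close>
  define Y where "Y S i = Z (i, i \<in> S)" for S i
  define \<Phi> where "\<Phi> S = (\<integral>\<omega>. cos (mlp V b (\<lambda>i. Y S i \<omega>) + \<theta>) \<partial>M)" for S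
  have Y: "std3_seq M (Y S) \<beta>" for S
    unfolding Y_def by (rule Z.std3_seq_reindex) (auto simp: inj_def)
  have step: "\<bar>\<Phi> (insert i S) - \<Phi> S\<bar> \<le> \<beta> / 3 * sqrt ((3 * \<beta>) ^ d * infl V b i) ^ 3" if "i \<in> V" "i \<notin> S" for i S
  proof -
    let ?T = "insert i S"
    interpret Y1: std3_seq M "Y S" \<beta> by (rule Y)
    interpret Y2: std3_seq M "Y ?T" \<beta> by (rule Y)
    \<comment> \<open>Consecutive hybrids differ only at \<open>i\<close>, so both are compared with
      the same second-order approximation. The two errors together account for the factor 2.\<close>
    have eq: "mlp (V - {i}) c (\<lambda>l. Y ?T l \<omega>) = mlp (V - {i}) c (\<lambda>l. Y S l \<omega>)" for c \<omega>
      by (rule mlp_cong_vars) (auto simp: Y_def)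
    have "\<bar>\<Phi> ?T - \<Phi> S\<bar> \<le> 2 * (\<beta> / 6 * (\<integral>\<omega>. \<bar>mlp (V - {i}) (\<lambda>A. b (insert i A)) (\<lambda>l. Y S l \<omega>)\<bar> ^ 3 \<partial>M))"
      using Y1.lindeberg_step[OF V(1) that(1), of b \<theta>] Y2.lindeberg_step[OF V(1) that(1), of b \<theta>]
      unfolding eq \<Phi>_def by linarith
    also have "\<dots> \<le> 2 * (\<beta> / 6 * sqrt ((3 * \<beta>) ^ d * infl V b i) ^ 3)"
      using Y1.third_moment_derivative[OF V(1) that(1), of b d] V Z.beta1 by (intro mult_left_mono) auto
    finally show ?thesis by simp
  qed
  have "\<bar>\<Phi> S - \<Phi> {}\<bar> \<le> \<beta> / 3 * (\<Sum>i\<in>S. sqrt ((3 * \<beta>) ^ d * infl V b i) ^ 3)" if "S \<subseteq> V" for S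
    using finite_subset[OF that V(1)] that
  proof (induction S rule: finite_induct)
    case (insert i S)
    have "\<bar>\<Phi> (insert i S) - \<Phi> S\<bar> \<le> \<beta> / 3 * sqrt ((3 * \<beta>) ^ d * infl V b i) ^ 3"
      using insert by (intro step) auto
    moreover have "\<bar>\<Phi> S - \<Phi> {}\<bar> \<le> \<beta> / 3 * (\<Sum>i\<in>S. sqrt ((3 * \<beta>) ^ d * infl V b i) ^ 3)"
      using insert by auto
    moreover have "\<beta> / 3 * (\<Sum>i\<in>insert i S. sqrt ((3 * \<beta>) ^ d * infl V b i) ^ 3) = \<beta> / 3 * sqrt ((3 * \<beta>) ^ d * infl V b i) ^ 3 + \<beta> / 3 * (\<Sum>i\<in>S. sqrt ((3 * \<beta>) ^ d * infl V b i) ^ 3)"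
      by (simp only: sum.insert[OF insert(1,2)] distrib_left)
    ultimately show ?case by linarith
  qed simp
  from this[of V] have "\<bar>\<Phi> V - \<Phi> {}\<bar> \<le> \<beta> / 3 * (\<Sum>i\<in>V. sqrt ((3 * \<beta>) ^ d * infl V b i) ^ 3)" by simp
  moreover have "mlp V b (\<lambda>i. Y V i \<omega>) = mlp V b (\<lambda>i. Z (i, True) \<omega>)" for \<omega>
    by (rule mlp_cong_vars) (auto simp: Y_def)
  moreover have "mlp V b (\<lambda>i. Y {} i \<omega>) = mlp V b (\<lambda>i. Z (i, False) \<omega>)" for \<omega>
    by (rule mlp_cong_vars) (auto simp: Y_def)
  ultimately show ?thesis unfolding \<Phi>_def by simp
qed

section \<open>Stein's method for random signs\<close>

text \<open>The first-order term is taken at the end point \<open>u + h\<close>, because in Stein's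
  identity the cosine has to carry the full polynomial and not the one without
  \<open>X i\<close>.\<close>

lemma sin_taylor: "\<bar>sin (u + h) - sin u - h * cos (u + h)\<bar> \<le> (h :: real)\<^sup>2 / 2"
proof -
  have "cmod (cis (- h) - (1 - \<i> * h)) \<le> h\<^sup>2 / 2"
    using iexp_approx1[of "- h" 1] by (simp add: cis_conv_exp power2_eq_square)
  moreover have "sin (u + h) - sin u - h * cos (u + h) = - Im (cis (u + h) * (cis (- h) - (1 - \<i> * h)))"
  proof -
    have "Im (cis (u + h) * cis (- h)) = sin u" unfolding cis_mult by simp
    then show ?thesis by (simp add: right_diff_distrib)
  qed
  moreover have "\<bar>- Im (cis (u + h) * (cis (- h) - (1 - \<i> * h)))\<bar> \<le> cmod (cis (u + h) * (cis (- h) - (1 - \<i> * h)))"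
    unfolding abs_minus_cancel by (rule abs_Im_le_cmod)
  ultimately show ?thesis by (simp add: norm_mult)
qed

lemma cos_taylor1: "\<bar>cos (u + h) - cos u + h * sin u\<bar> \<le> (h :: real)\<^sup>2 / 2"
proof -
  have "\<bar>cos u - cos (u + h) - h * sin u\<bar> \<le> h\<^sup>2 / 2"
    using sin_taylor[of "u + h + pi / 2" "- h"] by (simp add: sin_add cos_add)
  then show ?thesis by linarith
qed

lemma DERIV_quadratic_bound:
  fixes f :: "real \<Rightarrow> real"
  assumes "\<And>\<delta>. \<bar>f (s + \<delta>) - f s - \<delta> * d\<bar> \<le> C * \<delta>\<^sup>2"
  shows "(f has_real_derivative d) (at s)"
  unfolding DERIV_def
proof (rule LIM_zero_cancel, rule Lim_null_comparison)
  show "eventually (\<lambda>h. norm ((f (s + h) - f s) / h - d) \<le> C * \<bar>h\<bar>) (at 0)"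
    unfolding eventually_at_filter
  proof (rule always_eventually, intro allI impI)
    fix h :: real assume h: "h \<noteq> 0"
    have "(f (s + h) - f s) / h - d = (f (s + h) - f s - h * d) / h" using h by (simp add: field_simps)
    then have "norm ((f (s + h) - f s) / h - d) = \<bar>f (s + h) - f s - h * d\<bar> / \<bar>h\<bar>" by simp
    also have "\<dots> \<le> C * h\<^sup>2 / \<bar>h\<bar>" by (intro divide_right_mono assms) auto
    also have "\<dots> = C * (\<bar>h\<bar> * \<bar>h\<bar>) / \<bar>h\<bar>" by (simp only: power2_eq_square abs_mult_self_eq)
    also have "\<dots> = C * \<bar>h\<bar>" using h by (simp del: abs_mult_self_eq)
    finally show "norm ((f (s + h) - f s) / h - d) \<le> C * \<bar>h\<bar>" .
  qed
  show "((\<lambda>h. C * \<bar>h\<bar>) \<longlongrightarrow> 0) (at 0)" by (auto intro!: tendsto_eq_intros)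
qed

text \<open>\<open>h' = - s v h\<close> has the solution \<open>h 0 * exp (- s^2 v / 2)\<close>.
  With the integrating factor \<open>exp (s^2 v / 2)\<close> the mean value theorem turns a defect
  \<open>e\<close> of the equation into an error at time 1; the factor picked up is at most
  \<open>exp (v / 2)\<close> and cancels in the end.\<close>

lemma gaussian_ode_bound:
  fixes h h' :: "real \<Rightarrow> real"
  assumes "\<And>s. (h has_real_derivative h' s) (at s)"
    and "\<And>s. 0 \<le> s \<Longrightarrow> s \<le> 1 \<Longrightarrow> \<bar>h' s + s * v * h s\<bar> \<le> e" and "v \<ge> 0"
  shows "\<bar>h 1 - h 0 * exp (- v / 2)\<bar> \<le> e"
proof -
  define H where "H s = h s * exp (s\<^sup>2 * v / 2)" for s
  have H: "(H has_real_derivative (h' s + s * v * h s) * exp (s\<^sup>2 * v / 2)) (at s)" for s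
    unfolding H_def by (auto intro!: derivative_eq_intros assms(1) simp: algebra_simps)
  have "\<exists>z. 0 < z \<and> z < 1 \<and> H 1 - H 0 = (1 - 0) * ((h' z + z * v * h z) * exp (z\<^sup>2 * v / 2))"
    using H by (intro MVT2) auto
  then obtain z where z: "0 < z" "z < 1" "H 1 - H 0 = (h' z + z * v * h z) * exp (z\<^sup>2 * v / 2)" by auto
  have "z\<^sup>2 * v / 2 \<le> v / 2" using z assms(3) power_le_one[of z 2] by (simp add: mult_left_le_one_le)
  then have "\<bar>H 1 - H 0\<bar> \<le> e * exp (v / 2)"
    unfolding z(3) abs_mult using assms(2)[of z] z by (intro mult_mono) auto
  then have "\<bar>H 1 - H 0\<bar> * exp (- v / 2) \<le> e * exp (v / 2) * exp (- v / 2)"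
    by (intro mult_right_mono) auto
  then have "\<bar>H 1 - H 0\<bar> * exp (- v / 2) \<le> e"
    by (simp only: mult.assoc flip: exp_add) simp
  moreover have "\<bar>H 1 - H 0\<bar> * exp (- v / 2) = \<bar>(H 1 - H 0) * exp (- v / 2)\<bar>" by (simp add: abs_mult)
  moreover have "(H 1 - H 0) * exp (- v / 2) = h 1 - h 0 * exp (- v / 2)"
    unfolding H_def by (simp add: algebra_simps flip: exp_add)
  ultimately show ?thesis by simp
qed

lemma sum_Pow_containing:
  assumes "finite V" "i \<in> V"
  shows "(\<Sum>A\<in>Pow (V - {i}). g (insert i A)) = (\<Sum>A\<in>Pow V. if i \<in> A then g A else 0)"
proof -
  have "(\<Sum>A\<in>Pow V. if i \<in> A then g A else 0) = (\<Sum>A\<in>{A \<in> Pow V. i \<in> A}. g A)"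
    using assms by (intro sum.inter_filter[symmetric]) auto
  also have "\<dots> = (\<Sum>A\<in>Pow (V - {i}). g (insert i A))"
    using assms by (intro sum.reindex_bij_witness[of _ "insert i" "\<lambda>A. A - {i}"]) (auto simp: insert_absorb)
  finally show ?thesis by simp
qed

lemma mlp_deriv_eq:
  assumes "finite V" "i \<in> V"
  shows "x i * mlp (V - {i}) (\<lambda>A. c (insert i A)) x = (\<Sum>A\<in>Pow V. if i \<in> A then c A * (\<Prod>l\<in>A. x l) else 0)"
proof -
  have "x i * mlp (V - {i}) (\<lambda>A. c (insert i A)) x = (\<Sum>A\<in>Pow (V - {i}). c (insert i A) * (\<Prod>l\<in>insert i A. x l))"
    unfolding mlp_def sum_distrib_left
  proof (rule sum.cong[OF refl])
    fix A assume "A \<in> Pow (V - {i})"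
    then have "finite A" "i \<notin> A" using assms finite_subset[of A "V - {i}"] by auto
    then show "x i * (c (insert i A) * (\<Prod>l\<in>A. x l)) = c (insert i A) * (\<Prod>l\<in>insert i A. x l)" by simp
  qed
  then show ?thesis using sum_Pow_containing[OF assms, of "\<lambda>A. c A * (\<Prod>l\<in>A. x l)"] by simp
qed

text \<open>Euler's identity: the weights \<open>1 / card A\<close> invert the number operator.\<close>

lemma mlp_euler:
  assumes "finite V" "b {} = 0"
  shows "(\<Sum>i\<in>V. x i * mlp (V - {i}) (\<lambda>A. b (insert i A) / card (insert i A)) x) = mlp V b x"
proof -
  have "(\<Sum>i\<in>V. x i * mlp (V - {i}) (\<lambda>A. b (insert i A) / card (insert i A)) x)
     = (\<Sum>i\<in>V. \<Sum>A\<in>Pow V. if i \<in> A then b A / card A * (\<Prod>l\<in>A. x l) else 0)"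
    using assms by (intro sum.cong refl mlp_deriv_eq[where c="\<lambda>A. b A / card A"]) auto
  also have "\<dots> = (\<Sum>A\<in>Pow V. \<Sum>i\<in>V. if i \<in> A then b A / card A * (\<Prod>l\<in>A. x l) else 0)"
    by (rule sum.swap)
  also have "\<dots> = (\<Sum>A\<in>Pow V. b A * (\<Prod>l\<in>A. x l))"
  proof (rule sum.cong[OF refl])
    fix A assume A: "A \<in> Pow V"
    then have "(\<Sum>i\<in>V. if i \<in> A then b A / card A * (\<Prod>l\<in>A. x l) else 0) = (\<Sum>i\<in>A. b A / card A * (\<Prod>l\<in>A. x l))"
      using assms by (simp add: sum.If_cases Int_absorb1)
    also have "\<dots> = b A * (\<Prod>l\<in>A. x l)"
      using A assms finite_subset[of A V] by (cases "A = {}") auto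
    finally show "(\<Sum>i\<in>V. if i \<in> A then b A / card A * (\<Prod>l\<in>A. x l) else 0) = b A * (\<Prod>l\<in>A. x l)" .
  qed
  finally show ?thesis unfolding mlp_def .
qed

text \<open>The values are prescribed at every point and not just almost surely, so that squares of
  the variables may be rewritten to 1 inside polynomials.\<close>

locale rademacher_seq = indep_seq M X for M :: "'a measure" and X :: "'i \<Rightarrow> 'a \<Rightarrow> real" +
  assumes X_pm: "X i \<omega> = 1 \<or> X i \<omega> = - 1" and X_mean: "(\<integral>\<omega>. X i \<omega> \<partial>M) = 0"
begin

lemma X_abs[simp]: "\<bar>X i \<omega>\<bar> = 1" using X_pm[of i \<omega>] by auto
lemma X_sq[simp]: "(X i \<omega>)\<^sup>2 = 1" using X_pm[of i \<omega>] by auto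

sublocale std3_seq M X "1 :: real"
  by unfold_locales (auto intro!: integrable_const_bound[where B=1] simp: X_mean prob_space)

text \<open>Integration by parts in one sign. The sine at the polynomial without \<open>X i\<close>
  is independent of \<open>X i\<close>, so its product with \<open>X i\<close> has mean 0; the
  first-order change of the sine contributes another \<open>X i\<close>, and the square of
  \<open>X i\<close> is 1. What remains is the second-order error.\<close>

lemma stein_step:
  fixes b c :: "'i set \<Rightarrow> real"
  assumes "finite V" "i \<in> V"
  defines "T \<equiv> P (V - {i}) c" and "D \<equiv> P (V - {i}) (\<lambda>A. b (insert i A))"
  shows "\<bar>(\<integral>\<omega>. X i \<omega> * T \<omega> * sin (s * P V b \<omega> + \<theta>) \<partial>M) - s * (\<integral>\<omega>. T \<omega> * D \<omega> * cos (s * P V b \<omega> + \<theta>) \<partial>M)\<bar>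
    \<le> s\<^sup>2 / 2 * (\<integral>\<omega>. \<bar>T \<omega>\<bar> * (D \<omega>)\<^sup>2 \<partial>M)"
    and "integrable M (\<lambda>\<omega>. X i \<omega> * T \<omega> * sin (s * P V b \<omega> + \<theta>))"
    and "integrable M (\<lambda>\<omega>. T \<omega> * D \<omega> * cos (s * P V b \<omega> + \<theta>))"
    and "integrable M (\<lambda>\<omega>. \<bar>T \<omega>\<bar> * (D \<omega>)\<^sup>2)"
proof -
  define U where "U = P (V - {i}) b"
  have mO[measurable]: "T \<in> borel_measurable (others i)" "U \<in> borel_measurable (others i)"
    unfolding T_def U_def by (auto intro!: others_mlp)
  have mM[measurable]: "T \<in> borel_measurable M" "D \<in> borel_measurable M" "U \<in> borel_measurable M"
    unfolding T_def D_def U_def by auto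
  have fin: "finite (V - {i})" using assms by auto
  have iT: "integrable M T" unfolding T_def by (rule P_int[OF fin])
  have iTD: "integrable M (\<lambda>\<omega>. T \<omega> * D \<omega>)" unfolding T_def D_def by (rule P_mult_int[OF fin])
  have iTu: "integrable M (\<lambda>\<omega>. T \<omega> * sin (s * U \<omega> + \<theta>))"
    by (rule Bochner_Integration.integrable_bound[OF iT]) (auto simp: abs_mult intro!: mult_left_le)
  show iXs: "integrable M (\<lambda>\<omega>. X i \<omega> * T \<omega> * sin (s * P V b \<omega> + \<theta>))"
    by (rule Bochner_Integration.integrable_bound[OF iT]) (auto simp: abs_mult intro!: mult_left_le)
  show iTDc: "integrable M (\<lambda>\<omega>. T \<omega> * D \<omega> * cos (s * P V b \<omega> + \<theta>))"
    by (rule Bochner_Integration.integrable_bound[OF iTD]) (auto simp: abs_mult intro!: mult_left_le)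
  show iTDD: "integrable M (\<lambda>\<omega>. \<bar>T \<omega>\<bar> * (D \<omega>)\<^sup>2)"
  proof (rule Bochner_Integration.integrable_bound)
    show "integrable M (\<lambda>\<omega>. \<bar>T \<omega>\<bar> ^ 3 + \<bar>D \<omega>\<bar> ^ 3)"
      unfolding T_def D_def by (intro Bochner_Integration.integrable_add P_cube_int fin)
    show "AE \<omega> in M. norm (\<bar>T \<omega>\<bar> * (D \<omega>)\<^sup>2) \<le> norm (\<bar>T \<omega>\<bar> ^ 3 + \<bar>D \<omega>\<bar> ^ 3)"
    proof (rule AE_I2)
      fix \<omega>
      have "\<bar>D \<omega>\<bar>\<^sup>2 * \<bar>T \<omega>\<bar> \<le> (2 * \<bar>D \<omega>\<bar> ^ 3 + \<bar>T \<omega>\<bar> ^ 3) / 3" by (rule sq_mult_le) auto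
      moreover have "x \<le> z + y" if "x \<le> (2 * y + z) / 3" "0 \<le> y" "0 \<le> z" for x y z :: real
        using that by simp
      ultimately have "\<bar>T \<omega>\<bar> * (D \<omega>)\<^sup>2 \<le> \<bar>T \<omega>\<bar> ^ 3 + \<bar>D \<omega>\<bar> ^ 3"
        unfolding power2_abs mult.commute[of "(D \<omega>)\<^sup>2"] by (meson abs_ge_zero zero_le_power)
      then show "norm (\<bar>T \<omega>\<bar> * (D \<omega>)\<^sup>2) \<le> norm (\<bar>T \<omega>\<bar> ^ 3 + \<bar>D \<omega>\<bar> ^ 3)" by simp
    qed
  qed measurable
  have mH: "(\<lambda>\<omega>. T \<omega> * sin (s * U \<omega> + \<theta>)) \<in> borel_measurable (others i)" by measurable
  note f1 = factor_X[OF mH iTu]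
  define R where "R \<omega> = X i \<omega> * T \<omega> * sin (s * P V b \<omega> + \<theta>) - X i \<omega> * (T \<omega> * sin (s * U \<omega> + \<theta>)) - s * (T \<omega> * D \<omega> * cos (s * P V b \<omega> + \<theta>))" for \<omega>
  have Rb: "\<bar>R \<omega>\<bar> \<le> s\<^sup>2 / 2 * (\<bar>T \<omega>\<bar> * (D \<omega>)\<^sup>2)" for \<omega>
  proof -
    define h where "h = s * X i \<omega> * D \<omega>"
    have W: "s * P V b \<omega> + \<theta> = (s * U \<omega> + \<theta>) + h"
      unfolding U_def D_def h_def using mlp_remove[OF assms(1,2)] by (simp add: algebra_simps)
    \<comment> \<open>The increment \<open>h\<close> contains one factor \<open>X i\<close>;
      multiplying by a further \<open>X i\<close> removes it.\<close>
    have "s * (T \<omega> * D \<omega>) = X i \<omega> * T \<omega> * h" using X_sq[of i \<omega>] unfolding h_def power2_eq_square by algebra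
    then have e: "s * (T \<omega> * D \<omega> * y) = X i \<omega> * T \<omega> * (h * y)" for y by (metis mult.assoc)
    have "R \<omega> = (X i \<omega> * T \<omega>) * (sin ((s * U \<omega> + \<theta>) + h) - sin (s * U \<omega> + \<theta>) - h * cos ((s * U \<omega> + \<theta>) + h))"
      unfolding R_def W e right_diff_distrib by (simp only: mult.assoc)
    also have "\<bar>\<dots>\<bar> \<le> \<bar>T \<omega>\<bar> * (h\<^sup>2 / 2)"
      unfolding abs_mult X_abs mult_1 by (intro mult_left_mono sin_taylor) auto
    also have "\<dots> = s\<^sup>2 / 2 * (\<bar>T \<omega>\<bar> * (D \<omega>)\<^sup>2)" unfolding h_def power_mult_distrib X_sq by simp
    finally show ?thesis .
  qed
  have iR: "integrable M R" unfolding R_def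
    by (intro Bochner_Integration.integrable_diff integrable_mult_right iXs f1(1) iTDc)
  have "(\<integral>\<omega>. R \<omega> \<partial>M) = (\<integral>\<omega>. X i \<omega> * T \<omega> * sin (s * P V b \<omega> + \<theta>) \<partial>M) - s * (\<integral>\<omega>. T \<omega> * D \<omega> * cos (s * P V b \<omega> + \<theta>) \<partial>M)"
    unfolding R_def
    by (simp only: Bochner_Integration.integral_diff iXs f1 iTDc integrable_mult_right Bochner_Integration.integrable_diff integral_mult_right_zero diff_zero)
  then have "\<bar>(\<integral>\<omega>. X i \<omega> * T \<omega> * sin (s * P V b \<omega> + \<theta>) \<partial>M) - s * (\<integral>\<omega>. T \<omega> * D \<omega> * cos (s * P V b \<omega> + \<theta>) \<partial>M)\<bar> \<le> (\<integral>\<omega>. \<bar>R \<omega>\<bar> \<partial>M)"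
    using integral_abs_bound[of M R] by simp
  also have "\<dots> \<le> (\<integral>\<omega>. s\<^sup>2 / 2 * (\<bar>T \<omega>\<bar> * (D \<omega>)\<^sup>2) \<partial>M)"
    by (intro integral_mono integrable_abs iR integrable_mult_right iTDD Rb)
  finally show "\<bar>(\<integral>\<omega>. X i \<omega> * T \<omega> * sin (s * P V b \<omega> + \<theta>) \<partial>M) - s * (\<integral>\<omega>. T \<omega> * D \<omega> * cos (s * P V b \<omega> + \<theta>) \<partial>M)\<bar>
    \<le> s\<^sup>2 / 2 * (\<integral>\<omega>. \<bar>T \<omega>\<bar> * (D \<omega>)\<^sup>2 \<partial>M)" unfolding integral_mult_right_zero .
qed

lemma cos_expectation_deriv:
  assumes "finite V"
  shows "((\<lambda>s. \<integral>\<omega>. cos (s * P V b \<omega> + \<theta>) \<partial>M) has_real_derivative - (\<integral>\<omega>. P V b \<omega> * sin (s * P V b \<omega> + \<theta>) \<partial>M)) (at s)"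
proof (rule DERIV_quadratic_bound)
  fix \<delta>
  let ?W = "P V b"
  have iW: "integrable M ?W" "integrable M (\<lambda>\<omega>. (?W \<omega>)\<^sup>2)" using P_int P_sq_int assms by auto
  have iWs: "integrable M (\<lambda>\<omega>. ?W \<omega> * sin (s * ?W \<omega> + \<theta>))"
    by (rule Bochner_Integration.integrable_bound[OF iW(1)]) (auto simp: abs_mult intro!: mult_left_le)
  have ic: "integrable M (\<lambda>\<omega>. cos (t * ?W \<omega> + \<theta>))" for t
    by (intro integrable_const_bound[where B=1]) auto
  define R where "R \<omega> = cos ((s + \<delta>) * ?W \<omega> + \<theta>) - cos (s * ?W \<omega> + \<theta>) + \<delta> * (?W \<omega> * sin (s * ?W \<omega> + \<theta>))" for \<omega>
  have iR: "integrable M R" unfolding R_def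
    by (intro Bochner_Integration.integrable_diff Bochner_Integration.integrable_add integrable_mult_right ic iWs)
  have Rb: "\<bar>R \<omega>\<bar> \<le> \<delta>\<^sup>2 / 2 * (?W \<omega>)\<^sup>2" for \<omega>
    using cos_taylor1[of "s * ?W \<omega> + \<theta>" "\<delta> * ?W \<omega>"] unfolding R_def by (simp add: algebra_simps)
  have "(\<integral>\<omega>. R \<omega> \<partial>M) = (\<integral>\<omega>. cos ((s + \<delta>) * ?W \<omega> + \<theta>) \<partial>M) - (\<integral>\<omega>. cos (s * ?W \<omega> + \<theta>) \<partial>M) - \<delta> * - (\<integral>\<omega>. ?W \<omega> * sin (s * ?W \<omega> + \<theta>) \<partial>M)"
    unfolding R_def
    by (simp only: Bochner_Integration.integral_diff Bochner_Integration.integral_add ic iWs integrable_mult_right Bochner_Integration.integrable_diff integral_mult_right_zero mult_minus_right diff_minus_eq_add)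
  then have "\<bar>(\<integral>\<omega>. cos ((s + \<delta>) * ?W \<omega> + \<theta>) \<partial>M) - (\<integral>\<omega>. cos (s * ?W \<omega> + \<theta>) \<partial>M) - \<delta> * - (\<integral>\<omega>. ?W \<omega> * sin (s * ?W \<omega> + \<theta>) \<partial>M)\<bar> \<le> (\<integral>\<omega>. \<bar>R \<omega>\<bar> \<partial>M)"
    using integral_abs_bound[of M R] by simp
  also have "\<dots> \<le> (\<integral>\<omega>. \<delta>\<^sup>2 / 2 * (?W \<omega>)\<^sup>2 \<partial>M)"
    by (intro integral_mono integrable_abs iR integrable_mult_right iW Rb)
  finally show "\<bar>(\<integral>\<omega>. cos ((s + \<delta>) * ?W \<omega> + \<theta>) \<partial>M) - (\<integral>\<omega>. cos (s * ?W \<omega> + \<theta>) \<partial>M) - \<delta> * - (\<integral>\<omega>. ?W \<omega> * sin (s * ?W \<omega> + \<theta>) \<partial>M)\<bar> \<le> (\<integral>\<omega>. (?W \<omega>)\<^sup>2 \<partial>M) / 2 * \<delta>\<^sup>2"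
    unfolding integral_mult_right_zero by (simp add: mult_ac)
qed

text \<open>In the language of Malliavin calculus, \<open>D V b i\<close> is the discrete derivative
  of the polynomial at \<open>i\<close>, and \<open>T V b i\<close> that of its image under the
  inverse of the number operator.\<close>

abbreviation "D V b i \<equiv> P (V - {i}) (\<lambda>A. b (insert i A))"
abbreviation "T V b i \<equiv> P (V - {i}) (\<lambda>A. b (insert i A) / card (insert i A))"

text \<open>Differentiating the expected cosine in the scale \<open>s\<close> produces
  \<open>W sin\<close>, with \<open>W\<close> the polynomial. Euler's identity splits
  \<open>W\<close> into the terms treated by \<open>stein_step\<close>, whose main parts add up to
  \<open>s \<Gamma> cos\<close>. Replacing the random \<open>\<Gamma>\<close> by its mean
  \<open>\<sigma>2\<close> gives the Gaussian differential equation. The two error terms are the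
  fluctuation of \<open>\<Gamma>\<close> and the Taylor remainders.\<close>

lemma clt_bound:
  assumes V: "finite V" "b {} = 0" and \<sigma>: "\<sigma>2 = (\<Sum>A\<in>Pow V. (b A)\<^sup>2)"
  defines "\<Gamma> \<equiv> \<lambda>\<omega>. \<Sum>i\<in>V. T V b i \<omega> * D V b i \<omega>"
  shows "\<bar>(\<integral>\<omega>. cos (P V b \<omega> + \<theta>) \<partial>M) - cos \<theta> * exp (- \<sigma>2 / 2)\<bar>
    \<le> (\<integral>\<omega>. \<bar>\<Gamma> \<omega> - \<sigma>2\<bar> \<partial>M) + (\<Sum>i\<in>V. \<integral>\<omega>. \<bar>T V b i \<omega>\<bar> * (D V b i \<omega>)\<^sup>2 \<partial>M)"
proof -
  let ?W = "P V b"
  let ?h = "\<lambda>s. \<integral>\<omega>. cos (s * ?W \<omega> + \<theta>) \<partial>M"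
  let ?h' = "\<lambda>s. - (\<integral>\<omega>. ?W \<omega> * sin (s * ?W \<omega> + \<theta>) \<partial>M)"
  let ?e1 = "\<integral>\<omega>. \<bar>\<Gamma> \<omega> - \<sigma>2\<bar> \<partial>M" and ?e2 = "\<Sum>i\<in>V. \<integral>\<omega>. \<bar>T V b i \<omega>\<bar> * (D V b i \<omega>)\<^sup>2 \<partial>M"
  have \<sigma>0: "\<sigma>2 \<ge> 0" unfolding \<sigma> by (intro sum_nonneg) auto
  have i\<Gamma>: "integrable M \<Gamma>" unfolding \<Gamma>_def
    by (intro Bochner_Integration.integrable_sum P_mult_int) (use V in auto)
  have ic: "integrable M (\<lambda>\<omega>. cos (t * ?W \<omega> + \<theta>))" for t
    by (intro integrable_const_bound[where B=1]) auto
  have e20: "?e2 \<ge> 0" by (intro sum_nonneg Bochner_Integration.integral_nonneg) auto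
  have bound: "\<bar>?h' s + s * \<sigma>2 * ?h s\<bar> \<le> ?e1 + ?e2" if s: "0 \<le> s" "s \<le> 1" for s
  proof -
    have s2: "s\<^sup>2 / 2 \<le> 1" using power_le_one[of s 2] s by simp
    note st = stein_step(1-3)[where s=s and \<theta>=\<theta> and b=b, OF V(1)]
    have [simp]: "integrable M (\<lambda>\<omega>. X i \<omega> * T V b i \<omega> * sin (s * ?W \<omega> + \<theta>))"
      "integrable M (\<lambda>\<omega>. T V b i \<omega> * D V b i \<omega> * cos (s * ?W \<omega> + \<theta>))" if "i \<in> V" for i
      using st(2,3) that by blast+
    have "?W \<omega> * sin (s * ?W \<omega> + \<theta>) = (\<Sum>i\<in>V. X i \<omega> * T V b i \<omega> * sin (s * ?W \<omega> + \<theta>))" for \<omega>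
      using mlp_euler[of V b "\<lambda>l. X l \<omega>"] V by (simp add: sum_distrib_right[symmetric])
    then have "(\<integral>\<omega>. ?W \<omega> * sin (s * ?W \<omega> + \<theta>) \<partial>M) = (\<integral>\<omega>. (\<Sum>i\<in>V. X i \<omega> * T V b i \<omega> * sin (s * ?W \<omega> + \<theta>)) \<partial>M)"
      by (simp only:)
    also have "\<dots> = (\<Sum>i\<in>V. \<integral>\<omega>. X i \<omega> * T V b i \<omega> * sin (s * ?W \<omega> + \<theta>) \<partial>M)"
      by (rule Bochner_Integration.integral_sum) simp
    finally have 1: "(\<integral>\<omega>. ?W \<omega> * sin (s * ?W \<omega> + \<theta>) \<partial>M) = (\<Sum>i\<in>V. \<integral>\<omega>. X i \<omega> * T V b i \<omega> * sin (s * ?W \<omega> + \<theta>) \<partial>M)" .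
    have i\<Gamma>c: "integrable M (\<lambda>\<omega>. \<Gamma> \<omega> * cos (s * ?W \<omega> + \<theta>))"
      unfolding \<Gamma>_def sum_distrib_right by (intro Bochner_Integration.integrable_sum) simp
    have 2: "(\<integral>\<omega>. \<Gamma> \<omega> * cos (s * ?W \<omega> + \<theta>) \<partial>M) = (\<Sum>i\<in>V. \<integral>\<omega>. T V b i \<omega> * D V b i \<omega> * cos (s * ?W \<omega> + \<theta>) \<partial>M)"
      unfolding \<Gamma>_def sum_distrib_right by (rule Bochner_Integration.integral_sum) simp
    have 3: "\<bar>(\<integral>\<omega>. ?W \<omega> * sin (s * ?W \<omega> + \<theta>) \<partial>M) - s * (\<integral>\<omega>. \<Gamma> \<omega> * cos (s * ?W \<omega> + \<theta>) \<partial>M)\<bar> \<le> ?e2"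
      unfolding 1 2 sum_distrib_left sum_subtractf[symmetric]
    proof (rule order_trans[OF sum_abs], rule sum_mono)
      fix i assume i: "i \<in> V"
      have "\<bar>(\<integral>\<omega>. X i \<omega> * T V b i \<omega> * sin (s * ?W \<omega> + \<theta>) \<partial>M) - s * (\<integral>\<omega>. T V b i \<omega> * D V b i \<omega> * cos (s * ?W \<omega> + \<theta>) \<partial>M)\<bar>
         \<le> s\<^sup>2 / 2 * (\<integral>\<omega>. \<bar>T V b i \<omega>\<bar> * (D V b i \<omega>)\<^sup>2 \<partial>M)" by (rule st(1)[OF i])
      also have "\<dots> \<le> 1 * (\<integral>\<omega>. \<bar>T V b i \<omega>\<bar> * (D V b i \<omega>)\<^sup>2 \<partial>M)"
        by (intro mult_right_mono s2 Bochner_Integration.integral_nonneg) auto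
      finally show "\<bar>(\<integral>\<omega>. X i \<omega> * T V b i \<omega> * sin (s * ?W \<omega> + \<theta>) \<partial>M) - s * (\<integral>\<omega>. T V b i \<omega> * D V b i \<omega> * cos (s * ?W \<omega> + \<theta>) \<partial>M)\<bar>
         \<le> (\<integral>\<omega>. \<bar>T V b i \<omega>\<bar> * (D V b i \<omega>)\<^sup>2 \<partial>M)" by simp
    qed
    let ?d = "\<lambda>\<omega>. \<Gamma> \<omega> * cos (s * ?W \<omega> + \<theta>) - \<sigma>2 * cos (s * ?W \<omega> + \<theta>)"
    have d: "(\<integral>\<omega>. \<Gamma> \<omega> * cos (s * ?W \<omega> + \<theta>) \<partial>M) - \<sigma>2 * ?h s = (\<integral>\<omega>. ?d \<omega> \<partial>M)"
      by (simp only: Bochner_Integration.integral_diff i\<Gamma>c ic integrable_mult_right integral_mult_right_zero)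
    have "\<bar>\<integral>\<omega>. ?d \<omega> \<partial>M\<bar> \<le> (\<integral>\<omega>. \<bar>?d \<omega>\<bar> \<partial>M)" by (rule integral_abs_bound)
    also have "\<dots> \<le> ?e1"
    proof (rule integral_mono)
      show "integrable M (\<lambda>\<omega>. \<bar>\<Gamma> \<omega> * cos (s * ?W \<omega> + \<theta>) - \<sigma>2 * cos (s * ?W \<omega> + \<theta>)\<bar>)"
        by (intro integrable_abs Bochner_Integration.integrable_diff i\<Gamma>c ic integrable_mult_right)
      show "integrable M (\<lambda>\<omega>. \<bar>\<Gamma> \<omega> - \<sigma>2\<bar>)"
        by (intro integrable_abs Bochner_Integration.integrable_diff i\<Gamma> integrable_const)
      show "\<bar>\<Gamma> \<omega> * cos (s * ?W \<omega> + \<theta>) - \<sigma>2 * cos (s * ?W \<omega> + \<theta>)\<bar> \<le> \<bar>\<Gamma> \<omega> - \<sigma>2\<bar>" for \<omega>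
        unfolding left_diff_distrib[symmetric] abs_mult by (intro mult_left_le) auto
    qed
    finally have d2: "\<bar>\<integral>\<omega>. ?d \<omega> \<partial>M\<bar> \<le> ?e1" .
    have 4: "\<bar>s * ((\<integral>\<omega>. \<Gamma> \<omega> * cos (s * ?W \<omega> + \<theta>) \<partial>M) - \<sigma>2 * ?h s)\<bar> \<le> ?e1"
      unfolding d abs_mult using s d2 by (simp only: abs_of_nonneg) (rule order_trans[OF mult_left_le_one_le[OF abs_ge_zero]])
    have "x = \<bar>- w + s * \<sigma>2 * y\<bar> \<Longrightarrow> \<bar>w - s * g\<bar> \<le> e2 \<Longrightarrow> \<bar>s * (g - \<sigma>2 * y)\<bar> \<le> e1 \<Longrightarrow> x \<le> e1 + e2" for x y w g e1 e2 :: real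
      by (simp add: algebra_simps)
    from this[OF refl 3 4] show ?thesis .
  qed
  have "\<bar>?h 1 - ?h 0 * exp (- \<sigma>2 / 2)\<bar> \<le> ?e1 + ?e2"
    by (rule gaussian_ode_bound[OF cos_expectation_deriv[OF V(1)] bound \<sigma>0])
  then show ?thesis by (simp add: prob_space)
qed

end

section \<open>Contractions of finite kernels\<close>

definition ksub :: "'i set \<Rightarrow> nat \<Rightarrow> 'i set set" where
  "ksub V m = {A. A \<subseteq> V \<and> card A = m}"

lemma finite_ksub[simp]: "finite V \<Longrightarrow> finite (ksub V m)"
  unfolding ksub_def by (rule finite_subset[of _ "Pow V"]) auto

text \<open>The squared norm of a contraction over \<open>r\<close> indices, with sets instead of
  tuples. Overlaps of \<open>P\<close> or \<open>Q\<close> with \<open>R\<close> are not excluded: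
  for kernels supported on sets of size \<open>p\<close> and \<open>q\<close> such unions are too
  small to contribute.\<close>

definition contr :: "'i set \<Rightarrow> nat \<Rightarrow> nat \<Rightarrow> nat \<Rightarrow> ('i set \<Rightarrow> real) \<Rightarrow> ('i set \<Rightarrow> real) \<Rightarrow> real" where
  "contr V p q r a c = (\<Sum>P\<in>ksub V (p - r). \<Sum>Q\<in>ksub V (q - r). (\<Sum>R\<in>ksub V r. a (P \<union> R) * c (Q \<union> R))\<^sup>2)"

lemma sum_sum_group:
  fixes h :: "'b \<Rightarrow> 'c \<Rightarrow> real"
  assumes "finite S" "finite T" "finite U" "\<And>x y. x \<in> S \<Longrightarrow> y \<in> T \<Longrightarrow> g x y \<in> U"
  shows "(\<Sum>x\<in>S. \<Sum>y\<in>T. h x y * z (g x y)) = (\<Sum>e\<in>U. (\<Sum>x\<in>S. \<Sum>y\<in>T. if g x y = e then h x y else 0) * z e)"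
proof -
  have "(\<Sum>e\<in>U. (\<Sum>x\<in>S. \<Sum>y\<in>T. if g x y = e then h x y else 0) * z e)
    = (\<Sum>e\<in>U. \<Sum>x\<in>S. \<Sum>y\<in>T. if e = g x y then h x y * z (g x y) else 0)"
    unfolding sum_distrib_right by (intro sum.cong refl) auto
  also have "\<dots> = (\<Sum>x\<in>S. \<Sum>y\<in>T. \<Sum>e\<in>U. if e = g x y then h x y * z (g x y) else 0)"
    by (subst sum.swap, rule sum.cong[OF refl], subst sum.swap) simp
  also have "\<dots> = (\<Sum>x\<in>S. \<Sum>y\<in>T. h x y * z (g x y))"
    using assms by (intro sum.cong refl) (simp add: sum.delta)
  finally show ?thesis by simp
qed

text \<open>Stein's bound involves the variance of \<open>\<Sum>i\<in>V. D V b i * T V b i\<close>; its expansion is split by the size \<open>r\<close> of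
  \<open>A \<inter> B\<close>, so that each part is controlled by one contraction.\<close>

definition gpart :: "'i set \<Rightarrow> nat \<Rightarrow> ('i set \<Rightarrow> real) \<Rightarrow> ('i set \<Rightarrow> real) \<Rightarrow> ('i \<Rightarrow> real) \<Rightarrow> real" where
  "gpart V r a c x = (\<Sum>A\<in>Pow V. \<Sum>B\<in>Pow V. (if A \<noteq> B \<and> card (A \<inter> B) = r then a A * c B else 0) * (\<Prod>i\<in>(A - B) \<union> (B - A). x i))"

lemma gpart_mlp:
  assumes "finite V"
  shows "gpart V r a c x = mlp V (\<lambda>E. \<Sum>A\<in>Pow V. \<Sum>B\<in>Pow V. if (A - B) \<union> (B - A) = E then (if A \<noteq> B \<and> card (A \<inter> B) = r then a A * c B else 0) else 0) x"
  unfolding gpart_def mlp_def using assms by (intro sum_sum_group) auto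

text \<open>A pair \<open>(A, B)\<close> with symmetric difference \<open>E\<close> is recovered
  from \<open>P = A - B\<close> and \<open>R = A \<inter> B\<close>, so the coefficient collects
  entries of the contraction at the splittings of \<open>E\<close>. On the right, \<open>R\<close>
  may meet \<open>E\<close>; then one of the two unions has too few elements and the term is
  0.\<close>

lemma gpart_coeff:
  assumes V: "finite V" and E: "E \<subseteq> V" "E \<noteq> {}"
    and a: "\<And>A. a A \<noteq> 0 \<Longrightarrow> card A = p" and c: "\<And>A. c A \<noteq> 0 \<Longrightarrow> card A = q" and r: "r \<le> p" "r \<le> q"
  shows "(\<Sum>A\<in>Pow V. \<Sum>B\<in>Pow V. if (A - B) \<union> (B - A) = E then (if A \<noteq> B \<and> card (A \<inter> B) = r then a A * c B else 0) else (0::real))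
    = (\<Sum>P\<in>Pow E. if card P = p - r \<and> card (E - P) = q - r then (\<Sum>R\<in>ksub V r. a (P \<union> R) * c ((E - P) \<union> R)) else 0)"
proof -
  let ?S = "{(A, B). A \<subseteq> V \<and> B \<subseteq> V \<and> (A - B) \<union> (B - A) = E \<and> card (A \<inter> B) = r \<and> card A = p \<and> card B = q}"
  let ?T = "{(P, R). P \<subseteq> E \<and> R \<subseteq> V \<and> card R = r \<and> card P = p - r \<and> card (E - P) = q - r \<and> R \<inter> E = {}}"
  have fin: "finite A" if "A \<subseteq> V" for A using that V finite_subset by auto
  have "(\<Sum>A\<in>Pow V. \<Sum>B\<in>Pow V. if (A - B) \<union> (B - A) = E then (if A \<noteq> B \<and> card (A \<inter> B) = r then a A * c B else 0) else (0::real))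
    = (\<Sum>(A, B)\<in>Pow V \<times> Pow V. if (A, B) \<in> ?S then a A * c B else 0)"
    unfolding sum.cartesian_product
  proof (intro sum.cong refl, clarify)
    fix A B assume "A \<subseteq> V" "B \<subseteq> V"
    then show "(if (A - B) \<union> (B - A) = E then (if A \<noteq> B \<and> card (A \<inter> B) = r then a A * c B else 0) else 0) = (if (A, B) \<in> ?S then a A * c B else 0)"
      using a[of A] c[of B] E(2) by (cases "a A = 0"; cases "c B = 0") auto
  qed
  also have "\<dots> = (\<Sum>(A, B)\<in>?S. a A * c B)"
    unfolding case_prod_unfold using V
    by (subst sum.inter_filter[symmetric]) (auto intro!: sum.cong)
  also have "\<dots> = (\<Sum>(P, R)\<in>?T. a (P \<union> R) * c ((E - P) \<union> R))"
  proof (rule sum.reindex_bij_witness[of _ "\<lambda>(P, R). (P \<union> R, (E - P) \<union> R)" "\<lambda>(A, B). (A - B, A \<inter> B)"])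
    fix z assume "z \<in> ?S"
    then obtain A B where z: "z = (A, B)" "A \<subseteq> V" "B \<subseteq> V" "(A - B) \<union> (B - A) = E" "card (A \<inter> B) = r" "card A = p" "card B = q" by auto
    have EP: "E - (A - B) = B - A" using z by auto
    have "card (A - B) = p - r" using z fin by (subst card_Diff_subset_Int) auto
    moreover have "card (B - A) = q - r" using z fin by (subst card_Diff_subset_Int) (auto simp: Int_commute)
    ultimately show "(case z of (A, B) \<Rightarrow> (A - B, A \<inter> B)) \<in> ?T" using z EP by auto
    show "(case (case z of (A, B) \<Rightarrow> (A - B, A \<inter> B)) of (P, R) \<Rightarrow> (P \<union> R, (E - P) \<union> R)) = z"
      using z EP by auto
    show "(case (case z of (A, B) \<Rightarrow> (A - B, A \<inter> B)) of (P, R) \<Rightarrow> a (P \<union> R) * c ((E - P) \<union> R)) = (case z of (A, B) \<Rightarrow> a A * c B)"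
    proof -
      have "(A - B) \<union> (A \<inter> B) = A" "(E - (A - B)) \<union> (A \<inter> B) = B" unfolding EP by auto
      then show ?thesis using z(1) by simp
    qed
  next
    fix z assume "z \<in> ?T"
    then obtain P R where z: "z = (P, R)" "P \<subseteq> E" "R \<subseteq> V" "card R = r" "card P = p - r" "card (E - P) = q - r" "R \<inter> E = {}" by auto
    have f: "finite P" "finite R" "finite (E - P)" using z E fin by (auto intro: finite_subset[OF _ V])
    have I: "(P \<union> R) \<inter> ((E - P) \<union> R) = R" using z by auto
    have D: "(P \<union> R) - ((E - P) \<union> R) = P" "((E - P) \<union> R) - (P \<union> R) = E - P" using z by auto
    have "card (P \<union> R) = p" "card ((E - P) \<union> R) = q"
      using z f r by (subst card_Un_disjoint; auto)+
    then show "(case z of (P, R) \<Rightarrow> (P \<union> R, (E - P) \<union> R)) \<in> ?S"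
      using z I D E by auto
    show "(case (case z of (P, R) \<Rightarrow> (P \<union> R, (E - P) \<union> R)) of (A, B) \<Rightarrow> (A - B, A \<inter> B)) = z"
      using z(1) I D by simp
  qed
  also have "\<dots> = (\<Sum>(P, R)\<in>Pow E \<times> ksub V r. if card P = p - r \<and> card (E - P) = q - r then a (P \<union> R) * c ((E - P) \<union> R) else 0)"
  proof (rule sum.mono_neutral_cong_left)
    show "finite (Pow E \<times> ksub V r)" using V finite_subset[OF E(1) V] by auto
    show "?T \<subseteq> Pow E \<times> ksub V r" unfolding ksub_def by auto
    show "\<forall>z\<in>Pow E \<times> ksub V r - ?T. (case z of (P, R) \<Rightarrow> if card P = p - r \<and> card (E - P) = q - r then a (P \<union> R) * c ((E - P) \<union> R) else 0) = 0"
    proof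
      fix z assume "z \<in> Pow E \<times> ksub V r - ?T"
      then obtain P R where z: "z = (P, R)" "P \<subseteq> E" "R \<subseteq> V" "card R = r"
          "\<not> (card P = p - r \<and> card (E - P) = q - r \<and> R \<inter> E = {})" unfolding ksub_def by auto
      have f: "finite P" "finite R" "finite (E - P)" using z E fin by (auto intro: finite_subset[OF _ V])
      have "a (P \<union> R) * c ((E - P) \<union> R) = 0" if "card P = p - r" "card (E - P) = q - r"
      proof (rule ccontr)
        assume "a (P \<union> R) * c ((E - P) \<union> R) \<noteq> 0"
        then have "card (P \<union> R) = p" "card ((E - P) \<union> R) = q" using a c by auto
        then have "card (P \<inter> R) = 0" "card ((E - P) \<inter> R) = 0"
          using card_Un_Int[of P R] card_Un_Int[of "E - P" R] f that z(4) r by auto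
        then have "R \<inter> E = {}" using f z(2) by auto
        then show False using z that by auto
      qed
      then show "(case z of (P, R) \<Rightarrow> if card P = p - r \<and> card (E - P) = q - r then a (P \<union> R) * c ((E - P) \<union> R) else 0) = 0"
        using z(1) by simp
    qed
  qed (auto)
  also have "\<dots> = (\<Sum>P\<in>Pow E. \<Sum>R\<in>ksub V r. if card P = p - r \<and> card (E - P) = q - r then a (P \<union> R) * c ((E - P) \<union> R) else 0)"
    by (simp only: sum.cartesian_product)
  also have "\<dots> = (\<Sum>P\<in>Pow E. if card P = p - r \<and> card (E - P) = q - r then (\<Sum>R\<in>ksub V r. a (P \<union> R) * c ((E - P) \<union> R)) else 0)"
    by (intro sum.cong refl) auto
  finally show ?thesis .
qed

lemma sum_sq_le_card:
  fixes f :: "'b \<Rightarrow> real"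
  shows "(\<Sum>x\<in>S. f x)\<^sup>2 \<le> real (card S) * (\<Sum>x\<in>S. (f x)\<^sup>2)"
  using sum_squared_le_sum_of_squares[of f S] by (simp add: mult.commute)

text \<open>Cauchy-Schwarz over the subsets \<open>P\<close> of \<open>E\<close>; sets with more
  than \<open>p + q\<close> elements admit no splitting, hence the factor
  \<open>2 ^ (p + q)\<close>. The pairs \<open>(P, E - P)\<close> run through disjoint pairs without
  repetition, so their entries add up to at most the full contraction norm.\<close>

lemma gpart_coeff_sq:
  assumes V: "finite V"
    and a: "\<And>A. a A \<noteq> 0 \<Longrightarrow> card A = p" and c: "\<And>A. c A \<noteq> 0 \<Longrightarrow> card A = q" and r: "r \<le> p" "r \<le> q"
  shows "(\<Sum>E\<in>Pow V. (\<Sum>A\<in>Pow V. \<Sum>B\<in>Pow V. if (A - B) \<union> (B - A) = E then (if A \<noteq> B \<and> card (A \<inter> B) = r then a A * c B else 0) else (0::real))\<^sup>2)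
    \<le> 2 ^ (p + q) * contr V p q r a c"
proof -
  let ?g = "\<lambda>E. (\<Sum>A\<in>Pow V. \<Sum>B\<in>Pow V. if (A - B) \<union> (B - A) = E then (if A \<noteq> B \<and> card (A \<inter> B) = r then a A * c B else 0) else (0::real))"
  define y where "y P Q = (\<Sum>R\<in>ksub V r. a (P \<union> R) * c (Q \<union> R))" for P Q
  let ?i = "\<lambda>P Q. if card P = p - r \<and> card Q = q - r then (y P Q)\<^sup>2 else 0"
  have "(?g E)\<^sup>2 \<le> 2 ^ (p + q) * (\<Sum>P\<in>Pow E. ?i P (E - P))" if E: "E \<in> Pow V" for E
  proof (cases "E = {}")
    case True
    then have "?g E = 0" by (auto intro!: sum.neutral)
    moreover have "0 \<le> (\<Sum>P\<in>Pow E. ?i P (E - P))" by (intro sum_nonneg) auto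
    ultimately show ?thesis by simp
  next
    case False
    have fE: "finite E" using E V finite_subset by auto
    have g: "?g E = (\<Sum>P\<in>Pow E. if card P = p - r \<and> card (E - P) = q - r then y P (E - P) else 0)"
      unfolding y_def using E False by (intro gpart_coeff[OF V _ _ a c r]) auto
    show ?thesis
    proof (cases "card E \<le> p + q")
      case True
      have "(?g E)\<^sup>2 \<le> real (card (Pow E)) * (\<Sum>P\<in>Pow E. (if card P = p - r \<and> card (E - P) = q - r then y P (E - P) else 0)\<^sup>2)"
        unfolding g by (rule sum_sq_le_card)
      also have "(\<Sum>P\<in>Pow E. (if card P = p - r \<and> card (E - P) = q - r then y P (E - P) else 0)\<^sup>2) = (\<Sum>P\<in>Pow E. ?i P (E - P))"
        by (intro sum.cong refl) auto
      also have "real (card (Pow E)) * (\<Sum>P\<in>Pow E. ?i P (E - P)) \<le> 2 ^ (p + q) * (\<Sum>P\<in>Pow E. ?i P (E - P))"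
        using True fE by (intro mult_right_mono sum_nonneg) (auto simp: card_Pow intro!: power_increasing)
      finally show ?thesis .
    next
      case False
      have cE: "card P + card (E - P) = card E" if "P \<subseteq> E" for P
        using that fE by (metis card_Diff_subset card_mono finite_subset le_add_diff_inverse)
      have ne: "\<not> (card P = p - r \<and> card (E - P) = q - r)" if "P \<in> Pow E" for P
        using cE[of P] that False by auto
      have "?g E = 0" unfolding g using ne by (intro sum.neutral ballI) (simp only: if_False)
      moreover have "0 \<le> (\<Sum>P\<in>Pow E. ?i P (E - P))" by (intro sum_nonneg) auto
      ultimately show ?thesis by simp
    qed
  qed
  then have "(\<Sum>E\<in>Pow V. (?g E)\<^sup>2) \<le> 2 ^ (p + q) * (\<Sum>E\<in>Pow V. \<Sum>P\<in>Pow E. ?i P (E - P))"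
    unfolding sum_distrib_left by (intro sum_mono)
  also have "(\<Sum>E\<in>Pow V. \<Sum>P\<in>Pow E. ?i P (E - P)) = (\<Sum>(P, Q)\<in>{(P, Q). P \<subseteq> V \<and> Q \<subseteq> V \<and> P \<inter> Q = {}}. ?i P Q)"
  proof -
    have "(\<Sum>E\<in>Pow V. \<Sum>P\<in>Pow E. ?i P (E - P)) = (\<Sum>(E, P)\<in>Sigma (Pow V) Pow. ?i P (E - P))"
    proof (rule sum.Sigma)
      show "\<forall>E\<in>Pow V. finite (Pow E)" using finite_subset[OF _ V] by auto
    qed (use V in auto)
    also have "\<dots> = (\<Sum>(P, Q)\<in>{(P, Q). P \<subseteq> V \<and> Q \<subseteq> V \<and> P \<inter> Q = {}}. ?i P Q)"
      by (rule sum.reindex_bij_witness[of _ "\<lambda>(P, Q). (P \<union> Q, P)" "\<lambda>(E, P). (P, E - P)"]) auto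
    finally show ?thesis .
  qed
  also have "\<dots> \<le> (\<Sum>(P, Q)\<in>Pow V \<times> Pow V. ?i P Q)"
    using V by (intro sum_mono2) (auto split: if_splits)
  also have "\<dots> = contr V p q r a c"
  proof -
    have "contr V p q r a c = (\<Sum>(P, Q)\<in>ksub V (p - r) \<times> ksub V (q - r). (y P Q)\<^sup>2)"
      unfolding contr_def y_def by (simp add: sum.cartesian_product)
    also have "\<dots> = (\<Sum>(P, Q)\<in>Pow V \<times> Pow V. ?i P Q)"
      using V by (intro sum.mono_neutral_cong_left) (auto simp: ksub_def split: if_splits)
    finally show ?thesis by simp
  qed
  finally show ?thesis by simp
qed

lemma (in rademacher_seq) gpart_L1:
  assumes V: "finite V"
    and a: "\<And>A. a A \<noteq> 0 \<Longrightarrow> card A = p" and c: "\<And>A. c A \<noteq> 0 \<Longrightarrow> card A = q" and r: "r \<le> p" "r \<le> q"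
  shows "integrable M (\<lambda>\<omega>. gpart V r a c (\<lambda>i. X i \<omega>))"
    and "(\<integral>\<omega>. \<bar>gpart V r a c (\<lambda>i. X i \<omega>)\<bar> \<partial>M) \<le> sqrt (2 ^ (p + q) * contr V p q r a c)"
proof -
  show "integrable M (\<lambda>\<omega>. gpart V r a c (\<lambda>i. X i \<omega>))" unfolding gpart_mlp[OF V] by (rule P_int[OF V])
  let ?G = "P V (\<lambda>E. \<Sum>A\<in>Pow V. \<Sum>B\<in>Pow V. if (A - B) \<union> (B - A) = E then (if A \<noteq> B \<and> card (A \<inter> B) = r then a A * c B else 0) else 0)"
  have "(\<integral>\<omega>. \<bar>?G \<omega>\<bar> \<partial>M)\<^sup>2 \<le> (\<integral>\<omega>. \<bar>?G \<omega>\<bar>\<^sup>2 \<partial>M)"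
    using P_int[OF V] P_sq_int[OF V] by (intro jensens_inequality[where I=UNIV and q="\<lambda>x. x\<^sup>2", of "\<lambda>\<omega>. \<bar>?G \<omega>\<bar>"]) (auto intro!: convex_power2)
  also have "\<dots> = (\<integral>\<omega>. (?G \<omega>)\<^sup>2 \<partial>M)" by simp
  also have "\<dots> \<le> 2 ^ (p + q) * contr V p q r a c"
    unfolding P_sq[OF V] by (rule gpart_coeff_sq[OF V a c r])
  finally show "(\<integral>\<omega>. \<bar>gpart V r a c (\<lambda>i. X i \<omega>)\<bar> \<partial>M) \<le> sqrt (2 ^ (p + q) * contr V p q r a c)"
    unfolding gpart_mlp[OF V] by (rule real_le_rsqrt)
qed

text \<open>Each pair \<open>(A, B)\<close> arises once for every common index \<open>i\<close>,
  which explains the weight \<open>card (A \<inter> B) / card A\<close>. On the diagonal the weight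
  is 1 and the monomial is constant; this is the sum of squares that is subtracted.\<close>

lemma gamma_expand:
  fixes x :: "'i \<Rightarrow> real"
  assumes V: "finite V" and x: "\<And>i. (x i)\<^sup>2 = 1" and b: "b {} = 0"
  shows "(\<Sum>i\<in>V. mlp (V - {i}) (\<lambda>A. b (insert i A) / card (insert i A)) x * mlp (V - {i}) (\<lambda>A. b (insert i A)) x) - (\<Sum>A\<in>Pow V. (b A)\<^sup>2)
    = (\<Sum>A\<in>Pow V. \<Sum>B\<in>Pow V. (if A \<noteq> B then card (A \<inter> B) / card A * b A * b B else 0) * (\<Prod>i\<in>(A - B) \<union> (B - A). x i))"
proof -
  let ?m = "\<lambda>A. \<Prod>l\<in>A. x l"
  let ?S = "\<lambda>A B. (A - B) \<union> (B - A)"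
  have xx: "x i * x i = 1" for i using x[of i] by (simp add: power2_eq_square)
  have fin: "finite A" if "A \<in> Pow V" for A using that V finite_subset by auto
  have mm: "?m A * ?m B = ?m (?S A B)" if "A \<in> Pow V" "B \<in> Pow V" for A B
    using prod_mult_prod_subset[OF fin[OF that(1)] fin[OF that(2)], of x] x by simp
  have "(\<Sum>i\<in>V. mlp (V - {i}) (\<lambda>A. b (insert i A) / card (insert i A)) x * mlp (V - {i}) (\<lambda>A. b (insert i A)) x)
     = (\<Sum>i\<in>V. \<Sum>A\<in>Pow V. \<Sum>B\<in>Pow V. if i \<in> A \<inter> B then b A / card A * b B * ?m (?S A B) else 0)"
  proof (rule sum.cong[OF refl])
    fix i assume i: "i \<in> V"
    let ?T = "mlp (V - {i}) (\<lambda>A. b (insert i A) / card (insert i A)) x" and ?D = "mlp (V - {i}) (\<lambda>A. b (insert i A)) x"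
    \<comment> \<open>Inserting \<open>x i\<close> twice restores the full monomials, so that
      \<open>mlp_deriv_eq\<close> applies to both factors.\<close>
    have "?T * ?D = (x i * ?T) * (x i * ?D)" using xx[of i] by algebra
    also have "\<dots> = (\<Sum>A\<in>Pow V. if i \<in> A then b A / card A * ?m A else 0) * (\<Sum>B\<in>Pow V. if i \<in> B then b B * ?m B else 0)"
      unfolding mlp_deriv_eq[OF V i, of x "\<lambda>A. b A / card A"] mlp_deriv_eq[OF V i, of x b] ..
    also have "\<dots> = (\<Sum>A\<in>Pow V. \<Sum>B\<in>Pow V. if i \<in> A \<inter> B then b A / card A * b B * ?m (?S A B) else 0)"
      unfolding sum_product
    proof (intro sum.cong refl)
      fix A B assume "A \<in> Pow V" "B \<in> Pow V"
      from mm[OF this] show "(if i \<in> A then b A / card A * ?m A else 0) * (if i \<in> B then b B * ?m B else 0) = (if i \<in> A \<inter> B then b A / card A * b B * ?m (?S A B) else 0)"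
        by (auto simp flip: mm)
    qed
    finally show "?T * ?D = (\<Sum>A\<in>Pow V. \<Sum>B\<in>Pow V. if i \<in> A \<inter> B then b A / card A * b B * ?m (?S A B) else 0)" .
  qed
  also have "\<dots> = (\<Sum>A\<in>Pow V. \<Sum>B\<in>Pow V. \<Sum>i\<in>V. if i \<in> A \<inter> B then b A / card A * b B * ?m (?S A B) else 0)"
    by (subst sum.swap, rule sum.cong[OF refl], rule sum.swap)
  also have "\<dots> = (\<Sum>A\<in>Pow V. \<Sum>B\<in>Pow V. card (A \<inter> B) / card A * b A * b B * ?m (?S A B))"
  proof (intro sum.cong refl)
    fix A B assume "A \<in> Pow V" "B \<in> Pow V"
    then have "V \<inter> (A \<inter> B) = A \<inter> B" by auto
    then show "(\<Sum>i\<in>V. if i \<in> A \<inter> B then b A / card A * b B * ?m (?S A B) else 0) = card (A \<inter> B) / card A * b A * b B * ?m (?S A B)"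
      using V by (simp add: sum.If_cases Int_def[symmetric] del: Int_iff)
  qed
  also have "\<dots> = (\<Sum>A\<in>Pow V. (b A)\<^sup>2 + (\<Sum>B\<in>Pow V. (if A \<noteq> B then card (A \<inter> B) / card A * b A * b B else 0) * ?m (?S A B)))"
  proof (rule sum.cong[OF refl])
    fix A assume A: "A \<in> Pow V"
    have diag: "card (A \<inter> A) / card A * b A * b A * ?m (?S A A) = (b A)\<^sup>2"
      using fin[OF A] b by (cases "A = {}") (auto simp: power2_eq_square)
    have "(\<Sum>B\<in>Pow V. card (A \<inter> B) / card A * b A * b B * ?m (?S A B))
       = card (A \<inter> A) / card A * b A * b A * ?m (?S A A) + (\<Sum>B\<in>Pow V - {A}. card (A \<inter> B) / card A * b A * b B * ?m (?S A B))"
      using A V by (intro sum.remove) auto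
    moreover have "(\<Sum>B\<in>Pow V. (if A \<noteq> B then card (A \<inter> B) / card A * b A * b B else 0) * ?m (?S A B))
       = 0 + (\<Sum>B\<in>Pow V - {A}. (if A \<noteq> B then card (A \<inter> B) / card A * b A * b B else 0) * ?m (?S A B))"
      using A V by (subst sum.remove[of _ A]) auto
    moreover have "(\<Sum>B\<in>Pow V - {A}. (if A \<noteq> B then card (A \<inter> B) / card A * b A * b B else 0) * ?m (?S A B)) = (\<Sum>B\<in>Pow V - {A}. card (A \<inter> B) / card A * b A * b B * ?m (?S A B))"
      by (rule sum.cong) auto
    ultimately show "(\<Sum>B\<in>Pow V. card (A \<inter> B) / card A * b A * b B * ?m (?S A B)) = (b A)\<^sup>2 + (\<Sum>B\<in>Pow V. (if A \<noteq> B then card (A \<inter> B) / card A * b A * b B else 0) * ?m (?S A B))"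
      using diag by linarith
  qed
  finally show ?thesis unfolding sum.distrib by simp
qed

lemma sum_swap3: "(\<Sum>x\<in>A. \<Sum>y\<in>B. \<Sum>z\<in>C. f x y z) = (\<Sum>z\<in>C. \<Sum>x\<in>A. \<Sum>y\<in>B. f x y z)"
proof -
  have "(\<Sum>x\<in>A. \<Sum>y\<in>B. \<Sum>z\<in>C. f x y z) = (\<Sum>x\<in>A. \<Sum>z\<in>C. \<Sum>y\<in>B. f x y z)"
    by (rule sum.cong[OF refl], rule sum.swap)
  then show ?thesis by (simp only: sum.swap[of _ C A])
qed

text \<open>Since \<open>a j\<close> lives on sets of size \<open>k j\<close>, the weight is the
  constant \<open>r / k j\<close> once the pairs are sorted by their kernels and by the size
  \<open>r\<close> of the intersection.\<close>

lemma gamma_gpart: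
  fixes a :: "'j \<Rightarrow> 'i set \<Rightarrow> real" and x :: "'i \<Rightarrow> real"
  assumes V: "finite V" and a: "\<And>j A. a j A \<noteq> 0 \<Longrightarrow> card A = k j"
  shows "(\<Sum>A\<in>Pow V. \<Sum>B\<in>Pow V. (if A \<noteq> B then card (A \<inter> B) / card A * (\<Sum>j\<in>J. t j * a j A) * (\<Sum>j\<in>J. t j * a j B) else 0) * (\<Prod>i\<in>(A - B) \<union> (B - A). x i))
    = (\<Sum>j\<in>J. \<Sum>l\<in>J. \<Sum>r=1..min (k j) (k l). t j * t l * (r / k j) * gpart V r (a j) (a l) x)"
proof -
  let ?m = "\<lambda>A B. \<Prod>i\<in>(A - B) \<union> (B - A). x i"
  have "(\<Sum>A\<in>Pow V. \<Sum>B\<in>Pow V. (if A \<noteq> B then card (A \<inter> B) / card A * (\<Sum>j\<in>J. t j * a j A) * (\<Sum>j\<in>J. t j * a j B) else 0) * ?m A B)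
    = (\<Sum>A\<in>Pow V. \<Sum>B\<in>Pow V. \<Sum>j\<in>J. \<Sum>l\<in>J. \<Sum>r=1..min (k j) (k l). t j * t l * (r / k j) * ((if A \<noteq> B \<and> card (A \<inter> B) = r then a j A * a l B else 0) * ?m A B))"
  proof (intro sum.cong refl)
    fix A B assume AB: "A \<in> Pow V" "B \<in> Pow V"
    have f: "finite A" "finite B" using AB V finite_subset by auto
    have r: "(\<Sum>r=1..min (k j) (k l). t j * t l * (real r / k j) * ((if A \<noteq> B \<and> card (A \<inter> B) = r then a j A * a l B else 0) * ?m A B))
      = (if A \<noteq> B then card (A \<inter> B) / card A * (t j * a j A) * (t l * a l B) else 0) * ?m A B" for j l
    proof (cases "A \<noteq> B \<and> a j A * a l B \<noteq> 0 \<and> card (A \<inter> B) \<noteq> 0")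
      case True
      then have "card A = k j" "card B = k l" using a by auto
      then have c: "card (A \<inter> B) \<in> {1..min (k j) (k l)}"
      proof -
        have "card (A \<inter> B) \<ge> 1" using True by linarith
        moreover have "card (A \<inter> B) \<le> card A" "card (A \<inter> B) \<le> card B" using f by (auto intro: card_mono)
        ultimately show ?thesis using \<open>card A = k j\<close> \<open>card B = k l\<close> by simp
      qed
      have "(\<Sum>r=1..min (k j) (k l). t j * t l * (real r / k j) * ((if A \<noteq> B \<and> card (A \<inter> B) = r then a j A * a l B else 0) * ?m A B))
        = (\<Sum>r=1..min (k j) (k l). if r = card (A \<inter> B) then t j * t l * (real (card (A \<inter> B)) / k j) * (a j A * a l B * ?m A B) else 0)"
        using True by (intro sum.cong refl) auto
      also have "\<dots> = t j * t l * (real (card (A \<inter> B)) / k j) * (a j A * a l B * ?m A B)"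
        using c by (simp only: sum.delta finite_atLeastAtMost if_True)
      finally show ?thesis using True \<open>card A = k j\<close> by (simp add: mult_ac)
    next
      case False
      then show ?thesis by (auto intro!: sum.neutral)
    qed
    show "(if A \<noteq> B then card (A \<inter> B) / card A * (\<Sum>j\<in>J. t j * a j A) * (\<Sum>j\<in>J. t j * a j B) else 0) * ?m A B
      = (\<Sum>j\<in>J. \<Sum>l\<in>J. \<Sum>r=1..min (k j) (k l). t j * t l * (r / k j) * ((if A \<noteq> B \<and> card (A \<inter> B) = r then a j A * a l B else 0) * ?m A B))"
      unfolding r by (cases "A = B") (simp_all add: sum_distrib_left sum_distrib_right sum_divide_distrib mult_ac)
  qed
  also have "\<dots> = (\<Sum>j\<in>J. \<Sum>A\<in>Pow V. \<Sum>B\<in>Pow V. \<Sum>l\<in>J. \<Sum>r=1..min (k j) (k l). t j * t l * (r / k j) * ((if A \<noteq> B \<and> card (A \<inter> B) = r then a j A * a l B else 0) * ?m A B))"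
    by (rule sum_swap3)
  also have "\<dots> = (\<Sum>j\<in>J. \<Sum>l\<in>J. \<Sum>A\<in>Pow V. \<Sum>B\<in>Pow V. \<Sum>r=1..min (k j) (k l). t j * t l * (r / k j) * ((if A \<noteq> B \<and> card (A \<inter> B) = r then a j A * a l B else 0) * ?m A B))"
    by (rule sum.cong[OF refl], rule sum_swap3)
  also have "\<dots> = (\<Sum>j\<in>J. \<Sum>l\<in>J. \<Sum>r=1..min (k j) (k l). \<Sum>A\<in>Pow V. \<Sum>B\<in>Pow V. t j * t l * (r / k j) * ((if A \<noteq> B \<and> card (A \<inter> B) = r then a j A * a l B else 0) * ?m A B))"
    by (rule sum.cong[OF refl], rule sum.cong[OF refl], rule sum_swap3)
  also have "\<dots> = (\<Sum>j\<in>J. \<Sum>l\<in>J. \<Sum>r=1..min (k j) (k l). t j * t l * (r / k j) * gpart V r (a j) (a l) x)"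
    unfolding gpart_def sum_distrib_left ..
  finally show ?thesis .
qed

lemma abs_sum3_le:
  fixes f :: "'a \<Rightarrow> 'b \<Rightarrow> 'c \<Rightarrow> real"
  shows "\<bar>\<Sum>x\<in>A. \<Sum>y\<in>B x. \<Sum>z\<in>C x y. f x y z\<bar> \<le> (\<Sum>x\<in>A. \<Sum>y\<in>B x. \<Sum>z\<in>C x y. \<bar>f x y z\<bar>)"
  by (rule order_trans[OF sum_abs], rule sum_mono, rule order_trans[OF sum_abs], rule sum_mono, rule sum_abs)

text \<open>The terms with \<open>r = k j = k l\<close> carry 0: there the intersection exhausts
  both sets, so only the pairs \<open>A = B\<close> are left, and these belong to the
  variance.\<close>

definition contr_err :: "'i set \<Rightarrow> 'j set \<Rightarrow> ('j \<Rightarrow> nat) \<Rightarrow> ('j \<Rightarrow> 'i set \<Rightarrow> real) \<Rightarrow> ('j \<Rightarrow> real) \<Rightarrow> real" where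
  "contr_err V J k a t = (\<Sum>j\<in>J. \<Sum>l\<in>J. \<Sum>r=1..min (k j) (k l).
     \<bar>t j\<bar> * \<bar>t l\<bar> * (if r = k j \<and> r = k l then 0 else sqrt (2 ^ (k j + k l) * contr V (k j) (k l) r (a j) (a l))))"

lemma gpart_full:
  assumes a: "\<And>A. a A \<noteq> 0 \<Longrightarrow> card A = r" and c: "\<And>A. c A \<noteq> 0 \<Longrightarrow> card A = r" and V: "finite V" and "r \<ge> 1"
  shows "gpart V r a c x = 0"
  unfolding gpart_def
proof (intro sum.neutral ballI)
  fix A B assume AB: "A \<in> Pow V" "B \<in> Pow V"
  then have f: "finite A" "finite B" using V finite_subset by auto
  have "a A * c B = 0" if "A \<noteq> B" "card (A \<inter> B) = r"
  proof (rule ccontr)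
    assume "a A * c B \<noteq> 0"
    then have "card A = r" "card B = r" using a c by auto
    then have "A \<inter> B = A" "A \<inter> B = B" using that f by (metis Int_lower1 card_subset_eq, metis Int_lower2 card_subset_eq)
    then show False using that by auto
  qed
  then show "(if A \<noteq> B \<and> card (A \<inter> B) = r then a A * c B else 0) * (\<Prod>i\<in>(A - B) \<union> (B - A). x i) = 0" by simp
qed

context rademacher_seq begin

lemma gamma_L1:
  fixes a :: "'j \<Rightarrow> 'i set \<Rightarrow> real" and J :: "'j set" and t :: "'j \<Rightarrow> real"
  assumes V: "finite V" and a: "\<And>j A. a j A \<noteq> 0 \<Longrightarrow> card A = k j" and k: "\<And>j. k j \<ge> 1"
  defines "b \<equiv> \<lambda>A. \<Sum>j\<in>J. t j * a j A"
  shows "(\<integral>\<omega>. \<bar>(\<Sum>i\<in>V. T V b i \<omega> * D V b i \<omega>) - (\<Sum>A\<in>Pow V. (b A)\<^sup>2)\<bar> \<partial>M) \<le> contr_err V J k a t"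
proof -
  let ?g = "\<lambda>j l r \<omega>. gpart V r (a j) (a l) (\<lambda>i. X i \<omega>)"
  have b0: "b {} = 0" unfolding b_def using a[of _ "{}"] k by (intro sum.neutral) (metis card.empty mult_eq_0_iff not_one_le_zero)
  have eq: "(\<Sum>i\<in>V. T V b i \<omega> * D V b i \<omega>) - (\<Sum>A\<in>Pow V. (b A)\<^sup>2) = (\<Sum>j\<in>J. \<Sum>l\<in>J. \<Sum>r=1..min (k j) (k l). t j * t l * (r / k j) * ?g j l r \<omega>)" for \<omega>
    using gamma_expand[where x="\<lambda>i. X i \<omega>" and b=b and V=V] V b0
      gamma_gpart[where x="\<lambda>i. X i \<omega>" and a=a and V=V and k=k and t=t and J=J] a
    unfolding b_def[symmetric] by (simp only: X_sq b_def)
  have ig: "integrable M (\<lambda>\<omega>. \<bar>?g j l r \<omega>\<bar>)" if "r \<in> {1..min (k j) (k l)}" for j l r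
    using that by (intro integrable_abs gpart_L1[OF V a a]) auto
  have bg: "(\<integral>\<omega>. \<bar>?g j l r \<omega>\<bar> \<partial>M) \<le> (if r = k j \<and> r = k l then 0 else sqrt (2 ^ (k j + k l) * contr V (k j) (k l) r (a j) (a l)))"
    if "r \<in> {1..min (k j) (k l)}" for j l r
  proof (cases "r = k j \<and> r = k l")
    case True
    then have "?g j l r \<omega> = 0" for \<omega> using that a by (intro gpart_full[OF _ _ V]) (metis, metis, auto)
    then show ?thesis using True by simp
  next
    case False
    then show ?thesis unfolding if_not_P[OF False] using that by (intro gpart_L1(2)[OF V a a]) auto
  qed
  have "(\<integral>\<omega>. \<bar>(\<Sum>i\<in>V. T V b i \<omega> * D V b i \<omega>) - (\<Sum>A\<in>Pow V. (b A)\<^sup>2)\<bar> \<partial>M) \<le> (\<integral>\<omega>. (\<Sum>j\<in>J. \<Sum>l\<in>J. \<Sum>r=1..min (k j) (k l). \<bar>t j\<bar> * \<bar>t l\<bar> * \<bar>?g j l r \<omega>\<bar>) \<partial>M)"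
  proof (rule integral_mono)
    show "integrable M (\<lambda>\<omega>. \<bar>(\<Sum>i\<in>V. T V b i \<omega> * D V b i \<omega>) - (\<Sum>A\<in>Pow V. (b A)\<^sup>2)\<bar>)"
      using V by (intro integrable_abs Bochner_Integration.integrable_diff Bochner_Integration.integrable_sum P_mult_int integrable_const) auto
    show "integrable M (\<lambda>\<omega>. \<Sum>j\<in>J. \<Sum>l\<in>J. \<Sum>r=1..min (k j) (k l). \<bar>t j\<bar> * \<bar>t l\<bar> * \<bar>?g j l r \<omega>\<bar>)"
      by (intro Bochner_Integration.integrable_sum integrable_mult_right ig)
    fix \<omega>
    have rk: "real r / k j \<le> 1" if "r \<in> {1..min (k j) (k l)}" for r j l using that k[of j] by simp
    show "\<bar>(\<Sum>i\<in>V. T V b i \<omega> * D V b i \<omega>) - (\<Sum>A\<in>Pow V. (b A)\<^sup>2)\<bar> \<le> (\<Sum>j\<in>J. \<Sum>l\<in>J. \<Sum>r=1..min (k j) (k l). \<bar>t j\<bar> * \<bar>t l\<bar> * \<bar>?g j l r \<omega>\<bar>)"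
      unfolding eq
    proof (rule order_trans[OF abs_sum3_le], intro sum_mono)
      fix j l r assume r: "r \<in> {1..min (k j) (k l)}"
      have "\<bar>t j * t l * (real r / k j) * ?g j l r \<omega>\<bar> = \<bar>t j\<bar> * \<bar>t l\<bar> * (real r / k j) * \<bar>?g j l r \<omega>\<bar>"
        by (simp add: abs_mult)
      also have "\<dots> \<le> \<bar>t j\<bar> * \<bar>t l\<bar> * 1 * \<bar>?g j l r \<omega>\<bar>"
        using rk[OF r] by (intro mult_right_mono mult_left_mono) auto
      finally show "\<bar>t j * t l * (real r / k j) * ?g j l r \<omega>\<bar> \<le> \<bar>t j\<bar> * \<bar>t l\<bar> * \<bar>?g j l r \<omega>\<bar>" by simp
    qed
  qed
  also have "\<dots> = (\<Sum>j\<in>J. \<Sum>l\<in>J. \<Sum>r=1..min (k j) (k l). \<bar>t j\<bar> * \<bar>t l\<bar> * (\<integral>\<omega>. \<bar>?g j l r \<omega>\<bar> \<partial>M))"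
  proof -
    have "(\<integral>\<omega>. (\<Sum>j\<in>J. \<Sum>l\<in>J. \<Sum>r=1..min (k j) (k l). \<bar>t j\<bar> * \<bar>t l\<bar> * \<bar>?g j l r \<omega>\<bar>) \<partial>M) = (\<Sum>j\<in>J. \<Sum>l\<in>J. \<Sum>r=1..min (k j) (k l). \<integral>\<omega>. \<bar>t j\<bar> * \<bar>t l\<bar> * \<bar>?g j l r \<omega>\<bar> \<partial>M)"
      by (subst Bochner_Integration.integral_sum, (intro Bochner_Integration.integrable_sum integrable_mult_right ig; assumption),
          rule sum.cong[OF refl],
          subst Bochner_Integration.integral_sum, (intro Bochner_Integration.integrable_sum integrable_mult_right ig; assumption),
          rule sum.cong[OF refl],
          rule Bochner_Integration.integral_sum, intro integrable_mult_right ig)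
    then show ?thesis unfolding integral_mult_right_zero .
  qed
  also have "\<dots> \<le> contr_err V J k a t"
    unfolding contr_err_def by (intro sum_mono mult_left_mono bg) auto
  finally show ?thesis .
qed

text \<open>Division by a cardinality of at least 1 shrinks coefficients, so \<open>T\<close> obeys
  the same cubic bound as \<open>D\<close>, and Hoelder combines the two.\<close>

lemma mixed_third_moment:
  assumes V: "finite V" "i \<in> V" and d: "\<And>A. A \<subseteq> V \<Longrightarrow> b A \<noteq> 0 \<Longrightarrow> card A \<le> d"
  shows "(\<integral>\<omega>. \<bar>T V b i \<omega>\<bar> * (D V b i \<omega>)\<^sup>2 \<partial>M) \<le> sqrt (3 ^ d * infl V b i) ^ 3"
proof -
  let ?s = "sqrt (3 ^ d * infl V b i)"
  have fin: "finite (V - {i})" using V by auto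
  have D3: "(\<integral>\<omega>. \<bar>D V b i \<omega>\<bar> ^ 3 \<partial>M) \<le> ?s ^ 3"
    using third_moment_derivative[OF V d] by simp
  have "(\<integral>\<omega>. \<bar>T V b i \<omega>\<bar> ^ 3 \<partial>M) \<le> sqrt ((3 * 1) ^ d * (\<Sum>A\<in>Pow (V - {i}). (b (insert i A) / card (insert i A))\<^sup>2)) ^ 3"
  proof (rule hypercontractive3[OF fin])
    fix A assume A: "A \<subseteq> V - {i}" "b (insert i A) / card (insert i A) \<noteq> 0"
    then have "card (insert i A) \<le> d" using V(2) by (intro d) auto
    then show "card A \<le> d"
      using A finite_subset[of A "V - {i}"] V by (subst (asm) card_insert_disjoint) auto
  qed
  also have "\<dots> \<le> ?s ^ 3"
  proof -
    have "(\<Sum>A\<in>Pow (V - {i}). (b (insert i A) / card (insert i A))\<^sup>2) \<le> infl V b i"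
      unfolding infl_def
    proof (rule sum_mono)
      fix A assume "A \<in> Pow (V - {i})"
      then have "card (insert i A) \<ge> 1" using V finite_subset[of A "V - {i}"] by (subst card_insert_disjoint) auto
      then have "\<bar>b (insert i A) / card (insert i A)\<bar> \<le> \<bar>b (insert i A)\<bar>"
        by (simp add: abs_divide divide_le_eq mult_le_cancel_left1)
      then show "(b (insert i A) / card (insert i A))\<^sup>2 \<le> (b (insert i A))\<^sup>2" by (rule abs_le_square_iff[THEN iffD1])
    qed
    then have "3 ^ d * (\<Sum>A\<in>Pow (V - {i}). (b (insert i A) / card (insert i A))\<^sup>2) \<le> 3 ^ d * infl V b i"
      by (intro mult_left_mono) auto
    then show ?thesis unfolding mult_1_right
      by (intro power_mono real_sqrt_le_mono real_sqrt_ge_zero mult_nonneg_nonneg sum_nonneg) auto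
  qed
  finally have T3: "(\<integral>\<omega>. \<bar>T V b i \<omega>\<bar> ^ 3 \<partial>M) \<le> ?s ^ 3" .
  have s0: "?s \<ge> 0" using infl_nonneg[of V b i] by simp
  have z: "b (insert i A) = 0" if "?s = 0" "A \<in> Pow (V - {i})" for A
  proof -
    have "infl V b i = 0" using that by simp
    then have "\<forall>A\<in>Pow (V - {i}). (b (insert i A))\<^sup>2 = 0" unfolding infl_def
      using fin by (subst (asm) sum_nonneg_eq_0_iff) auto
    then show ?thesis using that by auto
  qed
  have zD: "\<forall>\<omega>. \<bar>D V b i \<omega>\<bar> = 0" if "?s = 0"
    unfolding mlp_def using z[OF that] by simp
  have zT: "\<forall>\<omega>. \<bar>T V b i \<omega>\<bar> = 0" if "?s = 0"
    unfolding mlp_def using z[OF that] by simp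
  have "(\<integral>\<omega>. \<bar>D V b i \<omega>\<bar>\<^sup>2 * \<bar>T V b i \<omega>\<bar> \<partial>M) \<le> ?s\<^sup>2 * ?s"
    by (rule holder_cube(2)[where F="\<lambda>\<omega>. \<bar>D V b i \<omega>\<bar>" and G="\<lambda>\<omega>. \<bar>T V b i \<omega>\<bar>",
        OF abs_ge_zero P_cube_int[OF fin] D3 _ abs_ge_zero P_cube_int[OF fin] T3 _ s0 s0 zD zT])
      (intro borel_measurable_abs mlp_meas)+
  moreover have "\<bar>T V b i \<omega>\<bar> * (D V b i \<omega>)\<^sup>2 = \<bar>D V b i \<omega>\<bar>\<^sup>2 * \<bar>T V b i \<omega>\<bar>" for \<omega> by simp
  moreover have "?s\<^sup>2 * ?s = ?s ^ 3" by (simp only: power3_eq_cube power2_eq_square)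
  ultimately show ?thesis by (simp only:)
qed

end

definition infl_err :: "real \<Rightarrow> nat \<Rightarrow> 'i set \<Rightarrow> ('i set \<Rightarrow> real) \<Rightarrow> real" where
  "infl_err \<beta> d V b = (\<Sum>i\<in>V. sqrt ((3 * \<beta>) ^ d * infl V b i) ^ 3)"

text \<open>The \<open>False\<close> copy consists of signs. Passing to it costs
  \<open>\<beta> / 3\<close> times the influence error; Stein's method then adds the contraction
  error and one more influence error.\<close>

lemma finite_clt_bound:
  fixes Z :: "'i \<times> bool \<Rightarrow> 'a \<Rightarrow> real" and a :: "'j \<Rightarrow> 'i set \<Rightarrow> real" and J :: "'j set" and t :: "'j \<Rightarrow> real"
  assumes Z: "std3_seq M Z \<beta>" and Zr: "rademacher_seq M (\<lambda>i. Z (i, False))"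
    and V: "finite V" and a: "\<And>j A. a j A \<noteq> 0 \<Longrightarrow> card A = k j" and k: "\<And>j. k j \<ge> 1" "\<And>j. k j \<le> d"
  defines "b \<equiv> \<lambda>A. \<Sum>j\<in>J. t j * a j A"
  shows "\<bar>(\<integral>\<omega>. cos (mlp V b (\<lambda>i. Z (i, True) \<omega>) + \<theta>) \<partial>M) - cos \<theta> * exp (- (\<Sum>A\<in>Pow V. (b A)\<^sup>2) / 2)\<bar>
    \<le> contr_err V J k a t + (\<beta> / 3 + 1) * infl_err \<beta> d V b"
proof -
  interpret Z: std3_seq M Z \<beta> by fact
  interpret R: rademacher_seq M "\<lambda>i. Z (i, False)" by fact
  have b: "card A \<le> d" if "b A \<noteq> 0" for A
  proof -
    have "\<exists>j. a j A \<noteq> 0" using \<open>b A \<noteq> 0\<close> unfolding b_def by (rule contrapos_np) simp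
    then obtain j where "a j A \<noteq> 0" by blast
    then show ?thesis using a[of j A] k(2)[of j] by auto
  qed
  have "a j {} = 0" for j using a[of j "{}"] k(1)[of j] by auto
  then have b0: "b {} = 0" unfolding b_def by simp
  have 1: "\<bar>(\<integral>\<omega>. cos (mlp V b (\<lambda>i. Z (i, True) \<omega>) + \<theta>) \<partial>M) - (\<integral>\<omega>. cos (mlp V b (\<lambda>i. Z (i, False) \<omega>) + \<theta>) \<partial>M)\<bar> \<le> \<beta> / 3 * infl_err \<beta> d V b"
    unfolding infl_err_def by (rule lindeberg[OF Z V b])
  have 2: "\<bar>(\<integral>\<omega>. cos (mlp V b (\<lambda>i. Z (i, False) \<omega>) + \<theta>) \<partial>M) - cos \<theta> * exp (- (\<Sum>A\<in>Pow V. (b A)\<^sup>2) / 2)\<bar>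
     \<le> (\<integral>\<omega>. \<bar>(\<Sum>i\<in>V. R.T V b i \<omega> * R.D V b i \<omega>) - (\<Sum>A\<in>Pow V. (b A)\<^sup>2)\<bar> \<partial>M) + (\<Sum>i\<in>V. \<integral>\<omega>. \<bar>R.T V b i \<omega>\<bar> * (R.D V b i \<omega>)\<^sup>2 \<partial>M)"
    by (rule R.clt_bound[where b=b and V=V and \<theta>=\<theta>, OF V b0 refl])
  have 3: "(\<integral>\<omega>. \<bar>(\<Sum>i\<in>V. R.T V b i \<omega> * R.D V b i \<omega>) - (\<Sum>A\<in>Pow V. (b A)\<^sup>2)\<bar> \<partial>M) \<le> contr_err V J k a t"
    unfolding b_def by (rule R.gamma_L1[OF V a k(1)])
  have 4: "(\<Sum>i\<in>V. \<integral>\<omega>. \<bar>R.T V b i \<omega>\<bar> * (R.D V b i \<omega>)\<^sup>2 \<partial>M) \<le> infl_err \<beta> d V b"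
    unfolding infl_err_def
  proof (rule sum_mono)
    fix i assume i: "i \<in> V"
    have "(\<integral>\<omega>. \<bar>R.T V b i \<omega>\<bar> * (R.D V b i \<omega>)\<^sup>2 \<partial>M) \<le> sqrt (3 ^ d * infl V b i) ^ 3"
      by (rule R.mixed_third_moment[OF V i b])
    also have "\<dots> \<le> sqrt ((3 * \<beta>) ^ d * infl V b i) ^ 3"
      using Z.beta1 by (intro power_mono real_sqrt_le_mono mult_right_mono real_sqrt_ge_zero infl_nonneg mult_nonneg_nonneg) auto
    finally show "(\<integral>\<omega>. \<bar>R.T V b i \<omega>\<bar> * (R.D V b i \<omega>)\<^sup>2 \<partial>M) \<le> sqrt ((3 * \<beta>) ^ d * infl V b i) ^ 3" .
  qed
  have "(\<beta> / 3 + 1) * infl_err \<beta> d V b = \<beta> / 3 * infl_err \<beta> d V b + infl_err \<beta> d V b" by (simp add: distrib_right)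
  then show ?thesis using 1 2 3 4 by linarith
qed

section \<open>Bounds on the two error terms by contractions of single kernels\<close>

lemma sum_infl:
  assumes V: "finite V" and b: "\<And>A. A \<subseteq> V \<Longrightarrow> b A \<noteq> 0 \<Longrightarrow> card A \<le> d"
  shows "(\<Sum>i\<in>V. infl V b i) \<le> d * (\<Sum>A\<in>Pow V. (b A)\<^sup>2)"
proof -
  have "(\<Sum>i\<in>V. infl V b i) = (\<Sum>i\<in>V. \<Sum>A\<in>Pow V. if i \<in> A then (b A)\<^sup>2 else 0)"
    unfolding infl_def by (intro sum.cong refl sum_Pow_containing V)
  also have "\<dots> = (\<Sum>A\<in>Pow V. \<Sum>i\<in>V. if i \<in> A then (b A)\<^sup>2 else 0)" by (rule sum.swap)
  also have "\<dots> \<le> (\<Sum>A\<in>Pow V. d * (b A)\<^sup>2)"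
  proof (rule sum_mono)
    fix A assume "A \<in> Pow V"
    then have "(\<Sum>i\<in>V. if i \<in> A then (b A)\<^sup>2 else 0) = card A * (b A)\<^sup>2"
      using V by (simp add: sum.If_cases Int_absorb1)
    also have "\<dots> \<le> d * (b A)\<^sup>2" using b[of A] \<open>A \<in> Pow V\<close> by (cases "b A = 0") (auto intro!: mult_right_mono)
    finally show "(\<Sum>i\<in>V. if i \<in> A then (b A)\<^sup>2 else 0) \<le> d * (b A)\<^sup>2" .
  qed
  finally show ?thesis unfolding sum_distrib_left .
qed

text \<open>Writing the 3/2-th power of an influence as the influence times its square root, the
  square root is bounded by the largest influence \<open>\<delta>\<close>, and the influences
  themselves sum to at most \<open>d\<close> times the variance.\<close>

lemma infl_err_le:
  assumes V: "finite V" and b: "\<And>A. A \<subseteq> V \<Longrightarrow> b A \<noteq> 0 \<Longrightarrow> card A \<le> d" and "\<beta> \<ge> 1"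
    and d0: "\<delta> \<ge> 0" and \<delta>: "\<And>i. i \<in> V \<Longrightarrow> infl V b i \<le> \<delta>"
  shows "infl_err \<beta> d V b \<le> (3 * \<beta>) ^ d * sqrt ((3 * \<beta>) ^ d * \<delta>) * (d * (\<Sum>A\<in>Pow V. (b A)\<^sup>2))"
proof -
  have "infl_err \<beta> d V b \<le> (\<Sum>i\<in>V. (3 * \<beta>) ^ d * sqrt ((3 * \<beta>) ^ d * \<delta>) * infl V b i)"
    unfolding infl_err_def
  proof (rule sum_mono)
    fix i assume i: "i \<in> V"
    let ?x = "(3 * \<beta>) ^ d * infl V b i"
    have x0: "?x \<ge> 0" using infl_nonneg[of V b i] assms(3) by simp
    have "sqrt ?x ^ 3 = sqrt ?x * sqrt ?x * sqrt ?x" by (simp add: power3_eq_cube)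
    also have "\<dots> = ?x * sqrt ?x" using x0 by simp
    also have "\<dots> \<le> ?x * sqrt ((3 * \<beta>) ^ d * \<delta>)"
      using x0 \<delta>[OF i] assms(3) by (intro mult_left_mono real_sqrt_le_mono) auto
    finally show "sqrt ?x ^ 3 \<le> (3 * \<beta>) ^ d * sqrt ((3 * \<beta>) ^ d * \<delta>) * infl V b i" by (simp only: mult_ac)
  qed
  also have "\<dots> = (3 * \<beta>) ^ d * sqrt ((3 * \<beta>) ^ d * \<delta>) * (\<Sum>i\<in>V. infl V b i)"
    by (simp only: sum_distrib_left)
  also have "\<dots> \<le> (3 * \<beta>) ^ d * sqrt ((3 * \<beta>) ^ d * \<delta>) * (d * (\<Sum>A\<in>Pow V. (b A)\<^sup>2))"
    using d0 assms(3) by (intro mult_left_mono sum_infl[OF V b]) auto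
  finally show ?thesis .
qed

lemma contr_nonneg: "contr V p q r a c \<ge> 0"
  unfolding contr_def by (intro sum_nonneg) auto

text \<open>The influence of \<open>i\<close> is the diagonal entry at \<open>({i}, {i})\<close> of the contraction over all but one variable.\<close>

lemma infl_sq_le_contr:
  assumes V: "finite V" "i \<in> V" and a: "\<And>A. a A \<noteq> 0 \<Longrightarrow> card A = k" and k: "k \<ge> 1"
  shows "(infl V a i)\<^sup>2 \<le> contr V k k (k - 1) a a"
proof -
  have kk: "k - (k - 1) = 1" using k by simp
  have i: "{i} \<in> ksub V (k - (k - 1))" unfolding kk ksub_def using V by auto
  have "(\<Sum>R\<in>ksub V (k - 1). a ({i} \<union> R) * a ({i} \<union> R)) = infl V a i"
    unfolding infl_def
  proof (rule sum.mono_neutral_cong)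
    fix R assume "R \<in> Pow (V - {i}) - ksub V (k - 1)"
    then have R: "R \<subseteq> V - {i}" "card R \<noteq> k - 1" unfolding ksub_def by auto
    have "card (insert i R) = Suc (card R)" using R V finite_subset[of R "V - {i}"] by (subst card_insert_disjoint) auto
    then show "(a (insert i R))\<^sup>2 = 0" using a[of "insert i R"] R k by (cases "a (insert i R) = 0") auto
  next
    fix R assume R: "R \<in> ksub V (k - 1) - Pow (V - {i})"
    then have "i \<in> R" "card R = k - 1" unfolding ksub_def by auto
    then show "a ({i} \<union> R) * a ({i} \<union> R) = 0" using a[of R] k by (cases "a R = 0") (auto simp: insert_absorb)
  qed (use V in \<open>auto simp: power2_eq_square\<close>)
  then have "(infl V a i)\<^sup>2 = (\<Sum>R\<in>ksub V (k - 1). a ({i} \<union> R) * a ({i} \<union> R))\<^sup>2" by simp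
  also have "\<dots> \<le> (\<Sum>Q\<in>ksub V (k - (k - 1)). (\<Sum>R\<in>ksub V (k - 1). a ({i} \<union> R) * a (Q \<union> R))\<^sup>2)"
    using V i by (intro member_le_sum) auto
  also have "\<dots> \<le> contr V k k (k - 1) a a"
    unfolding contr_def using V i
    by (intro member_le_sum[of "{i}" _ "\<lambda>P. \<Sum>Q\<in>ksub V (k - (k - 1)). (\<Sum>R\<in>ksub V (k - 1). a (P \<union> R) * a (Q \<union> R))\<^sup>2"] sum_nonneg) auto
  finally show ?thesis .
qed

lemma infl_combination_le:
  assumes "finite J"
  shows "infl V (\<lambda>A. \<Sum>j\<in>J. t j * a j A) i \<le> card J * (\<Sum>j\<in>J. (t j)\<^sup>2 * infl V (a j) i)"
proof -
  have "infl V (\<lambda>A. \<Sum>j\<in>J. t j * a j A) i \<le> (\<Sum>A\<in>Pow (V - {i}). card J * (\<Sum>j\<in>J. (t j * a j (insert i A))\<^sup>2))"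
    unfolding infl_def by (intro sum_mono sum_sq_le_card)
  also have "\<dots> = card J * (\<Sum>j\<in>J. (t j)\<^sup>2 * infl V (a j) i)"
    unfolding infl_def sum_distrib_left power_mult_distrib by (rule sum.swap)
  finally show ?thesis .
qed

text \<open>Moving the two inner sums outside exchanges the contraction of two different kernels for
  an inner product of contractions of each kernel with itself.\<close>

lemma contr_mixed_eq:
  assumes "finite V" "r \<le> p" "r \<le> q"
  shows "contr V p q r a c = (\<Sum>R\<in>ksub V r. \<Sum>R'\<in>ksub V r.
     (\<Sum>P\<in>ksub V (p - r). a (P \<union> R) * a (P \<union> R')) * (\<Sum>Q\<in>ksub V (q - r). c (Q \<union> R) * c (Q \<union> R')))"
proof -
  have "contr V p q r a c = (\<Sum>P\<in>ksub V (p - r). \<Sum>Q\<in>ksub V (q - r). \<Sum>R\<in>ksub V r. \<Sum>R'\<in>ksub V r.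
     (a (P \<union> R) * a (P \<union> R')) * (c (Q \<union> R) * c (Q \<union> R')))"
    unfolding contr_def power2_eq_square sum_product by (simp only: mult_ac)
  also have "\<dots> = (\<Sum>P\<in>ksub V (p - r). \<Sum>R\<in>ksub V r. \<Sum>R'\<in>ksub V r. \<Sum>Q\<in>ksub V (q - r). 
     (a (P \<union> R) * a (P \<union> R')) * (c (Q \<union> R) * c (Q \<union> R')))"
    by (rule sum.cong[OF refl], subst sum.swap, rule sum.cong[OF refl], rule sum.swap)
  also have "\<dots> = (\<Sum>R\<in>ksub V r. \<Sum>R'\<in>ksub V r. \<Sum>P\<in>ksub V (p - r). \<Sum>Q\<in>ksub V (q - r). 
     (a (P \<union> R) * a (P \<union> R')) * (c (Q \<union> R) * c (Q \<union> R')))"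
    by (subst sum.swap, rule sum.cong[OF refl], rule sum.swap)
  finally show ?thesis unfolding sum_product .
qed

text \<open>Contracting \<open>a\<close> with itself over \<open>p - r\<close> indices leaves the
  pair \<open>(R, R')\<close> free, hence the complementary orders on the right. This is why
  conditions on the individual kernels control linear combinations.\<close>

lemma contr_mixed_le:
  assumes V: "finite V" and r: "r \<le> p" "r \<le> q"
  shows "(contr V p q r a c)\<^sup>2 \<le> contr V p p (p - r) a a * contr V q q (q - r) c c"
proof -
  let ?A = "\<lambda>R R'. \<Sum>P\<in>ksub V (p - r). a (P \<union> R) * a (P \<union> R')"
  let ?C = "\<lambda>R R'. \<Sum>Q\<in>ksub V (q - r). c (Q \<union> R) * c (Q \<union> R')"
  have "(contr V p q r a c)\<^sup>2 = (\<Sum>(R, R')\<in>ksub V r \<times> ksub V r. ?A R R' * ?C R R')\<^sup>2"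
    unfolding contr_mixed_eq[OF assms] by (simp only: sum.cartesian_product)
  also have "\<dots> \<le> (\<Sum>(R, R')\<in>ksub V r \<times> ksub V r. (?A R R')\<^sup>2) * (\<Sum>(R, R')\<in>ksub V r \<times> ksub V r. (?C R R')\<^sup>2)"
    unfolding case_prod_unfold by (rule Cauchy_Schwarz_ineq_sum)
  also have "(\<Sum>(R, R')\<in>ksub V r \<times> ksub V r. (?A R R')\<^sup>2) = contr V p p (p - r) a a"
    unfolding contr_def using r by (simp add: sum.cartesian_product Un_commute)
  also have "(\<Sum>(R, R')\<in>ksub V r \<times> ksub V r. (?C R R')\<^sup>2) = contr V q q (q - r) c c"
    unfolding contr_def using r by (simp add: sum.cartesian_product Un_commute)
  finally show ?thesis .
qed

text \<open>Cauchy-Schwarz over \<open>R\<close> decouples \<open>P\<close> from \<open>Q\<close>.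
  Each set \<open>A\<close> of size \<open>p\<close> is a union \<open>P \<union> R\<close> in at
  most \<open>2 ^ p\<close> ways, because \<open>P\<close> and \<open>R\<close> must then be
  disjoint and \<open>P\<close> determines \<open>R\<close>.\<close>

lemma contr_bounded:
  assumes V: "finite V" and r: "r \<le> p" and a: "\<And>A. a A \<noteq> 0 \<Longrightarrow> card A = p"
  shows "contr V p p r a a \<le> (2 ^ p * (\<Sum>A\<in>Pow V. (a A)\<^sup>2))\<^sup>2"
proof -
  let ?s = "\<lambda>P. \<Sum>R\<in>ksub V r. (a (P \<union> R))\<^sup>2"
  have "contr V p p r a a \<le> (\<Sum>P\<in>ksub V (p - r). \<Sum>Q\<in>ksub V (p - r). ?s P * ?s Q)"
    unfolding contr_def by (intro sum_mono Cauchy_Schwarz_ineq_sum)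
  also have "\<dots> = (\<Sum>P\<in>ksub V (p - r). ?s P)\<^sup>2" by (simp only: power2_eq_square sum_product)
  also have "\<dots> \<le> (2 ^ p * (\<Sum>A\<in>Pow V. (a A)\<^sup>2))\<^sup>2"
  proof (rule power_mono)
    have "(\<Sum>P\<in>ksub V (p - r). ?s P) = (\<Sum>(P, R)\<in>ksub V (p - r) \<times> ksub V r. (a (P \<union> R))\<^sup>2)"
      by (simp only: sum.cartesian_product)
    also have "\<dots> = (\<Sum>A\<in>Pow V. \<Sum>(P, R)\<in>{z \<in> ksub V (p - r) \<times> ksub V r. fst z \<union> snd z = A}. (a (P \<union> R))\<^sup>2)"
      unfolding case_prod_unfold using V
      by (intro sum.group[symmetric]) (auto simp: ksub_def)
    also have "\<dots> \<le> (\<Sum>A\<in>Pow V. 2 ^ p * (a A)\<^sup>2)"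
    proof (rule sum_mono)
      fix A assume A: "A \<in> Pow V"
      let ?Z = "{z \<in> ksub V (p - r) \<times> ksub V r. fst z \<union> snd z = A}"
      have eq: "(\<Sum>(P, R)\<in>?Z. (a (P \<union> R))\<^sup>2) = card ?Z * (a A)\<^sup>2"
        by (subst sum.cong[of ?Z ?Z _ "\<lambda>_. (a A)\<^sup>2"]) auto
      show "(\<Sum>(P, R)\<in>?Z. (a (P \<union> R))\<^sup>2) \<le> 2 ^ p * (a A)\<^sup>2"
      proof (cases "a A = 0")
        case False
        then have cA: "card A = p" using a by auto
        have fA: "finite A" using A V finite_subset by auto
        have "card ?Z \<le> card (Pow A)"
        proof (rule card_inj_on_le[of fst])
          show "inj_on fst ?Z"
          proof (rule inj_onI)
            fix z z' assume z: "z \<in> ?Z" "z' \<in> ?Z" "fst z = fst z'"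
            have *: "snd z = A - fst z" if "z \<in> ?Z" for z
            proof -
              have f: "finite (fst z)" "finite (snd z)" using that V finite_subset[of _ V] by (auto simp: ksub_def)
              have "card (fst z) + card (snd z) = p" using that r by (auto simp: ksub_def)
              moreover have "card (fst z \<union> snd z) = p" using that cA by auto
              ultimately have "card (fst z \<inter> snd z) = 0" using card_Un_Int[OF f] by linarith
              then have "fst z \<inter> snd z = {}" using f by auto
              then show ?thesis using that by auto
            qed
            show "z = z'" using *[OF z(1)] *[OF z(2)] z(3) by (simp add: prod_eq_iff)
          qed
        qed (use fA in auto)
        then have "real (card ?Z) \<le> 2 ^ p" using cA fA by (simp add: card_Pow)
        then show ?thesis unfolding eq by (intro mult_right_mono) auto
      qed (simp add: eq)
    qed
    finally show "(\<Sum>P\<in>ksub V (p - r). ?s P) \<le> 2 ^ p * (\<Sum>A\<in>Pow V. (a A)\<^sup>2)"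
      unfolding sum_distrib_left .
  qed (intro sum_nonneg; simp)
  finally show ?thesis .
qed

lemma tendsto_zero_le:
  fixes f g :: "nat \<Rightarrow> real"
  assumes "\<And>n. 0 \<le> f n" "\<And>n. f n \<le> g n" "g \<longlonglongrightarrow> 0"
  shows "f \<longlonglongrightarrow> 0"
  by (rule tendsto_sandwich[OF _ _ tendsto_const assms(3)]) (auto simp: assms(1,2))

lemma tendsto_sum0:
  fixes f :: "'a \<Rightarrow> nat \<Rightarrow> real"
  assumes "\<And>x. x \<in> A \<Longrightarrow> (f x) \<longlonglongrightarrow> 0"
  shows "(\<lambda>n. \<Sum>x\<in>A. f x n) \<longlonglongrightarrow> 0"
  using tendsto_sum[of A f "\<lambda>_. 0" sequentially] assms by simp

section \<open>Convergence for sequences of finite kernels\<close>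

locale kernel_seq =
  fixes V :: "nat \<Rightarrow> 'i set" and k :: "'m::finite \<Rightarrow> nat" and a :: "nat \<Rightarrow> 'm \<Rightarrow> 'i set \<Rightarrow> real" and S :: "'m \<Rightarrow> 'm \<Rightarrow> real"
  assumes finV: "finite (V n)" and k2: "k j \<ge> 2" and supp: "a n j A \<noteq> 0 \<Longrightarrow> card A = k j"
    and gram: "(\<lambda>n. \<Sum>A\<in>Pow (V n). a n i A * a n j A) \<longlonglongrightarrow> S i j"
begin

definition comb :: "('m \<Rightarrow> real) \<Rightarrow> nat \<Rightarrow> 'i set \<Rightarrow> real" where
  "comb t n A = (\<Sum>j\<in>UNIV. t j * a n j A)"

lemma comb_sq:
  "(\<Sum>A\<in>Pow (V n). (comb t n A)\<^sup>2) = (\<Sum>i\<in>UNIV. \<Sum>j\<in>UNIV. t i * t j * (\<Sum>A\<in>Pow (V n). a n i A * a n j A))"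
proof -
  have "(\<Sum>A\<in>Pow (V n). (comb t n A)\<^sup>2) = (\<Sum>A\<in>Pow (V n). \<Sum>i\<in>UNIV. \<Sum>j\<in>UNIV. t i * t j * (a n i A * a n j A))"
    unfolding comb_def power2_eq_square sum_product by (simp only: mult_ac)
  also have "\<dots> = (\<Sum>i\<in>UNIV. \<Sum>j\<in>UNIV. \<Sum>A\<in>Pow (V n). t i * t j * (a n i A * a n j A))"
    by (subst sum.swap, rule sum.cong[OF refl], rule sum.swap)
  finally show ?thesis unfolding sum_distrib_left .
qed

lemma comb_sq_tendsto:
  "(\<lambda>n. \<Sum>A\<in>Pow (V n). (comb t n A)\<^sup>2) \<longlonglongrightarrow> (\<Sum>i\<in>UNIV. \<Sum>j\<in>UNIV. t i * t j * S i j)"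
  unfolding comb_sq by (intro tendsto_sum tendsto_mult tendsto_const gram)

definition deg :: nat where "deg = Max (range k)"

lemma k_le_deg: "k j \<le> deg" unfolding deg_def by simp

lemma comb_supp: "comb t n A \<noteq> 0 \<Longrightarrow> card A \<le> deg"
proof -
  assume "comb t n A \<noteq> 0"
  then have "\<exists>j. a n j A \<noteq> 0" unfolding comb_def by (rule contrapos_np) simp
  then obtain j where "a n j A \<noteq> 0" by blast
  then show ?thesis using supp[of n j A] k_le_deg[of j] by auto
qed

context
  assumes contr0: "\<And>j r. r \<in> {1..k j - 1} \<Longrightarrow> (\<lambda>n. contr (V n) (k j) (k j) r (a n j) (a n j)) \<longlonglongrightarrow> 0"
begin

text \<open>At least one of \<open>r < k j\<close> and \<open>r < k l\<close> holds. For that kernel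
  the complementary order lies between 1 and its degree minus 1 and its contraction tends to 0; the
  other factor of \<open>contr_mixed_le\<close> stays bounded because the Gram matrix
  converges.\<close>

lemma contr_mixed0:
  assumes r: "r \<in> {1..min (k j) (k l)}" "\<not> (r = k j \<and> r = k l)"
  shows "(\<lambda>n. contr (V n) (k j) (k l) r (a n j) (a n l)) \<longlonglongrightarrow> 0"
proof -
  define c where "c n j = contr (V n) (k j) (k j) (k j - r) (a n j) (a n j)" for n j
  define B where "B n j = (2 ^ k j * (\<Sum>A\<in>Pow (V n). (a n j A)\<^sup>2))\<^sup>2" for n j
  have c0: "c n j \<ge> 0" for n j unfolding c_def by (rule contr_nonneg)
  have cB: "c n j \<le> B n j" for n j unfolding c_def B_def by (rule contr_bounded[OF finV _ supp]) auto
  have B0: "B n j \<ge> 0" for n j unfolding B_def by simp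
  have B: "(\<lambda>n. B n j) \<longlonglongrightarrow> (2 ^ k j * S j j)\<^sup>2" for j
    using gram[of j j] unfolding B_def power2_eq_square by (intro tendsto_mult tendsto_const)
  have z: "(\<lambda>n. c n j) \<longlonglongrightarrow> 0" if "r < k j" for j
  proof -
    have "k j - r \<in> {1..k j - 1}" using that r(1) by auto
    then show ?thesis unfolding c_def by (rule contr0)
  qed
  have mono: "(contr (V n) (k j) (k l) r (a n j) (a n l))\<^sup>2 \<le> c n j * c n l" for n
    unfolding c_def using r by (intro contr_mixed_le[OF finV]) auto
  have sq: "(\<lambda>n. (contr (V n) (k j) (k l) r (a n j) (a n l))\<^sup>2) \<longlonglongrightarrow> 0"
  proof (cases "r < k j")
    case True
    have "(\<lambda>n. c n j * B n l) \<longlonglongrightarrow> 0" using tendsto_mult[OF z[OF True] B[of l]] by simp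
    moreover have "(contr (V n) (k j) (k l) r (a n j) (a n l))\<^sup>2 \<le> c n j * B n l" for n
      using mono[of n] mult_left_mono[OF cB[of n l] c0[of n j]] by linarith
    ultimately show ?thesis by (rule_tac tendsto_zero_le[rotated 2]) auto
  next
    case False
    then have "r < k l" using r by auto
    have "(\<lambda>n. B n j * c n l) \<longlonglongrightarrow> 0" using tendsto_mult[OF B[of j] z[OF \<open>r < k l\<close>]] by simp
    moreover have "(contr (V n) (k j) (k l) r (a n j) (a n l))\<^sup>2 \<le> B n j * c n l" for n
      using mono[of n] mult_right_mono[OF cB[of n j] c0[of n l]] by linarith
    ultimately show ?thesis by (rule_tac tendsto_zero_le[rotated 2]) auto
  qed
  then show ?thesis using tendsto_real_sqrt[OF sq] contr_nonneg by simp
qed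

lemma contr_err0: "(\<lambda>n. contr_err (V n) UNIV k (a n) t) \<longlonglongrightarrow> 0"
  unfolding contr_err_def
proof (intro tendsto_sum0)
  fix j l :: 'm and r assume r: "r \<in> {1..min (k j) (k l)}"
  show "(\<lambda>n. \<bar>t j\<bar> * \<bar>t l\<bar> * (if r = k j \<and> r = k l then 0 else sqrt (2 ^ (k j + k l) * contr (V n) (k j) (k l) r (a n j) (a n l)))) \<longlonglongrightarrow> 0"
  proof (cases "r = k j \<and> r = k l")
    case False
    have "(\<lambda>n. \<bar>t j\<bar> * \<bar>t l\<bar> * sqrt (2 ^ (k j + k l) * contr (V n) (k j) (k l) r (a n j) (a n l))) \<longlonglongrightarrow> \<bar>t j\<bar> * \<bar>t l\<bar> * sqrt (2 ^ (k j + k l) * 0)"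
      by (intro tendsto_mult tendsto_const tendsto_real_sqrt contr_mixed0[OF r False])
    then show ?thesis unfolding if_not_P[OF False] by simp
  qed simp
qed

text \<open>The largest influence of a combination is bounded by square roots of the contractions of
  order \<open>k j - 1\<close>. This order is among those assumed to vanish, because
  \<open>k j\<close> is at least 2.\<close>

lemma infl_err0:
  assumes "\<beta> \<ge> 1"
  shows "(\<lambda>n. infl_err \<beta> deg (V n) (comb t n)) \<longlonglongrightarrow> 0"
proof -
  define \<delta> where "\<delta> n = CARD('m) * (\<Sum>j\<in>UNIV. (t j)\<^sup>2 * sqrt (contr (V n) (k j) (k j) (k j - 1) (a n j) (a n j)))" for n
  have "(\<lambda>n. \<delta> n) \<longlonglongrightarrow> CARD('m) * (\<Sum>j\<in>(UNIV::'m set). (t j)\<^sup>2 * sqrt 0)"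
    unfolding \<delta>_def using k2
    by (intro tendsto_mult tendsto_const tendsto_sum tendsto_real_sqrt contr0) (simp add: le_diff_conv2 numeral_2_eq_2 Suc_le_eq)
  then have \<delta>: "\<delta> \<longlonglongrightarrow> 0" by simp
  have \<delta>0: "\<delta> n \<ge> 0" for n unfolding \<delta>_def by (intro mult_nonneg_nonneg sum_nonneg real_sqrt_ge_zero contr_nonneg) auto
  have infl: "infl (V n) (comb t n) i \<le> \<delta> n" if i: "i \<in> V n" for n i
  proof -
    have "infl (V n) (comb t n) i \<le> CARD('m) * (\<Sum>j\<in>UNIV. (t j)\<^sup>2 * infl (V n) (a n j) i)"
      using infl_combination_le[of "UNIV :: 'm set" "V n" t "a n" i] by (simp add: comb_def[abs_def])
    also have "\<dots> \<le> \<delta> n" unfolding \<delta>_def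
    proof (intro mult_left_mono sum_mono)
      fix j
      have "1 \<le> k j" using k2[of j] by simp
      then show "infl (V n) (a n j) i \<le> sqrt (contr (V n) (k j) (k j) (k j - 1) (a n j) (a n j))"
        by (intro real_le_rsqrt infl_sq_le_contr finV i supp)
    qed auto
    finally show ?thesis .
  qed
  define U where "U n = (3 * \<beta>) ^ deg * sqrt ((3 * \<beta>) ^ deg * \<delta> n) * (deg * (\<Sum>A\<in>Pow (V n). (comb t n A)\<^sup>2))" for n
  have "(\<lambda>n. U n) \<longlonglongrightarrow> (3 * \<beta>) ^ deg * sqrt ((3 * \<beta>) ^ deg * 0) * (deg * (\<Sum>i\<in>UNIV. \<Sum>j\<in>UNIV. t i * t j * S i j))"
    unfolding U_def by (intro tendsto_mult tendsto_const tendsto_real_sqrt comb_sq_tendsto \<delta>)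
  then have U: "U \<longlonglongrightarrow> 0" by simp
  have "infl_err \<beta> deg (V n) (comb t n) \<le> U n" for n
    unfolding U_def by (intro infl_err_le finV comb_supp assms \<delta>0 infl)
  moreover have "0 \<le> infl_err \<beta> deg (V n) (comb t n)" for n
    unfolding infl_err_def using assms by (intro sum_nonneg zero_le_power real_sqrt_ge_zero mult_nonneg_nonneg infl_nonneg) auto
  ultimately show ?thesis by (rule_tac tendsto_zero_le[OF _ _ U]) auto
qed

lemma cos_tendsto_aux:
  fixes Z :: "'i \<times> bool \<Rightarrow> 'a \<Rightarrow> real"
  assumes Z: "std3_seq M Z \<beta>" and Zr: "rademacher_seq M (\<lambda>i. Z (i, False))"
  shows "(\<lambda>n. \<integral>\<omega>. cos (mlp (V n) (comb t n) (\<lambda>i. Z (i, True) \<omega>) + \<theta>) \<partial>M)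
    \<longlonglongrightarrow> cos \<theta> * exp (- (\<Sum>i\<in>UNIV. \<Sum>j\<in>UNIV. t i * t j * S i j) / 2)"
proof -
  interpret Z: std3_seq M Z \<beta> by fact
  let ?E = "\<lambda>n. \<integral>\<omega>. cos (mlp (V n) (comb t n) (\<lambda>i. Z (i, True) \<omega>) + \<theta>) \<partial>M"
  let ?G = "\<lambda>n. cos \<theta> * exp (- (\<Sum>A\<in>Pow (V n). (comb t n A)\<^sup>2) / 2)"
  let ?e = "\<lambda>n. contr_err (V n) UNIV k (a n) t + (\<beta> / 3 + 1) * infl_err \<beta> deg (V n) (comb t n)"
  have k1: "1 \<le> k j" for j using k2[of j] by simp
  have b: "\<bar>?E n - ?G n\<bar> \<le> ?e n" for n
  proof -
    have s: "a n j A \<noteq> 0 \<Longrightarrow> card A = k j" for j A by (rule supp)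
    have c: "comb t n = (\<lambda>A. \<Sum>j\<in>UNIV. t j * a n j A)" by (rule ext) (rule comb_def)
    show ?thesis unfolding c
      by (rule finite_clt_bound[where a="a n" and k=k and d=deg and J=UNIV and t=t and V="V n", OF Z Zr finV s k1 k_le_deg])
  qed
  have "?e \<longlonglongrightarrow> 0 + (\<beta> / 3 + 1) * 0"
    by (intro tendsto_add tendsto_mult tendsto_const contr_err0 infl_err0 Z.beta1)
  then have e0: "?e \<longlonglongrightarrow> 0" by (simp only: mult_zero_right add_0)
  have "(\<lambda>n. ?E n - ?G n) \<longlonglongrightarrow> 0"
    by (rule Lim_null_comparison[OF _ e0]) (rule always_eventually, simp only: real_norm_def b, simp)
  moreover have "?G \<longlonglongrightarrow> cos \<theta> * exp (- (\<Sum>i\<in>UNIV. \<Sum>j\<in>UNIV. t i * t j * S i j) / 2)"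
    by (intro tendsto_mult tendsto_const tendsto_exp tendsto_divide tendsto_minus comb_sq_tendsto) auto
  ultimately have "(\<lambda>n. (?E n - ?G n) + ?G n) \<longlonglongrightarrow> 0 + cos \<theta> * exp (- (\<Sum>i\<in>UNIV. \<Sum>j\<in>UNIV. t i * t j * S i j) / 2)"
    by (rule tendsto_add)
  then show ?thesis by (simp only: diff_add_cancel add_0)
qed

end

end

section \<open>Laws of independent families and an independent copy made of signs\<close>

lemma PiM_coordinates:
  fixes \<mu> :: "'i \<Rightarrow> real measure"
  assumes p: "\<And>i. prob_space (\<mu> i)" and s: "\<And>i. sets (\<mu> i) = sets borel"
  shows "indep_seq (PiM UNIV \<mu>) (\<lambda>i \<omega>. \<omega> i)" and "distr (PiM UNIV \<mu>) borel (\<lambda>\<omega>. \<omega> i) = \<mu> i"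
proof -
  have d: "distr (PiM UNIV \<mu>) borel (\<lambda>\<omega>. \<omega> i) = \<mu> i" for i
    using distr_PiM_component[of UNIV \<mu> i] p s distr_cong[of "PiM UNIV \<mu>" "PiM UNIV \<mu>" "\<mu> i" borel] by simp
  then show "distr (PiM UNIV \<mu>) borel (\<lambda>\<omega>. \<omega> i) = \<mu> i" .
  have sP: "sets (PiM UNIV \<mu>) = sets (PiM UNIV (\<lambda>_. borel))"
    by (intro sets_PiM_cong refl s)
  have m: "(\<lambda>\<omega>. \<omega> i) \<in> borel_measurable (PiM UNIV \<mu>)" for i
    using measurable_component_singleton[of i UNIV \<mu>] measurable_cong_sets[OF refl s[of i], of "PiM UNIV \<mu>"] by auto
  interpret P: prob_space "PiM UNIV \<mu>" by (rule prob_space_PiM) (rule p)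
  have "distr (PiM UNIV \<mu>) (PiM UNIV (\<lambda>_. borel)) (\<lambda>x. \<lambda>i\<in>UNIV. x i) = PiM UNIV (\<lambda>i. distr (PiM UNIV \<mu>) borel (\<lambda>\<omega>. \<omega> i))"
    unfolding d using distr_id2[OF sP[symmetric]] by (simp add: restrict_def)
  then have "P.indep_vars (\<lambda>_. borel) (\<lambda>i \<omega>. \<omega> i) UNIV"
    by (subst P.indep_vars_iff_distr_eq_PiM) (auto intro: m)
  then show "indep_seq (PiM UNIV \<mu>) (\<lambda>i \<omega>. \<omega> i)"
    by unfold_locales
qed

lemma (in indep_seq) law:
  "distr M (PiM UNIV (\<lambda>_. borel)) (\<lambda>\<omega> i. X i \<omega>) = PiM UNIV (\<lambda>i. distr M borel (X i))"
  "(\<lambda>\<omega> i. X i \<omega>) \<in> measurable M (PiM UNIV (\<lambda>_. borel))"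
proof -
  show "distr M (PiM UNIV (\<lambda>_. borel)) (\<lambda>\<omega> i. X i \<omega>) = PiM UNIV (\<lambda>i. distr M borel (X i))"
    using indep indep_vars_iff_distr_eq_PiM[where I=UNIV and M'="\<lambda>_. borel" and X=X] X_meas by (simp add: restrict_def)
  show "(\<lambda>\<omega> i. X i \<omega>) \<in> measurable M (PiM UNIV (\<lambda>_. borel))"
    by (rule measurable_PiM_single') (auto intro: X_meas)
qed

lemma indep_seq_law_eq:
  fixes h :: "('i \<Rightarrow> real) \<Rightarrow> real"
  assumes X: "indep_seq M X" and Y: "indep_seq N Y"
    and d: "\<And>i. distr M borel (X i) = distr N borel (Y i)"
    and h: "h \<in> borel_measurable (PiM UNIV (\<lambda>_. borel))"
  shows "(\<integral>\<omega>. h (\<lambda>i. X i \<omega>) \<partial>M) = (\<integral>\<omega>. h (\<lambda>i. Y i \<omega>) \<partial>N)"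
proof -
  interpret X: indep_seq M X by fact
  interpret Y: indep_seq N Y by fact
  have "(\<integral>\<omega>. h (\<lambda>i. X i \<omega>) \<partial>M) = (\<integral>x. h x \<partial>PiM UNIV (\<lambda>i. distr M borel (X i)))"
    unfolding X.law(1)[symmetric] by (rule integral_distr[symmetric, OF X.law(2) h])
  also have "\<dots> = (\<integral>\<omega>. h (\<lambda>i. Y i \<omega>) \<partial>N)"
    unfolding d Y.law(1)[symmetric] by (rule integral_distr[OF Y.law(2) h])
  finally show ?thesis .
qed

lemma mlp_borel: "mlp V b \<in> borel_measurable (PiM UNIV (\<lambda>_. borel))"
  unfolding mlp_def[abs_def] by measurable

text \<open>The space \<open>M\<close> may be too small to carry signs independent of
  \<open>X\<close>. As only expectations of functions of the family are compared, the family may be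
  moved to a product space that has room for the second copy.\<close>

lemma rademacher_extension:
  fixes M :: "'a measure" and X :: "'i \<Rightarrow> 'a \<Rightarrow> real"
  assumes "std3_seq M X \<beta>"
  shows "\<exists>(N :: ('i \<times> bool \<Rightarrow> real) measure) Z. std3_seq N Z \<beta> \<and> rademacher_seq N (\<lambda>i. Z (i, False)) \<and>
     (\<forall>h \<in> borel_measurable (PiM UNIV (\<lambda>_. borel)). (\<integral>\<omega>. h (\<lambda>i. X i \<omega>) \<partial>M) = (\<integral>\<omega>. h (\<lambda>i. Z (i, True) \<omega>) \<partial>N :: real))"
proof -
  interpret std3_seq M X \<beta> by fact
  define \<rho> :: "real measure" where "\<rho> = distr (measure_pmf (map_pmf (\<lambda>b. if b then 1 else - 1) (bernoulli_pmf (1/2)))) borel (\<lambda>x. x)"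
  define \<mu> where "\<mu> z = (if snd z then distr M borel (X (fst z)) else \<rho>)" for z :: "'i \<times> bool"
  \<comment> \<open>A coordinate with law \<open>\<rho>\<close> takes the values 1 and -1 only
    almost surely; composing with this map makes it a sign at every point.\<close>
  define s where "s x = (if (x::real) \<ge> 0 then 1 else - 1 :: real)" for x
  have [measurable]: "s \<in> borel_measurable borel" unfolding s_def by measurable
  have p: "prob_space (\<mu> z)" for z
    unfolding \<mu>_def \<rho>_def by (auto intro!: prob_space_distr measure_pmf.prob_space_distr)
  have st: "sets (\<mu> z) = sets borel" for z unfolding \<mu>_def \<rho>_def by simp
  define N where "N = PiM UNIV \<mu>"
  interpret C: indep_seq N "\<lambda>z \<omega>. \<omega> z" unfolding N_def by (rule PiM_coordinates(1)[OF p st])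
  have d: "distr N borel (\<lambda>\<omega>. \<omega> z) = \<mu> z" for z unfolding N_def by (rule PiM_coordinates(2)[OF p st])
  define Z where "Z z \<omega> = (if snd z then \<omega> z else s (\<omega> z))" for z :: "'i \<times> bool" and \<omega>
  have "C.indep_vars (\<lambda>_. borel) (\<lambda>z \<omega>. (\<lambda>x. if snd z then x else s x) (\<omega> z)) UNIV"
    by (rule C.indep_vars_compose2[OF C.indep]) measurable
  then interpret Z: indep_seq N Z
    by unfold_locales (simp add: Z_def[abs_def])
  have iT: "(\<integral>\<omega>. g (Z (i, True) \<omega>) \<partial>N) = (\<integral>\<omega>. g (X i \<omega>) \<partial>M)" if [measurable]: "g \<in> borel_measurable borel" for g :: "real \<Rightarrow> real" and i
  proof -
    have "(\<integral>\<omega>. g (Z (i, True) \<omega>) \<partial>N) = (\<integral>x. g x \<partial>distr N borel (\<lambda>\<omega>. \<omega> (i, True)))"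
      unfolding Z_def using C.X_meas by (subst integral_distr) auto
    also have "\<dots> = (\<integral>\<omega>. g (X i \<omega>) \<partial>M)" unfolding d \<mu>_def by (simp add: integral_distr)
    finally show ?thesis .
  qed
  have jT: "integrable N (\<lambda>\<omega>. g (Z (i, True) \<omega>)) \<longleftrightarrow> integrable M (\<lambda>\<omega>. g (X i \<omega>))" if [measurable]: "g \<in> borel_measurable borel" for g :: "real \<Rightarrow> real" and i
  proof -
    have "integrable N (\<lambda>\<omega>. g (Z (i, True) \<omega>)) \<longleftrightarrow> integrable (distr N borel (\<lambda>\<omega>. \<omega> (i, True))) g"
      unfolding Z_def using C.X_meas by (subst integrable_distr_eq) auto
    also have "\<dots> \<longleftrightarrow> integrable M (\<lambda>\<omega>. g (X i \<omega>))" unfolding d \<mu>_def by (simp add: integrable_distr_eq)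
    finally show ?thesis .
  qed
  have iF: "(\<integral>\<omega>. Z (i, False) \<omega> \<partial>N) = 0" for i
  proof -
    have "(\<integral>\<omega>. Z (i, False) \<omega> \<partial>N) = (\<integral>x. s x \<partial>distr N borel (\<lambda>\<omega>. \<omega> (i, False)))"
      unfolding Z_def using C.X_meas by (subst integral_distr) auto
    also have "\<dots> = measure_pmf.expectation (bernoulli_pmf (1/2)) (\<lambda>b. s (if b then 1 else - 1))"
      unfolding d \<mu>_def \<rho>_def by (simp add: integral_distr integral_map_pmf)
    also have "\<dots> = 0" by (simp add: s_def)
    finally show ?thesis .
  qed
  have pm: "Z (i, False) \<omega> = 1 \<or> Z (i, False) \<omega> = - 1" for i \<omega> unfolding Z_def s_def by simp
  interpret R: rademacher_seq N "\<lambda>i. Z (i, False)"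
  proof (rule rademacher_seq.intro)
    show "indep_seq N (\<lambda>i. Z (i, False))" by (rule Z.indep_seq_reindex) (auto simp: inj_def)
    show "rademacher_seq_axioms N (\<lambda>i. Z (i, False))" by unfold_locales (auto simp: iF pm)
  qed
  have "std3_seq N Z \<beta>"
  proof unfold_locales
    fix z :: "'i \<times> bool"
    obtain i b where z: "z = (i, b)" by (cases z)
    show "integrable N (Z z)" "integrable N (\<lambda>\<omega>. (Z z \<omega>)\<^sup>2)" "integrable N (\<lambda>\<omega>. \<bar>Z z \<omega>\<bar> ^ 3)"
      using jT[of "\<lambda>x. x" i] jT[of "\<lambda>x. x\<^sup>2" i] jT[of "\<lambda>x. \<bar>x\<bar> ^ 3" i] int1[of i] int2[of i] int3[of i] R.int1[of i] R.int2[of i] R.int3[of i]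
      by (cases b; simp add: z)+
    show "(\<integral>\<omega>. Z z \<omega> \<partial>N) = 0" "(\<integral>\<omega>. (Z z \<omega>)\<^sup>2 \<partial>N) = 1"
      using iT[of "\<lambda>x. x" i] iT[of "\<lambda>x. x\<^sup>2" i] mean0[of i] var1[of i] R.mean0[of i] R.var1[of i]
      by (cases b; simp add: z)+
    show "(\<integral>\<omega>. \<bar>Z z \<omega>\<bar> ^ 3 \<partial>N) \<le> \<beta>"
      using iT[of "\<lambda>x. \<bar>x\<bar> ^ 3" i] mom3[of i] R.mom3[of i] beta1 by (cases b; simp add: z C.prob_space)
  qed (rule beta1)
  moreover have "(\<integral>\<omega>. h (\<lambda>i. X i \<omega>) \<partial>M) = (\<integral>\<omega>. h (\<lambda>i. Z (i, True) \<omega>) \<partial>N)"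
    if "h \<in> borel_measurable (PiM UNIV (\<lambda>_. borel))" for h :: "('i \<Rightarrow> real) \<Rightarrow> real"
  proof (rule indep_seq_law_eq[OF _ _ _ that])
    show "indep_seq M X" by (rule indep_seq_axioms)
    show "indep_seq N (\<lambda>i. Z (i, True))" by (rule Z.indep_seq_reindex) (auto simp: inj_def)
    show "distr M borel (X i) = distr N borel (Z (i, True))" for i
      using d[of "(i, True)"] unfolding \<mu>_def Z_def[abs_def] by simp
  qed
  ultimately show ?thesis using R.rademacher_seq_axioms by blast
qed

lemma (in kernel_seq) cos_tendsto:
  assumes contr0: "\<And>j r. r \<in> {1..k j - 1} \<Longrightarrow> (\<lambda>n. contr (V n) (k j) (k j) r (a n j) (a n j)) \<longlonglongrightarrow> 0"
    and X: "std3_seq M X \<beta>"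
  shows "(\<lambda>n. \<integral>\<omega>. cos ((\<Sum>j\<in>UNIV. t j * mlp (V n) (a n j) (\<lambda>i. X i \<omega>)) + \<theta>) \<partial>M)
    \<longlonglongrightarrow> cos \<theta> * exp (- (\<Sum>i\<in>UNIV. \<Sum>j\<in>UNIV. t i * t j * S i j) / 2)"
proof -
  interpret X: std3_seq M X \<beta> by fact
  obtain N :: "('i \<times> bool \<Rightarrow> real) measure" and Z where Z: "std3_seq N Z \<beta>" "rademacher_seq N (\<lambda>i. Z (i, False))"
    and h: "\<And>h :: ('i \<Rightarrow> real) \<Rightarrow> real. h \<in> borel_measurable (PiM UNIV (\<lambda>_. borel)) \<Longrightarrow> (\<integral>\<omega>. h (\<lambda>i. X i \<omega>) \<partial>M) = (\<integral>\<omega>. h (\<lambda>i. Z (i, True) \<omega>) \<partial>N)"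
    using rademacher_extension[OF X] by blast
  have eq: "(\<Sum>j\<in>UNIV. t j * mlp (V n) (a n j) x) = mlp (V n) (comb t n) x" for n x
    unfolding comb_def[abs_def] by (rule mlp_sum[symmetric])
  have "(\<lambda>x. cos (mlp (V n) (comb t n) x + \<theta>)) \<in> borel_measurable (PiM UNIV (\<lambda>_. borel))" for n
    using mlp_borel[of "V n" "comb t n"] by measurable
  from h[OF this] show ?thesis
    unfolding eq using cos_tendsto_aux[OF contr0 Z] by simp
qed

section \<open>Weak convergence from cosine tests\<close>

text \<open>The phase \<open>b\<close> makes sines available as well, \<open>t = 0\<close> gives the
  constants, and the product-to-sum formula makes the class an algebra.\<close>

inductive trig_poly :: "('a::real_inner \<Rightarrow> real) \<Rightarrow> bool" where
  cosine: "trig_poly (\<lambda>y. c * cos (t \<bullet> y + b))"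
| add: "trig_poly f \<Longrightarrow> trig_poly g \<Longrightarrow> trig_poly (\<lambda>y. f y + g y)"

lemma trig_poly_const: "trig_poly (\<lambda>_. c)"
  using trig_poly.cosine[of c 0 0] by simp

lemma trig_poly_mult: "trig_poly f \<Longrightarrow> trig_poly g \<Longrightarrow> trig_poly (\<lambda>y. f y * g y)"
proof (induction rule: trig_poly.induct)
  case (cosine c t b)
  from cosine show ?case
  proof (induction rule: trig_poly.induct)
    case (cosine c' t' b')
    have "(c * cos (t \<bullet> y + b)) * (c' * cos (t' \<bullet> y + b')) =
       (c * c' / 2) * cos ((t - t') \<bullet> y + (b - b')) + (c * c' / 2) * cos ((t + t') \<bullet> y + (b + b'))" for y
    proof -
      have 1: "(t - t') \<bullet> y + (b - b') = (t \<bullet> y + b) - (t' \<bullet> y + b')" "(t + t') \<bullet> y + (b + b') = (t \<bullet> y + b) + (t' \<bullet> y + b')"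
        by (simp_all add: inner_diff_left inner_add_left)
      show ?thesis unfolding 1 cos_diff cos_add by (simp add: algebra_simps)
    qed
    note eq = this
    show ?case unfolding eq by (rule trig_poly.add[OF trig_poly.cosine trig_poly.cosine])
  next
    case (add f g)
    then show ?case using trig_poly.add by (simp add: distrib_left)
  qed
next
  case (add f g')
  then show ?case using trig_poly.add by (simp add: distrib_right)
qed

lemma trig_poly_sum: "finite I \<Longrightarrow> (\<And>i. i \<in> I \<Longrightarrow> trig_poly (f i)) \<Longrightarrow> trig_poly (\<lambda>y. \<Sum>i\<in>I. f i y)"
  by (induction I rule: finite_induct) (auto intro: trig_poly_const trig_poly.add)

lemma trig_poly_cont_bounded:
  assumes "trig_poly f"
  shows "continuous_on UNIV f" "\<exists>B. \<forall>y. \<bar>f y\<bar> \<le> B"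
proof -
  from assms show "continuous_on UNIV f"
    by (induction rule: trig_poly.induct) (auto intro!: continuous_intros)
  from assms show "\<exists>B. \<forall>y. \<bar>f y\<bar> \<le> B"
  proof (induction rule: trig_poly.induct)
    case (cosine c t b)
    have "\<bar>c * cos (t \<bullet> y + b)\<bar> \<le> \<bar>c\<bar>" for y unfolding abs_mult by (intro mult_left_le) auto
    then show ?case by blast
  next
    case (add f g)
    then obtain B C where "\<And>y. \<bar>f y\<bar> \<le> B" "\<And>y. \<bar>g y\<bar> \<le> C" by blast
    then have "\<bar>f y + g y\<bar> \<le> B + C" for y by (meson abs_triangle_ineq add_mono order_trans)
    then show ?case by blast
  qed
qed

lemma integrable_cont_bounded:
  fixes f :: "'a::topological_space \<Rightarrow> real"
  assumes "prob_space M" "sets M = sets borel" "continuous_on UNIV f" "\<And>y. \<bar>f y\<bar> \<le> B"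
  shows "integrable M f"
proof (rule finite_measure.integrable_const_bound[where B=B])
  show "finite_measure M" using assms(1) by (rule prob_space.finite_measure)
  have "f \<in> borel_measurable borel" using assms(3) by (rule borel_measurable_continuous_onI)
  then show "f \<in> borel_measurable M" using measurable_cong_sets[OF assms(2) refl] by auto
qed (use assms in auto)

lemma poly_sin_trig_poly:
  fixes p :: "real ^ 'm \<Rightarrow> real"
  assumes "real_polynomial_function p"
  shows "trig_poly (\<lambda>y::real^'m. p (\<chi> i. sin (y $ i / L)))"
  using assms
proof (induction rule: real_polynomial_function.induct)
  case (linear f)
  have "f (\<chi> i. sin (y $ i / L)) = (\<Sum>i\<in>UNIV. f (axis i 1) * cos (axis i (1 / L) \<bullet> y + (- (pi / 2))))" for y :: "real^'m"
  proof -
    have "(\<chi> i. sin (y $ i / L)) = (\<Sum>i\<in>UNIV. sin (y $ i / L) *\<^sub>R axis i 1)"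
      by (simp add: vec_eq_iff axis_def if_distrib[of "\<lambda>x. _ * x"] cong: if_cong)
    then have "f (\<chi> i. sin (y $ i / L)) = (\<Sum>i\<in>UNIV. sin (y $ i / L) * f (axis i 1))"
      using linear.hyps by (simp add: bounded_linear.linear linear_sum linear_scale)
    moreover have "cos (axis i (1 / L) \<bullet> y + (- (pi / 2))) = sin (y $ i / L)" for i
      by (simp add: inner_axis' cos_diff)
    ultimately show ?thesis by (simp add: mult.commute)
  qed
  moreover have "trig_poly (\<lambda>y::real^'m. \<Sum>i\<in>UNIV. f (axis i 1) * cos (axis i (1 / L) \<bullet> y + (- (pi / 2))))"
    by (intro trig_poly_sum trig_poly.cosine) auto
  ultimately show ?case by simp
qed (auto intro: trig_poly_const trig_poly.add trig_poly_mult)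

text \<open>On the ball of radius \<open>R\<close> the function \<open>g\<close> agrees with \<open>g (R arcsin (sin (y / R)))\<close>, a
  continuous function of the sines of the coordinates, which are confined to a compact cube.\<close>

lemma trig_poly_approx:
  fixes g :: "real ^ 'm \<Rightarrow> real"
  assumes g: "continuous_on UNIV g" and B: "\<And>y. \<bar>g y\<bar> \<le> B" and R: "R > 0" and e: "e > 0"
  obtains u where "trig_poly u" "\<And>y. \<bar>u y\<bar> \<le> B + e" "\<And>y. norm y \<le> R \<Longrightarrow> \<bar>u y - g y\<bar> \<le> e"
proof -
  define G where "G s = g (\<chi> i. R * arcsin (s $ i))" for s :: "real^'m"
  let ?K = "cbox (\<chi> i. - 1) (\<chi> i. 1) :: (real^'m) set"
  have K: "s \<in> ?K \<longleftrightarrow> (\<forall>i. - 1 \<le> s $ i \<and> s $ i \<le> 1)" for s by (simp add: mem_box_cart)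
  have "continuous_on ?K G"
    unfolding G_def
    by (rule continuous_on_compose2[OF g]) (auto intro!: continuous_on_vec_lambda continuous_intros simp: K)
  then obtain p where p: "real_polynomial_function p" "\<And>s. s \<in> ?K \<Longrightarrow> \<bar>G s - p s\<bar> < e"
    using Stone_Weierstrass_real_polynomial_function[OF compact_cbox _ e] by metis
  define u where "u y = p (\<chi> i. sin (y $ i / R))" for y :: "real^'m"
  have inK: "(\<chi> i. sin (y $ i / R)) \<in> ?K" for y :: "real^'m" by (simp add: K)
  have near: "\<bar>u y - G (\<chi> i. sin (y $ i / R))\<bar> \<le> e" for y
    using p(2)[OF inK[of y]] unfolding u_def by linarith
  show ?thesis
  proof
    show "trig_poly u" unfolding u_def[abs_def] by (rule poly_sin_trig_poly[OF p(1)])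
    show "\<bar>u y\<bar> \<le> B + e" for y
      using near[of y] B[of "\<chi> i. R * arcsin ((\<chi> i. sin (y $ i / R)) $ i)"] unfolding G_def by linarith
    show "\<bar>u y - g y\<bar> \<le> e" if "norm y \<le> R" for y
    proof -
      have "(\<chi> i. R * arcsin ((\<chi> i. sin (y $ i / R)) $ i)) = y"
      proof (simp add: vec_eq_iff, rule allI)
        fix i
        have "\<bar>y $ i\<bar> \<le> R" using component_le_norm_cart[of y i] that by linarith
        then have "\<bar>y $ i / R\<bar> \<le> 1" using R by (simp add: divide_le_eq)
        \<comment> \<open>The argument lies in \<open>[-1, 1]\<close>, well inside the interval
          between \<open>- pi / 2\<close> and \<open>pi / 2\<close> on which \<open>arcsin\<close>
          inverts the sine.\<close>
        then have "arcsin (sin (y $ i / R)) = y $ i / R" using pi_gt3 by (intro arcsin_sin) linarith+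
        then show "R * arcsin (sin (y $ i / R)) = y $ i" using R by simp
      qed
      then show ?thesis using near[of y] unfolding G_def by simp
    qed
  qed
qed

lemma integral_approx_tail:
  fixes g u :: "real ^ 'm \<Rightarrow> real"
  assumes M: "prob_space M" "sets M = sets borel"
    and g: "continuous_on UNIV g" "\<And>y. \<bar>g y\<bar> \<le> B" and u: "continuous_on UNIV u" "\<And>y. \<bar>u y\<bar> \<le> B + e"
    and ug: "\<And>y. norm y \<le> R \<Longrightarrow> \<bar>u y - g y\<bar> \<le> e" and e: "e \<ge> 0"
    and tail: "measure M {y. norm y > R} \<le> \<delta>"
  shows "\<bar>(\<integral>y. u y \<partial>M) - (\<integral>y. g y \<partial>M)\<bar> \<le> e + (2 * B + e) * \<delta>"
proof -
  interpret prob_space M by fact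
  have B0: "B \<ge> 0" using g(2)[of 0] by linarith
  have sets: "{y. norm y > R} \<in> sets M"
    unfolding M(2) by (intro borel_open open_Collect_less continuous_intros)
  have iu: "integrable M u" and ig: "integrable M g"
    using integrable_cont_bounded[OF M] g u by blast+
  have "\<bar>(\<integral>y. u y \<partial>M) - (\<integral>y. g y \<partial>M)\<bar> = \<bar>\<integral>y. u y - g y \<partial>M\<bar>" using iu ig by simp
  also have "\<dots> \<le> (\<integral>y. \<bar>u y - g y\<bar> \<partial>M)" by (rule integral_abs_bound)
  also have "\<dots> \<le> (\<integral>y. e + (2 * B + e) * indicator {y. norm y > R} y \<partial>M)"
  proof (rule integral_mono)
    show "\<bar>u y - g y\<bar> \<le> e + (2 * B + e) * indicator {y. norm y > R} y" for y
      using ug[of y] u(2)[of y] g(2)[of y] e by (cases "norm y > R") auto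
  qed (use iu ig sets in \<open>auto intro!: Bochner_Integration.integrable_add integrable_mult_right integrable_real_indicator simp: emeasure_eq_measure\<close>)
  also have "\<dots> = e + (2 * B + e) * measure M {y. norm y > R}"
    using sets by (subst Bochner_Integration.integral_add) (auto simp: prob_space emeasure_eq_measure intro!: integrable_mult_right integrable_real_indicator)
  also have "\<dots> \<le> e + (2 * B + e) * \<delta>" using B0 e by (intro add_left_mono mult_left_mono tail) auto
  finally show ?thesis .
qed

text \<open>A continuity theorem in several dimensions. Convergence passes from cosines to
  trigonometric polynomials by linearity; tightness confines the mass to a ball on which such a
  polynomial is close to \<open>g\<close>, and outside both are bounded.\<close>

lemma cos_tests_imp_weak_conv:
  fixes g :: "real ^ 'm \<Rightarrow> real"
  assumes \<nu>: "\<And>n. prob_space (\<nu> n)" "\<And>n. sets (\<nu> n) = sets borel" and \<mu>: "prob_space \<mu>" "sets \<mu> = sets borel"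
    and tight: "\<And>\<delta>. \<delta> > 0 \<Longrightarrow> \<exists>R>0. (\<forall>n. measure (\<nu> n) {y. norm y > R} \<le> \<delta>) \<and> measure \<mu> {y. norm y > R} \<le> \<delta>"
    and cos: "\<And>t b. (\<lambda>n. \<integral>y. cos (t \<bullet> y + b) \<partial>\<nu> n) \<longlonglongrightarrow> (\<integral>y. cos (t \<bullet> y + b) \<partial>\<mu>)"
    and g: "continuous_on UNIV g" "bounded (range g)"
  shows "(\<lambda>n. \<integral>y. g y \<partial>\<nu> n) \<longlonglongrightarrow> (\<integral>y. g y \<partial>\<mu>)"
proof -
  have trig: "(\<lambda>n. \<integral>y. u y \<partial>\<nu> n) \<longlonglongrightarrow> (\<integral>y. u y \<partial>\<mu>)" if "trig_poly u" for u
    using that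
  proof (induction rule: trig_poly.induct)
    case (cosine c t b)
    then show ?case using tendsto_mult_left[OF cos] by simp
  next
    case (add f h)
    have i: "integrable M f" "integrable M h" if "prob_space M" "sets M = sets borel" for M
      using trig_poly_cont_bounded[OF add.hyps(1)] trig_poly_cont_bounded[OF add.hyps(2)]
        integrable_cont_bounded[OF that] by blast+
    show ?case using tendsto_add[OF add.IH] by (simp add: i \<nu> \<mu>)
  qed
  obtain B where B: "\<And>y. \<bar>g y\<bar> \<le> B" using g(2) unfolding bounded_iff by auto
  have B0: "B \<ge> 0" using B[of 0] by linarith
  show ?thesis
  proof (rule LIMSEQ_I)
    fix r :: real assume r: "r > 0"
    \<comment> \<open>The two parts \<open>e\<close> and \<open>(2 * B + e) * \<delta>\<close> of
      the approximation error are each at most \<open>r / 12\<close>, which makes each of the three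
      comparisons below cost at most \<open>r / 6\<close>.\<close>
    define e where "e = min 1 (r / 12)"
    define \<delta> where "\<delta> = r / (12 * (2 * B + 1))"
    have e: "e > 0" "e \<le> 1" "e \<le> r / 12" and \<delta>: "\<delta> > 0" using r B0 unfolding e_def \<delta>_def by auto
    have small: "e + (2 * B + e) * \<delta> \<le> r / 6"
    proof -
      have "(2 * B + e) * \<delta> \<le> (2 * B + 1) * \<delta>" using e \<delta> by (intro mult_right_mono) auto
      also have "\<dots> = r / 12" using B0 unfolding \<delta>_def by (simp add: field_simps)
      finally show ?thesis using e by linarith
    qed
    obtain R where R: "R > 0" "\<And>n. measure (\<nu> n) {y. norm y > R} \<le> \<delta>" "measure \<mu> {y. norm y > R} \<le> \<delta>"
      using tight[OF \<delta>] by blast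
    obtain u where u: "trig_poly u" "\<And>y. \<bar>u y\<bar> \<le> B + e" "\<And>y. norm y \<le> R \<Longrightarrow> \<bar>u y - g y\<bar> \<le> e"
      using trig_poly_approx[OF g(1) B R(1) e(1)] by blast
    note uc = trig_poly_cont_bounded(1)[OF u(1)]
    have 1: "\<bar>(\<integral>y. u y \<partial>\<nu> n) - (\<integral>y. g y \<partial>\<nu> n)\<bar> \<le> r / 6" for n
      using integral_approx_tail[OF \<nu> g(1) B uc u(2,3) less_imp_le[OF e(1)] R(2)[of n]] small by linarith
    have 2: "\<bar>(\<integral>y. u y \<partial>\<mu>) - (\<integral>y. g y \<partial>\<mu>)\<bar> \<le> r / 6"
      using integral_approx_tail[OF \<mu> g(1) B uc u(2,3) less_imp_le[OF e(1)] R(3)] small by linarith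
    obtain N where N: "\<And>n. n \<ge> N \<Longrightarrow> \<bar>(\<integral>y. u y \<partial>\<nu> n) - (\<integral>y. u y \<partial>\<mu>)\<bar> < r / 6"
      using LIMSEQ_D[OF trig[OF u(1)], of "r / 6"] r by auto
    have "\<bar>(\<integral>y. g y \<partial>\<nu> n) - (\<integral>y. g y \<partial>\<mu>)\<bar> < r" if "n \<ge> N" for n
      using 1[of n] 2 N[OF that] r by linarith
    then show "\<exists>no. \<forall>n\<ge>no. norm ((\<integral>y. g y \<partial>\<nu> n) - (\<integral>y. g y \<partial>\<mu>)) < r" by auto
  qed
qed

lemma tight_single:
  fixes \<mu> :: "(real ^ 'm) measure"
  assumes "prob_space \<mu>" "sets \<mu> = sets borel" "\<delta> > 0"
  shows "\<exists>R0. \<forall>R\<ge>R0. measure \<mu> {y. norm y > R} \<le> \<delta>"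
proof -
  interpret prob_space \<mu> by fact
  let ?A = "\<lambda>n::nat. {y :: real^'m. norm y > real n}"
  have s: "{y :: real^'m. norm y > r} \<in> events" for r
    unfolding assms(2) by (intro borel_open open_Collect_less continuous_intros)
  have "(\<Inter>n. ?A n) = {}"
  proof -
    have "\<exists>n. \<not> norm y > real n" for y :: "real^'m" using reals_Archimedean2[of "norm y"] by (metis less_asym)
    then show ?thesis by blast
  qed
  then have "(\<lambda>n. prob (?A n)) \<longlonglongrightarrow> 0"
    using finite_Lim_measure_decseq[of ?A] s by (force simp: decseq_def)
  from order_tendstoD(2)[OF this assms(3)] obtain n where n: "prob (?A n) < \<delta>"
    by (auto simp: eventually_sequentially)
  have "prob {y. norm y > R} \<le> \<delta>" if "R \<ge> real n" for R
    using finite_measure_mono[OF _ s[of "real n"], of "{y. norm y > R}"] n that by fastforce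
  then show ?thesis by blast
qed

section \<open>Centered Gaussian vectors\<close>

text \<open>Cholesky elimination, one index at a time: subtracting the rank-one matrix built from
  column \<open>i\<close> divided by the root of the pivot \<open>s\<close> clears row
  \<open>i\<close>. The remainder is again non-negative definite, as seen by minimising the
  quadratic form along the \<open>i\<close>-th axis. A zero pivot forces the whole row to vanish, so
  singular matrices are covered.\<close>

lemma psd_square_root_aux:
  fixes S :: "real^'m^'m" and I :: "'m set"
  assumes "finite I" "transpose S = S" "\<And>x. 0 \<le> x \<bullet> (S *v x)"
  shows "\<exists>(v :: 'm \<Rightarrow> real^'m) (S' :: real^'m^'m). transpose S' = S' \<and> (\<forall>x. 0 \<le> x \<bullet> (S' *v x)) \<and> (\<forall>i\<in>I. \<forall>p. S' $ i $ p = 0) \<and>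
     (\<forall>p q. S $ p $ q = S' $ p $ q + (\<Sum>i\<in>I. v i $ p * v i $ q))"
  using assms(1)
proof (induction I rule: finite_induct)
  case empty
  then show ?case using assms(2,3) by (intro exI[of _ "\<lambda>_. 0"] exI[of _ S]) auto
next
  case (insert i I)
  then obtain v and S' :: "real^'m^'m" where S': "transpose S' = S'" "\<And>x. 0 \<le> x \<bullet> (S' *v x)" "\<And>i p. i \<in> I \<Longrightarrow> S' $ i $ p = 0"
    and dec: "\<And>p q. S $ p $ q = S' $ p $ q + (\<Sum>i\<in>I. v i $ p * v i $ q)" by blast
  have sym: "S' $ p $ q = S' $ q $ p" for p q
  proof -
    have "transpose S' $ p $ q = S' $ q $ p" by (simp add: transpose_def)
    then show ?thesis unfolding S'(1) .
  qed
  define s where "s = S' $ i $ i"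
  define w where "w = S' *v axis i 1"
  have w: "w $ p = S' $ p $ i" for p unfolding w_def by (simp add: matrix_vector_mul_component inner_axis)
  have wx: "(S' *v x) $ i = x \<bullet> w" for x
    by (simp add: matrix_vector_mul_component inner_vec_def w sym[of i] mult.commute)
  have quad: "(x + c *\<^sub>R axis i 1) \<bullet> (S' *v (x + c *\<^sub>R axis i 1)) = x \<bullet> (S' *v x) + 2 * c * (x \<bullet> w) + c\<^sup>2 * s" for x c
  proof -
    have "S' *v (x + c *\<^sub>R axis i 1) = S' *v x + c *\<^sub>R w"
      by (simp add: matrix_vector_right_distrib matrix_vector_mult_scaleR w_def)
    moreover have "axis i 1 \<bullet> (S' *v x) = x \<bullet> w" by (simp add: inner_axis' wx)
    moreover have "axis i 1 \<bullet> w = s" by (simp add: inner_axis' w s_def)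
    ultimately show ?thesis
      by (simp only: inner_add_left inner_add_right inner_scaleR_left inner_scaleR_right power2_eq_square) (simp add: algebra_simps)
  qed
  have s0: "s \<ge> 0"
    using S'(2)[of "0 + 1 *\<^sub>R axis i 1"] unfolding quad by simp
  define u where "u p = (if s = 0 then 0 else w $ p / sqrt s)" for p
  define S'' where "S'' = (\<chi> p q. S' $ p $ q - u p * u q)"
  have row: "S' $ i $ p = u i * u p" for p
  proof (cases "s = 0")
    case True
    have "axis p 1 \<bullet> w = 0"
    proof (rule ccontr)
      define y where "y = axis p 1 \<bullet> w"
      define z where "z = axis p 1 \<bullet> (S' *v axis p 1)"
      assume "axis p 1 \<bullet> w \<noteq> 0"
      then have y: "y \<noteq> 0" unfolding y_def .
      \<comment> \<open>With a zero pivot the form is affine along the \<open>i\<close>-th axis;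
        this coefficient makes it equal to -1.\<close>
      have "0 \<le> z + 2 * (- (z + 1) / (2 * y)) * y"
        using S'(2)[of "axis p 1 + (- (z + 1) / (2 * y)) *\<^sub>R axis i 1"] unfolding quad True y_def z_def by simp
      also have "\<dots> = - 1" using y by (simp add: field_simps)
      finally show False by simp
    qed
    then show ?thesis using True by (simp add: u_def inner_axis' w sym[of i])
  next
    case False
    then have "u i * u p = s * w $ p / (sqrt s * sqrt s)" by (simp add: u_def w s_def)
    also have "\<dots> = w $ p" using False s0 by simp
    finally show ?thesis by (simp add: w sym[of i])
  qed
  have "transpose S'' = S''" by (simp add: S''_def transpose_def vec_eq_iff sym mult.commute)
  moreover have "0 \<le> x \<bullet> (S'' *v x)" for x
  proof -
    have eq: "x \<bullet> (S'' *v x) = x \<bullet> (S' *v x) - (\<Sum>p\<in>UNIV. x $ p * u p)\<^sup>2"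
      by (simp add: S''_def inner_vec_def matrix_vector_mult_def power2_eq_square sum_product sum_subtractf
          sum_distrib_left right_diff_distrib left_diff_distrib mult_ac)
    show ?thesis
    proof (cases "s = 0")
      case True
      then show ?thesis unfolding eq using S'(2)[of x] by (simp add: u_def)
    next
      case False
      then have sp: "s > 0" using s0 by simp
      have "(\<Sum>p\<in>UNIV. x $ p * u p) = (x \<bullet> w) / sqrt s"
        using False by (simp add: u_def inner_vec_def sum_divide_distrib)
      then have "(\<Sum>p\<in>UNIV. x $ p * u p)\<^sup>2 = (x \<bullet> w)\<^sup>2 / s" using sp by (simp add: power_divide)
      moreover have "0 \<le> x \<bullet> (S' *v x) - (x \<bullet> w)\<^sup>2 / s"
      proof -
        \<comment> \<open>The coefficient \<open>- (x \<bullet> w) / s\<close> minimises the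
          quadratic form along the \<open>i\<close>-th axis.\<close>
        have "0 \<le> x \<bullet> (S' *v x) + 2 * (- (x \<bullet> w) / s) * (x \<bullet> w) + (- (x \<bullet> w) / s)\<^sup>2 * s"
          using S'(2)[of "x + (- (x \<bullet> w) / s) *\<^sub>R axis i 1"] unfolding quad .
        also have "\<dots> = x \<bullet> (S' *v x) - (x \<bullet> w)\<^sup>2 / s" using sp by (simp add: power2_eq_square field_simps)
        finally show ?thesis .
      qed
      ultimately show ?thesis unfolding eq by simp
    qed
  qed
  moreover have "S'' $ l $ p = 0" if "l \<in> insert i I" for l p
  proof (cases "l = i")
    case True
    then show ?thesis by (simp add: S''_def row)
  next
    case False
    then have l: "l \<in> I" using that by auto
    have "w $ l = 0" unfolding w using S'(3)[OF l] .
    then show ?thesis using S'(3)[OF l] by (simp add: S''_def u_def)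
  qed
  moreover have "S $ p $ q = S'' $ p $ q + (\<Sum>l\<in>insert i I. (v(i := \<chi> p. u p)) l $ p * (v(i := \<chi> p. u p)) l $ q)" for p q
  proof -
    have "(\<Sum>l\<in>I. (v(i := \<chi> p. u p)) l $ p * (v(i := \<chi> p. u p)) l $ q) = (\<Sum>l\<in>I. v l $ p * v l $ q)"
      using insert by (intro sum.cong refl) auto
    then show ?thesis using dec[of p q] insert by (simp add: S''_def)
  qed
  ultimately show ?case by blast
qed

lemma psd_square_root:
  fixes S :: "real^'m^'m"
  assumes "transpose S = S" "\<And>x. 0 \<le> x \<bullet> (S *v x)"
  shows "\<exists>A :: real^'m^'m. A ** transpose A = S"
proof -
  from psd_square_root_aux[OF finite assms] obtain v :: "'m \<Rightarrow> real^'m" and S' :: "real^'m^'m"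
    where *: "\<forall>i\<in>UNIV. \<forall>p. S' $ i $ p = 0" "\<forall>p q. S $ p $ q = S' $ p $ q + (\<Sum>i\<in>UNIV. v i $ p * v i $ q)"
    by blast
  have z: "S' $ i $ p = 0" and d: "S $ p $ q = S' $ p $ q + (\<Sum>i\<in>UNIV. v i $ p * v i $ q)" for i p q
    using * by blast+
  have "(\<chi> p i. v i $ p) ** transpose (\<chi> p i. v i $ p) = S"
    by (simp add: vec_eq_iff matrix_matrix_mult_def transpose_def d z)
  then show ?thesis by blast
qed

definition gauss_root :: "real^'m^'m \<Rightarrow> real^'m^'m" where
  "gauss_root S = (SOME A. A ** transpose A = S)"

lemma gauss_root:
  assumes "transpose S = S" "\<And>x. 0 \<le> x \<bullet> (S *v x)"
  shows "gauss_root S ** transpose (gauss_root S) = S"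
  unfolding gauss_root_def by (rule someI_ex) (rule psd_square_root[OF assms])

lemma borel_measurable_vec_lambda:
  fixes f :: "'m::finite \<Rightarrow> 'a \<Rightarrow> real"
  assumes "\<And>j. f j \<in> borel_measurable M"
  shows "(\<lambda>\<omega>. \<chi> j. f j \<omega>) \<in> borel_measurable M"
  by (rule borel_measurable_euclidean_space[THEN iffD2]) (auto simp: Basis_vec_def inner_axis assms)

lemma gauss_map_measurable:
  "(\<lambda>z. A *v (\<chi> j. z j)) \<in> borel_measurable (\<Pi>\<^sub>M j\<in>(UNIV::'m::finite set). std_normal_distribution)"
proof -
  have "(\<lambda>z. (\<chi> j. z j) :: real^'m) \<in> borel_measurable (\<Pi>\<^sub>M j\<in>(UNIV::'m set). std_normal_distribution)"
  proof (rule borel_measurable_vec_lambda)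
    fix j :: 'm
    have "(\<lambda>z. z j) \<in> measurable (\<Pi>\<^sub>M j\<in>(UNIV::'m set). std_normal_distribution) std_normal_distribution"
      by (rule measurable_component_singleton) simp
    then show "(\<lambda>z. z j) \<in> borel_measurable (\<Pi>\<^sub>M j\<in>(UNIV::'m set). std_normal_distribution)"
      by (simp add: measurable_def)
  qed
  moreover have "(\<lambda>x. A *v x) \<in> borel_measurable borel"
    by (intro borel_measurable_continuous_onI linear_continuous_on matrix_vector_mul_bounded_linear)
  ultimately show ?thesis by (rule measurable_compose)
qed

lemma std_normal_prob: "prob_space std_normal_distribution"
  using real_dist_normal_dist by (simp add: real_distribution_def)

lemma centered_gaussian_eq: "centered_gaussian S = distr (\<Pi>\<^sub>M j\<in>UNIV. std_normal_distribution) borel (\<lambda>z. gauss_root S *v (\<chi> j. z j))"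
  unfolding centered_gaussian_def gauss_root_def ..

lemma centered_gaussian_prob: "prob_space (centered_gaussian S)" "sets (centered_gaussian S) = sets borel"
proof -
  interpret P: prob_space "\<Pi>\<^sub>M j\<in>(UNIV::'a set). std_normal_distribution"
    by (rule prob_space_PiM) (rule std_normal_prob)
  show "prob_space (centered_gaussian S)" unfolding centered_gaussian_eq
    by (rule P.prob_space_distr) (rule gauss_map_measurable)
  show "sets (centered_gaussian S) = sets borel" unfolding centered_gaussian_eq by simp
qed

lemma gaussian_product_cos:
  fixes c :: "'m::finite \<Rightarrow> real"
  shows "(\<integral>z. cos ((\<Sum>j\<in>UNIV. c j * z j) + b) \<partial>(\<Pi>\<^sub>M j\<in>UNIV. std_normal_distribution)) = cos b * exp (- (\<Sum>j\<in>UNIV. (c j)\<^sup>2) / 2)"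
proof -
  let ?N = "std_normal_distribution"
  let ?P = "\<Pi>\<^sub>M j\<in>(UNIV::'m set). ?N"
  interpret N: prob_space ?N by (rule std_normal_prob)
  interpret product_sigma_finite "\<lambda>_::'m. ?N" by unfold_locales
  interpret P: prob_space ?P by (rule prob_space_PiM) (rule std_normal_prob)
  have m: "(\<lambda>z. z j) \<in> borel_measurable ?P" for j
  proof -
    have "(\<lambda>z. z j) \<in> measurable ?P ?N" by (rule measurable_component_singleton) simp
    then show ?thesis by (simp add: measurable_def)
  qed
  have i1: "integrable ?N (\<lambda>x. iexp (c j * x))" for j
    by (rule N.integrable_const_bound[where B=1]) auto
  have ch: "(\<integral>x. iexp (c j * x) \<partial>?N) = complex_of_real (exp (- ((c j)\<^sup>2) / 2))" for j
    using char_std_normal_distribution by (simp add: char_def fun_eq_iff)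
  have "(\<integral>z. (\<Prod>j\<in>UNIV. iexp (c j * z j)) \<partial>?P) = (\<Prod>j\<in>(UNIV::'m set). complex_of_real (exp (- ((c j)\<^sup>2) / 2)))"
    by (subst product_integral_prod[OF finite i1]) (simp only: ch)
  also have "\<dots> = complex_of_real (exp (- (\<Sum>j\<in>UNIV. (c j)\<^sup>2) / 2))"
  proof -
    have "(\<Prod>j\<in>(UNIV::'m set). exp (- ((c j)\<^sup>2) / 2)) = exp (\<Sum>j\<in>UNIV. - ((c j)\<^sup>2) / 2)"
      by (rule exp_sum[symmetric]) simp
    also have "(\<Sum>j\<in>UNIV. - ((c j)\<^sup>2) / 2) = - (\<Sum>j\<in>UNIV. (c j)\<^sup>2) / 2"
      by (simp only: sum_divide_distrib[symmetric] sum_negf)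
    finally show ?thesis by (simp only: of_real_prod[symmetric])
  qed
  finally have E: "(\<integral>z. (\<Prod>j\<in>UNIV. iexp (c j * z j)) \<partial>?P) = complex_of_real (exp (- (\<Sum>j\<in>UNIV. (c j)\<^sup>2) / 2))" .
  have pw: "cos ((\<Sum>j\<in>UNIV. c j * z j) + b) = Re (cis b * (\<Prod>j\<in>UNIV. iexp (c j * z j)))" for z
  proof -
    have "(\<Prod>j\<in>UNIV. iexp (c j * z j)) = cis (\<Sum>j\<in>UNIV. c j * z j)"
      by (simp add: cis_conv_exp exp_sum[symmetric] sum_distrib_left)
    then show ?thesis by (simp add: cis_mult add.commute del: cis.simps) (simp add: cis.simps)
  qed
  have ip: "integrable ?P (\<lambda>z. cis b * (\<Prod>j\<in>UNIV. iexp (c j * z j)))"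
  proof (rule P.integrable_const_bound[where B=1])
    show "(\<lambda>z. cis b * (\<Prod>j\<in>UNIV. iexp (c j * z j))) \<in> borel_measurable ?P"
      using m by measurable
  qed (auto simp: norm_mult prod_norm[symmetric])
  have "(\<integral>z. cos ((\<Sum>j\<in>UNIV. c j * z j) + b) \<partial>?P) = Re (\<integral>z. cis b * (\<Prod>j\<in>UNIV. iexp (c j * z j)) \<partial>?P)"
    unfolding pw by (rule integral_Re[OF ip])
  also have "\<dots> = cos b * exp (- (\<Sum>j\<in>UNIV. (c j)\<^sup>2) / 2)"
    unfolding integral_mult_right_zero E by simp
  finally show ?thesis .
qed

text \<open>A linear functional of \<open>A z\<close> is a combination of independent normals with
  variance \<open>norm (transpose A *v t) ^ 2\<close>, which equals
  \<open>t \<bullet> (S *v t)\<close>; the choice of the root \<open>A\<close> therefore leaves no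
  trace.\<close>

lemma centered_gaussian_cos:
  fixes S :: "real^'m^'m"
  assumes S: "transpose S = S" "\<And>x. 0 \<le> x \<bullet> (S *v x)"
  shows "(\<integral>y. cos (t \<bullet> y + b) \<partial>centered_gaussian S) = cos b * exp (- (t \<bullet> (S *v t)) / 2)"
proof -
  define A where "A = gauss_root S"
  define c where "c = transpose A *v t"
  have A: "A ** transpose A = S" unfolding A_def by (rule gauss_root[OF S])
  have tA: "t \<bullet> (A *v y) = c \<bullet> y" for y unfolding c_def by (simp add: dot_lmul_matrix transpose_matrix_vector)
  have cc: "(\<Sum>j\<in>UNIV. (c $ j)\<^sup>2) = t \<bullet> (S *v t)"
  proof -
    have "(\<Sum>j\<in>UNIV. (c $ j)\<^sup>2) = c \<bullet> c" by (simp add: inner_vec_def power2_eq_square)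
    also have "\<dots> = t \<bullet> (A *v c)" by (rule tA[symmetric])
    also have "A *v c = S *v t" unfolding c_def A[symmetric] by (rule matrix_vector_mul_assoc)
    finally show ?thesis .
  qed
  have "(\<lambda>y. cos (t \<bullet> y + b)) \<in> borel_measurable borel"
    by (intro borel_measurable_continuous_onI continuous_intros)
  then have "(\<integral>y. cos (t \<bullet> y + b) \<partial>centered_gaussian S) = (\<integral>z. cos (t \<bullet> (A *v (\<chi> j. z j)) + b) \<partial>(\<Pi>\<^sub>M j\<in>UNIV. std_normal_distribution))"
    unfolding centered_gaussian_eq A_def by (rule integral_distr[OF gauss_map_measurable])
  also have "\<dots> = cos b * exp (- (\<Sum>j\<in>UNIV. (c $ j)\<^sup>2) / 2)"
    unfolding tA using gaussian_product_cos[of "\<lambda>j. c $ j" b] by (simp add: inner_vec_def)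
  finally show ?thesis unfolding cc .
qed

section \<open>Kernels as functions on finite sets\<close>

definition zbox :: "nat \<Rightarrow> int set" where "zbox N = {- int N..int N}"
definition blist :: "nat \<Rightarrow> nat \<Rightarrow> int list set" where "blist k N = {l. length l = k \<and> set l \<subseteq> zbox N}"

lemma finite_box[simp]: "finite (zbox N)" unfolding zbox_def by simp

lemma finite_blist[simp]: "finite (blist k N)"
  using finite_lists_length_eq[of "zbox N" k] unfolding blist_def by (simp add: conj_commute)

lemma blist_subset: "blist k N \<subseteq> index_tuples k" unfolding blist_def index_tuples_def by auto

lemma blist_mono: "N \<le> N' \<Longrightarrow> blist k N \<subseteq> blist k N'" unfolding blist_def zbox_def by force

lemma finite_in_box:
  assumes "finite (A :: int set)" shows "\<exists>N. A \<subseteq> zbox N"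
proof -
  have "A \<subseteq> zbox (nat (Max (insert 0 (abs ` A))))"
  proof
    fix x assume "x \<in> A"
    then have "\<bar>x\<bar> \<le> Max (insert 0 (abs ` A))" using assms by (intro Max_ge) auto
    then show "x \<in> zbox (nat (Max (insert 0 (abs ` A))))" unfolding zbox_def by auto
  qed
  then show ?thesis by blast
qed

lemma finite_in_blist:
  assumes "finite F" "F \<subseteq> index_tuples k" shows "\<exists>N. F \<subseteq> blist k N"
proof -
  obtain N where "(\<Union>l\<in>F. set l) \<subseteq> zbox N" using finite_in_box[of "\<Union>l\<in>F. set l"] assms by auto
  then show ?thesis using assms(2) unfolding blist_def index_tuples_def by (intro exI[of _ N]) auto
qed

text \<open>The cubes are cofinal among the finite sets of tuples, so limits over finite subsets can
  be taken along a sequence.\<close>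

lemma filterlim_blist: "filterlim (blist k) (finite_subsets_at_top (index_tuples k)) sequentially"
  unfolding filterlim_def le_filter_def eventually_filtermap eventually_finite_subsets_at_top
proof (intro allI impI)
  fix P assume "\<exists>F. finite F \<and> F \<subseteq> index_tuples k \<and> (\<forall>Y. finite Y \<and> F \<subseteq> Y \<and> Y \<subseteq> index_tuples k \<longrightarrow> P Y)"
  then obtain F where F: "finite F" "F \<subseteq> index_tuples k" "\<And>Y. finite Y \<Longrightarrow> F \<subseteq> Y \<Longrightarrow> Y \<subseteq> index_tuples k \<Longrightarrow> P Y" by (elim exE conjE) simp
  obtain N where "F \<subseteq> blist k N" using finite_in_blist[OF F(1,2)] by blast
  then have "P (blist k n)" if "n \<ge> N" for n
    using blist_mono[OF that, of k] by (intro F(3) blist_subset) auto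
  then show "eventually (\<lambda>x. P (blist k x)) sequentially" unfolding eventually_sequentially by blast
qed

lemma infsum_blist_tendsto:
  fixes h :: "int list \<Rightarrow> real"
  assumes "h summable_on index_tuples k"
  shows "(\<lambda>N. \<Sum>l\<in>blist k N. h l) \<longlonglongrightarrow> (\<Sum>\<^sub>\<infinity>l\<in>index_tuples k. h l)"
  using filterlim_compose[OF has_sum_infsum[OF assms, unfolded has_sum_def] filterlim_blist] .

text \<open>The factor \<open>fact k\<close> counts the orderings of a set of \<open>k\<close> indices.\<close>

definition setk :: "nat \<Rightarrow> (int list \<Rightarrow> real) \<Rightarrow> int set \<Rightarrow> real" where
  "setk k f A = (if card A = k then fact k * f (sorted_list_of_set A) else 0)"

lemma setk_card: "setk k f A \<noteq> 0 \<Longrightarrow> card A = k" unfolding setk_def by (auto split: if_splits)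

lemma l2_kernel_list:
  assumes f: "f \<in> l2_kernels k" and l: "length l = k"
  shows "f l = (if distinct l then setk k f (set l) / fact k else 0)"
proof (cases "distinct l")
  case True
  have "mset (sorted_list_of_set (set l)) = mset l"
    using True by (simp add: set_eq_iff_mset_eq_distinct[symmetric])
  then have "f (sorted_list_of_set (set l)) = f l"
    using f l unfolding l2_kernels_def index_tuples_def by blast
  then show ?thesis using True l distinct_card[OF True] unfolding setk_def by simp
next
  case False
  then obtain p q where "p < k" "q < k" "p \<noteq> q" "l ! p = l ! q" using l by (auto simp: distinct_conv_nth)
  then have "f l = 0" using f l unfolding l2_kernels_def index_tuples_def by blast
  then show ?thesis using False by simp
qed

lemma sum_distinct_lists:
  assumes V: "finite V"
  shows "(\<Sum>l\<in>{l. length l = k \<and> set l \<subseteq> V \<and> distinct l}. G (set l)) = fact k * (\<Sum>A\<in>ksub V k. G A :: real)"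
proof -
  let ?D = "{l. length l = k \<and> set l \<subseteq> V \<and> distinct l}"
  have fD: "finite ?D" by (rule finite_subset[OF _ finite_lists_length_eq[OF V, of k]]) auto
  have "(\<Sum>l\<in>?D. G (set l)) = (\<Sum>A\<in>ksub V k. \<Sum>l\<in>{l \<in> ?D. set l = A}. G (set l))"
    using V fD by (intro sum.group[symmetric]) (auto simp: ksub_def distinct_card)
  also have "\<dots> = (\<Sum>A\<in>ksub V k. fact k * G A)"
  proof (rule sum.cong[OF refl])
    fix A assume A: "A \<in> ksub V k"
    then have fA: "finite A" "card A = k" "A \<subseteq> V" using V finite_subset unfolding ksub_def by auto
    have "{l \<in> ?D. set l = A} = permutations_of_set A"
      using fA by (auto simp: permutations_of_set_def distinct_card)
    then have "card {l \<in> ?D. set l = A} = fact k" using fA by simp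
    moreover have "(\<Sum>l\<in>{l \<in> ?D. set l = A}. G (set l)) = (\<Sum>l\<in>{l \<in> ?D. set l = A}. G A)" by (rule sum.cong) auto
    ultimately show "(\<Sum>l\<in>{l \<in> ?D. set l = A}. G (set l)) = fact k * G A" by simp
  qed
  finally show ?thesis unfolding sum_distrib_left .
qed

lemma sum_blist:
  assumes "\<And>l. l \<in> blist k N \<Longrightarrow> F l = (if distinct l then G (set l) else (0::real))"
  shows "(\<Sum>l\<in>blist k N. F l) = fact k * (\<Sum>A\<in>ksub (zbox N) k. G A)"
proof -
  have "(\<Sum>l\<in>blist k N. F l) = (\<Sum>l\<in>{l. length l = k \<and> set l \<subseteq> zbox N \<and> distinct l}. G (set l))"
  proof (intro sum.mono_neutral_cong_right finite_blist)
    show "{l. length l = k \<and> set l \<subseteq> zbox N \<and> distinct l} \<subseteq> blist k N" unfolding blist_def by auto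
  qed (use assms in \<open>auto simp: blist_def\<close>)
  then show ?thesis by (simp add: sum_distinct_lists)
qed

lemma sum_ksub_Pow:
  assumes "finite V" "\<And>A. g A \<noteq> 0 \<Longrightarrow> card A = k"
  shows "(\<Sum>A\<in>ksub V k. g A) = (\<Sum>A\<in>Pow V. g A)"
  using assms by (intro sum.mono_neutral_left) (auto simp: ksub_def)

text \<open>The two \<open>setk\<close> contribute \<open>fact k\<close> twice; one factor is
  absorbed by counting the orderings of a set, the other is the factorial in
  \<open>kernel_inner\<close>.\<close>

lemma blist_inner:
  assumes "f \<in> l2_kernels k" "g \<in> l2_kernels k"
  shows "fact k * (\<Sum>l\<in>blist k N. f l * g l) = (\<Sum>A\<in>Pow (zbox N). setk k f A * setk k g A)"
proof -
  have "(\<Sum>l\<in>blist k N. f l * g l) = fact k * (\<Sum>A\<in>ksub (zbox N) k. setk k f A / fact k * (setk k g A / fact k))"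
    by (rule sum_blist) (auto simp: l2_kernel_list[OF assms(1)] l2_kernel_list[OF assms(2)] blist_def)
  also have "\<dots> = (\<Sum>A\<in>ksub (zbox N) k. setk k f A * setk k g A) / fact k"
    by (simp add: sum_distrib_left sum_divide_distrib)
  also have "(\<Sum>A\<in>ksub (zbox N) k. setk k f A * setk k g A) = (\<Sum>A\<in>Pow (zbox N). setk k f A * setk k g A)"
    by (rule sum_ksub_Pow) (auto simp: setk_card)
  finally show ?thesis by simp
qed

lemma blist_mlp:
  assumes "f \<in> l2_kernels k"
  shows "(\<Sum>l\<in>blist k N. f l * (\<Prod>p<k. x (l ! p))) = mlp (zbox N) (setk k f) x"
proof -
  have "(\<Sum>l\<in>blist k N. f l * (\<Prod>p<k. x (l ! p))) = fact k * (\<Sum>A\<in>ksub (zbox N) k. setk k f A / fact k * (\<Prod>i\<in>A. x i))"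
  proof (rule sum_blist)
    fix l assume l: "l \<in> blist k N"
    have "(\<Prod>p<k. x (l ! p)) = (\<Prod>i\<in>set l. x i)" if "distinct l"
      using l bij_betw_nth[OF that, of "{..<k}" "set l"] unfolding blist_def
      by (intro prod.reindex_bij_betw) auto
    then show "f l * (\<Prod>p<k. x (l ! p)) = (if distinct l then setk k f (set l) / fact k * (\<Prod>i\<in>set l. x i) else 0)"
      using l2_kernel_list[OF assms, of l] l by (auto simp: blist_def)
  qed
  also have "\<dots> = (\<Sum>A\<in>ksub (zbox N) k. setk k f A * (\<Prod>i\<in>A. x i))" by (simp add: sum_distrib_left)
  also have "\<dots> = mlp (zbox N) (setk k f) x"
    unfolding mlp_def by (rule sum_ksub_Pow) (auto simp: setk_card)
  finally show ?thesis .
qed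

lemma l2_kernel_sq_summable: "f \<in> l2_kernels k \<Longrightarrow> (\<lambda>l. (f l)\<^sup>2) summable_on index_tuples k"
  unfolding l2_kernels_def by blast

lemma l2_kernel_mult_summable:
  assumes "f \<in> l2_kernels k" "g \<in> l2_kernels k"
  shows "(\<lambda>l. f l * g l) summable_on index_tuples k"
proof -
  have "(\<lambda>l. (f l)\<^sup>2 + (g l)\<^sup>2) summable_on index_tuples k"
    by (intro summable_on_add l2_kernel_sq_summable assms)
  then have "(\<lambda>l. norm (f l * g l)) summable_on index_tuples k"
    by (rule Infinite_Sum.abs_summable_on_comparison_test') (use abs_mult_le_squares in auto)
  then show ?thesis by (rule Infinite_Sum.abs_summable_summable)
qed

lemma gram_tendsto:
  assumes "f \<in> l2_kernels k" "g \<in> l2_kernels l"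
  shows "(\<lambda>N. \<Sum>A\<in>Pow (zbox N). setk k f A * setk l g A) \<longlonglongrightarrow> kernel_inner k f l g"
proof (cases "k = l")
  case True
  then have g: "g \<in> l2_kernels k" using assms(2) by simp
  have "(\<lambda>N. fact k * (\<Sum>l\<in>blist k N. f l * g l)) \<longlonglongrightarrow> kernel_inner k f l g"
    unfolding kernel_inner_def using True infsum_blist_tendsto[OF l2_kernel_mult_summable[OF assms(1) g]]
    by (auto intro: tendsto_mult_left)
  then show ?thesis unfolding blist_inner[OF assms(1) g] using True by simp
next
  case False
  then have "setk k f A * setk l g A = 0" for A using setk_card[of k f A] setk_card[of l g A] by (metis mult_eq_0_iff)
  then have "(\<lambda>N. \<Sum>A\<in>Pow (zbox N). setk k f A * setk l g A) = (\<lambda>_. 0)" by (simp only: sum.neutral_const)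
  then show ?thesis using False by (simp add: kernel_inner_def)
qed

text \<open>Since the diagonal values vanish, concatenating tuples amounts to taking unions of sets.\<close>

lemma l2_kernel_append:
  assumes f: "f \<in> l2_kernels k" and l: "length j + length u = k"
  shows "f (j @ u) = (if distinct j \<and> distinct u then setk k f (set u \<union> set j) / fact k else 0)"
proof -
  have "setk k f (set u \<union> set j) = 0" if "distinct j" "distinct u" "set j \<inter> set u \<noteq> {}"
  proof -
    have "card (set u \<inter> set j) > 0" using that by (subst card_gt_0_iff) auto
    then have "card (set u \<union> set j) \<noteq> k"
      using card_Un_Int[OF finite_set finite_set, of u j] distinct_card[OF that(1)] distinct_card[OF that(2)] l by linarith
    then show ?thesis by (simp add: setk_def)
  qed
  then show ?thesis using l2_kernel_list[OF f, of "j @ u"] l by (auto simp: Un_commute)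
qed

lemma take_drop_bij:
  assumes "r \<le> k"
  shows "(\<Sum>i\<in>blist (2 * k - 2 * r) N. F (take (k - r) i) (drop (k - r) i)) = (\<Sum>u\<in>blist (k - r) N. \<Sum>v\<in>blist (k - r) N. F u v :: real)"
  unfolding sum.cartesian_product
  by (rule sum.reindex_bij_witness[of _ "\<lambda>(u, v). u @ v" "\<lambda>i. (take (k - r) i, drop (k - r) i)"])
     (use assms in \<open>auto simp: blist_def dest: in_set_takeD in_set_dropD\<close>)

text \<open>Four kernel values give the denominator \<open>fact k ^ 4\<close>. The orderings of
  \<open>R\<close> count once in each of the two inner sums that are multiplied, those of
  \<open>P\<close> and of \<open>Q\<close> once each.\<close>

lemma blist_contr:
  assumes f: "f \<in> l2_kernels k" and r: "r \<le> k"
  shows "(\<Sum>i\<in>blist (2 * k - 2 * r) N. (\<Sum>j\<in>blist r N. f (j @ take (k - r) i) * f (j @ drop (k - r) i))\<^sup>2)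
    = (fact (k - r) * fact r)\<^sup>2 / fact k ^ 4 * contr (zbox N) k k r (setk k f) (setk k f)"
proof -
  let ?a = "setk k f"
  define y where "y P Q = fact r * (\<Sum>R\<in>ksub (zbox N) r. ?a (P \<union> R) / fact k * (?a (Q \<union> R) / fact k))" for P Q
  have 1: "(\<Sum>j\<in>blist r N. f (j @ u) * f (j @ v))\<^sup>2 = (if distinct v then if distinct u then (y (set u) (set v))\<^sup>2 else 0 else 0)"
    if "u \<in> blist (k - r) N" "v \<in> blist (k - r) N" for u v
  proof (cases "distinct u \<and> distinct v")
    case True
    have "(\<Sum>j\<in>blist r N. f (j @ u) * f (j @ v)) = y (set u) (set v)"
      unfolding y_def
      by (rule sum_blist) (use True that r in \<open>auto simp: l2_kernel_append[OF f] blist_def\<close>)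
    then show ?thesis using True by simp
  next
    case False
    then have "(\<Sum>j\<in>blist r N. f (j @ u) * f (j @ v)) = 0"
      using that r by (intro sum.neutral) (auto simp: l2_kernel_append[OF f] blist_def)
    then show ?thesis using False by auto
  qed
  have "(\<Sum>i\<in>blist (2 * k - 2 * r) N. (\<Sum>j\<in>blist r N. f (j @ take (k - r) i) * f (j @ drop (k - r) i))\<^sup>2)
     = (\<Sum>u\<in>blist (k - r) N. \<Sum>v\<in>blist (k - r) N. (\<Sum>j\<in>blist r N. f (j @ u) * f (j @ v))\<^sup>2)"
    by (rule take_drop_bij[OF r, of "\<lambda>u v. (\<Sum>j\<in>blist r N. f (j @ u) * f (j @ v))\<^sup>2"])
  also have "\<dots> = (\<Sum>u\<in>blist (k - r) N. if distinct u then fact (k - r) * (\<Sum>Q\<in>ksub (zbox N) (k - r). (y (set u) Q)\<^sup>2) else 0)"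
  proof (rule sum.cong[OF refl])
    fix u assume u: "u \<in> blist (k - r) N"
    have "(\<Sum>v\<in>blist (k - r) N. (\<Sum>j\<in>blist r N. f (j @ u) * f (j @ v))\<^sup>2) = fact (k - r) * (\<Sum>Q\<in>ksub (zbox N) (k - r). if distinct u then (y (set u) Q)\<^sup>2 else 0)"
      by (rule sum_blist) (rule 1[OF u])
    then show "(\<Sum>v\<in>blist (k - r) N. (\<Sum>j\<in>blist r N. f (j @ u) * f (j @ v))\<^sup>2) = (if distinct u then fact (k - r) * (\<Sum>Q\<in>ksub (zbox N) (k - r). (y (set u) Q)\<^sup>2) else 0)"
      by simp
  qed
  also have "\<dots> = fact (k - r) * (\<Sum>P\<in>ksub (zbox N) (k - r). fact (k - r) * (\<Sum>Q\<in>ksub (zbox N) (k - r). (y P Q)\<^sup>2))"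
    by (rule sum_blist) simp
  also have "\<dots> = (fact (k - r))\<^sup>2 * (\<Sum>P\<in>ksub (zbox N) (k - r). \<Sum>Q\<in>ksub (zbox N) (k - r). (y P Q)\<^sup>2)"
    by (simp add: sum_distrib_left[symmetric] power2_eq_square)
  also have "(\<Sum>P\<in>ksub (zbox N) (k - r). \<Sum>Q\<in>ksub (zbox N) (k - r). (y P Q)\<^sup>2) = (fact r / (fact k)\<^sup>2)\<^sup>2 * contr (zbox N) k k r ?a ?a"
  proof -
    define c :: real where "c = fact r / (fact k)\<^sup>2"
    have "y P Q = c * (\<Sum>R\<in>ksub (zbox N) r. ?a (P \<union> R) * ?a (Q \<union> R))" for P Q
      unfolding y_def c_def by (simp add: sum_divide_distrib power2_eq_square sum_distrib_left)
    then have "(y P Q)\<^sup>2 = c\<^sup>2 * (\<Sum>R\<in>ksub (zbox N) r. ?a (P \<union> R) * ?a (Q \<union> R))\<^sup>2" for P Q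
      by (simp only: power_mult_distrib)
    then show ?thesis unfolding contr_def c_def[symmetric] by (simp only: sum_distrib_left)
  qed
  finally show ?thesis by (simp add: power_mult_distrib power_divide flip: power_mult)
qed

text \<open>Dominated convergence for the counting measure, with unconditional sums read as
  integrals.\<close>

lemma infsum_dominated:
  fixes h :: "nat \<Rightarrow> 'b \<Rightarrow> real"
  assumes g: "g summable_on A" and b: "\<And>N x. x \<in> A \<Longrightarrow> \<bar>h N x\<bar> \<le> g x" and lim: "\<And>x. x \<in> A \<Longrightarrow> (\<lambda>N. h N x) \<longlonglongrightarrow> H x"
  shows "(\<lambda>N. infsum (h N) A) \<longlonglongrightarrow> infsum H A" "H summable_on A"
proof -
  have g0: "g x \<ge> 0" if "x \<in> A" for x using b[OF that, of 0] by linarith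
  have bH: "\<bar>H x\<bar> \<le> g x" if "x \<in> A" for x
    using tendsto_rabs[OF lim[OF that]] b[OF that] by (intro LIMSEQ_le_const2) auto
  have gi: "integrable (count_space A) g"
  proof -
    have "(\<lambda>x. norm (g x)) summable_on A" using g g0 summable_on_cong[of A "\<lambda>x. norm (g x)" g] by simp
    then have "Infinite_Set_Sum.abs_summable_on g A" using abs_summable_equivalent by blast
    then show ?thesis by (simp add: Infinite_Set_Sum.abs_summable_on_def)
  qed
  have eq: "infsum k A = (\<integral>x. k x \<partial>count_space A)" if "\<And>x. x \<in> A \<Longrightarrow> \<bar>k x\<bar> \<le> g x" for k :: "'b \<Rightarrow> real"
  proof -
    have "integrable (count_space A) k"
      by (rule Bochner_Integration.integrable_bound[OF gi]) (use that in \<open>auto simp: AE_count_space intro: order_trans[OF _ abs_ge_self]\<close>)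
    then show ?thesis using infsetsum_infsum[of k A] by (simp add: Infinite_Set_Sum.abs_summable_on_def infsetsum_def)
  qed
  have "(\<lambda>N. \<integral>x. h N x \<partial>count_space A) \<longlonglongrightarrow> (\<integral>x. H x \<partial>count_space A)"
    by (rule integral_dominated_convergence[where w=g]) (use gi b lim in \<open>auto simp: AE_count_space\<close>)
  then show "(\<lambda>N. infsum (h N) A) \<longlonglongrightarrow> infsum H A"
    using eq[OF b] eq[OF bH] by simp
  have "(\<lambda>x. norm (H x)) summable_on A"
    by (rule Infinite_Sum.abs_summable_on_comparison_test'[OF g]) (use bH in auto)
  then show "H summable_on A" by (rule Infinite_Sum.abs_summable_summable)
qed

text \<open>Bounding finite sections by Cauchy--Schwarz in the contracted variables gives a summable
  majorant, so the squared norm of a contraction is the limit of its finite sections.\<close>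

lemma contraction_norm_tendsto:
  assumes f: "f \<in> l2_kernels k" and r: "r \<le> k"
  shows "(\<lambda>N. (fact (k - r) * fact r)\<^sup>2 / fact k ^ 4 * contr (zbox N) k k r (setk k f) (setk k f))
    \<longlonglongrightarrow> (discrete_norm (2 * k - 2 * r) (contraction k k r f f))\<^sup>2"
proof -
  let ?T = "index_tuples (2 * k - 2 * r)"
  let ?t = "take (k - r) :: int list \<Rightarrow> int list" and ?d = "drop (k - r) :: int list \<Rightarrow> int list"
  define C where "C = (\<Sum>\<^sub>\<infinity>l\<in>index_tuples k. (f l)\<^sup>2)"
  define s where "s u = (\<Sum>\<^sub>\<infinity>j\<in>index_tuples r. (f (j @ u))\<^sup>2)" for u
  define G where "G N i = (\<Sum>j\<in>blist r N. f (j @ ?t i) * f (j @ ?d i))" for N i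
  \<comment> \<open>Extending by 0 outside the cube truncates the free and the contracted variables
    at the same \<open>N\<close>, while all partial sums keep the common index set
    \<open>?T\<close>.\<close>
  define h where "h N i = (if i \<in> blist (2 * k - 2 * r) N then (G N i)\<^sup>2 else 0)" for N i
  have fS: "(\<lambda>l. (f l)\<^sup>2) summable_on index_tuples k" by (rule l2_kernel_sq_summable[OF f])
  have sS: "(\<lambda>j. (f (j @ u))\<^sup>2) summable_on index_tuples r" if "length u = k - r" for u
  proof -
    have "(\<lambda>l. (f l)\<^sup>2) summable_on ((\<lambda>j. j @ u) ` index_tuples r)"
      by (rule summable_on_subset_banach[OF fS]) (use that r in \<open>auto simp: index_tuples_def\<close>)
    then show ?thesis by (subst (asm) summable_on_reindex) (auto simp: inj_on_def o_def)
  qed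
  have s_lim: "(\<lambda>N. \<Sum>j\<in>blist r N. (f (j @ u))\<^sup>2) \<longlonglongrightarrow> s u" if "length u = k - r" for u
    unfolding s_def by (rule infsum_blist_tendsto[OF sS[OF that]])
  have s0: "s u \<ge> 0" for u unfolding s_def by (rule infsum_nonneg) auto
  have s_fin: "(\<Sum>j\<in>blist r N. (f (j @ u))\<^sup>2) \<le> s u" if "length u = k - r" for u N
    unfolding s_def by (rule finite_sum_le_infsum[OF sS[OF that] _ blist_subset]) auto
  have s_sum: "(\<Sum>u\<in>U. s u) \<le> C" if U: "finite U" "U \<subseteq> index_tuples (k - r)" for U
  proof (rule LIMSEQ_le_const2)
    show "(\<lambda>N. \<Sum>u\<in>U. \<Sum>j\<in>blist r N. (f (j @ u))\<^sup>2) \<longlonglongrightarrow> (\<Sum>u\<in>U. s u)"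
      using U by (intro tendsto_sum s_lim) (auto simp: index_tuples_def)
    have "(\<Sum>u\<in>U. \<Sum>j\<in>blist r N. (f (j @ u))\<^sup>2) \<le> C" for N
    proof -
      have "(\<Sum>u\<in>U. \<Sum>j\<in>blist r N. (f (j @ u))\<^sup>2) = (\<Sum>(u, j)\<in>U \<times> blist r N. (f (j @ u))\<^sup>2)"
        by (simp only: sum.cartesian_product)
      also have "\<dots> = (\<Sum>l\<in>(\<lambda>(u, j). j @ u) ` (U \<times> blist r N). (f l)\<^sup>2)"
        by (subst sum.reindex) (auto simp: inj_on_def blist_def case_prod_unfold)
      also have "\<dots> \<le> C" unfolding C_def
      proof (rule finite_sum_le_infsum[OF fS])
        show "finite ((\<lambda>(u, j). j @ u) ` (U \<times> blist r N))" using U by (intro finite_imageI finite_cartesian_product finite_blist)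
      qed (use U r in \<open>auto simp: index_tuples_def blist_def\<close>)
      finally show ?thesis .
    qed
    then show "\<exists>N. \<forall>n\<ge>N. (\<Sum>u\<in>U. \<Sum>j\<in>blist r n. (f (j @ u))\<^sup>2) \<le> C" by blast
  qed
  have len: "length (?t i) = k - r" "length (?d i) = k - r" if "i \<in> ?T" for i
    using that r by (auto simp: index_tuples_def)
  have dom: "(\<lambda>i. s (?t i) * s (?d i)) summable_on ?T"
  proof (rule nonneg_bdd_above_summable_on)
    show "bdd_above (sum (\<lambda>i. s (?t i) * s (?d i)) ` {F. F \<subseteq> ?T \<and> finite F})"
    proof (rule bdd_aboveI2)
      fix F assume "F \<in> {F. F \<subseteq> ?T \<and> finite F}"
      then have F: "finite F" "F \<subseteq> ?T" by auto
      let ?U = "?t ` F \<union> ?d ` F"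
      have U: "finite ?U" "?U \<subseteq> index_tuples (k - r)" using F len by (auto simp: index_tuples_def)
      have "(\<Sum>i\<in>F. s (?t i) * s (?d i)) = (\<Sum>(u, v)\<in>(\<lambda>i. (?t i, ?d i)) ` F. s u * s v)"
      proof (subst sum.reindex)
        show "inj_on (\<lambda>i. (?t i, ?d i)) F"
          by (rule inj_onI) (metis append_take_drop_id prod.inject)
      qed (simp add: o_def)
      also have "\<dots> \<le> (\<Sum>(u, v)\<in>?U \<times> ?U. s u * s v)"
        using F s0 by (intro sum_mono2) auto
      also have "\<dots> = (\<Sum>u\<in>?U. s u) * (\<Sum>v\<in>?U. s v)"
        by (simp only: sum_product sum.cartesian_product)
      also have "\<dots> \<le> C * C" 
        using s_sum[OF U] s0 by (intro mult_mono sum_nonneg) (auto intro: order_trans[OF sum_nonneg])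
      finally show "(\<Sum>i\<in>F. s (?t i) * s (?d i)) \<le> C * C" .
    qed
  qed (use s0 in auto)
  have bnd: "\<bar>h N i\<bar> \<le> s (?t i) * s (?d i)" if "i \<in> ?T" for N i
  proof -
    have "(G N i)\<^sup>2 \<le> (\<Sum>j\<in>blist r N. (f (j @ ?t i))\<^sup>2) * (\<Sum>j\<in>blist r N. (f (j @ ?d i))\<^sup>2)"
      unfolding G_def by (rule Cauchy_Schwarz_ineq_sum)
    also have "\<dots> \<le> s (?t i) * s (?d i)"
      using s_fin len[OF that] s0 by (intro mult_mono sum_nonneg) auto
    finally show ?thesis using s0 unfolding h_def by auto
  qed
  have lim: "(\<lambda>N. h N i) \<longlonglongrightarrow> (contraction k k r f f i)\<^sup>2" if i: "i \<in> ?T" for i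
  proof -
    have "(\<lambda>j. f (j @ ?t i) * f (j @ ?d i)) summable_on index_tuples r"
    proof -
      have "(\<lambda>j. (f (j @ ?t i))\<^sup>2 + (f (j @ ?d i))\<^sup>2) summable_on index_tuples r"
        by (intro summable_on_add sS len i)
      then have "(\<lambda>j. norm (f (j @ ?t i) * f (j @ ?d i))) summable_on index_tuples r"
        by (rule Infinite_Sum.abs_summable_on_comparison_test') (use abs_mult_le_squares in auto)
      then show ?thesis by (rule Infinite_Sum.abs_summable_summable)
    qed
    then have "(\<lambda>N. (G N i)\<^sup>2) \<longlonglongrightarrow> (contraction k k r f f i)\<^sup>2"
      unfolding G_def contraction_def by (intro tendsto_power infsum_blist_tendsto)
    moreover have "eventually (\<lambda>N. (G N i)\<^sup>2 = h N i) sequentially"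
    proof -
      obtain N0 where "{i} \<subseteq> blist (2 * k - 2 * r) N0" using finite_in_blist[of "{i}"] i by blast
      then have "i \<in> blist (2 * k - 2 * r) N" if "N \<ge> N0" for N using blist_mono[OF that] by blast
      then show ?thesis unfolding h_def eventually_sequentially by (intro exI[of _ N0]) auto
    qed
    ultimately show ?thesis by (rule Lim_transform_eventually)
  qed
  have "infsum (h N) ?T = (\<Sum>i\<in>blist (2 * k - 2 * r) N. (G N i)\<^sup>2)" for N
  proof -
    have "infsum (h N) ?T = infsum (\<lambda>i. (G N i)\<^sup>2) (blist (2 * k - 2 * r) N)"
      by (rule infsum_cong_neutral) (use blist_subset in \<open>auto simp: h_def\<close>)
    then show ?thesis by simp
  qed
  then have "infsum (h N) ?T = (fact (k - r) * fact r)\<^sup>2 / fact k ^ 4 * contr (zbox N) k k r (setk k f) (setk k f)" for N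
    unfolding G_def blist_contr[OF f r] .
  moreover have "(discrete_norm (2 * k - 2 * r) (contraction k k r f f))\<^sup>2 = infsum (\<lambda>i. (contraction k k r f f i)\<^sup>2) ?T"
    unfolding discrete_norm_def by (simp add: infsum_nonneg)
  ultimately show ?thesis using infsum_dominated(1)[OF dom bnd lim] by simp
qed

section \<open>Homogeneous sums\<close>

definition hsum :: "(int \<Rightarrow> 'a \<Rightarrow> real) \<Rightarrow> nat \<Rightarrow> (int list \<Rightarrow> real) \<Rightarrow> int list set \<Rightarrow> 'a \<Rightarrow> real" where
  "hsum X k f F \<omega> = (\<Sum>i\<in>F. f i * (\<Prod>p<k. X (i ! p) \<omega>))"

text \<open>\<open>F\<close> need not be closed under permutations, so the coefficient of a set
  collects those of its orderings that lie in \<open>F\<close>. There are at most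
  \<open>fact k\<close> of them, and Cauchy-Schwarz gives the constant.\<close>

lemma hsum_L2:
  fixes M :: "'a measure" and Y :: "int \<Rightarrow> 'a \<Rightarrow> real"
  assumes "std_seq M Y"
  assumes f: "f \<in> l2_kernels k" and F: "finite F" "F \<subseteq> index_tuples k"
  shows "(\<lambda>\<omega>. hsum Y k f F \<omega>) \<in> borel_measurable M" 
    and "integrable M (\<lambda>\<omega>. (hsum Y k f F \<omega>)\<^sup>2)"
    and "(\<integral>\<omega>. (hsum Y k f F \<omega>)\<^sup>2 \<partial>M) \<le> fact k * (\<Sum>l\<in>F. (f l)\<^sup>2)"
proof -
  interpret Y: std_seq M Y by fact
  obtain N where N: "F \<subseteq> blist k N" using finite_in_blist[OF F] by blast
  define b where "b A = (\<Sum>l\<in>{l \<in> F. distinct l \<and> set l = A}. f l)" for A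
  have eq: "hsum Y k f F \<omega> = mlp (zbox N) b (\<lambda>i. Y i \<omega>)" for \<omega>
  proof -
    have "hsum Y k f F \<omega> = (\<Sum>l\<in>{l \<in> F. distinct l}. f l * (\<Prod>i\<in>set l. Y i \<omega>))"
      unfolding hsum_def
    proof (rule sum.mono_neutral_cong_right)
      show "\<forall>i\<in>F - {l \<in> F. distinct l}. f i * (\<Prod>p<k. Y (i ! p) \<omega>) = 0"
      proof
        fix i assume "i \<in> F - {l \<in> F. distinct l}"
        then have "\<not> distinct i" "length i = k" using F by (auto simp: index_tuples_def)
        then have "f i = 0" using l2_kernel_list[OF f, of i] by simp
        then show "f i * (\<Prod>p<k. Y (i ! p) \<omega>) = 0" by simp
      qed
      fix l assume l: "l \<in> {l \<in> F. distinct l}"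
      then have "(\<Prod>p<k. Y (l ! p) \<omega>) = (\<Prod>i\<in>set l. Y i \<omega>)"
        using F bij_betw_nth[of l "{..<k}" "set l"] by (intro prod.reindex_bij_betw) (auto simp: index_tuples_def)
      then show "f l * (\<Prod>p<k. Y (l ! p) \<omega>) = f l * (\<Prod>i\<in>set l. Y i \<omega>)" by simp
    qed (use F in auto)
    also have "\<dots> = (\<Sum>A\<in>Pow (zbox N). \<Sum>l\<in>{l \<in> {l \<in> F. distinct l}. set l = A}. f l * (\<Prod>i\<in>set l. Y i \<omega>))"
      using F N by (intro sum.group[symmetric]) (auto simp: blist_def)
    also have "\<dots> = mlp (zbox N) b (\<lambda>i. Y i \<omega>)"
      unfolding mlp_def b_def sum_distrib_right by (intro sum.cong refl) auto
    finally show ?thesis .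
  qed
  show "(\<lambda>\<omega>. hsum Y k f F \<omega>) \<in> borel_measurable M" unfolding eq by (rule Y.mlp_meas)
  show "integrable M (\<lambda>\<omega>. (hsum Y k f F \<omega>)\<^sup>2)" unfolding eq by (rule Y.P_sq_int) simp
  have "(\<integral>\<omega>. (hsum Y k f F \<omega>)\<^sup>2 \<partial>M) = (\<Sum>A\<in>Pow (zbox N). (b A)\<^sup>2)"
    unfolding eq by (rule Y.P_sq) simp
  also have "\<dots> \<le> (\<Sum>A\<in>Pow (zbox N). fact k * (\<Sum>l\<in>{l \<in> F. distinct l \<and> set l = A}. (f l)\<^sup>2))"
  proof (rule sum_mono)
    fix A assume "A \<in> Pow (zbox N)"
    then have fA: "finite A" using finite_subset[OF _ finite_box] by auto
    have c: "card {l \<in> F. distinct l \<and> set l = A} \<le> fact k"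
    proof (cases "{l \<in> F. distinct l \<and> set l = A} = {}")
      case False
      then have "card A = k" using F distinct_card by (fastforce simp: index_tuples_def)
      have "card {l \<in> F. distinct l \<and> set l = A} \<le> card (permutations_of_set A)"
        by (rule card_mono[OF finite_permutations_of_set]) (auto simp: permutations_of_set_def)
      then show ?thesis using fA \<open>card A = k\<close> by simp
    next
      case True
      show ?thesis unfolding True by simp
    qed
    then have "real (card {l \<in> F. distinct l \<and> set l = A}) \<le> fact k" by (metis of_nat_fact of_nat_le_iff)
    then have "real (card {l \<in> F. distinct l \<and> set l = A}) * (\<Sum>l\<in>{l \<in> F. distinct l \<and> set l = A}. (f l)\<^sup>2) \<le> fact k * (\<Sum>l\<in>{l \<in> F. distinct l \<and> set l = A}. (f l)\<^sup>2)"
      by (intro mult_right_mono sum_nonneg) auto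
    then show "(b A)\<^sup>2 \<le> fact k * (\<Sum>l\<in>{l \<in> F. distinct l \<and> set l = A}. (f l)\<^sup>2)"
      unfolding b_def using sum_sq_le_card order_trans by blast
  qed
  also have "\<dots> = fact k * (\<Sum>A\<in>Pow (zbox N). \<Sum>l\<in>{l \<in> {l \<in> F. distinct l}. set l = A}. (f l)\<^sup>2)"
    unfolding sum_distrib_left by simp
  also have "(\<Sum>A\<in>Pow (zbox N). \<Sum>l\<in>{l \<in> {l \<in> F. distinct l}. set l = A}. (f l)\<^sup>2) = (\<Sum>l\<in>{l \<in> F. distinct l}. (f l)\<^sup>2)"
    using F N by (intro sum.group) (auto simp: blist_def)
  also have "fact k * \<dots> \<le> fact k * (\<Sum>l\<in>F. (f l)\<^sup>2)"
    using F by (intro mult_left_mono sum_mono2) auto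
  finally show "(\<integral>\<omega>. (hsum Y k f F \<omega>)\<^sup>2 \<partial>M) \<le> fact k * (\<Sum>l\<in>F. (f l)\<^sup>2)" by simp
qed

definition ksq :: "nat \<Rightarrow> (int list \<Rightarrow> real) \<Rightarrow> real" where
  "ksq k f = (\<Sum>\<^sub>\<infinity>l\<in>index_tuples k. (f l)\<^sup>2)"

lemma hsum_diff: "finite G \<Longrightarrow> F \<subseteq> G \<Longrightarrow> hsum X k f G \<omega> - hsum X k f F \<omega> = hsum X k f (G - F) \<omega>"
  unfolding hsum_def by (simp add: sum_diff)

context
  fixes M :: "'a measure" and X :: "int \<Rightarrow> 'a \<Rightarrow> real" and k :: nat and f :: "int list \<Rightarrow> real"
  assumes X: "std_seq M X" and f: "f \<in> l2_kernels k"
begin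

interpretation std_seq M X by (rule X)

lemma partial_le_ksq: "finite F \<Longrightarrow> F \<subseteq> index_tuples k \<Longrightarrow> (\<Sum>l\<in>F. (f l)\<^sup>2) \<le> ksq k f"
  unfolding ksq_def by (rule finite_sum_le_infsum[OF l2_kernel_sq_summable[OF f]]) auto

lemma hsum_diff_L2:
  assumes "finite G" "G \<subseteq> index_tuples k" "F \<subseteq> G"
  shows "(\<integral>\<^sup>+ \<omega>. ennreal ((hsum X k f G \<omega> - hsum X k f F \<omega>)\<^sup>2) \<partial>M) \<le> ennreal (fact k * (ksq k f - (\<Sum>l\<in>F. (f l)\<^sup>2)))"
proof -
  have D: "finite (G - F)" "G - F \<subseteq> index_tuples k" using assms by auto
  have "(\<integral>\<^sup>+ \<omega>. ennreal ((hsum X k f G \<omega> - hsum X k f F \<omega>)\<^sup>2) \<partial>M) = ennreal (\<integral>\<omega>. (hsum X k f (G - F) \<omega>)\<^sup>2 \<partial>M)"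
    unfolding hsum_diff[OF assms(1,3)] by (intro nn_integral_eq_integral hsum_L2(2)[OF X f D]) auto
  also have "\<dots> \<le> ennreal (fact k * (\<Sum>l\<in>G - F. (f l)\<^sup>2))"
    by (intro ennreal_leI hsum_L2(3)[OF X f D])
  also have "(\<Sum>l\<in>G - F. (f l)\<^sup>2) = (\<Sum>l\<in>G. (f l)\<^sup>2) - (\<Sum>l\<in>F. (f l)\<^sup>2)"
    using assms by (intro sum_diff) auto
  also have "ennreal (fact k * \<dots>) \<le> ennreal (fact k * (ksq k f - (\<Sum>l\<in>F. (f l)\<^sup>2)))"
    using partial_le_ksq[OF assms(1,2)] by (intro ennreal_leI mult_left_mono) auto
  finally show ?thesis .
qed

lemma hsum_meas[measurable]: "finite F \<Longrightarrow> F \<subseteq> index_tuples k \<Longrightarrow> hsum X k f F \<in> borel_measurable M"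
  using hsum_L2(1)[OF X f] by simp

lemma is_homogeneous_sum_hsum:
  "is_homogeneous_sum M X k f Y \<longleftrightarrow> Y \<in> borel_measurable M \<and>
     ((\<lambda>F. \<integral>\<^sup>+ \<omega>. ennreal ((Y \<omega> - hsum X k f F \<omega>)\<^sup>2) \<partial>M) \<longlongrightarrow> 0) (finite_subsets_at_top (index_tuples k))"
  unfolding is_homogeneous_sum_def hsum_def ..

text \<open>The Riesz-Fischer argument: along cubes with tails below \<open>(1 / 4) ^ m\<close> the
  increments have norm at most \<open>(1 / 2) ^ m\<close> in L1, so the sums converge almost
  everywhere. Fatou's lemma then bounds the squared distance of the limit from any finite partial
  sum by the remaining tail.\<close>

lemma homogeneous_sum_exists: "\<exists>Y. is_homogeneous_sum M X k f Y"
proof -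
  let ?\<tau> = "\<lambda>N. ksq k f - (\<Sum>l\<in>blist k N. (f l)\<^sup>2)"
  have "(\<lambda>N. ?\<tau> N) \<longlonglongrightarrow> ksq k f - ksq k f"
    unfolding ksq_def by (intro tendsto_diff tendsto_const infsum_blist_tendsto l2_kernel_sq_summable f)
  then have "\<forall>m. \<exists>N. ?\<tau> N < (1 / 4) ^ m / fact k"
    by (intro allI order_tendstoD(2)[THEN eventually_happens'[OF sequentially_bot]]) auto
  then obtain c where c: "\<And>m. ?\<tau> (c m) < (1 / 4) ^ m / fact k" by metis
  \<comment> \<open>The sum makes the sizes monotone, and the summand \<open>m\<close> makes them
    exhaust all tuples; \<open>c\<close> alone guarantees neither.\<close>
  define N where "N m = (\<Sum>i\<le>m. c i) + m" for m :: nat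
  have N_ge: "c m \<le> N m" for m unfolding N_def by (simp add: trans_le_add1 member_le_sum)
  have N_Suc: "N m \<le> N (Suc m)" for m unfolding N_def by simp
  have N_id: "m \<le> N m" for m unfolding N_def by simp
  have \<tau>N: "?\<tau> (N m) \<le> (1 / 4) ^ m / fact k" for m
  proof -
    have "(\<Sum>l\<in>blist k (c m). (f l)\<^sup>2) \<le> (\<Sum>l\<in>blist k (N m). (f l)\<^sup>2)"
      using blist_mono[OF N_ge] by (intro sum_mono2) auto
    then show ?thesis using c[of m] by linarith
  qed
  define g where "g m = hsum X k f (blist k (N m))" for m
  have gm[measurable]: "g m \<in> borel_measurable M" for m unfolding g_def by (intro hsum_meas blist_subset) simp
  define d where "d m \<omega> = g (Suc m) \<omega> - g m \<omega>" for m \<omega>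
  have dm[measurable]: "d m \<in> borel_measurable M" for m unfolding d_def by measurable
  have d1: "(\<integral>\<^sup>+ \<omega>. ennreal \<bar>d m \<omega>\<bar> \<partial>M) \<le> ennreal ((1 / 2) ^ m)" for m
  proof -
    let ?D = "blist k (N (Suc m)) - blist k (N m)"
    have D: "finite ?D" "?D \<subseteq> index_tuples k" using blist_subset by auto
    have de: "d m \<omega> = hsum X k f ?D \<omega>" for \<omega> unfolding d_def g_def by (intro hsum_diff blist_mono N_Suc) simp
    have i2: "integrable M (\<lambda>\<omega>. (d m \<omega>)\<^sup>2)" unfolding de by (rule hsum_L2(2)[OF X f D])
    have i1: "integrable M (\<lambda>\<omega>. \<bar>d m \<omega>\<bar>)" using integrable_pow_le[of "d m" 2 1] i2 by simp
    have "(\<integral>\<^sup>+ \<omega>. ennreal ((d m \<omega>)\<^sup>2) \<partial>M) \<le> ennreal (fact k * ?\<tau> (N m))"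
      unfolding d_def g_def by (intro hsum_diff_L2 blist_subset blist_mono N_Suc) simp
    also have "\<dots> \<le> ennreal (fact k * ((1 / 4) ^ m / fact k))"
      by (intro ennreal_leI mult_left_mono \<tau>N) auto
    finally have "ennreal (\<integral>\<omega>. (d m \<omega>)\<^sup>2 \<partial>M) \<le> ennreal ((1 / 4) ^ m)"
      using nn_integral_eq_integral[OF i2] by simp
    then have v: "(\<integral>\<omega>. (d m \<omega>)\<^sup>2 \<partial>M) \<le> (1 / 4) ^ m" by (subst (asm) ennreal_le_iff) auto
    have "(\<integral>\<omega>. \<bar>d m \<omega>\<bar> \<partial>M)\<^sup>2 \<le> (\<integral>\<omega>. \<bar>d m \<omega>\<bar>\<^sup>2 \<partial>M)"
      by (rule jensens_inequality[where I=UNIV and q="\<lambda>x. x\<^sup>2", of "\<lambda>\<omega>. \<bar>d m \<omega>\<bar>"]) (use i1 i2 in \<open>auto intro!: convex_power2\<close>)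
    also have "\<dots> \<le> ((1 / 2) ^ m)\<^sup>2" using v by (simp add: power2_eq_square flip: power_mult_distrib)
    finally have "(\<integral>\<omega>. \<bar>d m \<omega>\<bar> \<partial>M) \<le> (1 / 2) ^ m" by (rule power2_le_imp_le) auto
    then show ?thesis using nn_integral_eq_integral[OF i1] by (simp add: ennreal_leI)
  qed
  have "(\<integral>\<^sup>+ \<omega>. (\<Sum>m. ennreal \<bar>d m \<omega>\<bar>) \<partial>M) = (\<Sum>m. \<integral>\<^sup>+ \<omega>. ennreal \<bar>d m \<omega>\<bar> \<partial>M)"
    by (rule nn_integral_suminf) measurable
  also have "\<dots> \<le> (\<Sum>m. ennreal ((1 / 2) ^ m))" by (intro suminf_le d1) auto
  also have "\<dots> < \<infinity>" by (subst suminf_ennreal2) (auto simp: summable_geometric)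
  finally have "(\<integral>\<^sup>+ \<omega>. (\<Sum>m. ennreal \<bar>d m \<omega>\<bar>) \<partial>M) \<noteq> \<infinity>" by simp
  then have "AE \<omega> in M. (\<Sum>m. ennreal \<bar>d m \<omega>\<bar>) \<noteq> \<infinity>"
    by (intro nn_integral_PInf_AE) auto
  \<comment> \<open>\<open>lim\<close> is measurable everywhere; where the sums diverge it takes a
    default value, on a null set.\<close>
  define Y where "Y \<omega> = lim (\<lambda>m. g m \<omega>)" for \<omega>
  have Ym[measurable]: "Y \<in> borel_measurable M" unfolding Y_def by measurable
  have conv: "AE \<omega> in M. (\<lambda>m. g m \<omega>) \<longlonglongrightarrow> Y \<omega>"
    using \<open>AE \<omega> in M. (\<Sum>m. ennreal \<bar>d m \<omega>\<bar>) \<noteq> \<infinity>\<close>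
  proof eventually_elim
    fix \<omega> assume "(\<Sum>m. ennreal \<bar>d m \<omega>\<bar>) \<noteq> \<infinity>"
    then have "summable (\<lambda>m. \<bar>d m \<omega>\<bar>)" by (intro summable_suminf_not_top) auto
    then have "summable (\<lambda>m. d m \<omega>)" by (rule summable_rabs_cancel)
    then have "(\<lambda>n. \<Sum>m<n. d m \<omega>) \<longlonglongrightarrow> (\<Sum>m. d m \<omega>)" by (rule summable_LIMSEQ)
    moreover have "(\<Sum>m<n. d m \<omega>) = g n \<omega> - g 0 \<omega>" for n unfolding d_def by (rule sum_lessThan_telescope)
    ultimately have "(\<lambda>n. (g n \<omega> - g 0 \<omega>) + g 0 \<omega>) \<longlonglongrightarrow> (\<Sum>m. d m \<omega>) + g 0 \<omega>"
      by (intro tendsto_add tendsto_const) simp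
    then have "convergent (\<lambda>n. g n \<omega>)" by (auto simp: convergent_def)
    then show "(\<lambda>m. g m \<omega>) \<longlonglongrightarrow> Y \<omega>" unfolding Y_def by (simp add: convergent_LIMSEQ_iff)
  qed
  have bound: "(\<integral>\<^sup>+ \<omega>. ennreal ((Y \<omega> - hsum X k f F \<omega>)\<^sup>2) \<partial>M) \<le> ennreal (fact k * (ksq k f - (\<Sum>l\<in>F. (f l)\<^sup>2)))"
    if F: "finite F" "F \<subseteq> index_tuples k" for F
  proof -
    have [measurable]: "hsum X k f F \<in> borel_measurable M" using hsum_meas F .
    have "(\<integral>\<^sup>+ \<omega>. ennreal ((Y \<omega> - hsum X k f F \<omega>)\<^sup>2) \<partial>M) = (\<integral>\<^sup>+ \<omega>. liminf (\<lambda>m. ennreal ((g m \<omega> - hsum X k f F \<omega>)\<^sup>2)) \<partial>M)"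
    proof (rule nn_integral_cong_AE, use conv in eventually_elim)
      fix \<omega> assume "(\<lambda>m. g m \<omega>) \<longlonglongrightarrow> Y \<omega>"
      then have "(\<lambda>m. ennreal ((g m \<omega> - hsum X k f F \<omega>)\<^sup>2)) \<longlonglongrightarrow> ennreal ((Y \<omega> - hsum X k f F \<omega>)\<^sup>2)"
        by (intro tendsto_ennrealI tendsto_power tendsto_diff tendsto_const)
      then show "ennreal ((Y \<omega> - hsum X k f F \<omega>)\<^sup>2) = liminf (\<lambda>m. ennreal ((g m \<omega> - hsum X k f F \<omega>)\<^sup>2))"
        by (intro lim_imp_Liminf[symmetric]) auto
    qed
    also have "\<dots> \<le> liminf (\<lambda>m. \<integral>\<^sup>+ \<omega>. ennreal ((g m \<omega> - hsum X k f F \<omega>)\<^sup>2) \<partial>M)"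
      by (rule nn_integral_liminf) measurable
    also have "\<dots> \<le> liminf (\<lambda>m. ennreal (fact k * (ksq k f - (\<Sum>l\<in>F. (f l)\<^sup>2))))"
    proof (rule Liminf_mono)
      obtain n where n: "F \<subseteq> blist k n" using finite_in_blist[OF F] by blast
      have "(\<integral>\<^sup>+ \<omega>. ennreal ((g m \<omega> - hsum X k f F \<omega>)\<^sup>2) \<partial>M) \<le> ennreal (fact k * (ksq k f - (\<Sum>l\<in>F. (f l)\<^sup>2)))" if "m \<ge> n" for m
        unfolding g_def using n blist_mono[of n "N m" k] N_id[of m] that by (intro hsum_diff_L2 blist_subset) auto
      then show "eventually (\<lambda>m. (\<integral>\<^sup>+ \<omega>. ennreal ((g m \<omega> - hsum X k f F \<omega>)\<^sup>2) \<partial>M) \<le> ennreal (fact k * (ksq k f - (\<Sum>l\<in>F. (f l)\<^sup>2)))) sequentially"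
        unfolding eventually_sequentially by blast
    qed
    also have "\<dots> = ennreal (fact k * (ksq k f - (\<Sum>l\<in>F. (f l)\<^sup>2)))" by (simp add: Liminf_const)
    finally show ?thesis .
  qed
  have "((\<lambda>F. \<integral>\<^sup>+ \<omega>. ennreal ((Y \<omega> - hsum X k f F \<omega>)\<^sup>2) \<partial>M) \<longlongrightarrow> 0) (finite_subsets_at_top (index_tuples k))"
  proof (rule tendsto_sandwich[OF _ _ tendsto_const])
    have "((\<lambda>F. \<Sum>l\<in>F. (f l)\<^sup>2) \<longlongrightarrow> ksq k f) (finite_subsets_at_top (index_tuples k))"
      using has_sum_infsum[OF l2_kernel_sq_summable[OF f]] unfolding has_sum_def ksq_def .
    then have "((\<lambda>F. ennreal (fact k * (ksq k f - (\<Sum>l\<in>F. (f l)\<^sup>2)))) \<longlongrightarrow> ennreal (fact k * (ksq k f - ksq k f))) (finite_subsets_at_top (index_tuples k))"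
      by (intro tendsto_ennrealI tendsto_mult tendsto_diff tendsto_const)
    then show "((\<lambda>F. ennreal (fact k * (ksq k f - (\<Sum>l\<in>F. (f l)\<^sup>2)))) \<longlongrightarrow> 0) (finite_subsets_at_top (index_tuples k))" by simp
    show "eventually (\<lambda>F. (\<integral>\<^sup>+ \<omega>. ennreal ((Y \<omega> - hsum X k f F \<omega>)\<^sup>2) \<partial>M) \<le> ennreal (fact k * (ksq k f - (\<Sum>l\<in>F. (f l)\<^sup>2)))) (finite_subsets_at_top (index_tuples k))"
      using bound by (intro eventually_finite_subsets_at_top_weakI) auto
  qed auto
  then show ?thesis using Ym is_homogeneous_sum_hsum by blast
qed

text \<open>The chosen version is known only through its defining limit. Comparing it with a cube
  through a much larger finite set, by \<open>(x + y)^2 \<le> 2 x^2 + 2 y^2\<close>, yields an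
  explicit rate at the price of the factor 2.\<close>

lemma homogeneous_sum_approx:
  defines "Y \<equiv> homogeneous_sum M X k f"
  shows "Y \<in> borel_measurable M"
    and "integrable M (\<lambda>\<omega>. (Y \<omega> - mlp (zbox N) (setk k f) (\<lambda>i. X i \<omega>))\<^sup>2)"
    and "(\<integral>\<omega>. (Y \<omega> - mlp (zbox N) (setk k f) (\<lambda>i. X i \<omega>))\<^sup>2 \<partial>M) \<le> 2 * fact k * (ksq k f - (\<Sum>l\<in>blist k N. (f l)\<^sup>2))"
proof -
  have "is_homogeneous_sum M X k f Y" unfolding Y_def homogeneous_sum_def by (rule someI_ex[OF homogeneous_sum_exists])
  then have Ym[measurable]: "Y \<in> borel_measurable M"
    and lim: "((\<lambda>F. \<integral>\<^sup>+ \<omega>. ennreal ((Y \<omega> - hsum X k f F \<omega>)\<^sup>2) \<partial>M) \<longlongrightarrow> 0) (finite_subsets_at_top (index_tuples k))"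
    unfolding is_homogeneous_sum_hsum by auto
  show "Y \<in> borel_measurable M" by (rule Ym)
  let ?S = "hsum X k f (blist k N)"
  let ?\<tau> = "ksq k f - (\<Sum>l\<in>blist k N. (f l)\<^sup>2)"
  have [measurable]: "?S \<in> borel_measurable M" by (intro hsum_meas blist_subset) simp
  have S: "mlp (zbox N) (setk k f) (\<lambda>i. X i \<omega>) = ?S \<omega>" for \<omega>
    unfolding hsum_def by (rule blist_mlp[OF f, symmetric])
  have \<tau>0: "?\<tau> \<ge> 0" using partial_le_ksq[OF finite_blist blist_subset] by simp
  have nn: "(\<integral>\<^sup>+ \<omega>. ennreal ((Y \<omega> - ?S \<omega>)\<^sup>2) \<partial>M) \<le> ennreal (2 * fact k * ?\<tau>)"
  proof (rule ennreal_le_epsilon)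
    fix e :: real assume e: "e > 0"
    have "eventually (\<lambda>F. (\<integral>\<^sup>+ \<omega>. ennreal ((Y \<omega> - hsum X k f F \<omega>)\<^sup>2) \<partial>M) < ennreal (e / 2)) (finite_subsets_at_top (index_tuples k))"
      using e by (intro order_tendstoD(2)[OF lim]) auto
    then obtain F0 where F0: "finite F0" "F0 \<subseteq> index_tuples k"
      "\<And>F. finite F \<Longrightarrow> F0 \<subseteq> F \<Longrightarrow> F \<subseteq> index_tuples k \<Longrightarrow> (\<integral>\<^sup>+ \<omega>. ennreal ((Y \<omega> - hsum X k f F \<omega>)\<^sup>2) \<partial>M) < ennreal (e / 2)"
      unfolding eventually_finite_subsets_at_top by auto
    define F where "F = F0 \<union> blist k N"
    have F: "finite F" "F \<subseteq> index_tuples k" "blist k N \<subseteq> F" "F0 \<subseteq> F" unfolding F_def using F0 blist_subset by auto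
    have [measurable]: "hsum X k f F \<in> borel_measurable M" using hsum_meas F(1,2) .
    have "(\<integral>\<^sup>+ \<omega>. ennreal ((Y \<omega> - ?S \<omega>)\<^sup>2) \<partial>M) \<le> (\<integral>\<^sup>+ \<omega>. 2 * ennreal ((Y \<omega> - hsum X k f F \<omega>)\<^sup>2) + 2 * ennreal ((hsum X k f F \<omega> - ?S \<omega>)\<^sup>2) \<partial>M)"
    proof (rule nn_integral_mono)
      fix \<omega>
      let ?x = "Y \<omega> - hsum X k f F \<omega>" and ?y = "hsum X k f F \<omega> - ?S \<omega>"
      have "2 * ?x * ?y \<le> ?x\<^sup>2 + ?y\<^sup>2" by (rule sum_squares_bound)
      moreover have "(Y \<omega> - ?S \<omega>)\<^sup>2 = (?x + ?y)\<^sup>2" by simp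
      ultimately have "(Y \<omega> - ?S \<omega>)\<^sup>2 \<le> 2 * ?x\<^sup>2 + 2 * ?y\<^sup>2" unfolding power2_sum[of ?x ?y] by linarith
      then have "ennreal ((Y \<omega> - ?S \<omega>)\<^sup>2) \<le> ennreal (2 * ?x\<^sup>2 + 2 * ?y\<^sup>2)" by (rule ennreal_leI)
      also have "\<dots> = 2 * ennreal (?x\<^sup>2) + 2 * ennreal (?y\<^sup>2)" by (simp add: ennreal_plus ennreal_mult)
      finally show "ennreal ((Y \<omega> - ?S \<omega>)\<^sup>2) \<le> 2 * ennreal (?x\<^sup>2) + 2 * ennreal (?y\<^sup>2)" .
    qed
    also have "\<dots> = 2 * (\<integral>\<^sup>+ \<omega>. ennreal ((Y \<omega> - hsum X k f F \<omega>)\<^sup>2) \<partial>M) + 2 * (\<integral>\<^sup>+ \<omega>. ennreal ((hsum X k f F \<omega> - ?S \<omega>)\<^sup>2) \<partial>M)"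
      by (subst nn_integral_add) (auto simp: nn_integral_cmult)
    also have "\<dots> \<le> 2 * ennreal (e / 2) + 2 * ennreal (fact k * ?\<tau>)"
      using F0(3)[OF F(1,4,2)] by (intro add_mono mult_left_mono hsum_diff_L2 F) auto
    also have "\<dots> = ennreal (2 * fact k * ?\<tau>) + ennreal e"
    proof -
      have "2 * ennreal (e / 2) = ennreal e" using e by (subst ennreal_numeral[symmetric], subst ennreal_mult[symmetric]) auto
      moreover have "2 * ennreal (fact k * ?\<tau>) = ennreal (2 * fact k * ?\<tau>)"
        using \<tau>0 by (subst ennreal_numeral[symmetric], subst ennreal_mult[symmetric]) (auto simp: mult.assoc)
      ultimately show ?thesis by (simp only: add.commute)
    qed
    finally show "(\<integral>\<^sup>+ \<omega>. ennreal ((Y \<omega> - ?S \<omega>)\<^sup>2) \<partial>M) \<le> ennreal (2 * fact k * ?\<tau>) + ennreal e" .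
  qed
  show i: "integrable M (\<lambda>\<omega>. (Y \<omega> - mlp (zbox N) (setk k f) (\<lambda>i. X i \<omega>))\<^sup>2)"
    unfolding S by (rule integrableI_bounded) (use nn in \<open>auto simp: top_unique less_top[symmetric] intro: le_less_trans\<close>)
  then have "ennreal (\<integral>\<omega>. (Y \<omega> - ?S \<omega>)\<^sup>2 \<partial>M) \<le> ennreal (2 * fact k * ?\<tau>)"
    using nn unfolding S by (subst nn_integral_eq_integral[symmetric]) auto
  then show "(\<integral>\<omega>. (Y \<omega> - mlp (zbox N) (setk k f) (\<lambda>i. X i \<omega>))\<^sup>2 \<partial>M) \<le> 2 * fact k * ?\<tau>"
    unfolding S using \<tau>0 by (subst (asm) ennreal_le_iff) auto
qed

end

section \<open>Fourth moments\<close>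

text \<open>The moment conditions are those of the law on \<open>{0, \<plusminus> sqrt \<kappa>}\<close>. Its fourth moment \<open>\<kappa>\<close> can be
  made as large as desired, which turns the influences into a gain in the fourth moment of a chaos.\<close>

locale sym_seq = indep_seq M X for M :: "'a measure" and X :: "'i \<Rightarrow> 'a \<Rightarrow> real" +
  fixes \<kappa> :: real and m :: "nat \<Rightarrow> real"
  assumes kappa: "\<kappa> \<ge> 1" and int6: "integrable M (\<lambda>\<omega>. \<bar>X i \<omega>\<bar> ^ 6)"
    and mom: "p \<le> 6 \<Longrightarrow> (\<integral>\<omega>. X i \<omega> ^ p \<partial>M) = m p"
    and m_odd: "m 1 = 0" "m 3 = 0" "m 5 = 0" and m_even: "m 2 = 1" "m 4 = \<kappa>" "m 6 = \<kappa>\<^sup>2"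
begin

lemma int_pow: "p \<le> 6 \<Longrightarrow> integrable M (\<lambda>\<omega>. X i \<omega> ^ p)"
  using integrable_pow_le[OF int6, of p i] by (rule_tac integrable_abs_cancel) (auto simp: power_abs)

lemma m0: "m 0 = 1" using mom[of 0] by (simp add: prob_space)

sublocale std_seq M X
proof unfold_locales
  fix i
  show "integrable M (X i)" "integrable M (\<lambda>\<omega>. (X i \<omega>)\<^sup>2)" using int_pow[of 1 i] int_pow[of 2 i] by auto
  show "(\<integral>\<omega>. X i \<omega> \<partial>M) = 0" "(\<integral>\<omega>. (X i \<omega>)\<^sup>2 \<partial>M) = 1" using mom[of 1 i] mom[of 2 i] m_odd m_even by auto
qed

lemma factor_pow:
  assumes "H \<in> borel_measurable (others i)" "integrable M H" "p \<le> 6"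
  shows "integrable M (\<lambda>\<omega>. X i \<omega> ^ p * H \<omega>)" "(\<integral>\<omega>. X i \<omega> ^ p * H \<omega> \<partial>M) = m p * (\<integral>\<omega>. H \<omega> \<partial>M)"
  using factor[of H i "\<lambda>x. x ^ p", OF assms(1) _ int_pow[OF assms(3)] assms(2)] mom[OF assms(3), of i] by simp_all

lemma P_pow_int: "finite V \<Longrightarrow> p \<le> 6 \<Longrightarrow> integrable M (\<lambda>\<omega>. \<bar>P V b \<omega>\<bar> ^ p)"
  by (rule integrable_pow_le[OF integrable_mlp_pow[OF int6] _ mlp_meas])

lemma P_mixed_int:
  assumes "finite V" "p + q = 6"
  shows "integrable M (\<lambda>\<omega>. P V b \<omega> ^ p * P V c \<omega> ^ q)"
proof (rule Bochner_Integration.integrable_bound)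
  show "integrable M (\<lambda>\<omega>. \<bar>P V b \<omega>\<bar> ^ 6 + \<bar>P V c \<omega>\<bar> ^ 6)"
    by (intro Bochner_Integration.integrable_add P_pow_int assms) auto
  have "\<bar>x ^ p * y ^ q\<bar> \<le> \<bar>x\<bar> ^ 6 + \<bar>y\<bar> ^ 6" for x y :: real
  proof -
    have "\<bar>x ^ p * y ^ q\<bar> \<le> max \<bar>x\<bar> \<bar>y\<bar> ^ p * max \<bar>x\<bar> \<bar>y\<bar> ^ q"
      unfolding abs_mult power_abs by (intro mult_mono power_mono) auto
    also have "\<dots> = max \<bar>x\<bar> \<bar>y\<bar> ^ 6" by (simp flip: power_add add: assms(2))
    also have "\<dots> \<le> \<bar>x\<bar> ^ 6 + \<bar>y\<bar> ^ 6" by (simp add: max_def)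
    finally show ?thesis .
  qed
  then show "AE \<omega> in M. norm (P V b \<omega> ^ p * P V c \<omega> ^ q) \<le> norm (\<bar>P V b \<omega>\<bar> ^ 6 + \<bar>P V c \<omega>\<bar> ^ 6)"
    by (intro AE_I2) (simp add: order_trans[OF _ abs_ge_self])
qed measurable

text \<open>The odd moments vanish, so the binomial expansion of the sixth power keeps four terms,
  with moments 1, 1, \<open>\<kappa>\<close> and \<open>\<kappa>^2\<close>; Hoelder for squares
  bounds the two mixed ones. With weight \<open>5 * \<kappa>\<close> per variable the coefficients
  15, \<open>15 \<kappa>\<close> and \<open>\<kappa>^2\<close> are dominated by those of a perfect
  cube.\<close>

lemma hypercontractive6_weighted:
  "finite V \<Longrightarrow> (\<integral>\<omega>. P V b \<omega> ^ 6 \<partial>M) \<le> (\<Sum>A\<in>Pow V. (5 * \<kappa>) ^ card A * (b A)\<^sup>2) ^ 3"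
proof (induction V arbitrary: b rule: finite_induct)
  case empty
  then show ?case by (simp add: mlp_def prob_space flip: power_mult)
next
  case (insert i V)
  let ?b = "\<lambda>A. b (insert i A)"
  let ?S = "\<lambda>b. (\<Sum>A\<in>Pow V. (5 * \<kappa>) ^ card A * (b A)\<^sup>2)"
  let ?U = "P V b" and ?D = "P V ?b"
  define s where "s = ?S b"
  define n where "n = ?S ?b"
  have nn: "s \<ge> 0" "n \<ge> 0" unfolding s_def n_def using kappa by (auto intro!: sum_nonneg)
  have mO[measurable]: "P V d \<in> borel_measurable (others i)" for d using insert by (intro others_mlp)
  have IH: "(\<integral>\<omega>. ?U \<omega> ^ 6 \<partial>M) \<le> s ^ 3" "(\<integral>\<omega>. ?D \<omega> ^ 6 \<partial>M) \<le> n ^ 3"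
    unfolding s_def n_def by (rule insert.IH)+
  have cube: "((x::real)\<^sup>2) ^ 3 = x ^ 6" for x by (simp flip: power_mult)
  have i6: "integrable M (\<lambda>\<omega>. ((P V d \<omega>)\<^sup>2) ^ 3)" for d
    unfolding cube using P_mixed_int[OF insert(1), of 6 0 d d] by simp
  have z: "\<forall>\<omega>. (P V d \<omega>)\<^sup>2 = 0" if "?S d = 0" for d
    using mlp_eq_0[OF insert(1), of "\<lambda>A. (5 * \<kappa>) ^ card A" d] that kappa by simp
  have zs: "s = 0 \<Longrightarrow> \<forall>\<omega>. (?U \<omega>)\<^sup>2 = 0" and zn: "n = 0 \<Longrightarrow> \<forall>\<omega>. (?D \<omega>)\<^sup>2 = 0"
    unfolding s_def n_def by (rule z, assumption)+
  have sm: "(\<lambda>\<omega>. (P V d \<omega>)\<^sup>2) \<in> borel_measurable M" for d by (intro borel_measurable_power mlp_meas)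
  have sq0: "0 \<le> (P V d \<omega>)\<^sup>2" for d \<omega> by simp
  note h1 = holder_cube(2)[where F="\<lambda>\<omega>. (?U \<omega>)\<^sup>2" and G="\<lambda>\<omega>. (?D \<omega>)\<^sup>2" and a=s and n=n,
      OF sq0 i6 IH(1)[folded cube] sm sq0 i6 IH(2)[folded cube] sm nn zs zn]
  note h2 = holder_cube(2)[where F="\<lambda>\<omega>. (?D \<omega>)\<^sup>2" and G="\<lambda>\<omega>. (?U \<omega>)\<^sup>2" and a=n and n=s,
      OF sq0 i6 IH(2)[folded cube] sm sq0 i6 IH(1)[folded cube] sm nn(2,1) zn zs]
  have e42: "(\<integral>\<omega>. ?D \<omega> ^ 2 * ?U \<omega> ^ 4 \<partial>M) \<le> s\<^sup>2 * n"
    using h1 by (simp add: mult.commute flip: power_mult)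
  have e24: "(\<integral>\<omega>. ?D \<omega> ^ 4 * ?U \<omega> ^ 2 \<partial>M) \<le> n\<^sup>2 * s"
    using h2 by (simp flip: power_mult)
  let ?H = "\<lambda>p \<omega>. ?D \<omega> ^ p * ?U \<omega> ^ (6 - p)"
  have iH: "integrable M (?H p)" "?H p \<in> borel_measurable (others i)" if "p \<le> 6" for p
    using that by (auto intro!: P_mixed_int insert(1))
  have expand: "P (insert i V) b \<omega> ^ 6 = (\<Sum>p\<le>6. real (6 choose p) * (X i \<omega> ^ p * ?H p \<omega>))" for \<omega>
  proof -
    have "P (insert i V) b \<omega> ^ 6 = (X i \<omega> * ?D \<omega> + ?U \<omega>) ^ 6"
      by (simp add: mlp_insert[OF insert(1,2)] add.commute)
    then show ?thesis unfolding binomial_ring power_mult_distrib by (simp only: mult.assoc)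
  qed
  have "(\<integral>\<omega>. P (insert i V) b \<omega> ^ 6 \<partial>M) = (\<Sum>p\<le>6. \<integral>\<omega>. real (6 choose p) * (X i \<omega> ^ p * ?H p \<omega>) \<partial>M)"
    unfolding expand by (rule Bochner_Integration.integral_sum) (intro integrable_mult_right factor_pow(1) iH; simp)
  also have "\<dots> = (\<Sum>p\<le>6. real (6 choose p) * (m p * (\<integral>\<omega>. ?H p \<omega> \<partial>M)))"
    unfolding integral_mult_right_zero by (intro sum.cong refl arg_cong2[of _ _ _ _ "(*)"] factor_pow(2) iH) auto
  also have "\<dots> = (\<integral>\<omega>. ?U \<omega> ^ 6 \<partial>M) + 15 * (\<integral>\<omega>. ?D \<omega> ^ 2 * ?U \<omega> ^ 4 \<partial>M) + 15 * \<kappa> * (\<integral>\<omega>. ?D \<omega> ^ 4 * ?U \<omega> ^ 2 \<partial>M) + \<kappa>\<^sup>2 * (\<integral>\<omega>. ?D \<omega> ^ 6 \<partial>M)"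
  proof -
    have six: "(\<Sum>p\<le>6. g p) = g 0 + g 1 + g 2 + g 3 + g 4 + g 5 + g 6" for g :: "nat \<Rightarrow> real"
      by (simp add: eval_nat_numeral)
    have ch: "(6::nat) choose 2 = 15" "(6::nat) choose 4 = 15" "(6::nat) choose 6 = 1"
      by (simp_all add: eval_nat_numeral)
    show ?thesis unfolding six ch m_odd m_even m0 by simp
  qed
  also have "\<dots> \<le> s ^ 3 + 15 * (s\<^sup>2 * n) + 15 * \<kappa> * (n\<^sup>2 * s) + \<kappa>\<^sup>2 * n ^ 3"
    using kappa IH e42 e24 by (intro add_mono mult_left_mono) auto
  also have "\<dots> \<le> s ^ 3 + (15 * \<kappa>) * (s\<^sup>2 * n) + (75 * \<kappa>\<^sup>2) * (n\<^sup>2 * s) + (125 * \<kappa> ^ 3) * n ^ 3"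
  proof -
    have "\<kappa> \<le> \<kappa>\<^sup>2" "\<kappa>\<^sup>2 \<le> \<kappa> ^ 3" using kappa by (auto simp: power2_eq_square power3_eq_cube)
    moreover have "\<kappa>\<^sup>2 \<ge> 0" by simp
    ultimately have c: "15 * \<kappa> \<le> 75 * \<kappa>\<^sup>2" "\<kappa>\<^sup>2 \<le> 125 * \<kappa> ^ 3" using kappa by linarith+
    show ?thesis
      using mult_right_mono[OF kappa, of "15 * (s\<^sup>2 * n)"] mult_right_mono[OF c(1), of "n\<^sup>2 * s"] mult_right_mono[OF c(2), of "n ^ 3"] nn
      by (simp add: mult_ac)
  qed
  also have "\<dots> = (s + 5 * \<kappa> * n) ^ 3"
    by (simp add: power2_eq_square power3_eq_cube algebra_simps)
  also have "s + 5 * \<kappa> * n = (\<Sum>A\<in>Pow (insert i V). (5 * \<kappa>) ^ card A * (b A)\<^sup>2)"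
  proof -
    have "card (insert i A) = Suc (card A)" if "A \<in> Pow V" for A
      using that insert finite_subset[of A V] by (subst card_insert_disjoint) auto
    then show ?thesis unfolding s_def n_def using insert(1,2)
      by (simp add: sum_Pow_insert sum_distrib_left mult_ac)
  qed
  finally show ?case .
qed

lemma hypercontractive6:
  assumes "finite V" "\<And>A. b A \<noteq> 0 \<Longrightarrow> card A = d"
  shows "(\<integral>\<omega>. P V b \<omega> ^ 6 \<partial>M) \<le> ((5 * \<kappa>) ^ d * (\<Sum>A\<in>Pow V. (b A)\<^sup>2)) ^ 3"
proof -
  have "(\<Sum>A\<in>Pow V. (5 * \<kappa>) ^ card A * (b A)\<^sup>2) = (5 * \<kappa>) ^ d * (\<Sum>A\<in>Pow V. (b A)\<^sup>2)"
    unfolding sum_distrib_left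
  proof (rule sum.cong[OF refl])
    fix A show "(5 * \<kappa>) ^ card A * (b A)\<^sup>2 = (5 * \<kappa>) ^ d * (b A)\<^sup>2" using assms(2)[of A] by (cases "b A = 0") auto
  qed
  then show ?thesis using hypercontractive6_weighted[OF assms(1), of b] by simp
qed

lemma monomial:
  assumes "finite V" "\<And>i. i \<in> V \<Longrightarrow> n i \<le> 6"
  shows "integrable M (\<lambda>\<omega>. \<Prod>i\<in>V. X i \<omega> ^ n i) \<and> (\<integral>\<omega>. (\<Prod>i\<in>V. X i \<omega> ^ n i) \<partial>M) = (\<Prod>i\<in>V. m (n i))"
  using assms
proof (induction V rule: finite_induct)
  case empty
  then show ?case by (simp add: prob_space)
next
  case (insert i V)
  have H: "(\<lambda>\<omega>. \<Prod>l\<in>V. X l \<omega> ^ n l) \<in> borel_measurable (others i)"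
    using insert(2) by (intro borel_measurable_prod borel_measurable_power others_X) auto
  have iH: "integrable M (\<lambda>\<omega>. \<Prod>l\<in>V. X l \<omega> ^ n l)" "(\<integral>\<omega>. (\<Prod>l\<in>V. X l \<omega> ^ n l) \<partial>M) = (\<Prod>l\<in>V. m (n l))"
    using insert by auto
  have "n i \<le> 6" using insert by auto
  note f = factor_pow[OF H iH(1) this]
  show ?case unfolding prod.insert[OF insert(1,2)] using f iH(2) by simp
qed

lemma prod_of_bool:
  assumes "finite V" "A \<subseteq> V"
  shows "(\<Prod>i\<in>A. x i) = (\<Prod>i\<in>V. x i ^ of_bool (i \<in> A) :: real)"
proof -
  have "(\<Prod>i\<in>V. x i ^ of_bool (i \<in> A)) = (\<Prod>i\<in>V. if i \<in> A then x i else 1)" by (intro prod.cong refl) auto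
  also have "\<dots> = (\<Prod>i\<in>A. x i)" using assms by (simp add: prod.If_cases Int_absorb1)
  finally show ?thesis by simp
qed

lemma prod_moments:
  assumes "finite V" "\<And>i. i \<in> V \<Longrightarrow> m (n i) = (if even (n i) then 1 else 0)"
  shows "(\<Prod>i\<in>V. m (n i)) = (if \<forall>i\<in>V. even (n i) then 1 else 0)"
  using assms by (auto intro!: prod.neutral prod_zero)

lemma m_small: "p \<le> 3 \<Longrightarrow> m p = (if even p then 1 else 0)"
proof -
  assume "p \<le> 3"
  then consider "p = 0" | "p = 1" | "p = 2" | "p = 3" by linarith
  then show ?thesis using m0 m_odd m_even by cases auto
qed

text \<open>No exponent exceeds 3, and up to order 3 the moments are those of a sign: the integral
  depends only on the parities of the exponents.\<close>

lemma moment3: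
  assumes V: "finite V" "A \<subseteq> V" "B \<subseteq> V" "E \<subseteq> V"
  shows "integrable M (\<lambda>\<omega>. (\<Prod>i\<in>A. X i \<omega>) * (\<Prod>i\<in>B. X i \<omega>) * (\<Prod>i\<in>E. X i \<omega>))"
    and "(\<integral>\<omega>. (\<Prod>i\<in>A. X i \<omega>) * (\<Prod>i\<in>B. X i \<omega>) * (\<Prod>i\<in>E. X i \<omega>) \<partial>M) = (if (A - B) \<union> (B - A) = E then 1 else 0)"
proof -
  define n where "n i = of_bool (i \<in> A) + of_bool (i \<in> B) + (of_bool (i \<in> E) :: nat)" for i
  have eq: "(\<Prod>i\<in>A. X i \<omega>) * (\<Prod>i\<in>B. X i \<omega>) * (\<Prod>i\<in>E. X i \<omega>) = (\<Prod>i\<in>V. X i \<omega> ^ n i)" for \<omega>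
    unfolding prod_of_bool[OF V(1,2)] prod_of_bool[OF V(1,3)] prod_of_bool[OF V(1,4)] n_def
    by (simp only: prod.distrib power_add)
  have n3: "n i \<le> 3" for i unfolding n_def by auto
  then have n6: "n i \<le> 6" for i using order_trans[of "n i" 3 6] by simp
  show "integrable M (\<lambda>\<omega>. (\<Prod>i\<in>A. X i \<omega>) * (\<Prod>i\<in>B. X i \<omega>) * (\<Prod>i\<in>E. X i \<omega>))"
    unfolding eq using monomial[OF V(1), of n] n6 by blast
  have "(\<forall>i\<in>V. even (n i)) \<longleftrightarrow> (A - B) \<union> (B - A) = E"
  proof -
    have "even (n i) \<longleftrightarrow> (i \<in> (A - B) \<union> (B - A) \<longleftrightarrow> i \<in> E)" for i unfolding n_def by auto
    then show ?thesis using V by auto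
  qed
  then show "(\<integral>\<omega>. (\<Prod>i\<in>A. X i \<omega>) * (\<Prod>i\<in>B. X i \<omega>) * (\<Prod>i\<in>E. X i \<omega>) \<partial>M) = (if (A - B) \<union> (B - A) = E then 1 else 0)"
    unfolding eq using monomial[OF V(1), of n] n6 prod_moments[OF V(1), of n] m_small[OF n3] by simp
qed

text \<open>An exponent 4 can occur only at \<open>i\<close>, when \<open>i\<close> belongs to both
  \<open>A\<close> and \<open>B\<close>; this is where \<open>\<kappa>\<close> enters.\<close>

lemma moment_sq:
  assumes V: "finite V" "A \<subseteq> V" "B \<subseteq> V" "i \<in> V"
  shows "integrable M (\<lambda>\<omega>. (\<Prod>i\<in>A. X i \<omega>) * (\<Prod>i\<in>B. X i \<omega>) * (X i \<omega>)\<^sup>2)"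
    and "(\<integral>\<omega>. (\<Prod>i\<in>A. X i \<omega>) * (\<Prod>i\<in>B. X i \<omega>) * (X i \<omega>)\<^sup>2 \<partial>M) = (if A = B then if i \<in> A then \<kappa> else 1 else 0)"
proof -
  define n where "n l = of_bool (l \<in> A) + of_bool (l \<in> B) + (if l = i then 2 else 0 :: nat)" for l
  have "(X i \<omega>)\<^sup>2 = (\<Prod>l\<in>V. X l \<omega> ^ (if l = i then 2 else 0))" for \<omega>
  proof -
    have "(\<Prod>l\<in>V. X l \<omega> ^ (if l = i then 2 else 0)) = (\<Prod>l\<in>V. if l = i then (X i \<omega>)\<^sup>2 else 1)" by (intro prod.cong refl) auto
    then show ?thesis using V by simp
  qed
  then have eq: "(\<Prod>i\<in>A. X i \<omega>) * (\<Prod>i\<in>B. X i \<omega>) * (X i \<omega>)\<^sup>2 = (\<Prod>i\<in>V. X i \<omega> ^ n i)" for \<omega>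
    unfolding prod_of_bool[OF V(1,2)] prod_of_bool[OF V(1,3)] n_def
    by (simp only: prod.distrib power_add)
  have n6: "n l \<le> 6" for l unfolding n_def by auto
  show "integrable M (\<lambda>\<omega>. (\<Prod>i\<in>A. X i \<omega>) * (\<Prod>i\<in>B. X i \<omega>) * (X i \<omega>)\<^sup>2)"
    unfolding eq using monomial[OF V(1), of n] n6 by blast
  have "(\<Prod>l\<in>V. m (n l)) = (if A = B then if i \<in> A then \<kappa> else 1 else 0)"
  proof (cases "A = B")
    case True
    have "m (n l) = (if l = i then if i \<in> A then \<kappa> else 1 else 1)" for l
    proof -
      have "m (Suc (Suc 0)) = 1" "m (Suc (Suc (Suc (Suc 0)))) = \<kappa>" using m_even by (simp_all add: eval_nat_numeral)
      then show ?thesis using m0 m_even True unfolding n_def by auto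
    qed
    then have "(\<Prod>l\<in>V. m (n l)) = (\<Prod>l\<in>V. if l = i then if i \<in> A then \<kappa> else 1 else 1)" by simp
    then show ?thesis using V True by simp
  next
    case False
    then obtain l where l: "l \<in> V" "l \<in> A \<longleftrightarrow> l \<notin> B" using V by auto
    then have "m (n l) = 0" unfolding n_def using m_odd by (cases "l \<in> A"; cases "l = i") (auto simp: numeral_3_eq_3)
    then have "(\<Prod>l\<in>V. m (n l)) = 0" using V(1) l(1) by (metis prod_zero)
    then show ?thesis using False by simp
  qed
  then show "(\<integral>\<omega>. (\<Prod>i\<in>A. X i \<omega>) * (\<Prod>i\<in>B. X i \<omega>) * (X i \<omega>)\<^sup>2 \<partial>M) = (if A = B then if i \<in> A then \<kappa> else 1 else 0)"
    unfolding eq using monomial[OF V(1), of n] n6 by simp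
qed

text \<open>The inner product of the squared polynomial with the monomial of \<open>E\<close>, as
  \<open>P_sq_times_monomial\<close> shows.\<close>

definition pcoef :: "'b set \<Rightarrow> ('b set \<Rightarrow> real) \<Rightarrow> 'b set \<Rightarrow> real" where
  "pcoef V a E = (\<Sum>A\<in>Pow V. \<Sum>B\<in>Pow V. if (A - B) \<union> (B - A) = E then a A * a B else 0)"

lemma P_sq_expand: "(P V a \<omega>)\<^sup>2 = (\<Sum>A\<in>Pow V. \<Sum>B\<in>Pow V. a A * a B * ((\<Prod>i\<in>A. X i \<omega>) * (\<Prod>i\<in>B. X i \<omega>)))"
  unfolding power2_eq_square mlp_def sum_product by (simp only: mult_ac)

lemma P_sq_times:
  assumes V: "finite V" and i: "\<And>A B. A \<subseteq> V \<Longrightarrow> B \<subseteq> V \<Longrightarrow> integrable M (\<lambda>\<omega>. (\<Prod>i\<in>A. X i \<omega>) * (\<Prod>i\<in>B. X i \<omega>) * Y \<omega>)"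
  shows "integrable M (\<lambda>\<omega>. (P V a \<omega>)\<^sup>2 * Y \<omega>)"
    and "(\<integral>\<omega>. (P V a \<omega>)\<^sup>2 * Y \<omega> \<partial>M) = (\<Sum>A\<in>Pow V. \<Sum>B\<in>Pow V. a A * a B * (\<integral>\<omega>. (\<Prod>i\<in>A. X i \<omega>) * (\<Prod>i\<in>B. X i \<omega>) * Y \<omega> \<partial>M))"
proof -
  have eq: "(P V a \<omega>)\<^sup>2 * Y \<omega> = (\<Sum>A\<in>Pow V. \<Sum>B\<in>Pow V. a A * a B * ((\<Prod>i\<in>A. X i \<omega>) * (\<Prod>i\<in>B. X i \<omega>) * Y \<omega>))" for \<omega>
    unfolding P_sq_expand sum_distrib_right by (simp only: mult.assoc)
  have i': "integrable M (\<lambda>\<omega>. a A * a B * ((\<Prod>i\<in>A. X i \<omega>) * (\<Prod>i\<in>B. X i \<omega>) * Y \<omega>))" if "A \<in> Pow V" "B \<in> Pow V" for A B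
    using that by (intro integrable_mult_right i) auto
  show "integrable M (\<lambda>\<omega>. (P V a \<omega>)\<^sup>2 * Y \<omega>)" unfolding eq by (intro Bochner_Integration.integrable_sum i')
  have "(\<integral>\<omega>. (P V a \<omega>)\<^sup>2 * Y \<omega> \<partial>M) = (\<Sum>A\<in>Pow V. \<integral>\<omega>. (\<Sum>B\<in>Pow V. a A * a B * ((\<Prod>i\<in>A. X i \<omega>) * (\<Prod>i\<in>B. X i \<omega>) * Y \<omega>)) \<partial>M)"
    unfolding eq by (rule Bochner_Integration.integral_sum) (intro Bochner_Integration.integrable_sum i')
  also have "\<dots> = (\<Sum>A\<in>Pow V. \<Sum>B\<in>Pow V. \<integral>\<omega>. a A * a B * ((\<Prod>i\<in>A. X i \<omega>) * (\<Prod>i\<in>B. X i \<omega>) * Y \<omega>) \<partial>M)"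
    by (rule sum.cong[OF refl], rule Bochner_Integration.integral_sum) (intro i')
  finally show "(\<integral>\<omega>. (P V a \<omega>)\<^sup>2 * Y \<omega> \<partial>M) = (\<Sum>A\<in>Pow V. \<Sum>B\<in>Pow V. a A * a B * (\<integral>\<omega>. (\<Prod>i\<in>A. X i \<omega>) * (\<Prod>i\<in>B. X i \<omega>) * Y \<omega> \<partial>M))"
    unfolding integral_mult_right_zero .
qed

lemma P_sq_times_monomial:
  assumes V: "finite V" and E: "E \<subseteq> V"
  shows "integrable M (\<lambda>\<omega>. (P V a \<omega>)\<^sup>2 * (\<Prod>i\<in>E. X i \<omega>))" "(\<integral>\<omega>. (P V a \<omega>)\<^sup>2 * (\<Prod>i\<in>E. X i \<omega>) \<partial>M) = pcoef V a E"
proof -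
  note i = moment3(1)[OF V _ _ E] and e = moment3(2)[OF V _ _ E]
  show "integrable M (\<lambda>\<omega>. (P V a \<omega>)\<^sup>2 * (\<Prod>i\<in>E. X i \<omega>))" by (rule P_sq_times(1)[OF V i])
  show "(\<integral>\<omega>. (P V a \<omega>)\<^sup>2 * (\<Prod>i\<in>E. X i \<omega>) \<partial>M) = pcoef V a E"
    unfolding pcoef_def
    by (subst P_sq_times(2)[OF V], rule i, assumption, assumption) (intro sum.cong refl, auto simp: e)
qed

text \<open>The enlarged fourth moment is felt exactly by the pairs \<open>A = B\<close> containing
  \<open>i\<close>, whose weights add up to the influence.\<close>

lemma P_sq_times_sq:
  assumes V: "finite V" and i: "i \<in> V"
  shows "integrable M (\<lambda>\<omega>. (P V a \<omega>)\<^sup>2 * (X i \<omega>)\<^sup>2)"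
    and "(\<integral>\<omega>. (P V a \<omega>)\<^sup>2 * (X i \<omega>)\<^sup>2 \<partial>M) = (\<Sum>A\<in>Pow V. (a A)\<^sup>2) + (\<kappa> - 1) * infl V a i"
proof -
  note j = moment_sq(1)[OF V _ _ i] and e = moment_sq(2)[OF V _ _ i]
  show "integrable M (\<lambda>\<omega>. (P V a \<omega>)\<^sup>2 * (X i \<omega>)\<^sup>2)" by (rule P_sq_times(1)[OF V j])
  have "(\<integral>\<omega>. (P V a \<omega>)\<^sup>2 * (X i \<omega>)\<^sup>2 \<partial>M) = (\<Sum>A\<in>Pow V. \<Sum>B\<in>Pow V. if A = B then (a A)\<^sup>2 * (if i \<in> A then \<kappa> else 1) else 0)"
    by (subst P_sq_times(2)[OF V], rule j, assumption, assumption) (intro sum.cong refl, simp only: Pow_iff e, simp add: power2_eq_square)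
  also have "\<dots> = (\<Sum>A\<in>Pow V. (a A)\<^sup>2 * (if i \<in> A then \<kappa> else 1))"
    using V by simp
  also have "\<dots> = (\<Sum>A\<in>Pow V. (a A)\<^sup>2 + (\<kappa> - 1) * (if i \<in> A then (a A)\<^sup>2 else 0))"
    by (intro sum.cong refl) (auto simp: algebra_simps)
  also have "\<dots> = (\<Sum>A\<in>Pow V. (a A)\<^sup>2) + (\<kappa> - 1) * infl V a i"
    unfolding infl_def sum_Pow_containing[OF V i, of "\<lambda>A. (a A)\<^sup>2"] by (simp only: sum.distrib sum_distrib_left)
  finally show "(\<integral>\<omega>. (P V a \<omega>)\<^sup>2 * (X i \<omega>)\<^sup>2 \<partial>M) = (\<Sum>A\<in>Pow V. (a A)\<^sup>2) + (\<kappa> - 1) * infl V a i" .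
qed

end

context sym_seq begin

text \<open>Bessel's inequality for \<open>Q\<^sup>2\<close> and the orthogonal family of the constant, the monomials of
  degree \<open>2k\<close>, and the functions \<open>X\<^sub>i\<^sup>2 - 1\<close>.\<close>

lemma fourth_moment_bessel:
  assumes V: "finite V" and a: "\<And>A. a A \<noteq> 0 \<Longrightarrow> card A = k" and k: "k \<ge> 1"
  shows "(\<Sum>A\<in>Pow V. (a A)\<^sup>2)\<^sup>2 + (\<Sum>E\<in>ksub V (2 * k). (pcoef V a E)\<^sup>2) + (\<kappa> - 1) * (\<Sum>i\<in>V. (infl V a i)\<^sup>2)
    \<le> (\<integral>\<omega>. P V a \<omega> ^ 4 \<partial>M)"
proof -
  let ?E = "insert {} (ksub V (2 * k))"
  define c where "c E = (if E \<in> ?E then pcoef V a E else 0)" for E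
  define I where "I i = infl V a i" for i
  \<comment> \<open>The projection of the squared polynomial. Monomials have norm 1, hence the
    coefficients \<open>c E\<close>; the function \<open>X_i^2 - 1\<close> has squared norm
    \<open>\<kappa> - 1\<close> and inner product \<open>(\<kappa> - 1) * I i\<close> with the
    square, hence the coefficient \<open>I i\<close>.\<close>
  define L where "L \<omega> = P V c \<omega> + (\<Sum>i\<in>V. I i * ((X i \<omega>)\<^sup>2 - 1))" for \<omega>
  define B where "B = (\<Sum>E\<in>Pow V. (c E)\<^sup>2) + (\<kappa> - 1) * (\<Sum>i\<in>V. (I i)\<^sup>2)"
  let ?Q2 = "\<lambda>\<omega>. (P V a \<omega>)\<^sup>2"
  let ?Y = "\<lambda>i \<omega>. (X i \<omega>)\<^sup>2 - 1"
  have Q2: "(\<integral>\<omega>. ?Q2 \<omega> \<partial>M) = (\<Sum>A\<in>Pow V. (a A)\<^sup>2)" by (rule P_sq[OF V])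
  have iQ4: "integrable M (\<lambda>\<omega>. P V a \<omega> ^ 4)" using P_pow_int[OF V, of 4 a] by simp
  have iQ2: "integrable M ?Q2" by (rule P_sq_int[OF V])
  have iQY: "integrable M (\<lambda>\<omega>. ?Q2 \<omega> * ?Y i \<omega>)" "(\<integral>\<omega>. ?Q2 \<omega> * ?Y i \<omega> \<partial>M) = (\<kappa> - 1) * I i" if "i \<in> V" for i
    using P_sq_times_sq[OF V that, of a] iQ2 Q2 unfolding I_def
    by (simp_all add: right_diff_distrib Bochner_Integration.integral_diff)
  have iQE: "integrable M (\<lambda>\<omega>. ?Q2 \<omega> * P V c \<omega>)" "(\<integral>\<omega>. ?Q2 \<omega> * P V c \<omega> \<partial>M) = (\<Sum>E\<in>Pow V. (c E)\<^sup>2)"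
  proof -
    have eq: "?Q2 \<omega> * P V c \<omega> = (\<Sum>E\<in>Pow V. c E * (?Q2 \<omega> * (\<Prod>i\<in>E. X i \<omega>)))" for \<omega>
      unfolding mlp_def[of V c] sum_distrib_left by (simp only: mult.left_commute)
    have i: "integrable M (\<lambda>\<omega>. c E * (?Q2 \<omega> * (\<Prod>i\<in>E. X i \<omega>)))" if "E \<in> Pow V" for E
      using that by (intro integrable_mult_right P_sq_times_monomial(1)[OF V]) auto
    show "integrable M (\<lambda>\<omega>. ?Q2 \<omega> * P V c \<omega>)" unfolding eq by (intro Bochner_Integration.integrable_sum i)
    have "(\<integral>\<omega>. ?Q2 \<omega> * P V c \<omega> \<partial>M) = (\<Sum>E\<in>Pow V. \<integral>\<omega>. c E * (?Q2 \<omega> * (\<Prod>i\<in>E. X i \<omega>)) \<partial>M)"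
      unfolding eq by (rule Bochner_Integration.integral_sum) (rule i)
    also have "\<dots> = (\<Sum>E\<in>Pow V. (c E)\<^sup>2)"
    proof (rule sum.cong[OF refl])
      fix E assume "E \<in> Pow V"
      then have E: "E \<subseteq> V" by auto
      show "(\<integral>\<omega>. c E * (?Q2 \<omega> * (\<Prod>i\<in>E. X i \<omega>)) \<partial>M) = (c E)\<^sup>2"
        unfolding integral_mult_right_zero P_sq_times_monomial(2)[OF V E] by (simp add: c_def power2_eq_square)
    qed
    finally show "(\<integral>\<omega>. ?Q2 \<omega> * P V c \<omega> \<partial>M) = (\<Sum>E\<in>Pow V. (c E)\<^sup>2)" .
  qed
  have QL: "integrable M (\<lambda>\<omega>. ?Q2 \<omega> * L \<omega>)" "(\<integral>\<omega>. ?Q2 \<omega> * L \<omega> \<partial>M) = B"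
  proof -
    have eq: "?Q2 \<omega> * L \<omega> = ?Q2 \<omega> * P V c \<omega> + (\<Sum>i\<in>V. I i * (?Q2 \<omega> * ?Y i \<omega>))" for \<omega>
      unfolding L_def distrib_left sum_distrib_left by (simp only: mult.left_commute)
    have i: "integrable M (\<lambda>\<omega>. I i * (?Q2 \<omega> * ?Y i \<omega>))" if "i \<in> V" for i using iQY(1)[OF that] by (rule integrable_mult_right)
    show "integrable M (\<lambda>\<omega>. ?Q2 \<omega> * L \<omega>)"
      unfolding eq by (intro Bochner_Integration.integrable_add iQE(1) Bochner_Integration.integrable_sum i)
    have "(\<integral>\<omega>. ?Q2 \<omega> * L \<omega> \<partial>M) = (\<integral>\<omega>. ?Q2 \<omega> * P V c \<omega> \<partial>M) + (\<integral>\<omega>. (\<Sum>i\<in>V. I i * (?Q2 \<omega> * ?Y i \<omega>)) \<partial>M)"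
      unfolding eq by (intro Bochner_Integration.integral_add iQE(1) Bochner_Integration.integrable_sum i)
    also have "(\<integral>\<omega>. (\<Sum>i\<in>V. I i * (?Q2 \<omega> * ?Y i \<omega>)) \<partial>M) = (\<Sum>i\<in>V. \<integral>\<omega>. I i * (?Q2 \<omega> * ?Y i \<omega>) \<partial>M)"
      by (rule Bochner_Integration.integral_sum) (rule i)
    also have "\<dots> = (\<Sum>i\<in>V. (\<kappa> - 1) * (I i)\<^sup>2)"
      unfolding integral_mult_right_zero by (rule sum.cong[OF refl], simp only: iQY(2), simp add: power2_eq_square)
    finally show "(\<integral>\<omega>. ?Q2 \<omega> * L \<omega> \<partial>M) = B" unfolding iQE(2) B_def by (simp only: sum_distrib_left)
  qed
  have emp: "integrable M (\<lambda>\<omega>. (\<Prod>i\<in>E. X i \<omega>) * (X i \<omega>)\<^sup>2)" "(\<integral>\<omega>. (\<Prod>i\<in>E. X i \<omega>) * (X i \<omega>)\<^sup>2 \<partial>M) = (if E = {} then 1 else 0)"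
    if "E \<subseteq> V" "i \<in> V" for E i
    using moment_sq[OF V empty_subsetI that] by (auto split: if_splits)
  have prodE: "integrable M (\<lambda>\<omega>. \<Prod>i\<in>E. X i \<omega>)" "(\<integral>\<omega>. (\<Prod>i\<in>E. X i \<omega>) \<partial>M) = (if E = {} then 1 else 0)" if "E \<subseteq> V" for E
    using moment3[OF V empty_subsetI empty_subsetI that] by (auto split: if_splits)
  have YY: "integrable M (\<lambda>\<omega>. ?Y i \<omega> * ?Y l \<omega>)" "(\<integral>\<omega>. ?Y i \<omega> * ?Y l \<omega> \<partial>M) = (if i = l then \<kappa> - 1 else 0)"
    if il: "i \<in> V" "l \<in> V" for i l
  proof -
    have eq: "?Y i \<omega> * ?Y l \<omega> = (\<Prod>p\<in>{i}. X p \<omega>) * (\<Prod>p\<in>{i}. X p \<omega>) * (X l \<omega>)\<^sup>2 - (X i \<omega>)\<^sup>2 - ((X l \<omega>)\<^sup>2 - 1)" for \<omega>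
      by (simp add: power2_eq_square algebra_simps)
    have ms: "integrable M (\<lambda>\<omega>. (\<Prod>p\<in>{i}. X p \<omega>) * (\<Prod>p\<in>{i}. X p \<omega>) * (X l \<omega>)\<^sup>2)"
      "(\<integral>\<omega>. (\<Prod>p\<in>{i}. X p \<omega>) * (\<Prod>p\<in>{i}. X p \<omega>) * (X l \<omega>)\<^sup>2 \<partial>M) = (if l = i then \<kappa> else 1)"
      using moment_sq[OF V _ _ il(2), of "{i}" "{i}"] il by auto
    have yl: "integrable M (?Y l)" "(\<integral>\<omega>. ?Y l \<omega> \<partial>M) = 0" using int2[of l] var1[of l] by (simp_all add: prob_space)
    show "integrable M (\<lambda>\<omega>. ?Y i \<omega> * ?Y l \<omega>)"
      unfolding eq by (intro Bochner_Integration.integrable_diff ms(1) int2 integrable_const)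
    have "(\<integral>\<omega>. ?Y i \<omega> * ?Y l \<omega> \<partial>M) = (if l = i then \<kappa> else 1) - 1 - 0"
      unfolding eq Bochner_Integration.integral_diff[OF Bochner_Integration.integrable_diff[OF ms(1) int2] yl(1)]
        Bochner_Integration.integral_diff[OF ms(1) int2] ms(2) var1 yl(2) ..
    then show "(\<integral>\<omega>. ?Y i \<omega> * ?Y l \<omega> \<partial>M) = (if i = l then \<kappa> - 1 else 0)" by auto
  qed
  have PY: "integrable M (\<lambda>\<omega>. P V c \<omega> * ?Y i \<omega>)" "(\<integral>\<omega>. P V c \<omega> * ?Y i \<omega> \<partial>M) = 0" if i: "i \<in> V" for i
  proof -
    have eq: "P V c \<omega> * ?Y i \<omega> = (\<Sum>E\<in>Pow V. c E * ((\<Prod>i\<in>E. X i \<omega>) * (X i \<omega>)\<^sup>2 - (\<Prod>i\<in>E. X i \<omega>)))" for \<omega>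
      unfolding mlp_def sum_distrib_right by (simp only: mult.assoc right_diff_distrib mult_1_right)
    have j: "integrable M (\<lambda>\<omega>. c E * ((\<Prod>i\<in>E. X i \<omega>) * (X i \<omega>)\<^sup>2 - (\<Prod>i\<in>E. X i \<omega>)))" if "E \<in> Pow V" for E
      using that i by (intro integrable_mult_right Bochner_Integration.integrable_diff emp(1) prodE(1)) auto
    show "integrable M (\<lambda>\<omega>. P V c \<omega> * ?Y i \<omega>)" unfolding eq by (intro Bochner_Integration.integrable_sum j)
    have "(\<integral>\<omega>. P V c \<omega> * ?Y i \<omega> \<partial>M) = (\<Sum>E\<in>Pow V. \<integral>\<omega>. c E * ((\<Prod>i\<in>E. X i \<omega>) * (X i \<omega>)\<^sup>2 - (\<Prod>i\<in>E. X i \<omega>)) \<partial>M)"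
      unfolding eq by (rule Bochner_Integration.integral_sum) (rule j)
    also have "\<dots> = 0"
    proof (rule sum.neutral, rule ballI)
      fix E assume "E \<in> Pow V"
      then have E: "E \<subseteq> V" by auto
      show "(\<integral>\<omega>. c E * ((\<Prod>i\<in>E. X i \<omega>) * (X i \<omega>)\<^sup>2 - (\<Prod>i\<in>E. X i \<omega>)) \<partial>M) = 0"
        unfolding integral_mult_right_zero Bochner_Integration.integral_diff[OF emp(1)[OF E i] prodE(1)[OF E]] emp(2)[OF E i] prodE(2)[OF E] by simp
    qed
    finally show "(\<integral>\<omega>. P V c \<omega> * ?Y i \<omega> \<partial>M) = 0" .
  qed
  have LL: "integrable M (\<lambda>\<omega>. (L \<omega>)\<^sup>2)" "(\<integral>\<omega>. (L \<omega>)\<^sup>2 \<partial>M) = B"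
  proof -
    have eq: "(L \<omega>)\<^sup>2 = (P V c \<omega>)\<^sup>2 + (\<Sum>i\<in>V. (2 * I i) * (P V c \<omega> * ?Y i \<omega>)) + (\<Sum>i\<in>V. \<Sum>l\<in>V. (I i * I l) * (?Y i \<omega> * ?Y l \<omega>))" for \<omega>
    proof -
      let ?S = "\<Sum>i\<in>V. I i * ?Y i \<omega>"
      have "(L \<omega>)\<^sup>2 = (P V c \<omega>)\<^sup>2 + 2 * P V c \<omega> * ?S + ?S * ?S"
        unfolding L_def by (simp add: power2_eq_square algebra_simps)
      also have "2 * P V c \<omega> * ?S = (\<Sum>i\<in>V. (2 * I i) * (P V c \<omega> * ?Y i \<omega>))"
        unfolding sum_distrib_left by (simp only: mult_ac)
      also have "?S * ?S = (\<Sum>i\<in>V. \<Sum>l\<in>V. (I i * I l) * (?Y i \<omega> * ?Y l \<omega>))"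
        unfolding sum_product by (simp only: mult_ac)
      finally show ?thesis .
    qed
    have i1: "integrable M (\<lambda>\<omega>. (2 * I i) * (P V c \<omega> * ?Y i \<omega>))" if "i \<in> V" for i
      using PY(1)[OF that] by (rule integrable_mult_right)
    have i2: "integrable M (\<lambda>\<omega>. (I i * I l) * (?Y i \<omega> * ?Y l \<omega>))" if "i \<in> V" "l \<in> V" for i l
      using YY(1)[OF that] by (rule integrable_mult_right)
    have i3: "integrable M (\<lambda>\<omega>. \<Sum>l\<in>V. (I i * I l) * (?Y i \<omega> * ?Y l \<omega>))" if "i \<in> V" for i
      using i2 that by (intro Bochner_Integration.integrable_sum)
    have j1: "integrable M (\<lambda>\<omega>. \<Sum>i\<in>V. (2 * I i) * (P V c \<omega> * ?Y i \<omega>))" by (intro Bochner_Integration.integrable_sum i1)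
    have j2: "integrable M (\<lambda>\<omega>. \<Sum>i\<in>V. \<Sum>l\<in>V. (I i * I l) * (?Y i \<omega> * ?Y l \<omega>))" by (intro Bochner_Integration.integrable_sum i3)
    show "integrable M (\<lambda>\<omega>. (L \<omega>)\<^sup>2)"
      unfolding eq by (intro Bochner_Integration.integrable_add P_sq_int V j1 j2)
    have "(\<integral>\<omega>. (L \<omega>)\<^sup>2 \<partial>M) = (\<integral>\<omega>. (P V c \<omega>)\<^sup>2 \<partial>M) + (\<integral>\<omega>. (\<Sum>i\<in>V. (2 * I i) * (P V c \<omega> * ?Y i \<omega>)) \<partial>M) + (\<integral>\<omega>. (\<Sum>i\<in>V. \<Sum>l\<in>V. (I i * I l) * (?Y i \<omega> * ?Y l \<omega>)) \<partial>M)"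
      unfolding eq by (rule integral_add3[OF P_sq_int[OF V] j1 j2])
    also have "(\<integral>\<omega>. (\<Sum>i\<in>V. (2 * I i) * (P V c \<omega> * ?Y i \<omega>)) \<partial>M) = (\<Sum>i\<in>V. \<integral>\<omega>. (2 * I i) * (P V c \<omega> * ?Y i \<omega>) \<partial>M)"
      by (rule Bochner_Integration.integral_sum) (rule i1)
    also have "\<dots> = 0" unfolding integral_mult_right_zero by (rule sum.neutral) (simp add: PY(2))
    also have "(\<integral>\<omega>. (\<Sum>i\<in>V. \<Sum>l\<in>V. (I i * I l) * (?Y i \<omega> * ?Y l \<omega>)) \<partial>M) = (\<Sum>i\<in>V. \<Sum>l\<in>V. \<integral>\<omega>. (I i * I l) * (?Y i \<omega> * ?Y l \<omega>) \<partial>M)"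
      by (subst Bochner_Integration.integral_sum, rule i3, assumption) (rule sum.cong[OF refl], rule Bochner_Integration.integral_sum, rule i2)
    also have "\<dots> = (\<Sum>i\<in>V. \<Sum>l\<in>V. if i = l then (\<kappa> - 1) * (I i)\<^sup>2 else 0)"
      unfolding integral_mult_right_zero by (rule sum.cong[OF refl], rule sum.cong[OF refl], simp only: YY(2), simp add: power2_eq_square)
    also have "\<dots> = (\<Sum>i\<in>V. (\<kappa> - 1) * (I i)\<^sup>2)" using V by simp
    finally show "(\<integral>\<omega>. (L \<omega>)\<^sup>2 \<partial>M) = B" unfolding P_sq[OF V] B_def by (simp add: sum_distrib_left)
  qed
  \<comment> \<open>The integral of the square times \<open>L\<close> and that of \<open>L\<close>
    squared are both \<open>B\<close>, so this square integrates to the fourth moment minus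
    \<open>B\<close>.\<close>
  have "0 \<le> (\<integral>\<omega>. (?Q2 \<omega> - L \<omega>)\<^sup>2 \<partial>M)" by (rule Bochner_Integration.integral_nonneg) simp
  also have "(\<lambda>\<omega>. (?Q2 \<omega> - L \<omega>)\<^sup>2) = (\<lambda>\<omega>. P V a \<omega> ^ 4 + (- 2) * (?Q2 \<omega> * L \<omega>) + (L \<omega>)\<^sup>2)"
    by (rule ext) (simp add: power2_eq_square power4_eq_xxxx algebra_simps)
  also have "(\<integral>\<omega>. P V a \<omega> ^ 4 + (- 2) * (?Q2 \<omega> * L \<omega>) + (L \<omega>)\<^sup>2 \<partial>M) = (\<integral>\<omega>. P V a \<omega> ^ 4 \<partial>M) + (\<integral>\<omega>. (- 2) * (?Q2 \<omega> * L \<omega>) \<partial>M) + (\<integral>\<omega>. (L \<omega>)\<^sup>2 \<partial>M)"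
    by (rule integral_add3[OF iQ4 integrable_mult_right[OF QL(1)] LL(1)])
  finally have "B \<le> (\<integral>\<omega>. P V a \<omega> ^ 4 \<partial>M)"
    unfolding integral_mult_right_zero QL(2) LL(2) by simp
  moreover have "(\<Sum>E\<in>Pow V. (c E)\<^sup>2) = (\<Sum>A\<in>Pow V. (a A)\<^sup>2)\<^sup>2 + (\<Sum>E\<in>ksub V (2 * k). (pcoef V a E)\<^sup>2)"
  proof -
    have nE: "{} \<notin> ksub V (2 * k)" using k unfolding ksub_def by auto
    have "(\<Sum>E\<in>Pow V. (c E)\<^sup>2) = (\<Sum>E\<in>?E. (pcoef V a E)\<^sup>2)"
      using V by (intro sum.mono_neutral_cong_right) (auto simp: c_def ksub_def)
    also have "\<dots> = (pcoef V a {})\<^sup>2 + (\<Sum>E\<in>ksub V (2 * k). (pcoef V a E)\<^sup>2)"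
      using nE V by simp
    also have "pcoef V a {} = (\<Sum>A\<in>Pow V. \<Sum>B\<in>Pow V. if A = B then (a A)\<^sup>2 else 0)"
      unfolding pcoef_def by (intro sum.cong refl) (auto simp: power2_eq_square)
    also have "\<dots> = (\<Sum>A\<in>Pow V. (a A)\<^sup>2)" using V by simp
    finally show ?thesis .
  qed
  ultimately show ?thesis unfolding B_def I_def by simp
qed

end

section \<open>Contraction norms as sums over quadruples of sets\<close>

definition cterm :: "('i set \<Rightarrow> real) \<Rightarrow> 'i set \<times> 'i set \<times> 'i set \<times> 'i set \<Rightarrow> real" where
  "cterm a = (\<lambda>(P, Q, R, R'). a (P \<union> R) * a (Q \<union> R) * (a (P \<union> R') * a (Q \<union> R')))"

definition quads :: "'i set \<Rightarrow> nat \<Rightarrow> nat \<Rightarrow> ('i set \<times> 'i set \<times> 'i set \<times> 'i set) set" where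
  "quads V k r = ksub V (k - r) \<times> ksub V (k - r) \<times> ksub V r \<times> ksub V r"

lemma contr_quads: "contr V k k r a a = (\<Sum>z\<in>quads V k r. cterm a z)"
  unfolding contr_def quads_def cterm_def power2_eq_square sum_product
  by (simp only: sum.cartesian_product case_prod_unfold fst_conv snd_conv)

definition djq :: "'i set \<times> 'i set \<times> 'i set \<times> 'i set \<Rightarrow> bool" where
  "djq = (\<lambda>(P, Q, R, R'). P \<inter> Q = {} \<and> R \<inter> R' = {} \<and> (P \<union> Q) \<inter> (R \<union> R') = {})"

text \<open>With \<open>A\<close>, \<open>C\<close> two halves of \<open>E\<close>: \<open>P = A - C\<close>, \<open>Q = C - A\<close>, \<open>R = A \<inter> C\<close> and \<open>R' = E - (A \<union> C)\<close>.\<close>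

lemma pcoef_sq_quads:
  assumes V: "finite V" and a: "\<And>A. a A \<noteq> 0 \<Longrightarrow> card A = k"
  shows "(\<Sum>E\<in>ksub V (2 * k). (\<Sum>A\<in>Pow V. \<Sum>B\<in>Pow V. if (A - B) \<union> (B - A) = E then a A * a B else 0)\<^sup>2)
    = (\<Sum>r\<le>k. \<Sum>z\<in>{z \<in> quads V k r. djq z}. cterm a z)"
proof -
  let ?S = "\<lambda>E. {A. A \<subseteq> E \<and> card A = k}"
  have fin: "finite A" if "A \<subseteq> V" for A using that V finite_subset by auto
  \<comment> \<open>Two sets of size \<open>k\<close> whose symmetric difference has
    \<open>2 * k\<close> elements are disjoint, so \<open>B\<close> is the complement of
    \<open>A\<close> in \<open>E\<close>.\<close>
  have half: "(\<Sum>A\<in>Pow V. \<Sum>B\<in>Pow V. if (A - B) \<union> (B - A) = E then a A * a B else 0) = (\<Sum>A\<in>?S E. a A * a (E - A))"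
    if E: "E \<in> ksub V (2 * k)" for E
  proof -
    have EV: "E \<subseteq> V" "card E = 2 * k" using E unfolding ksub_def by auto
    have "(\<Sum>A\<in>Pow V. \<Sum>B\<in>Pow V. if (A - B) \<union> (B - A) = E then a A * a B else 0) = (\<Sum>(A, B)\<in>Pow V \<times> Pow V. if (A - B) \<union> (B - A) = E then a A * a B else 0)"
      by (rule sum.cartesian_product)
    also have "\<dots> = (\<Sum>(A, B)\<in>(\<lambda>A. (A, E - A)) ` ?S E. a A * a B)"
    proof (rule sum.mono_neutral_cong_right)
      show "finite (Pow V \<times> Pow V)" using V by simp
      show "(\<lambda>A. (A, E - A)) ` ?S E \<subseteq> Pow V \<times> Pow V" using EV by auto
      show "\<forall>z\<in>Pow V \<times> Pow V - (\<lambda>A. (A, E - A)) ` ?S E. (case z of (A, B) \<Rightarrow> if (A - B) \<union> (B - A) = E then a A * a B else 0) = 0"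
      proof (clarify, rule ccontr)
        fix A B assume AB: "A \<subseteq> V" "B \<subseteq> V" "(A, B) \<notin> (\<lambda>A. (A, E - A)) ` ?S E" "(if (A - B) \<union> (B - A) = E then a A * a B else 0) \<noteq> 0"
        then have s: "(A - B) \<union> (B - A) = E" "card A = k" "card B = k" using a by (auto split: if_splits)
        have f: "finite A" "finite B" using AB fin by auto
        have "card E = card (A - B) + card (B - A)" unfolding s(1)[symmetric] using f by (intro card_Un_disjoint) auto
        moreover have "card (A - B) + card (A \<inter> B) = k" "card (B - A) + card (A \<inter> B) = k"
          using f s by (metis card_Diff_subset_Int card_mono finite_Int inf_le1 le_add_diff_inverse2, metis Int_commute card_Diff_subset_Int card_mono finite_Int inf_le1 le_add_diff_inverse2)
        ultimately have "card (A \<inter> B) = 0" using EV by linarith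
        then have "A \<inter> B = {}" using f by auto
        then have "B = E - A" "A \<subseteq> E" using s by auto
        then show False using AB(3) s by auto
      qed
      fix z assume "z \<in> (\<lambda>A. (A, E - A)) ` ?S E"
      then show "(case z of (A, B) \<Rightarrow> if (A - B) \<union> (B - A) = E then a A * a B else 0) = (case z of (A, B) \<Rightarrow> a A * a B)"
        by auto
    qed
    also have "\<dots> = (\<Sum>A\<in>?S E. a A * a (E - A))"
      by (subst sum.reindex) (auto simp: inj_on_def)
    finally show ?thesis .
  qed
  have "(\<Sum>E\<in>ksub V (2 * k). (\<Sum>A\<in>Pow V. \<Sum>B\<in>Pow V. if (A - B) \<union> (B - A) = E then a A * a B else 0)\<^sup>2)
     = (\<Sum>E\<in>ksub V (2 * k). (\<Sum>A\<in>?S E. a A * a (E - A))\<^sup>2)"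
    by (rule sum.cong[OF refl]) (simp only: half)
  also have "\<dots> = (\<Sum>E\<in>ksub V (2 * k). \<Sum>(A, C)\<in>?S E \<times> ?S E. a A * a (E - A) * (a C * a (E - C)))"
    unfolding power2_eq_square sum_product by (simp only: sum.cartesian_product)
  also have "\<dots> = (\<Sum>(E, A, C)\<in>(SIGMA E:ksub V (2 * k). ?S E \<times> ?S E). a A * a (E - A) * (a C * a (E - C)))"
  proof (rule sum.Sigma)
    show "finite (ksub V (2 * k))" using V by simp
    have "finite (?S E)" if "E \<subseteq> V" for E by (rule finite_subset[of _ "Pow E"]) (use that fin in auto)
    then show "\<forall>E\<in>ksub V (2 * k). finite (?S E \<times> ?S E)" unfolding ksub_def by auto
  qed
  also have "\<dots> = (\<Sum>(r, z)\<in>(SIGMA r:{..k}. {z \<in> quads V k r. djq z}). cterm a z)"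
  proof (rule sum.reindex_bij_witness[of _ "\<lambda>(r, P, Q, R, R'). (P \<union> Q \<union> R \<union> R', P \<union> R, Q \<union> R)" "\<lambda>(E, A, C). (card (A \<inter> C), A - C, C - A, A \<inter> C, E - (A \<union> C))"])
    fix x assume "x \<in> (SIGMA E:ksub V (2 * k). ?S E \<times> ?S E)"
    then obtain E A C where x: "x = (E, A, C)" "E \<subseteq> V" "card E = 2 * k" "A \<subseteq> E" "card A = k" "C \<subseteq> E" "card C = k"
      unfolding ksub_def by auto
    have f: "finite E" "finite A" "finite C" using x fin by (auto intro: finite_subset)
    have c1: "card (A - C) = k - card (A \<inter> C)" using x f by (subst card_Diff_subset_Int) auto
    have c2: "card (C - A) = k - card (A \<inter> C)" using x f by (subst card_Diff_subset_Int) (auto simp: Int_commute)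
    have c0: "card (A \<inter> C) \<le> k" using x f card_mono[of A "A \<inter> C"] by auto
    have "card (A \<union> C) + card (A \<inter> C) = 2 * k" using card_Un_Int[OF f(2,3)] x by simp
    moreover have "card (E - (A \<union> C)) = card E - card (A \<union> C)" using x f by (intro card_Diff_subset) auto
    ultimately have c3: "card (E - (A \<union> C)) = card (A \<inter> C)" using x by linarith
    show "(case x of (E, A, C) \<Rightarrow> (card (A \<inter> C), A - C, C - A, A \<inter> C, E - (A \<union> C))) \<in> (SIGMA r:{..k}. {z \<in> quads V k r. djq z})"
      using x c0 c1 c2 c3 by (auto simp: quads_def ksub_def djq_def)
    have e: "(A - C) \<union> (C - A) \<union> (A \<inter> C) \<union> (E - (A \<union> C)) = E" "(A - C) \<union> (A \<inter> C) = A" "(C - A) \<union> (A \<inter> C) = C"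
      "(A - C) \<union> (E - (A \<union> C)) = E - C" "(C - A) \<union> (E - (A \<union> C)) = E - A" using x by auto
    show "(case (case x of (E, A, C) \<Rightarrow> (card (A \<inter> C), A - C, C - A, A \<inter> C, E - (A \<union> C))) of (r, P, Q, R, R') \<Rightarrow> (P \<union> Q \<union> R \<union> R', P \<union> R, Q \<union> R)) = x"
      unfolding x(1) by (simp only: prod.case e)
    show "(case (case x of (E, A, C) \<Rightarrow> (card (A \<inter> C), A - C, C - A, A \<inter> C, E - (A \<union> C))) of (r, z) \<Rightarrow> cterm a z) = (case x of (E, A, C) \<Rightarrow> a A * a (E - A) * (a C * a (E - C)))"
      unfolding x(1) cterm_def by (simp only: prod.case e mult_ac)
  next
    fix x assume "x \<in> (SIGMA r:{..k}. {z \<in> quads V k r. djq z})"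
    then obtain r P Q R R' where x: "x = (r, P, Q, R, R')" "r \<le> k" "P \<subseteq> V" "Q \<subseteq> V" "R \<subseteq> V" "R' \<subseteq> V"
      "card P = k - r" "card Q = k - r" "card R = r" "card R' = r"
      and d: "P \<inter> Q = {}" "R \<inter> R' = {}" "(P \<union> Q) \<inter> (R \<union> R') = {}"
      by (auto simp: quads_def ksub_def djq_def)
    have f: "finite P" "finite Q" "finite R" "finite R'" using x fin by auto
    have c: "card (P \<union> R) = k" "card (Q \<union> R) = k" using x f d by (subst card_Un_disjoint; auto)+
    have "card (P \<union> Q) = 2 * (k - r)" "card (R \<union> R') = 2 * r" using x f d by (subst card_Un_disjoint; auto)+
    then have "card ((P \<union> Q) \<union> (R \<union> R')) = 2 * k" using x f d by (subst card_Un_disjoint) auto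
    then have cE: "card (P \<union> Q \<union> R \<union> R') = 2 * k" by (simp add: Un_assoc)
    show "(case x of (r, P, Q, R, R') \<Rightarrow> (P \<union> Q \<union> R \<union> R', P \<union> R, Q \<union> R)) \<in> (SIGMA E:ksub V (2 * k). ?S E \<times> ?S E)"
      using x c cE by (auto simp: ksub_def)
    have e: "(P \<union> R) \<inter> (Q \<union> R) = R" "(P \<union> R) - (Q \<union> R) = P" "(Q \<union> R) - (P \<union> R) = Q" "(P \<union> Q \<union> R \<union> R') - ((P \<union> R) \<union> (Q \<union> R)) = R'"
      using d by auto
    show "(case (case x of (r, P, Q, R, R') \<Rightarrow> (P \<union> Q \<union> R \<union> R', P \<union> R, Q \<union> R)) of (E, A, C) \<Rightarrow> (card (A \<inter> C), A - C, C - A, A \<inter> C, E - (A \<union> C))) = x"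
      unfolding x(1) by (simp only: prod.case e x(9))
  qed
  also have "\<dots> = (\<Sum>r\<le>k. \<Sum>z\<in>{z \<in> quads V k r. djq z}. cterm a z)"
    using V by (subst sum.Sigma) (auto simp: quads_def)
  finally show ?thesis .
qed

text \<open>A nonvanishing term that is not pairwise disjoint has an index common to all four arguments,
  so it already occurs in the contraction of the kernel restricted to the sets containing that index.\<close>

lemma quads_disjoint_ge:
  assumes V: "finite V" and a: "\<And>A. a A \<noteq> 0 \<Longrightarrow> card A = k" and r: "r \<le> k"
  shows "(\<Sum>z\<in>{z \<in> quads V k r. djq z}. cterm a z) \<ge> contr V k k r a a - 4 ^ k * (\<Sum>i\<in>V. (infl V a i)\<^sup>2)"
proof -
  \<comment> \<open>Taking absolute values makes every term of the restricted contractions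
    non-negative, so a sum over all indices dominates the contribution of any one of them and
    surplus terms may be added.\<close>
  define b where "b i A = (if i \<in> A then \<bar>a A\<bar> else 0)" for i A
  have fq: "finite (quads V k r)" using V by (simp add: quads_def)
  have b0: "b i A \<ge> 0" for i A unfolding b_def by simp
  have cb0: "cterm (b i) z \<ge> 0" for i z unfolding cterm_def by (auto simp: case_prod_unfold intro!: mult_nonneg_nonneg b0)
  have bad: "\<bar>cterm a z\<bar> \<le> (\<Sum>i\<in>V. cterm (b i) z)" if z: "z \<in> quads V k r" "\<not> djq z" for z
  proof (cases "cterm a z = 0")
    case True
    then show ?thesis using cb0 by (simp add: sum_nonneg)
  next
    case False
    obtain P Q R R' where zz: "z = (P, Q, R, R')" by (cases z)
    have q: "P \<subseteq> V" "Q \<subseteq> V" "R \<subseteq> V" "R' \<subseteq> V" "card P = k - r" "card Q = k - r" "card R = r" "card R' = r"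
      using z(1) unfolding zz quads_def ksub_def by auto
    have f: "finite P" "finite Q" "finite R" "finite R'" using q V finite_subset by auto
    have n: "a (P \<union> R) \<noteq> 0" "a (Q \<union> R) \<noteq> 0" "a (P \<union> R') \<noteq> 0" "a (Q \<union> R') \<noteq> 0"
      using False unfolding zz cterm_def by auto
    have dj: "A \<inter> B = {}" if "finite A" "finite B" "card A = k - r" "card B = r" "a (A \<union> B) \<noteq> 0" for A B
    proof -
      have "card (A \<union> B) = k" using a that by auto
      then have "card (A \<inter> B) = 0" using card_Un_Int[OF that(1,2)] that r by linarith
      then show ?thesis using that by auto
    qed
    \<comment> \<open>The supports already separate \<open>P\<close> and \<open>Q\<close> from
      \<open>R\<close> and \<open>R'\<close>. A failure of \<open>djq\<close> thus gives an index
      common to \<open>P\<close> and \<open>Q\<close>, or to \<open>R\<close> and \<open>R'\<close>,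
      and either way it lies in all four unions.\<close>
    have "(P \<union> Q) \<inter> (R \<union> R') = {}"
      using dj[OF f(1,3) q(5,7) n(1)] dj[OF f(2,3) q(6,7) n(2)] dj[OF f(1,4) q(5,8) n(3)] dj[OF f(2,4) q(6,8) n(4)] by auto
    then have "P \<inter> Q \<noteq> {} \<or> R \<inter> R' \<noteq> {}" using z(2) unfolding zz djq_def by auto
    then obtain i where i: "i \<in> P \<inter> Q \<or> i \<in> R \<inter> R'" by auto
    have iV: "i \<in> V" using i q by auto
    have "\<bar>cterm a z\<bar> = cterm (b i) z"
      using i unfolding zz cterm_def b_def by (auto simp: abs_mult)
    also have "\<dots> \<le> (\<Sum>i\<in>V. cterm (b i) z)" using iV V cb0 by (intro member_le_sum) auto
    finally show ?thesis .
  qed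
  have split: "contr V k k r a a = (\<Sum>z\<in>{z \<in> quads V k r. djq z}. cterm a z) + (\<Sum>z\<in>{z \<in> quads V k r. \<not> djq z}. cterm a z)"
    unfolding contr_quads using fq by (subst sum.union_disjoint[symmetric]) (auto intro!: sum.cong)
  have "(\<Sum>z\<in>{z \<in> quads V k r. \<not> djq z}. cterm a z) \<le> (\<Sum>z\<in>{z \<in> quads V k r. \<not> djq z}. \<Sum>i\<in>V. cterm (b i) z)"
    by (rule sum_mono, rule order_trans[OF abs_ge_self bad]) auto
  also have "\<dots> \<le> (\<Sum>z\<in>quads V k r. \<Sum>i\<in>V. cterm (b i) z)"
    using fq cb0 by (intro sum_mono2) (auto intro!: sum_nonneg)
  also have "\<dots> = (\<Sum>i\<in>V. contr V k k r (b i) (b i))" unfolding contr_quads by (rule sum.swap)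
  also have "\<dots> \<le> (\<Sum>i\<in>V. (2 ^ k * infl V a i)\<^sup>2)"
  proof (rule sum_mono)
    fix i assume i: "i \<in> V"
    \<comment> \<open>The squared norm of the kernel restricted to the sets containing
      \<open>i\<close> is the influence of \<open>i\<close>.\<close>
    have "contr V k k r (b i) (b i) \<le> (2 ^ k * (\<Sum>A\<in>Pow V. (b i A)\<^sup>2))\<^sup>2"
      by (rule contr_bounded[OF V r]) (use a in \<open>auto simp: b_def split: if_splits\<close>)
    also have "(\<Sum>A\<in>Pow V. (b i A)\<^sup>2) = infl V a i"
      unfolding infl_def sum_Pow_containing[OF V i, of "\<lambda>A. (a A)\<^sup>2"] by (intro sum.cong refl) (auto simp: b_def)
    finally show "contr V k k r (b i) (b i) \<le> (2 ^ k * infl V a i)\<^sup>2" .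
  qed
  also have "\<dots> = 4 ^ k * (\<Sum>i\<in>V. (infl V a i)\<^sup>2)"
  proof -
    have "((2::real) ^ k)\<^sup>2 = 4 ^ k" by (simp add: power2_eq_square flip: power_mult_distrib)
    then show ?thesis by (simp only: power_mult_distrib sum_distrib_left)
  qed
  finally show ?thesis using split by linarith
qed

text \<open>Contraction of order 0 is the tensor product, and contraction of order \<open>k\<close>
  the squared norm.\<close>

lemma contr_ends:
  assumes V: "finite V" and a: "\<And>A. a A \<noteq> 0 \<Longrightarrow> card A = k"
  shows "contr V k k 0 a a = (\<Sum>A\<in>Pow V. (a A)\<^sup>2)\<^sup>2" "contr V k k k a a = (\<Sum>A\<in>Pow V. (a A)\<^sup>2)\<^sup>2"
proof -
  have k0: "ksub V 0 = {{}}" using V finite_subset[of _ V] unfolding ksub_def by auto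
  have s: "(\<Sum>A\<in>ksub V k. (a A)\<^sup>2) = (\<Sum>A\<in>Pow V. (a A)\<^sup>2)"
    using V a by (intro sum.mono_neutral_left) (auto simp: ksub_def)
  have "contr V k k 0 a a = (\<Sum>P\<in>ksub V k. \<Sum>Q\<in>ksub V k. (a P)\<^sup>2 * (a Q)\<^sup>2)"
    unfolding contr_def k0 by (simp add: power_mult_distrib)
  then show "contr V k k 0 a a = (\<Sum>A\<in>Pow V. (a A)\<^sup>2)\<^sup>2"
    unfolding s[symmetric] power2_eq_square[of "\<Sum>A\<in>ksub V k. (a A)\<^sup>2"] sum_product .
  have "contr V k k k a a = (\<Sum>R\<in>ksub V k. (a R)\<^sup>2)\<^sup>2"
    unfolding contr_def diff_self_eq_0 k0 by (simp add: power2_eq_square)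
  then show "contr V k k k a a = (\<Sum>A\<in>Pow V. (a A)\<^sup>2)\<^sup>2" unfolding s .
qed

text \<open>One of the three squared variances is the projection onto the constants, the other two
  are the contractions of order 0 and \<open>k\<close>. Each of the \<open>k + 1\<close> orders
  loses at most \<open>4 ^ k\<close> times the sum of squared influences, and
  \<open>\<kappa>\<close> is chosen so that the components along \<open>X_i^2 - 1\<close> repay this
  exactly.\<close>

lemma (in sym_seq) fourth_moment_ge:
  assumes V: "finite V" and a: "\<And>A. a A \<noteq> 0 \<Longrightarrow> card A = k" and k: "k \<ge> 1"
    and \<kappa>: "\<kappa> - 1 = real (k + 1) * 4 ^ k"
  shows "3 * (\<Sum>A\<in>Pow V. (a A)\<^sup>2)\<^sup>2 + (\<Sum>r=1..k - 1. contr V k k r a a) \<le> (\<integral>\<omega>. P V a \<omega> ^ 4 \<partial>M)"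
proof -
  let ?s = "\<Sum>A\<in>Pow V. (a A)\<^sup>2" and ?I = "\<Sum>i\<in>V. (infl V a i)\<^sup>2"
  have "(\<Sum>E\<in>ksub V (2 * k). (pcoef V a E)\<^sup>2) = (\<Sum>r\<le>k. \<Sum>z\<in>{z \<in> quads V k r. djq z}. cterm a z)"
    unfolding pcoef_def by (rule pcoef_sq_quads[OF V a])
  moreover have "(\<Sum>r\<le>k. contr V k k r a a - 4 ^ k * ?I) \<le> (\<Sum>r\<le>k. \<Sum>z\<in>{z \<in> quads V k r. djq z}. cterm a z)"
    by (intro sum_mono quads_disjoint_ge[OF V a]) auto
  ultimately have "(\<Sum>r\<le>k. contr V k k r a a - 4 ^ k * ?I) \<le> (\<Sum>E\<in>ksub V (2 * k). (pcoef V a E)\<^sup>2)" by simp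
  moreover have "(\<Sum>r\<le>k. contr V k k r a a - 4 ^ k * ?I) = (\<Sum>r\<le>k. contr V k k r a a) - (\<kappa> - 1) * ?I"
    unfolding \<kappa> by (simp add: sum_subtractf)
  moreover have "(\<Sum>r\<le>k. contr V k k r a a) = 2 * ?s\<^sup>2 + (\<Sum>r=1..k - 1. contr V k k r a a)"
  proof -
    have "{..k} = insert 0 (insert k {1..k - 1})" using k by auto
    then have "(\<Sum>r\<le>k. contr V k k r a a) = contr V k k 0 a a + (contr V k k k a a + (\<Sum>r=1..k - 1. contr V k k r a a))"
      using k by simp
    then show ?thesis using contr_ends[OF V a] by simp
  qed
  ultimately show ?thesis using fourth_moment_bessel[where a=a and k=k, OF V a k] by linarith
qed

section \<open>Truncation of the kernels\<close>

lemma admissible_std3: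
  assumes "independent_standardized M X" "(SUP i. \<integral>\<^sup>+ \<omega>. ennreal (\<bar>X i \<omega>\<bar> ^ 3) \<partial>M) < \<infinity>"
  obtains \<beta> where "std3_seq M X \<beta>"
proof -
  let ?s = "SUP i. \<integral>\<^sup>+ \<omega>. ennreal (\<bar>X i \<omega>\<bar> ^ 3) \<partial>M"
  define \<beta> where "\<beta> = max 1 (enn2real ?s)"
  interpret prob_space M using assms(1) unfolding independent_standardized_def by blast
  interpret indep_seq M X using assms(1) unfolding independent_standardized_def by unfold_locales blast
  have le: "(\<integral>\<^sup>+ \<omega>. ennreal (\<bar>X i \<omega>\<bar> ^ 3) \<partial>M) \<le> ennreal (enn2real ?s)" for i
  proof -
    have "(\<integral>\<^sup>+ \<omega>. ennreal (\<bar>X i \<omega>\<bar> ^ 3) \<partial>M) \<le> ?s" by (rule SUP_upper) simp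
    also have "?s = ennreal (enn2real ?s)" using assms(2) by (simp add: less_top)
    finally show ?thesis .
  qed
  have int: "integrable M (\<lambda>\<omega>. \<bar>X i \<omega>\<bar> ^ 3)" for i
    by (rule integrableI_bounded) (use le[of i] in \<open>auto simp: power_abs intro: le_less_trans[OF _ ennreal_less_top]\<close>)
  have mom: "(\<integral>\<omega>. \<bar>X i \<omega>\<bar> ^ 3 \<partial>M) \<le> \<beta>" for i
  proof -
    have "ennreal (\<integral>\<omega>. \<bar>X i \<omega>\<bar> ^ 3 \<partial>M) \<le> ennreal (enn2real ?s)"
      using le[of i] nn_integral_eq_integral[OF int[of i]] by simp
    then have "(\<integral>\<omega>. \<bar>X i \<omega>\<bar> ^ 3 \<partial>M) \<le> enn2real ?s" by (subst (asm) ennreal_le_iff) auto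
    then show ?thesis unfolding \<beta>_def by simp
  qed
  have "std3_seq M X \<beta>"
    by unfold_locales (use assms(1) int mom in \<open>auto simp: independent_standardized_def \<beta>_def\<close>)
  then show thesis by (rule that)
qed

lemma (in prob_space) L1_le_L2:
  assumes "integrable M (\<lambda>\<omega>. (f \<omega>)\<^sup>2)" "f \<in> borel_measurable M" "(\<integral>\<omega>. (f \<omega>)\<^sup>2 \<partial>M) \<le> e"
  shows "integrable M f" "(\<integral>\<omega>. \<bar>f \<omega>\<bar> \<partial>M) \<le> sqrt e"
proof -
  show i: "integrable M f"
  proof (rule Bochner_Integration.integrable_bound)
    show "integrable M (\<lambda>\<omega>. 1 + (f \<omega>)\<^sup>2)" using assms(1) by simp
    have "\<bar>x\<bar> \<le> 1 + x\<^sup>2" for x :: real using sum_squares_bound[of "\<bar>x\<bar>" 1] by simp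
    then show "AE \<omega> in M. norm (f \<omega>) \<le> norm (1 + (f \<omega>)\<^sup>2)" by (intro AE_I2) simp
  qed (rule assms(2))
  have "(\<integral>\<omega>. \<bar>f \<omega>\<bar> \<partial>M)\<^sup>2 \<le> (\<integral>\<omega>. \<bar>f \<omega>\<bar>\<^sup>2 \<partial>M)"
    by (rule jensens_inequality[where I=UNIV and q="\<lambda>x. x\<^sup>2", of "\<lambda>\<omega>. \<bar>f \<omega>\<bar>"]) (use i assms in \<open>auto intro!: convex_power2\<close>)
  then show "(\<integral>\<omega>. \<bar>f \<omega>\<bar> \<partial>M) \<le> sqrt e" using assms(3) by (intro real_le_rsqrt) simp
qed

lemma abs_cos_diff_le: "\<bar>cos x - cos y\<bar> \<le> \<bar>x - y :: real\<bar>"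
proof -
  have "\<bar>cos x - cos y\<bar> = 2 * \<bar>sin ((x + y) / 2)\<bar> * \<bar>sin ((y - x) / 2)\<bar>"
    by (simp add: cos_diff_cos abs_mult)
  also have "\<dots> \<le> 2 * 1 * \<bar>(y - x) / 2\<bar>"
    by (intro mult_mono abs_sin_x_le_abs_x) auto
  finally show ?thesis by simp
qed

text \<open>Every kernel is replaced by its restriction to a cube, so large that for index \<open>n\<close> all quantities
  of interest change by at most \<open>1 / (n + 1)\<close>.\<close>

locale truncated =
  fixes k :: "'m::finite \<Rightarrow> nat" and f :: "nat \<Rightarrow> 'm \<Rightarrow> int list \<Rightarrow> real" and \<Sigma> :: "real^'m^'m" and N :: "nat \<Rightarrow> nat"
  assumes k: "k j \<ge> 2" and f: "f n j \<in> l2_kernels (k j)"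
    and sym: "transpose \<Sigma> = \<Sigma>" and psd: "0 \<le> x \<bullet> (\<Sigma> *v x)"
    and gram0: "(\<lambda>n. kernel_inner (k i) (f n i) (k j) (f n j)) \<longlonglongrightarrow> \<Sigma> $ i $ j"
    and N1: "\<bar>(\<Sum>A\<in>Pow (zbox (N n)). setk (k i) (f n i) A * setk (k j) (f n j) A) - kernel_inner (k i) (f n i) (k j) (f n j)\<bar> \<le> 1 / (real n + 1)"
    and N2: "2 * fact (k j) * (ksq (k j) (f n j) - (\<Sum>l\<in>blist (k j) (N n). (f n j l)\<^sup>2)) \<le> 1 / (real n + 1)"
    and N3: "r \<in> {1..k j - 1} \<Longrightarrow> \<bar>(fact (k j - r) * fact r)\<^sup>2 / fact (k j) ^ 4 * contr (zbox (N n)) (k j) (k j) r (setk (k j) (f n j)) (setk (k j) (f n j))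
       - (discrete_norm (2 * k j - 2 * r) (contraction (k j) (k j) r (f n j) (f n j)))\<^sup>2\<bar> \<le> 1 / (real n + 1)"
begin

abbreviation "V n \<equiv> zbox (N n)"
abbreviation "a n j \<equiv> setk (k j) (f n j)"

lemma inv_lim: "(\<lambda>n. 1 / (real n + 1)) \<longlonglongrightarrow> 0"
  using LIMSEQ_inverse_real_of_nat by (simp add: inverse_eq_divide add.commute)

lemma tendsto_diff0:
  assumes "\<And>n. \<bar>x n - y n\<bar> \<le> 1 / (real n + 1)"
  shows "(\<lambda>n. x n - y n) \<longlonglongrightarrow> (0::real)"
  by (rule Lim_null_comparison[OF _ inv_lim]) (use assms in simp)

sublocale kernel_seq V k a "\<lambda>i j. \<Sigma> $ i $ j"
proof unfold_locales
  fix i j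
  show "(\<lambda>n. \<Sum>A\<in>Pow (V n). a n i A * a n j A) \<longlonglongrightarrow> \<Sigma> $ i $ j"
    using tendsto_add[OF tendsto_diff0[OF N1[where i=i and j=j]] gram0[where i=i and j=j]] by simp
qed (auto simp: k setk_card)

lemma contr_iff:
  assumes "r \<in> {1..k j - 1}"
  shows "(\<lambda>n. contr (V n) (k j) (k j) r (a n j) (a n j)) \<longlonglongrightarrow> 0 \<longleftrightarrow>
    (\<lambda>n. discrete_norm (2 * k j - 2 * r) (contraction (k j) (k j) r (f n j) (f n j))) \<longlonglongrightarrow> 0"
    (is "?C \<longlonglongrightarrow> 0 \<longleftrightarrow> ?D \<longlonglongrightarrow> 0")
proof -
  define c :: real where "c = (fact (k j - r) * fact r)\<^sup>2 / fact (k j) ^ 4"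
  have c: "c > 0" unfolding c_def by simp
  have d0: "(\<lambda>n. c * ?C n - (?D n)\<^sup>2) \<longlonglongrightarrow> 0"
    unfolding c_def by (rule tendsto_diff0) (rule N3[OF assms])
  show ?thesis
  proof
    assume "?C \<longlonglongrightarrow> 0"
    then have "(\<lambda>n. c * ?C n) \<longlonglongrightarrow> 0" using tendsto_mult_left[of ?C 0 sequentially c] by simp
    then have "(\<lambda>n. (?D n)\<^sup>2) \<longlonglongrightarrow> 0" using tendsto_diff[OF _ d0, of "\<lambda>n. c * ?C n" 0] by simp
    then show "?D \<longlonglongrightarrow> 0" by simp
  next
    assume "?D \<longlonglongrightarrow> 0"
    then have "(\<lambda>n. (?D n)\<^sup>2) \<longlonglongrightarrow> 0" by simp
    from tendsto_add[OF d0 this] have "(\<lambda>n. c * ?C n) \<longlonglongrightarrow> 0" by simp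
    then have "(\<lambda>n. inverse c * (c * ?C n)) \<longlonglongrightarrow> inverse c * 0" by (rule tendsto_mult_left)
    then show "?C \<longlonglongrightarrow> 0" using c by (simp add: mult.assoc[symmetric])
  qed
qed

context
  fixes M :: "'b measure" and X :: "int \<Rightarrow> 'b \<Rightarrow> real"
  assumes X: "std_seq M X"
begin

interpretation X: std_seq M X by (rule X)

definition "Y n j = homogeneous_sum M X (k j) (f n j)"
definition "S n j \<omega> = mlp (V n) (a n j) (\<lambda>i. X i \<omega>)"

lemma Y_meas[measurable]: "Y n j \<in> borel_measurable M"
  unfolding Y_def by (rule homogeneous_sum_approx(1)[OF X f])

lemma S_meas[measurable]: "S n j \<in> borel_measurable M" unfolding S_def[abs_def] by (rule X.mlp_meas)

lemma YS_L2: "integrable M (\<lambda>\<omega>. (Y n j \<omega> - S n j \<omega>)\<^sup>2)" "(\<integral>\<omega>. (Y n j \<omega> - S n j \<omega>)\<^sup>2 \<partial>M) \<le> 1 / (real n + 1)"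
  unfolding Y_def S_def using homogeneous_sum_approx(2,3)[OF X f[of n j], of "N n"] N2[where j=j and n=n] by (blast, linarith)

lemma S_L2: "integrable M (\<lambda>\<omega>. (S n j \<omega>)\<^sup>2)" "(\<integral>\<omega>. (S n j \<omega>)\<^sup>2 \<partial>M) = (\<Sum>A\<in>Pow (V n). (a n j A)\<^sup>2)"
  unfolding S_def by (rule X.P_sq_int[OF finite_box], rule X.P_sq[OF finite_box])

lemma YS_L1: "integrable M (\<lambda>\<omega>. Y n j \<omega> - S n j \<omega>)" "(\<integral>\<omega>. \<bar>Y n j \<omega> - S n j \<omega>\<bar> \<partial>M) \<le> sqrt (1 / (real n + 1))"
  using X.L1_le_L2[OF YS_L2(1) _ YS_L2(2), of n j] by auto

lemma YS_L1_lim: "(\<lambda>n. \<integral>\<omega>. \<bar>Y n j \<omega> - S n j \<omega>\<bar> \<partial>M) \<longlonglongrightarrow> 0"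
proof (rule tendsto_zero_le)
  show "(\<lambda>n. sqrt (1 / (real n + 1))) \<longlonglongrightarrow> 0" using tendsto_real_sqrt[OF inv_lim] by simp
qed (rule Bochner_Integration.integral_nonneg, simp, rule YS_L1(2))

lemma Y_L2_bounded: "\<exists>C. \<forall>n. integrable M (\<lambda>\<omega>. (Y n j \<omega>)\<^sup>2) \<and> (\<integral>\<omega>. (Y n j \<omega>)\<^sup>2 \<partial>M) \<le> C"
proof -
  have "(\<lambda>n. \<Sum>A\<in>Pow (V n). (a n j A)\<^sup>2) \<longlonglongrightarrow> \<Sigma> $ j $ j" using gram[of j j] by (simp add: power2_eq_square)
  then have "Bseq (\<lambda>n. \<Sum>A\<in>Pow (V n). (a n j A)\<^sup>2)" by (intro convergent_imp_Bseq convergentI)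
  then obtain K where K: "\<And>n. \<bar>\<Sum>A\<in>Pow (V n). (a n j A)\<^sup>2\<bar> \<le> K" by (auto simp: Bseq_def)
  have b: "(Y n j \<omega>)\<^sup>2 \<le> 2 * (Y n j \<omega> - S n j \<omega>)\<^sup>2 + 2 * (S n j \<omega>)\<^sup>2" for n \<omega>
  proof -
    let ?x = "Y n j \<omega> - S n j \<omega>" and ?y = "S n j \<omega>"
    have "2 * ?x * ?y \<le> ?x\<^sup>2 + ?y\<^sup>2" by (rule sum_squares_bound)
    moreover have "(Y n j \<omega>)\<^sup>2 = (?x + ?y)\<^sup>2" by simp
    ultimately show ?thesis unfolding power2_sum[of ?x ?y] by linarith
  qed
  have iB: "integrable M (\<lambda>\<omega>. 2 * (Y n j \<omega> - S n j \<omega>)\<^sup>2 + 2 * (S n j \<omega>)\<^sup>2)" for n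
    by (intro Bochner_Integration.integrable_add integrable_mult_right YS_L2 S_L2)
  have i: "integrable M (\<lambda>\<omega>. (Y n j \<omega>)\<^sup>2)" for n
    by (rule Bochner_Integration.integrable_bound[OF iB[of n]]) (use b in \<open>auto intro!: AE_I2\<close>)
  have "(\<integral>\<omega>. (Y n j \<omega>)\<^sup>2 \<partial>M) \<le> 2 + 2 * K" for n
  proof -
    have "(\<integral>\<omega>. (Y n j \<omega>)\<^sup>2 \<partial>M) \<le> (\<integral>\<omega>. 2 * (Y n j \<omega> - S n j \<omega>)\<^sup>2 + 2 * (S n j \<omega>)\<^sup>2 \<partial>M)"
      by (rule integral_mono[OF i iB b])
    also have "\<dots> = 2 * (\<integral>\<omega>. (Y n j \<omega> - S n j \<omega>)\<^sup>2 \<partial>M) + 2 * (\<integral>\<omega>. (S n j \<omega>)\<^sup>2 \<partial>M)"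
      unfolding integral_mult_right_zero[symmetric] by (intro Bochner_Integration.integral_add integrable_mult_right YS_L2 S_L2)
    also have "\<dots> \<le> 2 * 1 + 2 * K"
    proof (intro add_mono mult_left_mono)
      have "1 / (real n + 1) \<le> 1" by simp
      then show "(\<integral>\<omega>. (Y n j \<omega> - S n j \<omega>)\<^sup>2 \<partial>M) \<le> 1" using YS_L2(2)[of n j] by linarith
      show "(\<integral>\<omega>. (S n j \<omega>)\<^sup>2 \<partial>M) \<le> K" unfolding S_L2(2) using K[of n] by linarith
    qed auto
    finally show ?thesis by simp
  qed
  then show ?thesis using i by blast
qed

text \<open>The cosine is 1-Lipschitz, so the L1 distance between the infinite sums and their
  truncations carries the limit of cosine tests over. Tightness follows from the bounded second
  moments by Markov's inequality.\<close>

lemma weak_conv: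
  assumes X3: "std3_seq M X \<beta>"
    and contr0: "\<And>j r. r \<in> {1..k j - 1} \<Longrightarrow> (\<lambda>n. contr (V n) (k j) (k j) r (a n j) (a n j)) \<longlonglongrightarrow> 0"
  shows "converges_in_distribution M (\<lambda>n \<omega>. \<chi> j. Y n j \<omega>) (centered_gaussian \<Sigma>)"
proof -
  let ?YY = "\<lambda>n \<omega>. (\<chi> j. Y n j \<omega>) :: real^'m"
  have YYm[measurable]: "?YY n \<in> borel_measurable M" for n by (rule borel_measurable_vec_lambda) measurable
  define \<nu> where "\<nu> n = distr M borel (?YY n)" for n
  have \<nu>: "prob_space (\<nu> n)" "sets (\<nu> n) = sets borel" for n
    unfolding \<nu>_def by (auto intro: X.prob_space_distr)
  note G = centered_gaussian_prob[of \<Sigma>]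
  have cos: "(\<lambda>n. \<integral>y. cos (t \<bullet> y + b) \<partial>\<nu> n) \<longlonglongrightarrow> (\<integral>y. cos (t \<bullet> y + b) \<partial>centered_gaussian \<Sigma>)" for t b
  proof -
    have m: "(\<lambda>y. cos (t \<bullet> y + b)) \<in> borel_measurable borel"
      by (intro borel_measurable_continuous_onI continuous_intros)
    let ?CY = "\<lambda>n \<omega>. cos ((\<Sum>j\<in>UNIV. t $ j * Y n j \<omega>) + b)" and ?CS = "\<lambda>n \<omega>. cos ((\<Sum>j\<in>UNIV. t $ j * S n j \<omega>) + b)"
    have Y: "(\<integral>y. cos (t \<bullet> y + b) \<partial>\<nu> n) = (\<integral>\<omega>. ?CY n \<omega> \<partial>M)" for n
      unfolding \<nu>_def by (subst integral_distr[OF YYm m]) (simp add: inner_vec_def)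
    have S: "(\<lambda>n. \<integral>\<omega>. ?CS n \<omega> \<partial>M) \<longlonglongrightarrow> cos b * exp (- (\<Sum>i\<in>UNIV. \<Sum>j\<in>UNIV. t $ i * t $ j * \<Sigma> $ i $ j) / 2)"
      unfolding S_def by (rule cos_tendsto[OF contr0 X3])
    have q: "(\<Sum>i\<in>UNIV. \<Sum>j\<in>UNIV. t $ i * t $ j * \<Sigma> $ i $ j) = t \<bullet> (\<Sigma> *v t)"
      by (simp add: inner_vec_def matrix_vector_mult_def sum_distrib_left mult_ac)
    have ic: "integrable M (?CY n)" "integrable M (?CS n)" for n
      by (rule X.integrable_const_bound[where B=1]; simp)+
    have iYS: "integrable M (\<lambda>\<omega>. \<Sum>j\<in>UNIV. \<bar>t $ j\<bar> * \<bar>Y n j \<omega> - S n j \<omega>\<bar>)" for n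
      by (intro Bochner_Integration.integrable_sum integrable_mult_right integrable_abs YS_L1)
    have "\<bar>(\<integral>\<omega>. ?CY n \<omega> \<partial>M) - (\<integral>\<omega>. ?CS n \<omega> \<partial>M)\<bar> \<le> (\<Sum>j\<in>UNIV. \<bar>t $ j\<bar> * (\<integral>\<omega>. \<bar>Y n j \<omega> - S n j \<omega>\<bar> \<partial>M))" for n
    proof -
      have "\<bar>(\<integral>\<omega>. ?CY n \<omega> \<partial>M) - (\<integral>\<omega>. ?CS n \<omega> \<partial>M)\<bar> = \<bar>\<integral>\<omega>. ?CY n \<omega> - ?CS n \<omega> \<partial>M\<bar>"
        by (simp only: Bochner_Integration.integral_diff[OF ic])
      also have "\<dots> \<le> (\<integral>\<omega>. \<bar>?CY n \<omega> - ?CS n \<omega>\<bar> \<partial>M)" by (rule integral_abs_bound)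
      also have "\<dots> \<le> (\<integral>\<omega>. (\<Sum>j\<in>UNIV. \<bar>t $ j\<bar> * \<bar>Y n j \<omega> - S n j \<omega>\<bar>) \<partial>M)"
      proof (rule integral_mono)
        show "integrable M (\<lambda>\<omega>. \<bar>?CY n \<omega> - ?CS n \<omega>\<bar>)" by (intro integrable_abs Bochner_Integration.integrable_diff ic)
        fix \<omega>
        have "\<bar>?CY n \<omega> - ?CS n \<omega>\<bar> \<le> \<bar>(\<Sum>j\<in>UNIV. t $ j * Y n j \<omega>) - (\<Sum>j\<in>UNIV. t $ j * S n j \<omega>)\<bar>"
          using abs_cos_diff_le[of "(\<Sum>j\<in>UNIV. t $ j * Y n j \<omega>) + b" "(\<Sum>j\<in>UNIV. t $ j * S n j \<omega>) + b"] by simp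
        also have "\<dots> = \<bar>\<Sum>j\<in>UNIV. t $ j * (Y n j \<omega> - S n j \<omega>)\<bar>"
          by (simp only: sum_subtractf right_diff_distrib)
        also have "\<dots> \<le> (\<Sum>j\<in>UNIV. \<bar>t $ j * (Y n j \<omega> - S n j \<omega>)\<bar>)" by (rule sum_abs)
        finally show "\<bar>?CY n \<omega> - ?CS n \<omega>\<bar> \<le> (\<Sum>j\<in>UNIV. \<bar>t $ j\<bar> * \<bar>Y n j \<omega> - S n j \<omega>\<bar>)"
          by (simp only: abs_mult)
      qed (rule iYS)
      also have "\<dots> = (\<Sum>j\<in>UNIV. \<bar>t $ j\<bar> * (\<integral>\<omega>. \<bar>Y n j \<omega> - S n j \<omega>\<bar> \<partial>M))"
        by (subst Bochner_Integration.integral_sum, intro integrable_mult_right integrable_abs YS_L1) (simp only: integral_mult_right_zero)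
      finally show ?thesis .
    qed
    moreover have "(\<lambda>n. \<Sum>j\<in>UNIV. \<bar>t $ j\<bar> * (\<integral>\<omega>. \<bar>Y n j \<omega> - S n j \<omega>\<bar> \<partial>M)) \<longlonglongrightarrow> 0"
    proof (rule tendsto_sum0)
      fix j show "(\<lambda>n. \<bar>t $ j\<bar> * (\<integral>\<omega>. \<bar>Y n j \<omega> - S n j \<omega>\<bar> \<partial>M)) \<longlonglongrightarrow> 0"
        using tendsto_mult_left[OF YS_L1_lim[of j], of "\<bar>t $ j\<bar>"] by simp
    qed
    ultimately have "(\<lambda>n. (\<integral>\<omega>. ?CY n \<omega> \<partial>M) - (\<integral>\<omega>. ?CS n \<omega> \<partial>M)) \<longlonglongrightarrow> 0"
      by (rule_tac Lim_null_comparison) auto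
    from tendsto_add[OF this S] show ?thesis
      unfolding Y centered_gaussian_cos[OF sym psd] q by simp
  qed
  have tight: "\<exists>R>0. (\<forall>n. measure (\<nu> n) {y. norm y > R} \<le> \<delta>) \<and> measure (centered_gaussian \<Sigma>) {y. norm y > R} \<le> \<delta>"
    if d: "\<delta> > 0" for \<delta>
  proof -
    obtain C where C: "\<And>n j. integrable M (\<lambda>\<omega>. (Y n j \<omega>)\<^sup>2)" "\<And>n j. (\<integral>\<omega>. (Y n j \<omega>)\<^sup>2 \<partial>M) \<le> C j"
      using Y_L2_bounded by metis
    define K where "K = (\<Sum>j\<in>UNIV. C j)"
    have EY: "(\<integral>\<omega>. (norm (?YY n \<omega>))\<^sup>2 \<partial>M) \<le> K" "integrable M (\<lambda>\<omega>. (norm (?YY n \<omega>))\<^sup>2)" for n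
    proof -
      have e: "(norm (?YY n \<omega>))\<^sup>2 = (\<Sum>j\<in>UNIV. (Y n j \<omega>)\<^sup>2)" for \<omega>
        by (simp add: norm_vec_def L2_set_def sum_nonneg)
      show "integrable M (\<lambda>\<omega>. (norm (?YY n \<omega>))\<^sup>2)" unfolding e by (intro Bochner_Integration.integrable_sum C)
      show "(\<integral>\<omega>. (norm (?YY n \<omega>))\<^sup>2 \<partial>M) \<le> K"
        unfolding e K_def by (subst Bochner_Integration.integral_sum, rule C(1)) (rule sum_mono, rule C(2))
    qed
    obtain R0 where R0: "\<And>R. R \<ge> R0 \<Longrightarrow> measure (centered_gaussian \<Sigma>) {y. norm y > R} \<le> \<delta>"
      using tight_single[OF G d] by blast
    \<comment> \<open>\<open>R0\<close> takes care of the Gaussian limit, the square root of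
      Markov's inequality for the sums, and 1 keeps \<open>R\<close> positive.\<close>
    define R where "R = max (max 1 R0) (sqrt (\<bar>K\<bar> / \<delta>))"
    have R: "R \<ge> 1" "R \<ge> R0" unfolding R_def by auto
    have "\<bar>K\<bar> / \<delta> \<le> R\<^sup>2"
    proof -
      have "\<bar>K\<bar> / \<delta> = (sqrt (\<bar>K\<bar> / \<delta>))\<^sup>2" using d by simp
      also have "\<dots> \<le> R\<^sup>2" using d by (intro power_mono) (auto simp: R_def)
      finally show ?thesis .
    qed
    then have KR: "K / R\<^sup>2 \<le> \<delta>" using R d by (simp add: field_simps)
    have "measure (\<nu> n) {y. norm y > R} \<le> \<delta>" for n
    proof -
      have s: "{y :: real^'m. norm y > R} \<in> sets borel" by (intro borel_open open_Collect_less continuous_intros)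
      have "measure (\<nu> n) {y. norm y > R} = measure M {\<omega> \<in> space M. norm (?YY n \<omega>) > R}"
        unfolding \<nu>_def by (subst measure_distr[OF YYm s]) (auto intro!: arg_cong[where f="measure M"])
      also have "\<dots> \<le> measure M {\<omega> \<in> space M. (norm (?YY n \<omega>))\<^sup>2 \<ge> R\<^sup>2}"
        using R by (intro X.finite_measure_mono) (auto intro!: power_mono)
      also have "\<dots> \<le> (\<integral>\<omega>. (norm (?YY n \<omega>))\<^sup>2 \<partial>M) / R\<^sup>2"
        using R by (intro integral_Markov_inequality_measure[OF EY(2), of "{}"]) auto
      also have "\<dots> \<le> K / R\<^sup>2" by (intro divide_right_mono EY) auto
      finally show ?thesis using KR by linarith
    qed
    then show ?thesis using R R0 by (intro exI[of _ R]) auto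
  qed
  show ?thesis
    unfolding converges_in_distribution_def
    using cos_tests_imp_weak_conv[OF \<nu> G tight cos] unfolding \<nu>_def by blast
qed

end
end

section \<open>A sequence with large fourth moments\<close>

text \<open>The first coin, with success probability \<open>1 / \<kappa>\<close>, decides whether
  the value is nonzero, and the second chooses its sign. This gives variance 1 and moments
  \<open>\<kappa>\<close> and \<open>\<kappa>^2\<close> of order four and six.\<close>

definition three_point :: "real \<Rightarrow> real pmf" where
  "three_point \<kappa> = map_pmf (\<lambda>(b, c). if b then if c then sqrt \<kappa> else - sqrt \<kappa> else 0)
     (pair_pmf (bernoulli_pmf (1 / \<kappa>)) (bernoulli_pmf (1 / 2)))"

lemma three_point_expectation:
  assumes "\<kappa> \<ge> 1"
  shows "measure_pmf.expectation (three_point \<kappa>) g = (g (sqrt \<kappa>) + g (- sqrt \<kappa>)) / (2 * \<kappa>) + (1 - 1 / \<kappa>) * g (0 :: real) "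
proof -
  have U: "(UNIV :: (bool \<times> bool) set) = {(True, True), (True, False), (False, True), (False, False)}" by auto
  have "measure_pmf.expectation (three_point \<kappa>) g = (\<Sum>z\<in>UNIV. pmf (pair_pmf (bernoulli_pmf (1 / \<kappa>)) (bernoulli_pmf (1 / 2))) z *\<^sub>R g (case z of (b, c) \<Rightarrow> if b then if c then sqrt \<kappa> else - sqrt \<kappa> else 0))"
    unfolding three_point_def integral_map_pmf by (rule integral_measure_pmf) auto
  also have "\<dots> = (g (sqrt \<kappa>) + g (- sqrt \<kappa>)) / (2 * \<kappa>) + (1 - 1 / \<kappa>) * g 0"
    unfolding U using assms by (simp add: pmf_pair field_simps)
  finally show ?thesis .
qed

lemma three_point_integrable: "integrable (measure_pmf (three_point \<kappa>)) (g :: real \<Rightarrow> real)"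
  by (rule integrable_measure_pmf_finite) (simp add: three_point_def)

definition three_point_space :: "real \<Rightarrow> (int \<Rightarrow> real) measure" where
  "three_point_space \<kappa> = PiM UNIV (\<lambda>_. distr (measure_pmf (three_point \<kappa>)) borel (\<lambda>x. x))"

context
  fixes \<kappa> :: real
  assumes kappa: "\<kappa> \<ge> 1"
begin

interpretation C: indep_seq "three_point_space \<kappa>" "\<lambda>i \<omega>. \<omega> i"
  unfolding three_point_space_def by (rule PiM_coordinates(1)) (auto intro: measure_pmf.prob_space_distr)

lemma three_point_coord:
  fixes g :: "real \<Rightarrow> real"
  assumes [measurable]: "g \<in> borel_measurable borel"
  shows "(\<integral>\<omega>. g (\<omega> i) \<partial>three_point_space \<kappa>) = (g (sqrt \<kappa>) + g (- sqrt \<kappa>)) / (2 * \<kappa>) + (1 - 1 / \<kappa>) * g 0"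
    and "integrable (three_point_space \<kappa>) (\<lambda>\<omega>. g (\<omega> i))"
proof -
  have d: "distr (three_point_space \<kappa>) borel (\<lambda>\<omega>. \<omega> i) = distr (measure_pmf (three_point \<kappa>)) borel (\<lambda>x. x)"
    unfolding three_point_space_def by (rule PiM_coordinates(2)) (auto intro: measure_pmf.prob_space_distr)
  have "(\<integral>\<omega>. g (\<omega> i) \<partial>three_point_space \<kappa>) = (\<integral>x. g x \<partial>distr (three_point_space \<kappa>) borel (\<lambda>\<omega>. \<omega> i))"
    by (rule integral_distr[symmetric]) (use C.X_meas assms in auto)
  also have "\<dots> = measure_pmf.expectation (three_point \<kappa>) g" unfolding d by (rule integral_distr) auto
  finally show "(\<integral>\<omega>. g (\<omega> i) \<partial>three_point_space \<kappa>) = (g (sqrt \<kappa>) + g (- sqrt \<kappa>)) / (2 * \<kappa>) + (1 - 1 / \<kappa>) * g 0"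
    unfolding three_point_expectation[OF kappa] .
  have "integrable (distr (three_point_space \<kappa>) borel (\<lambda>\<omega>. \<omega> i)) g"
    unfolding d by (subst integrable_distr_eq) (auto intro: three_point_integrable)
  then show "integrable (three_point_space \<kappa>) (\<lambda>\<omega>. g (\<omega> i))"
    by (subst (asm) integrable_distr_eq) (use C.X_meas in auto)
qed

text \<open>The moments are read off from the three atoms; the atom at 0 enters through
  \<open>0 ^ p\<close>, that is, only for \<open>p = 0\<close>.\<close>

lemma three_point_sym_seq:
  "sym_seq (three_point_space \<kappa>) (\<lambda>i \<omega>. \<omega> i) \<kappa> (\<lambda>p. (sqrt \<kappa> ^ p + (- sqrt \<kappa>) ^ p) / (2 * \<kappa>) + (1 - 1 / \<kappa>) * 0 ^ p)"
proof -
  have s2: "sqrt \<kappa> ^ 2 = \<kappa>" using kappa by simp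
  have s4: "sqrt \<kappa> ^ 4 = \<kappa>\<^sup>2" and s6: "sqrt \<kappa> ^ 6 = \<kappa> ^ 3"
    using power_mult[of "sqrt \<kappa>" 2 2] power_mult[of "sqrt \<kappa>" 2 3] s2 by simp_all
  show ?thesis
  proof unfold_locales
    fix i
    show "integrable (three_point_space \<kappa>) (\<lambda>\<omega>. \<bar>\<omega> i\<bar> ^ 6)" by (rule three_point_coord(2)[of "\<lambda>x. \<bar>x\<bar> ^ 6"]) measurable
    fix p :: nat
    show "(\<integral>\<omega>. \<omega> i ^ p \<partial>three_point_space \<kappa>) = (sqrt \<kappa> ^ p + (- sqrt \<kappa>) ^ p) / (2 * \<kappa>) + (1 - 1 / \<kappa>) * 0 ^ p"
      by (rule three_point_coord(1)[of "\<lambda>x. x ^ p"]) measurable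
  qed (use kappa s2 s4 s6 in \<open>auto simp: power2_eq_square power3_eq_cube field_simps\<close>)
qed

lemma three_point_admissible:
  "independent_standardized (three_point_space \<kappa>) (\<lambda>i \<omega>. \<omega> i)"
  "(SUP i. \<integral>\<^sup>+ \<omega>. ennreal (\<bar>\<omega> i\<bar> ^ 3) \<partial>three_point_space \<kappa>) < \<infinity>"
proof -
  interpret S: sym_seq "three_point_space \<kappa>" "\<lambda>i \<omega>. \<omega> i" \<kappa> "\<lambda>p. (sqrt \<kappa> ^ p + (- sqrt \<kappa>) ^ p) / (2 * \<kappa>) + (1 - 1 / \<kappa>) * 0 ^ p"
    by (rule three_point_sym_seq)
  show "independent_standardized (three_point_space \<kappa>) (\<lambda>i \<omega>. \<omega> i)"
    unfolding independent_standardized_def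
    using C.prob_space_axioms C.indep S.int1 S.mean0 S.int2 S.var1 by blast
  let ?c = "(sqrt \<kappa> ^ 3 + sqrt \<kappa> ^ 3) / (2 * \<kappa>)"
  have "(\<integral>\<^sup>+ \<omega>. ennreal (\<bar>\<omega> i\<bar> ^ 3) \<partial>three_point_space \<kappa>) \<le> ennreal ?c" for i
  proof -
    have m: "(\<lambda>x :: real. \<bar>x\<bar> ^ 3) \<in> borel_measurable borel" by measurable
    have "(\<integral>\<^sup>+ \<omega>. ennreal (\<bar>\<omega> i\<bar> ^ 3) \<partial>three_point_space \<kappa>) = ennreal (\<integral>\<omega>. \<bar>\<omega> i\<bar> ^ 3 \<partial>three_point_space \<kappa>)"
      by (rule nn_integral_eq_integral[OF three_point_coord(2)[OF m]]) simp
    then show ?thesis unfolding three_point_coord(1)[OF m] using kappa by simp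
  qed
  then have "(SUP i. \<integral>\<^sup>+ \<omega>. ennreal (\<bar>\<omega> i\<bar> ^ 3) \<partial>three_point_space \<kappa>) \<le> ennreal ?c" by (rule SUP_least)
  also have "\<dots> < \<infinity>" by simp
  finally show "(SUP i. \<integral>\<^sup>+ \<omega>. ennreal (\<bar>\<omega> i\<bar> ^ 3) \<partial>three_point_space \<kappa>) < \<infinity>" .
qed

end

text \<open>Convergence in distribution does not by itself carry fourth moments. This truncation is
  a bounded continuous test function, and its loss is controlled by the sixth moment divided by
  \<open>\<rho>^2\<close>.\<close>

definition trunc4 :: "real \<Rightarrow> real \<Rightarrow> real" where "trunc4 \<rho> x = (min \<bar>x\<bar> \<rho>) ^ 4"

lemma trunc4_cont: "continuous_on UNIV (trunc4 \<rho>)"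
  unfolding trunc4_def[abs_def] by (intro continuous_intros)

lemma trunc4_meas[measurable]: "trunc4 \<rho> \<in> borel_measurable borel"
  using trunc4_cont by (rule borel_measurable_continuous_onI)

lemma trunc4_bounds:
  assumes "\<rho> > 0"
  shows "0 \<le> trunc4 \<rho> x" "trunc4 \<rho> x \<le> \<rho> ^ 4" "trunc4 \<rho> x \<le> x ^ 4" "x ^ 4 \<le> trunc4 \<rho> x + x ^ 6 / \<rho>\<^sup>2"
    "\<bar>trunc4 \<rho> x - trunc4 \<rho> y\<bar> \<le> 4 * \<rho> ^ 3 * \<bar>x - y\<bar>"
proof -
  have m: "0 \<le> min \<bar>x\<bar> \<rho>" for x using assms by simp
  show "0 \<le> trunc4 \<rho> x" unfolding trunc4_def by simp
  show "trunc4 \<rho> x \<le> \<rho> ^ 4" unfolding trunc4_def using m by (intro power_mono) auto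
  have "min \<bar>x\<bar> \<rho> ^ 4 \<le> \<bar>x\<bar> ^ 4" using m by (intro power_mono) auto
  then show "trunc4 \<rho> x \<le> x ^ 4" unfolding trunc4_def by simp
  show "x ^ 4 \<le> trunc4 \<rho> x + x ^ 6 / \<rho>\<^sup>2"
  proof (cases "\<bar>x\<bar> \<le> \<rho>")
    case True
    then have "trunc4 \<rho> x = x ^ 4" unfolding trunc4_def by (simp add: min_absorb1)
    then show ?thesis by simp
  next
    case False
    then have "\<rho>\<^sup>2 \<le> x\<^sup>2" using assms by (metis abs_le_square_iff abs_of_pos le_cases not_le)
    then have "x ^ 4 * \<rho>\<^sup>2 \<le> x ^ 4 * x\<^sup>2" by (intro mult_left_mono) auto
    also have "x ^ 4 * x\<^sup>2 = x ^ 6" by (simp flip: power_add)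
    finally have "x ^ 4 \<le> x ^ 6 / \<rho>\<^sup>2" using assms by (simp add: pos_le_divide_eq)
    moreover have "0 \<le> trunc4 \<rho> x" unfolding trunc4_def by simp
    ultimately show ?thesis by linarith
  qed
  define u v where "u = min \<bar>x\<bar> \<rho>" and "v = min \<bar>y\<bar> \<rho>"
  have uv: "0 \<le> u" "u \<le> \<rho>" "0 \<le> v" "v \<le> \<rho>" "\<bar>u - v\<bar> \<le> \<bar>x - y\<bar>" unfolding u_def v_def using assms by auto
  have "u ^ 4 - v ^ 4 = (u - v) * (u ^ 3 + u\<^sup>2 * v + u * v\<^sup>2 + v ^ 3)"
    by (simp add: eval_nat_numeral algebra_simps)
  then have "\<bar>trunc4 \<rho> x - trunc4 \<rho> y\<bar> = \<bar>u - v\<bar> * (u ^ 3 + u\<^sup>2 * v + u * v\<^sup>2 + v ^ 3)"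
    unfolding trunc4_def u_def[symmetric] v_def[symmetric] using uv by (simp add: abs_mult)
  also have "\<dots> \<le> \<bar>x - y\<bar> * (\<rho> ^ 3 + \<rho>\<^sup>2 * \<rho> + \<rho> * \<rho>\<^sup>2 + \<rho> ^ 3)"
    using uv by (intro mult_mono add_mono power_mono) auto
  also have "\<dots> = 4 * \<rho> ^ 3 * \<bar>x - y\<bar>" by (simp add: power2_eq_square power3_eq_cube)
  finally show "\<bar>trunc4 \<rho> x - trunc4 \<rho> y\<bar> \<le> 4 * \<rho> ^ 3 * \<bar>x - y\<bar>" .
qed

text \<open>The phases 0 and \<open>- pi / 2\<close> give the real and the imaginary part.\<close>

lemma char_from_cos:
  assumes M: "real_distribution M" and c: "\<And>t b. (\<integral>x. cos (t * x + b) \<partial>M) = cos b * exp (- (v * t\<^sup>2) / 2)"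
  shows "char M t = complex_of_real (exp (- (v * t\<^sup>2) / 2))"
proof -
  interpret real_distribution M by fact
  have i: "integrable M (\<lambda>x. cos (t * x + b))" for b by (rule integrable_const_bound[where B=1]) auto
  have e: "iexp (t * x) = complex_of_real (cos (t * x + 0)) + \<i> * complex_of_real (cos (t * x + - (pi / 2)))" for x
  proof -
    have "iexp (t * x) = cis (t * x)" unfolding cis_conv_exp ..
    then show ?thesis by (simp add: complex_eq_iff cos_diff)
  qed
  have "char M t = (\<integral>x. complex_of_real (cos (t * x + 0)) + \<i> * complex_of_real (cos (t * x + - (pi / 2))) \<partial>M)"
    unfolding char_def e ..
  also have "\<dots> = (\<integral>x. complex_of_real (cos (t * x + 0)) \<partial>M) + (\<integral>x. \<i> * complex_of_real (cos (t * x + - (pi / 2))) \<partial>M)"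
    by (intro Bochner_Integration.integral_add integrable_mult_right integrable_of_real i)
  also have "\<dots> = complex_of_real (\<integral>x. cos (t * x + 0) \<partial>M) + \<i> * complex_of_real (\<integral>x. cos (t * x + - (pi / 2)) \<partial>M)"
    by (simp only: integral_mult_right_zero integral_complex_of_real)
  also have "\<dots> = complex_of_real (exp (- (v * t\<^sup>2) / 2))" unfolding c by simp
  finally show ?thesis .
qed

text \<open>The \<open>j\<close>-th marginal has the characteristic function of
  \<open>sqrt (S $ j $ j)\<close> times a standard normal variable, whose fourth moment is
  \<open>3 (S $ j $ j)^2\<close>; truncation only lowers it.\<close>

lemma centered_gaussian_fourth:
  fixes S :: "real^'m^'m"
  assumes S: "transpose S = S" "\<And>x. 0 \<le> x \<bullet> (S *v x)" and \<rho>: "\<rho> > 0"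
  shows "(\<integral>y. trunc4 \<rho> (y $ j) \<partial>centered_gaussian S) \<le> 3 * (S $ j $ j)\<^sup>2"
proof -
  let ?v = "S $ j $ j"
  let ?G = "centered_gaussian S" and ?N = "std_normal_distribution"
  note G = centered_gaussian_prob[of S]
  interpret G: prob_space ?G by (rule G)
  interpret N: prob_space ?N by (rule std_normal_prob)
  have jm: "(\<lambda>y. y $ j) \<in> borel_measurable (borel :: (real^'m) measure)"
    by (intro borel_measurable_continuous_onI continuous_intros)
  have m1[measurable]: "(\<lambda>y. y $ j) \<in> borel_measurable ?G" unfolding measurable_cong_sets[OF G(2) refl] by (rule jm)
  have sj: "axis j t \<bullet> (S *v axis j t) = ?v * t\<^sup>2" for t
    by (simp add: inner_axis' matrix_vector_mul_component inner_axis power2_eq_square)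
  have v0: "?v \<ge> 0" using S(2)[of "axis j 1"] unfolding sj by simp
  define M1 where "M1 = distr ?G borel (\<lambda>y. y $ j)"
  define M2 where "M2 = distr ?N borel (\<lambda>x. sqrt ?v * x)"
  have m2[measurable]: "(\<lambda>x. sqrt ?v * x) \<in> borel_measurable ?N" by measurable
  have r1: "real_distribution M1" unfolding M1_def by (rule G.real_distribution_distr) measurable
  have r2: "real_distribution M2" unfolding M2_def by (rule N.real_distribution_distr) measurable
  have c1: "(\<integral>x. cos (t * x + b) \<partial>M1) = cos b * exp (- (?v * t\<^sup>2) / 2)" for t b
  proof -
    have "(\<integral>x. cos (t * x + b) \<partial>M1) = (\<integral>y. cos (axis j t \<bullet> y + b) \<partial>?G)"
      unfolding M1_def by (subst integral_distr[OF m1]) (auto simp: inner_axis')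
    then show ?thesis unfolding centered_gaussian_cos[OF S] sj .
  qed
  have "char M2 t = complex_of_real (exp (- (?v * t\<^sup>2) / 2))" for t
  proof -
    have "char M2 t = char ?N (t * sqrt ?v)"
      unfolding char_def M2_def by (subst integral_distr[OF m2]) (auto simp: mult_ac)
    also have "\<dots> = complex_of_real (exp (- ((t * sqrt ?v)\<^sup>2) / 2))"
      using char_std_normal_distribution by (simp add: fun_eq_iff)
    also have "(t * sqrt ?v)\<^sup>2 = ?v * t\<^sup>2" using v0 by (simp add: power_mult_distrib)
    finally show ?thesis .
  qed
  then have "char M1 = char M2" using char_from_cos[OF r1 c1] by (intro ext) simp
  then have eq: "M1 = M2" by (rule Levy_uniqueness[OF r1 r2])
  have i4: "integrable ?N (\<lambda>x. x ^ 4)" by (rule integrable_std_normal_distribution_moment)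
  have e4: "(\<integral>x. x ^ 4 \<partial>?N) = 3"
    using std_normal_distribution_even_moments(1)[of 2] by (simp add: fact_numeral)
  have "(\<integral>y. trunc4 \<rho> (y $ j) \<partial>?G) = (\<integral>x. trunc4 \<rho> x \<partial>M1)"
    unfolding M1_def by (rule integral_distr[symmetric]) measurable
  also have "\<dots> = (\<integral>x. trunc4 \<rho> (sqrt ?v * x) \<partial>?N)"
    unfolding eq M2_def by (rule integral_distr) measurable
  also have "\<dots> \<le> (\<integral>x. ?v\<^sup>2 * x ^ 4 \<partial>?N)"
  proof (rule integral_mono)
    show "integrable ?N (\<lambda>x. trunc4 \<rho> (sqrt ?v * x))"
      by (rule N.integrable_const_bound[where B="\<rho> ^ 4"]) (use trunc4_bounds[OF \<rho>] in auto)
    have "sqrt ?v ^ 4 = ?v\<^sup>2" using power_mult[of "sqrt ?v" 2 2] v0 by simp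
    then show "trunc4 \<rho> (sqrt ?v * x) \<le> ?v\<^sup>2 * x ^ 4" for x
      using trunc4_bounds(3)[OF \<rho>, of "sqrt ?v * x"] by (simp add: power_mult_distrib)
  qed (intro integrable_mult_right i4)
  also have "\<dots> = 3 * ?v\<^sup>2" unfolding integral_mult_right_zero e4 by simp
  finally show ?thesis .
qed

context truncated begin

text \<open>\<open>fourth_moment_ge\<close> bounds the contractions by the excess of the fourth
  moment over the Gaussian value. The fourth moment is at most the truncated one plus the sixth
  moment over \<open>\<rho>^2\<close>; the truncated one converges to at most the Gaussian value,
  and hypercontractivity bounds the sixth uniformly in \<open>n\<close>. As \<open>\<kappa>\<close>
  depends on \<open>k j\<close>, each component has its own three-point sequence, and the joint
  limit is tested through that component alone.\<close>

lemma contr_tendsto_0: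
  assumes uan: "universally_asymptotically_normal TYPE(int \<Rightarrow> real) k f \<Sigma>" and r: "r \<in> {1..k j - 1}"
  shows "(\<lambda>n. contr (V n) (k j) (k j) r (a n j) (a n j)) \<longlonglongrightarrow> 0"
proof -
  define \<kappa> where "\<kappa> = 1 + real (k j + 1) * 4 ^ k j"
  have \<kappa>: "\<kappa> \<ge> 1" "\<kappa> - 1 = real (k j + 1) * 4 ^ k j" unfolding \<kappa>_def by auto
  define M where "M = three_point_space \<kappa>"
  define X where "X = (\<lambda>(i::int) (\<omega>::int \<Rightarrow> real). \<omega> i)"
  note ssq = three_point_sym_seq[OF \<kappa>(1), folded M_def X_def]
  interpret R: sym_seq M X \<kappa> "\<lambda>p. (sqrt \<kappa> ^ p + (- sqrt \<kappa>) ^ p) / (2 * \<kappa>) + (1 - 1 / \<kappa>) * 0 ^ p" by (rule ssq)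
  have sX: "std_seq M X" by (rule R.std_seq_axioms)
  let ?Y = "Y M X" and ?S = "S X"
  let ?s = "\<lambda>n. \<Sum>A\<in>Pow (V n). (a n j A)\<^sup>2"
  let ?C = "\<lambda>n. \<Sum>r\<in>{1..k j - 1}. contr (V n) (k j) (k j) r (a n j) (a n j)"
  note Ym[measurable] = Y_meas[OF sX] and Sm[measurable] = S_meas[OF sX]
  have supp': "\<And>A. a n j A \<noteq> 0 \<Longrightarrow> card A = k j" for n by (rule supp)
  have s: "?s \<longlonglongrightarrow> \<Sigma> $ j $ j" using gram[of j j] by (simp add: power2_eq_square)
  have conv: "converges_in_distribution M (\<lambda>n \<omega>. \<chi> j. ?Y n j \<omega>) (centered_gaussian \<Sigma>)"
    unfolding Y_def[OF sX]
  proof (rule uan[unfolded universally_asymptotically_normal_def, rule_format], rule conjI)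
    show "independent_standardized M X" "(SUP i. \<integral>\<^sup>+ \<omega>. ennreal (\<bar>X i \<omega>\<bar> ^ 3) \<partial>M) < \<infinity>"
      unfolding M_def X_def by (rule three_point_admissible[OF \<kappa>(1)])+
  qed
  define T where "T \<rho> = (\<integral>y. trunc4 \<rho> (y $ j) \<partial>centered_gaussian \<Sigma>)" for \<rho>
  have lim: "(\<lambda>n. \<integral>\<omega>. trunc4 \<rho> (?Y n j \<omega>) \<partial>M) \<longlonglongrightarrow> T \<rho>" if \<rho>: "\<rho> > 0" for \<rho>
  proof -
    have c: "continuous_on UNIV (\<lambda>y::real^'m. trunc4 \<rho> (y $ j))"
      by (rule continuous_on_compose2[OF trunc4_cont]) (auto intro!: continuous_intros)
    have b: "bounded (range (\<lambda>y::real^'m. trunc4 \<rho> (y $ j)))"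
      by (rule boundedI[where B="\<rho> ^ 4"]) (use trunc4_bounds(1,2)[OF \<rho>] in auto)
    have m: "(\<lambda>\<omega>. (\<chi> j. ?Y n j \<omega>) :: real^'m) \<in> borel_measurable M" for n
      by (rule borel_measurable_vec_lambda) (rule Ym)
    have m2: "(\<lambda>y::real^'m. trunc4 \<rho> (y $ j)) \<in> borel_measurable borel"
      using c by (rule borel_measurable_continuous_onI)
    have "(\<integral>y. trunc4 \<rho> (y $ j) \<partial>distr M borel (\<lambda>\<omega>. \<chi> j. ?Y n j \<omega>)) = (\<integral>\<omega>. trunc4 \<rho> (?Y n j \<omega>) \<partial>M)" for n
      unfolding integral_distr[OF m m2] by simp
    then show ?thesis using conv[unfolded converges_in_distribution_def, rule_format, OF conjI, OF c b]
      unfolding T_def by simp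
  qed
  have i4: "integrable M (\<lambda>\<omega>. ?S n j \<omega> ^ 4)" and i6: "integrable M (\<lambda>\<omega>. ?S n j \<omega> ^ 6)" for n
    using R.P_pow_int[OF finV, of 4 n "a n j"] R.P_pow_int[OF finV, of 6 n "a n j"] unfolding S_def[OF sX] by simp_all
  have iT: "integrable M (\<lambda>\<omega>. trunc4 \<rho> (?Y n j \<omega>))" "integrable M (\<lambda>\<omega>. trunc4 \<rho> (?S n j \<omega>))" if "\<rho> > 0" for \<rho> n
    using trunc4_bounds(1,2)[OF that] by (auto intro!: R.integrable_const_bound[where B="\<rho> ^ 4"])
  have le: "?C n \<le> (\<integral>\<omega>. trunc4 \<rho> (?Y n j \<omega>) \<partial>M) + 4 * \<rho> ^ 3 * (\<integral>\<omega>. \<bar>?Y n j \<omega> - ?S n j \<omega>\<bar> \<partial>M)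
      + ((5 * \<kappa>) ^ k j * ?s n) ^ 3 / \<rho>\<^sup>2 - 3 * (?s n)\<^sup>2" if \<rho>: "\<rho> > 0" for \<rho> n
  proof -
    have "3 * (?s n)\<^sup>2 + ?C n \<le> (\<integral>\<omega>. ?S n j \<omega> ^ 4 \<partial>M)"
      unfolding S_def[OF sX] by (rule R.fourth_moment_ge[OF finV supp' _ \<kappa>(2)]) (use k2[of j] in auto)
    also have "\<dots> \<le> (\<integral>\<omega>. trunc4 \<rho> (?S n j \<omega>) + ?S n j \<omega> ^ 6 / \<rho>\<^sup>2 \<partial>M)"
      by (rule integral_mono[OF i4]) (intro Bochner_Integration.integrable_add integrable_divide iT \<rho> i6, rule trunc4_bounds(4)[OF \<rho>])
    also have "\<dots> = (\<integral>\<omega>. trunc4 \<rho> (?S n j \<omega>) \<partial>M) + (\<integral>\<omega>. ?S n j \<omega> ^ 6 \<partial>M) / \<rho>\<^sup>2"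
      by (subst Bochner_Integration.integral_add) (intro integrable_divide iT \<rho> i6, intro integrable_divide i6, simp only: integral_divide_zero)
    also have "(\<integral>\<omega>. ?S n j \<omega> ^ 6 \<partial>M) \<le> ((5 * \<kappa>) ^ k j * ?s n) ^ 3"
      unfolding S_def[OF sX] by (rule R.hypercontractive6[OF finV supp'])
    also have "(\<integral>\<omega>. trunc4 \<rho> (?S n j \<omega>) \<partial>M) \<le> (\<integral>\<omega>. trunc4 \<rho> (?Y n j \<omega>) + 4 * \<rho> ^ 3 * \<bar>?Y n j \<omega> - ?S n j \<omega>\<bar> \<partial>M)"
    proof (rule integral_mono[OF iT(2)[OF \<rho>]])
      show "integrable M (\<lambda>\<omega>. trunc4 \<rho> (?Y n j \<omega>) + 4 * \<rho> ^ 3 * \<bar>?Y n j \<omega> - ?S n j \<omega>\<bar>)"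
        by (intro Bochner_Integration.integrable_add integrable_mult_right integrable_abs iT \<rho> YS_L1[OF sX])
      show "trunc4 \<rho> (?S n j \<omega>) \<le> trunc4 \<rho> (?Y n j \<omega>) + 4 * \<rho> ^ 3 * \<bar>?Y n j \<omega> - ?S n j \<omega>\<bar>" for \<omega>
        using trunc4_bounds(5)[OF \<rho>, of "?Y n j \<omega>" "?S n j \<omega>"] by linarith
    qed
    also have "\<dots> = (\<integral>\<omega>. trunc4 \<rho> (?Y n j \<omega>) \<partial>M) + 4 * \<rho> ^ 3 * (\<integral>\<omega>. \<bar>?Y n j \<omega> - ?S n j \<omega>\<bar> \<partial>M)"
      by (subst Bochner_Integration.integral_add) (intro iT \<rho>, intro integrable_mult_right integrable_abs YS_L1[OF sX], simp only: integral_mult_right_zero)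
    finally show ?thesis using \<rho> by (simp add: divide_right_mono)
  qed
  have C0: "?C \<longlonglongrightarrow> 0"
  proof (rule LIMSEQ_I)
    fix e :: real assume e: "e > 0"
    define L where "L = ((5 * \<kappa>) ^ k j * \<Sigma> $ j $ j) ^ 3"
    \<comment> \<open>Chosen so that the limiting sixth-moment loss \<open>L / \<rho>^2\<close> is
      below \<open>e\<close>; the summand 1 keeps \<open>\<rho>\<close> positive when
      \<open>L\<close> is 0.\<close>
    define \<rho> where "\<rho> = sqrt (2 * (\<bar>L\<bar> + 1) / e)"
    have \<rho>: "\<rho> > 0" and \<rho>2: "\<rho>\<^sup>2 = 2 * (\<bar>L\<bar> + 1) / e" unfolding \<rho>_def using e by auto
    have "L * e < 2 * (\<bar>L\<bar> + 1) * e" using e by (intro mult_strict_right_mono) auto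
    then have "L / \<rho>\<^sup>2 < e" unfolding \<rho>2 using e by (simp add: pos_divide_less_eq mult.commute)
    let ?u = "\<lambda>n. (\<integral>\<omega>. trunc4 \<rho> (?Y n j \<omega>) \<partial>M) + 4 * \<rho> ^ 3 * (\<integral>\<omega>. \<bar>?Y n j \<omega> - ?S n j \<omega>\<bar> \<partial>M)
      + ((5 * \<kappa>) ^ k j * ?s n) ^ 3 / \<rho>\<^sup>2 - 3 * (?s n)\<^sup>2"
    have "?u \<longlonglongrightarrow> T \<rho> + 4 * \<rho> ^ 3 * 0 + L / \<rho>\<^sup>2 - 3 * (\<Sigma> $ j $ j)\<^sup>2"
      unfolding L_def using \<rho> by (intro tendsto_intros lim[OF \<rho>] YS_L1_lim[OF sX] s) auto
    moreover have "T \<rho> + 4 * \<rho> ^ 3 * 0 + L / \<rho>\<^sup>2 - 3 * (\<Sigma> $ j $ j)\<^sup>2 < e"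
      using centered_gaussian_fourth[OF sym psd \<rho>, of j] \<open>L / \<rho>\<^sup>2 < e\<close> unfolding T_def by simp
    ultimately have "eventually (\<lambda>n. ?u n < e) sequentially" by (rule order_tendstoD(2))
    then have "eventually (\<lambda>n. norm (?C n - 0) < e) sequentially"
    proof eventually_elim
      case (elim n)
      have "?C n \<ge> 0" by (intro sum_nonneg contr_nonneg)
      then show ?case using le[OF \<rho>, of n] elim by simp
    qed
    then show "\<exists>no. \<forall>n\<ge>no. norm (?C n - 0) < e" unfolding eventually_sequentially .
  qed
  show ?thesis
  proof (rule tendsto_zero_le[OF contr_nonneg _ C0])
    fix n show "contr (V n) (k j) (k j) r (a n j) (a n j) \<le> ?C n"
      by (rule member_le_sum[OF r]) (auto simp: contr_nonneg)
  qed
qed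

text \<open>The type of the probability space is arbitrary here, because the condition on the
  contractions does not mention it.\<close>

lemma sufficiency:
  assumes c: "\<And>j r. r \<in> {1..k j - 1} \<Longrightarrow> (\<lambda>n. contr (V n) (k j) (k j) r (a n j) (a n j)) \<longlonglongrightarrow> 0"
  shows "universally_asymptotically_normal TYPE('b) k f \<Sigma>"
  unfolding universally_asymptotically_normal_def
proof (intro allI impI, elim conjE)
  fix M :: "'b measure" and X
  assume X: "independent_standardized M X" "(SUP i. \<integral>\<^sup>+ \<omega>. ennreal (\<bar>X i \<omega>\<bar> ^ 3) \<partial>M) < \<infinity>"
  obtain \<beta> where X3: "std3_seq M X \<beta>" using X by (rule admissible_std3)
  then have X2: "std_seq M X" by (simp add: std3_seq_def)
  show "converges_in_distribution M (\<lambda>n \<omega>. \<chi> j. homogeneous_sum M X (k j) (f n j) \<omega>) (centered_gaussian \<Sigma>)"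
    using weak_conv[OF X2 X3 c] unfolding Y_def[OF X2] .
qed

end

text \<open>There are finitely many components and orders, so finitely many convergences can be
  brought within \<open>e\<close> by one cube.\<close>

lemma truncation_exists:
  fixes k :: "'m::finite \<Rightarrow> nat" and f :: "'m \<Rightarrow> int list \<Rightarrow> real"
  assumes f: "\<And>j. f j \<in> l2_kernels (k j)" and e: "e > 0"
  shows "\<exists>N. (\<forall>i j. \<bar>(\<Sum>A\<in>Pow (zbox N). setk (k i) (f i) A * setk (k j) (f j) A) - kernel_inner (k i) (f i) (k j) (f j)\<bar> \<le> e)
    \<and> (\<forall>j. 2 * fact (k j) * (ksq (k j) (f j) - (\<Sum>l\<in>blist (k j) N. (f j l)\<^sup>2)) \<le> e)
    \<and> (\<forall>j. \<forall>r\<in>{1..k j - 1}. \<bar>(fact (k j - r) * fact r)\<^sup>2 / fact (k j) ^ 4 * contr (zbox N) (k j) (k j) r (setk (k j) (f j)) (setk (k j) (f j))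
       - (discrete_norm (2 * k j - 2 * r) (contraction (k j) (k j) r (f j) (f j)))\<^sup>2\<bar> \<le> e)" (is "\<exists>N. ?A N \<and> ?B N \<and> ?C N")
proof -
  have close: "eventually (\<lambda>N. \<bar>u N - l\<bar> \<le> e) sequentially" if "u \<longlonglongrightarrow> l" for u and l :: real
    using tendstoD[OF that e] by eventually_elim (simp add: dist_real_def)
  have "eventually ?A sequentially"
    by (intro eventually_all_finite close gram_tendsto f)
  moreover have "eventually ?B sequentially"
  proof (rule eventually_all_finite)
    fix j
    have "(\<lambda>N. 2 * fact (k j) * (ksq (k j) (f j) - (\<Sum>l\<in>blist (k j) N. (f j l)\<^sup>2))) \<longlonglongrightarrow> 2 * fact (k j) * (ksq (k j) (f j) - ksq (k j) (f j))"
      unfolding ksq_def by (intro tendsto_intros infsum_blist_tendsto l2_kernel_sq_summable f)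
    from close[OF this] show "eventually (\<lambda>N. 2 * fact (k j) * (ksq (k j) (f j) - (\<Sum>l\<in>blist (k j) N. (f j l)\<^sup>2)) \<le> e) sequentially"
      by eventually_elim simp
  qed
  moreover have "eventually ?C sequentially"
  proof (rule eventually_all_finite)
    fix j
    show "eventually (\<lambda>N. \<forall>r\<in>{1..k j - 1}. \<bar>(fact (k j - r) * fact r)\<^sup>2 / fact (k j) ^ 4 * contr (zbox N) (k j) (k j) r (setk (k j) (f j)) (setk (k j) (f j))
       - (discrete_norm (2 * k j - 2 * r) (contraction (k j) (k j) r (f j) (f j)))\<^sup>2\<bar> \<le> e) sequentially"
    proof (rule eventually_ball_finite)
      show "\<forall>r\<in>{1..k j - 1}. eventually (\<lambda>N. \<bar>(fact (k j - r) * fact r)\<^sup>2 / fact (k j) ^ 4 * contr (zbox N) (k j) (k j) r (setk (k j) (f j)) (setk (k j) (f j))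
       - (discrete_norm (2 * k j - 2 * r) (contraction (k j) (k j) r (f j) (f j)))\<^sup>2\<bar> \<le> e) sequentially"
      proof
        fix r assume "r \<in> {1..k j - 1}"
        then have "r \<le> k j" by auto
        from close[OF contraction_norm_tendsto[OF f this]]
        show "eventually (\<lambda>N. \<bar>(fact (k j - r) * fact r)\<^sup>2 / fact (k j) ^ 4 * contr (zbox N) (k j) (k j) r (setk (k j) (f j)) (setk (k j) (f j))
       - (discrete_norm (2 * k j - 2 * r) (contraction (k j) (k j) r (f j) (f j)))\<^sup>2\<bar> \<le> e) sequentially" .
      qed
    qed simp
  qed
  ultimately have "eventually (\<lambda>N. ?A N \<and> ?B N \<and> ?C N) sequentially" by eventually_elim blast
  then show ?thesis by (rule eventually_happens'[OF sequentially_bot])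
qed

theorem theorem2p6:
  fixes k :: "'m::finite \<Rightarrow> nat"
    and f :: "nat \<Rightarrow> 'm \<Rightarrow> int list \<Rightarrow> real"
    and \<Sigma> :: "real^'m^'m"
  assumes "\<And>j. k j \<ge> 2"
    and "\<And>n j. f n j \<in> l2_kernels (k j)"
    and "\<And>j. bdd_above (range (\<lambda>n. \<Sum>\<^sub>\<infinity>i \<in> index_tuples (k j). (f n j i)\<^sup>2))"
    and "transpose \<Sigma> = \<Sigma>"
    and "\<And>x. 0 \<le> x \<bullet> (\<Sigma> *v x)"
    and "\<And>j. \<Sigma> $ j $ j > 0"
    and "\<And>i j. (\<lambda>n. kernel_inner (k i) (f n i) (k j) (f n j)) \<longlonglongrightarrow> \<Sigma> $ i $ j"
  shows "(universally_asymptotically_normal TYPE(int \<Rightarrow> real) k f \<Sigma> \<longleftrightarrow>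
            (\<forall>j. \<forall>r \<in> {1..k j - 1}.
               (\<lambda>n. discrete_norm (2 * k j - 2 * r)
                  (contraction (k j) (k j) r (f n j) (f n j))) \<longlonglongrightarrow> 0)) \<and>
         (universally_asymptotically_normal TYPE(int \<Rightarrow> real) k f \<Sigma> \<longrightarrow>
            universally_asymptotically_normal TYPE('a) k f \<Sigma>)"
proof -
  have "\<forall>n. \<exists>N. (\<forall>i j. \<bar>(\<Sum>A\<in>Pow (zbox N). setk (k i) (f n i) A * setk (k j) (f n j) A) - kernel_inner (k i) (f n i) (k j) (f n j)\<bar> \<le> 1 / (real n + 1))
    \<and> (\<forall>j. 2 * fact (k j) * (ksq (k j) (f n j) - (\<Sum>l\<in>blist (k j) N. (f n j l)\<^sup>2)) \<le> 1 / (real n + 1))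
    \<and> (\<forall>j. \<forall>r\<in>{1..k j - 1}. \<bar>(fact (k j - r) * fact r)\<^sup>2 / fact (k j) ^ 4 * contr (zbox N) (k j) (k j) r (setk (k j) (f n j)) (setk (k j) (f n j))
       - (discrete_norm (2 * k j - 2 * r) (contraction (k j) (k j) r (f n j) (f n j)))\<^sup>2\<bar> \<le> 1 / (real n + 1))"
    by (intro allI truncation_exists assms(2)) simp
  then obtain N where N: "\<And>n. (\<forall>i j. \<bar>(\<Sum>A\<in>Pow (zbox (N n)). setk (k i) (f n i) A * setk (k j) (f n j) A) - kernel_inner (k i) (f n i) (k j) (f n j)\<bar> \<le> 1 / (real n + 1))
    \<and> (\<forall>j. 2 * fact (k j) * (ksq (k j) (f n j) - (\<Sum>l\<in>blist (k j) (N n). (f n j l)\<^sup>2)) \<le> 1 / (real n + 1))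
    \<and> (\<forall>j. \<forall>r\<in>{1..k j - 1}. \<bar>(fact (k j - r) * fact r)\<^sup>2 / fact (k j) ^ 4 * contr (zbox (N n)) (k j) (k j) r (setk (k j) (f n j)) (setk (k j) (f n j))
       - (discrete_norm (2 * k j - 2 * r) (contraction (k j) (k j) r (f n j) (f n j)))\<^sup>2\<bar> \<le> 1 / (real n + 1))"
    unfolding choice_iff by blast
  interpret truncated k f \<Sigma> N
  proof
    show "2 \<le> k j" for j by (rule assms(1))
    show "f n j \<in> l2_kernels (k j)" for n j by (rule assms(2))
    show "transpose \<Sigma> = \<Sigma>" by (rule assms(4))
    show "0 \<le> x \<bullet> (\<Sigma> *v x)" for x by (rule assms(5))
    show "(\<lambda>n. kernel_inner (k i) (f n i) (k j) (f n j)) \<longlonglongrightarrow> \<Sigma> $ i $ j" for i j by (rule assms(7))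
  qed (use N in blast)+
  have eq: "(\<forall>j. \<forall>r \<in> {1..k j - 1}. (\<lambda>n. discrete_norm (2 * k j - 2 * r) (contraction (k j) (k j) r (f n j) (f n j))) \<longlonglongrightarrow> 0) \<longleftrightarrow>
      (\<forall>j. \<forall>r \<in> {1..k j - 1}. (\<lambda>n. contr (V n) (k j) (k j) r (a n j) (a n j)) \<longlonglongrightarrow> 0)"
    by (intro iff_allI ball_cong refl contr_iff[symmetric])
  show ?thesis unfolding eq
  proof (intro conjI iffI impI allI ballI)
    assume *: "\<forall>j. \<forall>r \<in> {1..k j - 1}. (\<lambda>n. contr (V n) (k j) (k j) r (a n j) (a n j)) \<longlonglongrightarrow> 0"
    show "universally_asymptotically_normal TYPE(int \<Rightarrow> real) k f \<Sigma>"
      by (rule sufficiency) (use * in blast)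
  next
    \<comment> \<open>Contractions mediate between the two types: normality over
      \<open>int \<Rightarrow> real\<close> makes them vanish, and this yields normality over any
      other type.\<close>
    assume *: "universally_asymptotically_normal TYPE(int \<Rightarrow> real) k f \<Sigma>"
    show "universally_asymptotically_normal TYPE('a) k f \<Sigma>"
      by (rule sufficiency) (rule contr_tendsto_0[OF *])
  qed (rule contr_tendsto_0)
qed

end
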